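(* Let $d\ge2$, $B_1\subset\mathbb{R}^d$ the unit ball, $\mathcal H=L^2(\partial B_1)$, $\mathcal W=H^2(\partial B_1)$, and let $\mathcal K\subset\mathcal H$ be a convex cone. Let $\mathcal G:H^1(B_1)\to\mathbb{R}$ be a functional satisfying the following properties. (SL) There exist a constant $k\in\mathbb N$ and a functional $\mathcal F:H^1(\partial B_1)\to\mathbb{R}$ such that for every $u=u(r,\theta)\in H^1([0,1]\times\partial B_1)$ $$\mathcal G(r^k u)\le\int_0^1\mathcal F(u(r,\cdot))\,r^{2k+d-3}\,dr+C_{sl}\int_0^1\int_{\partial B_1}|\partial_r u|^2\,r^{2k+d-1}\,d\mathcal H^{d-1}\,dr,$$ for a geometric constant $C_{sl}>0$, with equality if and only if $u$ is $0$-homogeneous (constant in the first variable). (FL) There are an open set $\mathcal U_{fl}\subset\mathcal K$ containing the point $\psi$ of (ŁS) and a constant $\varepsilon_{fl}>0$ such that for every $u_0\in\mathcal U_{fl}$ there exists a strong solution $u\in H^1(]0,\varepsilon_{fl}[\,;\mathcal H)\cap L^2(]0,\varepsilon_{fl}[\,;\mathcal W\cap\mathcal K)$ of $$\begin{cases}(u'(t)+\nabla\mathcal F(u(t)))\cdot(v-u(t))\ge0\quad\text{for every }v\in\mathcal K,\ 0<t\le\varepsilon_{fl},\\ u(0)=u_0,\end{cases}$$ and the flow is continuous with respect to the initial datum. (ŁS) $\mathcal F$ has the constrained Łojasiewicz property with respect to $\mathcal S=\{\psi\}$, with exponent $\gamma$, where $\psi\in\mathcal W\cap\mathcal K$ is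 a critical point of $\mathcal F$ in $\mathcal K$. Then there are constants $\delta_0>0$ and $E>0$, depending only on the dimension and $\psi$, and a universal constant $\varepsilon>0$, such that: if $c\in H^1(\partial B_1)\cap\mathcal K$ satisfies $$\|c-\psi\|_{L^2(\partial B_1)}\le\delta_0\qquad\text{and}\qquad\mathcal F(c)-\mathcal F(\psi)\le E,$$ then there exists a function $h=h(r,\theta)\in H^1(B_1)$ with $h=c$ on $\partial B_1$ and $h(r,\cdot)\in\mathcal K$ for every $r\in(0,1]$, such that $$\mathcal G(h)-\mathcal G(\phi)\le\Big(1-\varepsilon\,|\mathcal G(z)-\mathcal G(\phi)|^{1-2\gamma}\Big)\big(\mathcal G(z)-\mathcal G(\phi)\big),$$ where $\phi(r,\theta):=r^k\psi(\theta)$ and $z(r,\theta):=r^k c(\theta)$.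
   Context: $(r,\theta)$ are polar coordinates in $B_1$ ($r=|x|$, $\theta=x/|x|\in\partial B_1$); $r^k u$ denotes the function on $B_1$ equal to $r^k u(r,\theta)$. The dot and $\|\cdot\|$ are the scalar product and norm of $\mathcal H=L^2(\partial B_1)$. The functional $\mathcal F$ restricted to $\mathcal W$ and $\nabla\mathcal F:\mathcal W\to\mathcal H$ are continuous (for the $H^2$ norm on $\mathcal W$) and satisfy $\mathcal F(u+tv)=\mathcal F(u)+t\,v\cdot\nabla\mathcal F(u)+o(t)$ as $t\to0$, for all $u,v\in\mathcal W$; $\mathcal K\cap\mathcal W$ is dense in $\mathcal K$. For $u\in\mathcal K\cap\mathcal W$, $$\|\nabla\mathcal F(u)\|_{\mathcal K}:=\sup\Big\{0,\ \sup_{v\in\mathcal K\setminus\{u\}}\frac{-(v-u)\cdot\nabla\mathcal F(u)}{\|v-u\|}\Big\}.$$ $\psi\in\mathcal K\cap\mathcal W$ is a critical point of $\mathcal F$ in $\mathcal K$ if $(v-\psi)\cdot\nabla\mathcal F(\psi)\ge0$ for every $v\in\mathcal K$. Strong solution on $[0,T[$: a function $u:[0,T[\,\to\mathcal K$ with $u\in C([0,T[\,;\mathcal H)$, $u(0)=u_0$, $u\in H^1_{loc}(]0,T[\,;\mathcal H)$, $u\in C(]0,T[\,;\mathcal W\cap\mathcal K)$, and $\langle u'(t)+\nabla\mathcal F(u(t)),v-u(t)\rangle\ge0$ for every $v\in\mathcal K$ and almost every $t$. The flow is continuous with respect to the initial datum if for every $t>0$ and $\eta>0$ there is $\delta>0$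 such that $\|u_0-v_0\|\le\delta$ implies $\|u(s)-v(s)\|\le\eta$ for every $s\in[0,t]$ for which both solutions $u,v$ (with initial data $u_0,v_0$) are defined. $\mathcal F$ has the constrained Łojasiewicz property with respect to $\{\psi\}$ if there are $\gamma\in\,]0,\frac12]$, $C_L>0$, $\delta_L>0$, $E_L>0$ such that $(\mathcal F(u)-\mathcal F(\psi))_+^{1-\gamma}\le C_L\|\nabla\mathcal F(u)\|_{\mathcal K}$ for every $u\in\mathcal K\cap\mathcal W$ with $\|u-\psi\|\le\delta_L$ and $\mathcal F(u)-\mathcal F(\psi)\le E_L$. "Universal" means that $\varepsilon$ does not depend on $c$ (it may depend on $d$, $k$, $C_{sl}$ and the constants of the Łojasiewicz property).
   Formalization: F is additionally assumed continuous on H^1(∂B_1) for the H^1 norm (without this the claim fails for data c in H^1 but not in H^2), and the case k=0, d=2, where G(z) and the integral in (SL) are undefined, is excluded by requiring 2k+d≥3. *)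

theory Defs
  imports "HOL-Analysis.Analysis"
begin

section \<open>The Hilbert space \<open>L\<^sup>2\<close> of the unit sphere\<close>

definition square_integrable :: "'b measure \<Rightarrow> ('b \<Rightarrow> 'c::real_normed_vector) \<Rightarrow> bool" where
  "square_integrable M f \<longleftrightarrow> f \<in> borel_measurable M \<and> integrable M (\<lambda>x. (norm (f x))\<^sup>2)"

text \<open>
  The surface measure of the unit sphere, as the angular part of Lebesgue measure in polar
  coordinates: the area of \<open>A\<close> is \<open>d\<close> times the volume of the cone
  \<open>{x. norm x < 1 \<and> x / norm x \<in> A}\<close>. Here \<open>sgn x = x /\<^sub>R norm x\<close>; the measure lives on the whole
  space and is concentrated on the sphere.
\<close>

definition sphere_measure :: "'a::euclidean_space measure" where
  "sphere_measure =
     distr (density lborel (\<lambda>x. ennreal (DIM('a)) * indicator (ball 0 1) x)) borel sgn"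

definition ae_eq_sphere :: "('a::euclidean_space \<Rightarrow> real) \<Rightarrow> ('a \<Rightarrow> real) \<Rightarrow> bool" where
  "ae_eq_sphere f g \<longleftrightarrow> square_integrable sphere_measure f \<and> square_integrable sphere_measure g \<and>
     (AE x in sphere_measure. f x = g x)"

lemma square_integrable_mult_integrable:
  fixes f g :: "'b \<Rightarrow> real"
  assumes "square_integrable M f" "square_integrable M g"
  shows "integrable M (\<lambda>x. f x * g x)"
proof (rule Bochner_Integration.integrable_bound)
  show "integrable M (\<lambda>x. (norm (f x))\<^sup>2 + (norm (g x))\<^sup>2)"
    using assms by (auto simp: square_integrable_def)
  show "(\<lambda>x. f x * g x) \<in> borel_measurable M"
    using assms by (auto simp: square_integrable_def)
  have "\<bar>a * b\<bar> \<le> a\<^sup>2 + b\<^sup>2" for a b :: real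
  proof -
    have "2 * (\<bar>a\<bar> * \<bar>b\<bar>) \<le> a\<^sup>2 + b\<^sup>2"
      using zero_le_power2[of "\<bar>a\<bar> - \<bar>b\<bar>"] by (simp add: power2_diff)
    moreover have "0 \<le> \<bar>a\<bar> * \<bar>b\<bar>" by simp
    ultimately show ?thesis unfolding abs_mult by linarith
  qed
  then show "AE x in M. norm (f x * g x) \<le> norm ((norm (f x))\<^sup>2 + (norm (g x))\<^sup>2)"
    by (simp add: abs_mult)
qed

lemma square_integrable_zero: "square_integrable M (\<lambda>_. 0 :: real)"
  by (simp add: square_integrable_def)

lemma square_integrable_add:
  fixes f g :: "'b \<Rightarrow> real"
  assumes "square_integrable M f" "square_integrable M g"
  shows "square_integrable M (\<lambda>x. f x + g x)"
proof -
  have "integrable M (\<lambda>x. (f x)\<^sup>2 + 2 * (f x * g x) + (g x)\<^sup>2)"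
    using assms square_integrable_mult_integrable[OF assms]
    by (auto simp: square_integrable_def)
  then have "integrable M (\<lambda>x. (f x + g x)\<^sup>2)"
    by (rule Bochner_Integration.integrable_cong[THEN iffD1, rotated -1])
      (auto simp: power2_eq_square algebra_simps)
  then show ?thesis
    using assms by (auto simp: square_integrable_def)
qed

lemma square_integrable_scale:
  fixes f :: "'b \<Rightarrow> real"
  assumes "square_integrable M f"
  shows "square_integrable M (\<lambda>x. r * f x)"
  using assms by (auto simp: square_integrable_def power_mult_distrib)

lemma square_integrable_uminus:
  fixes f :: "'b \<Rightarrow> real"
  assumes "square_integrable M f"
  shows "square_integrable M (\<lambda>x. - f x)"
  using square_integrable_scale[OF assms, of "-1"] by simp

lemma part_equivp_ae_eq_sphere: "part_equivp ae_eq_sphere"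
proof (rule part_equivpI)
  show "\<exists>f. ae_eq_sphere f f"
    by (rule exI[of _ "\<lambda>_. 0"]) (simp add: ae_eq_sphere_def square_integrable_zero)
  show "symp ae_eq_sphere"
    by (auto simp: symp_def ae_eq_sphere_def)
  show "transp ae_eq_sphere"
    by (auto simp: transp_def ae_eq_sphere_def)
qed

quotient_type (overloaded) 'a l2_sphere =
  "'a::euclidean_space \<Rightarrow> real" / partial: ae_eq_sphere
  by (rule part_equivp_ae_eq_sphere)

instantiation l2_sphere :: (euclidean_space) real_vector
begin

lift_definition zero_l2_sphere :: "'a l2_sphere" is "\<lambda>_. 0"
  by (simp add: ae_eq_sphere_def square_integrable_zero)

lift_definition plus_l2_sphere :: "'a l2_sphere \<Rightarrow> 'a l2_sphere \<Rightarrow> 'a l2_sphere"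
  is "\<lambda>f g x. f x + g x"
  by (auto simp: ae_eq_sphere_def intro: square_integrable_add)

lift_definition uminus_l2_sphere :: "'a l2_sphere \<Rightarrow> 'a l2_sphere"
  is "\<lambda>f x. - f x"
  by (auto simp: ae_eq_sphere_def intro: square_integrable_uminus)

definition minus_l2_sphere :: "'a l2_sphere \<Rightarrow> 'a l2_sphere \<Rightarrow> 'a l2_sphere" where
  "minus_l2_sphere f g = f + - g"

lift_definition scaleR_l2_sphere :: "real \<Rightarrow> 'a l2_sphere \<Rightarrow> 'a l2_sphere"
  is "\<lambda>r f x. r * f x"
  by (auto simp: ae_eq_sphere_def intro: square_integrable_scale)

instance
proof
  fix a b c :: "'a l2_sphere" and r s :: real
  show "a + b + c = a + (b + c)"
    by transfer (auto simp: ae_eq_sphere_def add.assoc intro!: square_integrable_add)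
  show "a + b = b + a"
    by transfer (auto simp: ae_eq_sphere_def add.commute intro!: square_integrable_add)
  show "0 + a = a"
    by transfer (auto simp: ae_eq_sphere_def)
  show "- a + a = 0"
    by transfer (auto simp: ae_eq_sphere_def square_integrable_zero)
  show "a - b = a + - b"
    by (simp add: minus_l2_sphere_def)
  show "r *\<^sub>R (a + b) = r *\<^sub>R a + r *\<^sub>R b"
    by transfer (auto simp: ae_eq_sphere_def distrib_left
        intro!: square_integrable_add square_integrable_scale)
  show "(r + s) *\<^sub>R a = r *\<^sub>R a + s *\<^sub>R a"
    by transfer (auto simp: ae_eq_sphere_def distrib_right
        intro!: square_integrable_add square_integrable_scale)
  show "r *\<^sub>R s *\<^sub>R a = (r * s) *\<^sub>R a"
    by transfer (auto simp: ae_eq_sphere_def mult.assoc intro!: square_integrable_scale)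
  show "1 *\<^sub>R a = a"
    by transfer (auto simp: ae_eq_sphere_def)
qed

end

lift_definition l2_inner :: "'a::euclidean_space l2_sphere \<Rightarrow> 'a l2_sphere \<Rightarrow> real"
  is "\<lambda>f g. \<integral>x. f x * g x \<partial>sphere_measure"
  by (rule integral_cong_AE) (auto simp: ae_eq_sphere_def square_integrable_def)

instantiation l2_sphere :: (euclidean_space) "{norm, dist, sgn}"
begin

definition norm_l2_sphere :: "'a l2_sphere \<Rightarrow> real" where
  "norm_l2_sphere f = sqrt (l2_inner f f)"

definition dist_l2_sphere :: "'a l2_sphere \<Rightarrow> 'a l2_sphere \<Rightarrow> real" where
  "dist_l2_sphere f g = sqrt (l2_inner (f - g) (f - g))"

definition sgn_l2_sphere :: "'a l2_sphere \<Rightarrow> 'a l2_sphere" where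
  "sgn_l2_sphere f = f /\<^sub>R sqrt (l2_inner f f)"

instance ..

end

instantiation l2_sphere :: (euclidean_space) uniformity_dist
begin

definition uniformity_l2_sphere :: "('a l2_sphere \<times> 'a l2_sphere) filter" where
  "uniformity_l2_sphere = (INF e\<in>{0<..}. principal {(x, y). dist x y < e})"

instance
  by standard (rule uniformity_l2_sphere_def)

end

instantiation l2_sphere :: (euclidean_space) open_uniformity
begin

definition open_l2_sphere :: "'a l2_sphere set \<Rightarrow> bool" where
  "open_l2_sphere U \<longleftrightarrow> (\<forall>x\<in>U. eventually (\<lambda>(x', y). x' = x \<longrightarrow> y \<in> U) uniformity)"

instance
  by standard (rule open_l2_sphere_def)

end

instantiation l2_sphere :: (euclidean_space) real_inner
begin

definition inner_l2_sphere :: "'a l2_sphere \<Rightarrow> 'a l2_sphere \<Rightarrow> real" where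
  "inner_l2_sphere = l2_inner"

instance
proof
  fix a b c :: "'a l2_sphere" and r :: real
  show "dist a b = norm (a - b)"
    by (simp add: dist_l2_sphere_def norm_l2_sphere_def)
  show "sgn a = a /\<^sub>R norm a"
    by (simp add: sgn_l2_sphere_def norm_l2_sphere_def)
  show "norm a = sqrt (inner a a)"
    by (simp add: norm_l2_sphere_def inner_l2_sphere_def)
  show "inner a b = inner b a"
    unfolding inner_l2_sphere_def by transfer (simp add: mult.commute)
  show "inner (a + b) c = inner a c + inner b c"
    unfolding inner_l2_sphere_def
    by transfer (auto simp: ae_eq_sphere_def distrib_right
        intro!: Bochner_Integration.integral_add square_integrable_mult_integrable)
  show "inner (r *\<^sub>R a) b = r * inner a b"
    unfolding inner_l2_sphere_def by transfer (simp add: mult.assoc)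
  show "0 \<le> inner a a"
    unfolding inner_l2_sphere_def by transfer simp
  show "inner a a = 0 \<longleftrightarrow> a = 0"
    unfolding inner_l2_sphere_def
  proof transfer
    fix f :: "'a \<Rightarrow> real" assume f: "ae_eq_sphere f f"
    then have "integrable sphere_measure (\<lambda>x. f x * f x)"
      by (auto simp: ae_eq_sphere_def intro: square_integrable_mult_integrable)
    then have "(\<integral>x. f x * f x \<partial>sphere_measure) = 0 \<longleftrightarrow> (AE x in sphere_measure. f x * f x = 0)"
      by (rule integral_nonneg_eq_0_iff_AE) simp
    then show "((\<integral>x. f x * f x \<partial>sphere_measure) = 0) = ae_eq_sphere f (\<lambda>_. 0)"
      using f by (auto simp: ae_eq_sphere_def square_integrable_zero)
  qed
qed

end

section \<open>Sobolev spaces on the sphere\<close>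

text \<open>
  Test functions are taken \<open>C\<^sup>1\<close> on the ambient Euclidean space; \<open>D\<phi>\<close> is the gradient of \<open>\<phi>\<close>.
\<close>

definition C1_gradient :: "('b::real_inner \<Rightarrow> real) \<Rightarrow> ('b \<Rightarrow> 'b) \<Rightarrow> bool" where
  "C1_gradient \<phi> D\<phi> \<longleftrightarrow> (\<forall>x. GDERIV \<phi> x :> D\<phi> x) \<and> continuous_on UNIV D\<phi>"

definition tangential :: "'a::euclidean_space \<Rightarrow> 'a \<Rightarrow> 'a" where
  "tangential \<theta> v = v - (v \<bullet> \<theta>) *\<^sub>R \<theta>"

text \<open>
  \<open>g\<close> is the component in direction \<open>e\<close> of the weak tangential gradient of \<open>c\<close>. On the unit sphere the
  tangential derivative \<open>\<nabla>\<^sub>\<theta>\<phi> \<bullet> e\<close> is not skew-adjoint: the divergence theorem reads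
  \<open>\<integral> \<nabla>\<^sub>\<theta>f \<bullet> e = (d - 1) \<integral> f (\<theta> \<bullet> e)\<close>, with \<open>d - 1\<close> the mean curvature.
\<close>

definition has_tangential_derivative ::
    "'a::euclidean_space l2_sphere \<Rightarrow> 'a \<Rightarrow> 'a l2_sphere \<Rightarrow> bool" where
  "has_tangential_derivative c e g \<longleftrightarrow>
     (\<forall>\<phi> D\<phi>. C1_gradient \<phi> D\<phi> \<longrightarrow>
        (\<integral>\<theta>. rep_l2_sphere c \<theta> * (tangential \<theta> (D\<phi> \<theta>) \<bullet> e) \<partial>sphere_measure) =
        - (\<integral>\<theta>. rep_l2_sphere g \<theta> * \<phi> \<theta> \<partial>sphere_measure)
        + (real DIM('a) - 1) * (\<integral>\<theta>. rep_l2_sphere c \<theta> * \<phi> \<theta> * (\<theta> \<bullet> e) \<partial>sphere_measure))"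

definition tangential_derivative :: "'a::euclidean_space \<Rightarrow> 'a l2_sphere \<Rightarrow> 'a l2_sphere" where
  "tangential_derivative e c = (THE g. has_tangential_derivative c e g)"

definition H1_sphere :: "'a::euclidean_space l2_sphere set" where
  "H1_sphere = {c. \<forall>e\<in>Basis. \<exists>g. has_tangential_derivative c e g}"

definition norm_H1 :: "'a::euclidean_space l2_sphere \<Rightarrow> real" where
  "norm_H1 c = sqrt ((norm c)\<^sup>2 + (\<Sum>e\<in>Basis. (norm (tangential_derivative e c))\<^sup>2))"

definition H2_sphere :: "'a::euclidean_space l2_sphere set" where
  "H2_sphere = {c \<in> H1_sphere. \<forall>e\<in>Basis. tangential_derivative e c \<in> H1_sphere}"

definition norm_H2 :: "'a::euclidean_space l2_sphere \<Rightarrow> real" where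
  "norm_H2 c = sqrt ((norm c)\<^sup>2 + (\<Sum>e\<in>Basis. (norm_H1 (tangential_derivative e c))\<^sup>2))"

definition norm_continuous_on ::
    "'b::real_vector set \<Rightarrow> ('b \<Rightarrow> real) \<Rightarrow> ('b \<Rightarrow> 'c::metric_space) \<Rightarrow> bool" where
  "norm_continuous_on S N f \<longleftrightarrow>
     (\<forall>u\<in>S. \<forall>\<eta>>0. \<exists>\<delta>>0. \<forall>v\<in>S. N (v - u) < \<delta> \<longrightarrow> dist (f v) (f u) < \<eta>)"

section \<open>The spaces \<open>H\<^sup>1\<close> of the ball and of the cylinder \<open>[0,1] \<times> \<partial>B\<^sub>1\<close>\<close>

abbreviation ball_measure :: "'a::euclidean_space measure" where
  "ball_measure \<equiv> restrict_space lborel (ball 0 1)"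

definition weak_gradient_ball :: "('a::euclidean_space \<Rightarrow> real) \<Rightarrow> ('a \<Rightarrow> 'a) \<Rightarrow> bool" where
  "weak_gradient_ball h Dh \<longleftrightarrow>
     square_integrable ball_measure h \<and> square_integrable ball_measure Dh \<and>
     (\<forall>\<phi> D\<phi>. C1_gradient \<phi> D\<phi> \<and> (\<exists>\<rho><1. \<forall>x. \<rho> \<le> norm x \<longrightarrow> \<phi> x = 0) \<longrightarrow>
        (\<integral>x. h x *\<^sub>R D\<phi> x \<partial>ball_measure) = - (\<integral>x. \<phi> x *\<^sub>R Dh x \<partial>ball_measure))"

text \<open>
  Elements of \<open>H\<^sup>1(B\<^sub>1)\<close> are represented by functions; functionals on \<open>H\<^sup>1(B\<^sub>1)\<close> are required below
  to be invariant under almost everywhere equality.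
\<close>

definition H1_ball :: "('a::euclidean_space \<Rightarrow> real) set" where
  "H1_ball = {h. \<exists>Dh. weak_gradient_ball h Dh}"

text \<open>The trace on \<open>\<partial>B\<^sub>1\<close>, determined by the Gauss--Green formula.\<close>

definition has_trace :: "('a::euclidean_space \<Rightarrow> real) \<Rightarrow> 'a l2_sphere \<Rightarrow> bool" where
  "has_trace h c \<longleftrightarrow>
     (\<exists>Dh. weak_gradient_ball h Dh \<and>
        (\<forall>\<phi> D\<phi>. C1_gradient \<phi> D\<phi> \<longrightarrow>
           (\<integral>x. h x *\<^sub>R D\<phi> x \<partial>ball_measure) + (\<integral>x. \<phi> x *\<^sub>R Dh x \<partial>ball_measure) =
           (\<integral>\<theta>. (rep_l2_sphere c \<theta> * \<phi> \<theta>) *\<^sub>R \<theta> \<partial>sphere_measure)))"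

text \<open>
  \<open>h(r, \<cdot>)\<close> is the trace of \<open>h\<close> on \<open>\<partial>B\<^sub>r\<close>, read on the unit sphere, so that it makes sense for every
  \<open>r \<in> (0,1]\<close> and not merely for almost every one.
\<close>

definition has_slice :: "('a::euclidean_space \<Rightarrow> real) \<Rightarrow> real \<Rightarrow> 'a l2_sphere \<Rightarrow> bool" where
  "has_slice h r w \<longleftrightarrow> has_trace (\<lambda>x. h (r *\<^sub>R x)) w"

abbreviation cylinder_measure :: "(real \<times> 'a::euclidean_space) measure" where
  "cylinder_measure \<equiv> restrict_space lborel {0..1} \<Otimes>\<^sub>M sphere_measure"

text \<open>
  \<open>u \<in> H\<^sup>1([0,1] \<times> \<partial>B\<^sub>1)\<close> with weak derivatives \<open>\<partial>\<^sub>r u = ur\<close> and \<open>\<nabla>\<^sub>\<theta> u = u\<theta>\<close>.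
\<close>

definition weak_derivatives_cylinder ::
    "(real \<Rightarrow> 'a::euclidean_space \<Rightarrow> real) \<Rightarrow> (real \<Rightarrow> 'a \<Rightarrow> real) \<Rightarrow> (real \<Rightarrow> 'a \<Rightarrow> 'a) \<Rightarrow> bool" where
  "weak_derivatives_cylinder u ur u\<theta> \<longleftrightarrow>
     square_integrable cylinder_measure (\<lambda>(r, \<theta>). u r \<theta>) \<and>
     square_integrable cylinder_measure (\<lambda>(r, \<theta>). ur r \<theta>) \<and>
     square_integrable cylinder_measure (\<lambda>(r, \<theta>). u\<theta> r \<theta>) \<and>
     (\<forall>\<phi> D\<phi>. C1_gradient \<phi> D\<phi> \<and>
        (\<exists>a>0. \<exists>b<1. \<forall>r x. r \<le> a \<or> b \<le> r \<longrightarrow> \<phi> (r, x) = 0) \<longrightarrow>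
          (\<integral>(r, \<theta>). u r \<theta> * fst (D\<phi> (r, \<theta>)) \<partial>cylinder_measure) =
            - (\<integral>(r, \<theta>). ur r \<theta> * \<phi> (r, \<theta>) \<partial>cylinder_measure) \<and>
          (\<integral>(r, \<theta>). u r \<theta> *\<^sub>R tangential \<theta> (snd (D\<phi> (r, \<theta>))) \<partial>cylinder_measure) =
            - (\<integral>(r, \<theta>). \<phi> (r, \<theta>) *\<^sub>R u\<theta> r \<theta> \<partial>cylinder_measure)
            + (real DIM('a) - 1) *\<^sub>R
                (\<integral>(r, \<theta>). (u r \<theta> * \<phi> (r, \<theta>)) *\<^sub>R \<theta> \<partial>cylinder_measure))"

definition zero_homogeneous :: "(real \<Rightarrow> 'a::euclidean_space \<Rightarrow> real) \<Rightarrow> bool" where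
  "zero_homogeneous u \<longleftrightarrow> (\<exists>c. AE (r, \<theta>) in cylinder_measure. u r \<theta> = c \<theta>)"

definition polar :: "nat \<Rightarrow> (real \<Rightarrow> 'a::euclidean_space \<Rightarrow> real) \<Rightarrow> 'a \<Rightarrow> real" where
  "polar k u x = norm x ^ k * u (norm x) (sgn x)"

definition homogeneous_extension :: "nat \<Rightarrow> 'a::euclidean_space l2_sphere \<Rightarrow> 'a \<Rightarrow> real" where
  "homogeneous_extension k c = polar k (\<lambda>_. rep_l2_sphere c)"

section \<open>Curves and strong solutions\<close>

text \<open>
  \<open>u \<in> H\<^sup>1(]a,b[; \<H>)\<close> with derivative \<open>u'\<close>, in terms of the continuous representative. For a Borel
  measurable \<open>u'\<close> with square integrable norm in this separable space, the Bochner integral and the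
  integral of the library for vector-valued functions agree.
\<close>

definition H1_curve ::
    "real \<Rightarrow> real \<Rightarrow> (real \<Rightarrow> 'a::euclidean_space l2_sphere) \<Rightarrow> (real \<Rightarrow> 'a l2_sphere) \<Rightarrow> bool" where
  "H1_curve a b u u' \<longleftrightarrow>
     set_borel_measurable lborel {a<..<b} u' \<and>
     set_integrable lborel {a<..<b} (\<lambda>t. (norm (u t))\<^sup>2) \<and>
     set_integrable lborel {a<..<b} (\<lambda>t. (norm (u' t))\<^sup>2) \<and>
     (\<forall>s t. a < s \<and> s \<le> t \<and> t < b \<longrightarrow> (u' has_integral (u t - u s)) {s..t})"

definition H1_loc_curve ::
    "real \<Rightarrow> (real \<Rightarrow> 'a::euclidean_space l2_sphere) \<Rightarrow> (real \<Rightarrow> 'a l2_sphere) \<Rightarrow> bool" where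
  "H1_loc_curve T u u' \<longleftrightarrow> (\<forall>a b. 0 < a \<and> a < b \<and> b < T \<longrightarrow> H1_curve a b u u')"

definition strong_solution ::
    "'a::euclidean_space l2_sphere set \<Rightarrow> ('a l2_sphere \<Rightarrow> 'a l2_sphere) \<Rightarrow> real \<Rightarrow>
     'a l2_sphere \<Rightarrow> (real \<Rightarrow> 'a l2_sphere) \<Rightarrow> bool" where
  "strong_solution K gradF T u0 u \<longleftrightarrow>
     0 < T \<and> (\<forall>t\<in>{0..<T}. u t \<in> K) \<and> continuous_on {0..<T} u \<and> u 0 = u0 \<and>
     (\<forall>t\<in>{0<..<T}. u t \<in> H2_sphere \<and> ((\<lambda>s. norm_H2 (u s - u t)) \<longlongrightarrow> 0) (at t within {0<..<T})) \<and>
     (\<exists>u'. H1_loc_curve T u u' \<and>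
        (AE t in lborel. t \<in> {0<..<T} \<longrightarrow> (\<forall>v\<in>K. 0 \<le> (u' t + gradF (u t)) \<bullet> (v - u t))))"

definition flow_continuous ::
    "'a::euclidean_space l2_sphere set \<Rightarrow> ('a l2_sphere \<Rightarrow> 'a l2_sphere) \<Rightarrow> 'a l2_sphere set \<Rightarrow> bool" where
  "flow_continuous K gradF U \<longleftrightarrow>
     (\<forall>t>0. \<forall>\<eta>>0. \<exists>\<delta>>0. \<forall>u0\<in>U. \<forall>v0\<in>U. \<forall>S T u v.
        strong_solution K gradF S u0 u \<and> strong_solution K gradF T v0 v \<and> norm (u0 - v0) \<le> \<delta> \<longrightarrow>
          (\<forall>s\<in>{0..t}. s < S \<and> s < T \<longrightarrow> norm (u s - v s) \<le> \<eta>))"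

section \<open>The hypotheses on the functionals\<close>

text \<open>
  A functional \<open>F : H\<^sup>1(\<partial>B\<^sub>1) \<rightarrow> \<real>\<close> is understood to be continuous on the Hilbert space
  \<open>H\<^sup>1(\<partial>B\<^sub>1)\<close>: this links the energy of a datum which is only in \<open>H\<^sup>1(\<partial>B\<^sub>1)\<close> with the energy along the
  flow, which takes values in \<open>H\<^sup>2(\<partial>B\<^sub>1)\<close>. The values of \<open>F\<close> outside \<open>H\<^sup>1(\<partial>B\<^sub>1)\<close> and of \<open>gradF\<close>
  outside \<open>H\<^sup>2(\<partial>B\<^sub>1)\<close> are irrelevant.
\<close>

definition energy_functional ::
    "('a::euclidean_space l2_sphere \<Rightarrow> real) \<Rightarrow> ('a l2_sphere \<Rightarrow> 'a l2_sphere) \<Rightarrow> bool" where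
  "energy_functional F gradF \<longleftrightarrow>
     norm_continuous_on H1_sphere norm_H1 F \<and>
     norm_continuous_on H2_sphere norm_H2 F \<and>
     norm_continuous_on H2_sphere norm_H2 gradF \<and>
     (\<forall>u\<in>H2_sphere. \<forall>v\<in>H2_sphere.
        ((\<lambda>t. F (u + t *\<^sub>R v)) has_real_derivative (v \<bullet> gradF u)) (at 0))"

definition constrained_slope ::
    "'a::euclidean_space l2_sphere set \<Rightarrow> ('a l2_sphere \<Rightarrow> 'a l2_sphere) \<Rightarrow> 'a l2_sphere \<Rightarrow> real" where
  "constrained_slope K gradF u =
     Sup (insert 0 ((\<lambda>v. - ((v - u) \<bullet> gradF u) / norm (v - u)) ` (K - {u})))"

definition critical_point ::
    "'a::euclidean_space l2_sphere set \<Rightarrow> ('a l2_sphere \<Rightarrow> 'a l2_sphere) \<Rightarrow> 'a l2_sphere \<Rightarrow> bool" where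
  "critical_point K gradF \<psi> \<longleftrightarrow>
     \<psi> \<in> K \<inter> H2_sphere \<and> (\<forall>v\<in>K. 0 \<le> (v - \<psi>) \<bullet> gradF \<psi>)"

definition lojasiewicz ::
    "'a::euclidean_space l2_sphere set \<Rightarrow> ('a l2_sphere \<Rightarrow> real) \<Rightarrow> ('a l2_sphere \<Rightarrow> 'a l2_sphere) \<Rightarrow>
     'a l2_sphere \<Rightarrow> real \<Rightarrow> real \<Rightarrow> real \<Rightarrow> real \<Rightarrow> bool" where
  "lojasiewicz K F gradF \<psi> \<gamma> CL \<delta>L EL \<longleftrightarrow>
     0 < \<gamma> \<and> \<gamma> \<le> 1 / 2 \<and> 0 < CL \<and> 0 < \<delta>L \<and> 0 < EL \<and>
     (\<forall>u\<in>K \<inter> H2_sphere. norm (u - \<psi>) \<le> \<delta>L \<and> F u - F \<psi> \<le> EL \<longrightarrow>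
        (max 0 (F u - F \<psi>)) powr (1 - \<gamma>) \<le> CL * constrained_slope K gradF u)"

definition flow_property ::
    "'a::euclidean_space l2_sphere set \<Rightarrow> ('a l2_sphere \<Rightarrow> 'a l2_sphere) \<Rightarrow> 'a l2_sphere \<Rightarrow> bool" where
  "flow_property K gradF \<psi> \<longleftrightarrow>
     (\<exists>U \<epsilon>fl. openin (top_of_set K) U \<and> \<psi> \<in> U \<and> 0 < \<epsilon>fl \<and>
        (\<forall>u0\<in>U. \<exists>u. strong_solution K gradF \<epsilon>fl u0 u \<and>
           (\<exists>u'. H1_curve 0 \<epsilon>fl u u') \<and>
           set_integrable lborel {0<..<\<epsilon>fl} (\<lambda>t. (norm_H2 (u t))\<^sup>2)) \<and>
        flow_continuous K gradF U)"

text \<open>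
  The class in \<open>L\<^sup>2(\<partial>B\<^sub>1)\<close> of the slice \<open>u(r, \<cdot>)\<close> is \<open>abs_l2_sphere (u r)\<close>; it is an element of
  \<open>H\<^sup>1(\<partial>B\<^sub>1)\<close> for almost every \<open>r\<close>. The inequality is only required when the integral of
  \<open>F(u(r, \<cdot>)) r\<^bsup>2k+d-3\<^esup>\<close> exists (nonintegrable functions have integral \<open>0\<close> in the library). The
  natural subtraction in the exponent is exact as soon as \<open>2k + d \<ge> 3\<close>.
\<close>

definition slicing_bound ::
    "nat \<Rightarrow> real \<Rightarrow> ('a::euclidean_space l2_sphere \<Rightarrow> real) \<Rightarrow>
     (real \<Rightarrow> 'a \<Rightarrow> real) \<Rightarrow> (real \<Rightarrow> 'a \<Rightarrow> real) \<Rightarrow> real" where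
  "slicing_bound k Csl F u ur =
     (LINT r:{0..1}|lborel. F (abs_l2_sphere (u r)) * r ^ (2 * k + DIM('a) - 3))
     + Csl * (LINT r:{0..1}|lborel.
                (\<integral>\<theta>. (ur r \<theta>)\<^sup>2 * r ^ (2 * k + DIM('a) - 1) \<partial>sphere_measure))"

definition slicing_property ::
    "nat \<Rightarrow> real \<Rightarrow> ('a::euclidean_space l2_sphere \<Rightarrow> real) \<Rightarrow> (('a \<Rightarrow> real) \<Rightarrow> real) \<Rightarrow> bool" where
  "slicing_property k Csl F G \<longleftrightarrow>
     (\<forall>u ur u\<theta>. weak_derivatives_cylinder u ur u\<theta> \<and>
        set_integrable lborel {0..1} (\<lambda>r. F (abs_l2_sphere (u r)) * r ^ (2 * k + DIM('a) - 3)) \<longrightarrow>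
          G (polar k u) \<le> slicing_bound k Csl F u ur \<and>
          (G (polar k u) = slicing_bound k Csl F u ur \<longleftrightarrow> zero_homogeneous u))"

definition ae_invariant :: "(('a::euclidean_space \<Rightarrow> real) \<Rightarrow> real) \<Rightarrow> bool" where
  "ae_invariant G \<longleftrightarrow>
     (\<forall>f\<in>H1_ball. \<forall>g\<in>H1_ball. (AE x in ball_measure. f x = g x) \<longrightarrow> G f = G g)"

end

(*
  The competitor is a piece of the constrained gradient flow of F started at c, run over a time of
  order 1/Csl and reparametrised so that r = 1 corresponds to time 0.  Along the flow the variational
  inequality, tested with the earlier states u(t - h), yields the energy inequality
  F(u(t)) + int_s^t |u'|^2 <= F(u(s)).  Hence in the slicing inequality for this competitor the
  radial derivative costs at most half of the energy gained in the spherical term, and what remains is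
  a fixed multiple of the drop of F along the flow.  By the same variational inequality the constrained
  slope is at most |u'|, so the Lojasiewicz inequality forces F either to lose half of its excess
  over F(psi), or to drop by a multiple of that excess to the power 2 - 2 gamma.  Homogeneous
  extensions give equality in the slicing inequality, which expresses G(z) - G(phi) through
  F(c) - F(psi).

  The energy inequality has to hold from time 0 on, where the flow is only known to be continuous in
  L^2.  As the squared H^2 norm is integrable in time and c lies in H^1, interpolation gives
  convergence to c in H^1 along a sequence of times, and there F is continuous.
*)
theory Submission
  imports Defs
begin

text \<open>The time of order 1/Csl may exceed the guaranteed lifetime of the flow. Near \<psi>,
  continuous dependence on the datum, compared with the stationary solution \<psi>, keeps the flow
  in the open set where it can be restarted, so its lifetime can be prolonged; this fixes \<delta>0.
  With n = 2k + d - 2, the time \<rho> = 1/(2 Csl n) is the one for which an integration by parts in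
  r bounds the radial cost by half of the gain.

  A second difficulty is that derivatives on the sphere are known only weakly, while the
  interpolation integrates by parts between two Sobolev functions and the competitor needs a trace
  on every sphere. The functions (y.a)^j take the place of mollifiers: finite families of them are
  invariant under the spherical Laplacian, and L^2 projections onto such invariant spans do not
  increase the Dirichlet energy. For the traces, the curve in L^2 is realised as a function that is
  a primitive in r along almost every direction.\<close>

abbreviation cls :: "('a::euclidean_space \<Rightarrow> real) \<Rightarrow> 'a l2_sphere" where "cls \<equiv> abs_l2_sphere"

abbreviation rep :: "'a::euclidean_space l2_sphere \<Rightarrow> 'a \<Rightarrow> real" where "rep \<equiv> rep_l2_sphere"

abbreviation L2_sphere :: "('a::euclidean_space \<Rightarrow> 'b::real_normed_vector) \<Rightarrow> bool" where
  "L2_sphere \<equiv> square_integrable sphere_measure"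

abbreviation sphere_integral ::
    "('a::euclidean_space \<Rightarrow> 'b::{banach, second_countable_topology}) \<Rightarrow> 'b" (binder "\<oint>" 10) where
  "sphere_integral \<equiv> integral\<^sup>L sphere_measure"

abbreviation L2_cylinder :: "(real \<Rightarrow> 'a::euclidean_space \<Rightarrow> 'b::real_normed_vector) \<Rightarrow> bool" where
  "L2_cylinder u \<equiv> square_integrable cylinder_measure (\<lambda>(r, y). u r y)"

abbreviation jointly_measurable :: "(real \<Rightarrow> 'a::euclidean_space \<Rightarrow> 'b::topological_space) \<Rightarrow> bool" where
  "jointly_measurable u \<equiv> (\<lambda>(r, y). u r y) \<in> borel_measurable (borel \<Otimes>\<^sub>M borel)"

abbreviation unit_lebesgue :: "real measure" where
  "unit_lebesgue \<equiv> restrict_space lborel {0..1}"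

section \<open>The surface measure and polar coordinates\<close>

lemma sets_sphere_measure [simp, measurable_cong]: "sets sphere_measure = sets borel"
 by (simp add: sphere_measure_def)

lemma space_sphere_measure [simp]: "space sphere_measure = UNIV"
 by (simp add: sphere_measure_def)

lemma measurable_sgn [measurable]: "(sgn :: 'a::euclidean_space \<Rightarrow> 'a) \<in> borel_measurable borel"
proof -
 have "(\<lambda>x::'a. inverse (norm x) *\<^sub>R x) \<in> borel_measurable borel" by measurable
 then show ?thesis by (simp add: sgn_div_norm[abs_def])
qed

lemma emeasure_sphere_measure:
 fixes A :: "'a::euclidean_space set"
 assumes "A \<in> sets borel"
 shows "emeasure sphere_measure A = DIM('a) * emeasure lborel (ball 0 1 \<inter> sgn -` A)"
proof -
 have [measurable]: "A \<in> sets borel" "sgn -` A \<in> sets (borel :: 'a measure)"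
  using assms measurable_sets[OF measurable_sgn assms] by auto
 have "emeasure sphere_measure A = (\<integral>\<^sup>+x. ennreal (DIM('a)) * indicator (ball 0 1 \<inter> sgn -` A) x \<partial>lborel)"
  unfolding sphere_measure_def
  by (subst emeasure_distr) (auto simp: emeasure_density indicator_def intro!: nn_integral_cong)
 also have "\<dots> = DIM('a) * emeasure lborel (ball 0 1 \<inter> sgn -` A)"
  by (subst nn_integral_cmult_indicator) (auto simp: ennreal_of_nat_eq_real_of_nat)
 finally show ?thesis .
qed

lemma emeasure_lborel_ball_finite: "emeasure lborel (ball (x::'a::euclidean_space) r) < \<infinity>"
 by (rule emeasure_bounded_finite) simp

interpretation sphere_measure: finite_measure "sphere_measure :: 'a::euclidean_space measure"
proof
 have "emeasure sphere_measure (UNIV :: 'a set) = DIM('a) * emeasure lborel (ball (0::'a) 1)"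
  by (subst emeasure_sphere_measure) auto
 also have "\<dots> \<noteq> \<infinity>"
  using emeasure_lborel_ball_finite[of "0::'a" 1] by (simp add: ennreal_mult_eq_top_iff)
 finally show "emeasure (sphere_measure :: 'a measure) (space sphere_measure) \<noteq> \<infinity>" by simp
qed

lemma AE_sphere_measure_norm: "AE x in (sphere_measure :: 'a::euclidean_space measure). norm x = 1"
proof (rule AE_I)
 show "{x \<in> space sphere_measure. norm x \<noteq> 1} \<subseteq> {x :: 'a. norm x \<noteq> 1}" by auto
 show "{x :: 'a. norm x \<noteq> 1} \<in> sets sphere_measure" by measurable
 have "ball 0 1 \<inter> sgn -` {x :: 'a. norm x \<noteq> 1} = {0}"
  by (auto simp: norm_sgn)
 then show "emeasure sphere_measure {x :: 'a. norm x \<noteq> 1} = 0"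
  by (subst emeasure_sphere_measure) (auto simp: emeasure_lborel_singleton)
qed

interpretation unit_interval: finite_measure "unit_lebesgue"
 by (auto intro!: finite_measureI simp: emeasure_restrict_space space_restrict_space)

interpretation cylinder: pair_sigma_finite "unit_lebesgue"
  "sphere_measure :: 'a::euclidean_space measure" ..

interpretation cylinder_measure: finite_measure "cylinder_measure :: (real \<times> 'a::euclidean_space) measure"
 by (intro finite_measure_pair_measure unit_interval.finite_measure_axioms sphere_measure.finite_measure_axioms)

text \<open>Dilation by \<open>a\<close> fixes directions and multiplies volume by a^d; this power
  is the origin of the radial density r^(d-1).\<close>

lemma emeasure_cone_scale:
 fixes B :: "'a::euclidean_space set"
 assumes [measurable]: "B \<in> sets borel" and "0 < a"
 shows "emeasure lborel (cball 0 a \<inter> sgn -` B) = ennreal (a ^ DIM('a)) * emeasure lborel (cball 0 1 \<inter> sgn -` B)"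
proof -
 have sB[measurable]: "sgn -` B \<in> sets (borel :: 'a measure)"
  using measurable_sets[OF measurable_sgn assms(1)] by auto
 have "emeasure lborel (cball 0 a \<inter> sgn -` B)
   = emeasure (density (distr lborel borel (\<lambda>x. 0 + a *\<^sub>R x)) (\<lambda>_. ennreal (\<bar>a\<bar>^DIM('a)))) (cball 0 a \<inter> sgn -` B)"
  using lborel_affine[of a 0] assms(2) by (metis less_irrefl)
 also have "\<dots> = ennreal (\<bar>a\<bar>^DIM('a)) * emeasure (distr lborel borel (\<lambda>x. 0 + a *\<^sub>R x)) (cball 0 a \<inter> sgn -` B)"
  by (subst emeasure_density_const) auto
 also have "emeasure (distr lborel borel (\<lambda>x. 0 + a *\<^sub>R x)) (cball 0 a \<inter> sgn -` B)
   = emeasure lborel ((\<lambda>x. 0 + a *\<^sub>R x) -` (cball 0 a \<inter> sgn -` B))"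
  by (subst emeasure_distr) auto
 also have "(\<lambda>x. 0 + a *\<^sub>R x) -` (cball 0 a \<inter> sgn -` B) = cball 0 1 \<inter> sgn -` B"
  using assms(2) by (auto simp: sgn_scaleR)
 finally show ?thesis using assms(2) by simp
qed

lemma emeasure_cone_cball:
 fixes B :: "'a::euclidean_space set"
 assumes [measurable]: "B \<in> sets borel"
 shows "emeasure lborel (cball 0 1 \<inter> sgn -` B) = emeasure lborel (ball 0 1 \<inter> sgn -` B)"
proof (rule emeasure_eq_AE)
 have "sphere 0 1 \<in> null_sets (lborel :: 'a measure)"
  using negligible_sphere[of "0::'a" 1] by (simp add: negligible_iff_null_sets null_sets_completion_iff)
 then have "AE x::'a in lborel. x \<notin> sphere 0 1" by (rule AE_not_in)
 then show "AE x in lborel. (x \<in> cball 0 1 \<inter> sgn -` B) = (x \<in> ball 0 1 \<inter> sgn -` B)"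
  by eventually_elim auto
 have "sgn -` B \<in> sets (borel :: 'a measure)"
  using measurable_sets[OF measurable_sgn assms(1)] by auto
 then show "cball 0 1 \<inter> sgn -` B \<in> sets lborel" "ball 0 1 \<inter> sgn -` B \<in> sets lborel" by auto
qed

text \<open>Both measures on the line are compared on half lines \<open>{x<..}\<close>, which
  determine them. For 0 < x < 1 the left side is the cone minus its part in the closed ball of
  radius x, that is (1 - x^d) times the volume of the cone, and the right side integrates r^(d-1)
  from x to 1; the factor d in the surface measure cancels the 1/d.\<close>

lemma polar_measure_slice:
 fixes B :: "'a::euclidean_space set"
 assumes [measurable]: "B \<in> sets borel"
 shows "distr (density lborel (indicator (ball 0 1 \<inter> sgn -` B))) borel norm =
  density lborel (\<lambda>r. emeasure sphere_measure B * ennreal (r ^ (DIM('a) - 1)) * indicator {0..1} r)"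
  (is "?L = ?R")
proof (rule measure_eqI_lessThan)
 have sB[measurable]: "sgn -` B \<in> sets (borel :: 'a measure)"
  using measurable_sets[OF measurable_sgn assms(1)] by auto
 define m where "m = emeasure lborel (ball 0 1 \<inter> sgn -` B)"
 have mfin: "m < \<infinity>"
  unfolding m_def
  by (rule le_less_trans[OF emeasure_mono emeasure_lborel_ball_finite[of "0::'a" 1]]) auto
 have L: "emeasure ?L {x<..} = emeasure lborel (ball 0 1 \<inter> sgn -` B \<inter> {z. x < norm z})" for x
 proof -
  have "emeasure ?L {x<..} = emeasure (density lborel (indicator (ball 0 1 \<inter> sgn -` B))) {z. x < norm z}"
   by (subst emeasure_distr) (auto simp: vimage_def)
  also have "\<dots> = (\<integral>\<^sup>+z. indicator (ball 0 1 \<inter> sgn -` B) z * indicator {z. x < norm z} z \<partial>lborel)"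
   by (rule emeasure_density) (auto intro!: borel_measurable_indicator)
  also have "\<dots> = (\<integral>\<^sup>+z. indicator (ball 0 1 \<inter> sgn -` B \<inter> {z. x < norm z}) z \<partial>lborel)"
   by (intro nn_integral_cong) (auto simp: indicator_def)
  also have "\<dots> = emeasure lborel (ball 0 1 \<inter> sgn -` B \<inter> {z. x < norm z})"
   by (subst nn_integral_indicator) auto
  finally show ?thesis .
 qed
 have R: "emeasure ?R {x<..} = DIM('a) * m * (\<integral>\<^sup>+r. ennreal (r ^ (DIM('a) - 1)) * indicator ({0..1} \<inter> {x<..}) r \<partial>lborel)" for x
 proof -
  have "emeasure ?R {x<..} = (\<integral>\<^sup>+r. emeasure sphere_measure B * (ennreal (r ^ (DIM('a) - 1)) * indicator ({0..1} \<inter> {x<..}) r) \<partial>lborel)"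
   by (subst emeasure_density) (auto simp: indicator_def intro!: nn_integral_cong)
  also have "\<dots> = emeasure sphere_measure B * (\<integral>\<^sup>+r. ennreal (r ^ (DIM('a) - 1)) * indicator ({0..1} \<inter> {x<..}) r \<partial>lborel)"
   by (subst nn_integral_cmult) auto
  finally show ?thesis by (simp add: emeasure_sphere_measure m_def)
 qed
 have I: "(\<integral>\<^sup>+r. ennreal (r ^ (DIM('a) - 1)) * indicator {x..1} r \<partial>lborel) = ennreal ((1 - x ^ DIM('a)) / DIM('a))"
  if "0 \<le> x" "x \<le> 1" for x :: real
 proof -
  have "(\<integral>\<^sup>+r. ennreal (r ^ (DIM('a) - 1)) * indicator {x..1} r \<partial>lborel)
    = ennreal (1 ^ DIM('a) / DIM('a) - x ^ DIM('a) / DIM('a))"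
  proof (rule nn_integral_FTC_Icc[where F="\<lambda>x. x ^ DIM('a) / DIM('a)"])
   fix y assume "y \<in> {x..1}"
   show "((\<lambda>x. x ^ DIM('a) / DIM('a)) has_real_derivative y ^ (DIM('a) - 1)) (at y)"
    by (auto intro!: derivative_eq_intros)
  qed (use that in auto)
  then show ?thesis by (simp add: diff_divide_distrib)
 qed
 have eq: "emeasure ?L {x<..} = emeasure ?R {x<..}" for x
 proof -
  consider "1 \<le> x" | "x < 0" | "x = 0" | "0 < x" "x < 1" by linarith
  then show ?thesis
  proof cases
   case 1
   then have "ball 0 1 \<inter> sgn -` B \<inter> {z. x < norm z} = {}" "{0..1} \<inter> {x<..} = {}" by auto
   then show ?thesis unfolding L R by simp
  next
   case 2
   then have "ball 0 1 \<inter> sgn -` B \<inter> {z. x < norm z} = ball 0 1 \<inter> sgn -` B" "{0..1} \<inter> {x<..} = {0..1}"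
    by (auto intro: less_le_trans[OF _ norm_ge_zero])
   then show ?thesis unfolding L R using I[of 0]
    by (simp add: zero_power m_def[symmetric] ennreal_of_nat_eq_real_of_nat mult.assoc ennreal_mult'[symmetric] mult.left_commute)
  next
   case 3
   have "emeasure lborel (ball 0 1 \<inter> sgn -` B \<inter> {z. x < norm z}) = m"
    unfolding m_def
   proof (rule emeasure_eq_AE)
    have "AE z::'a in lborel. z \<noteq> 0" by (rule AE_lborel_singleton)
    then show "AE z in lborel. (z \<in> ball 0 1 \<inter> sgn -` B \<inter> {z. x < norm z}) = (z \<in> ball 0 1 \<inter> sgn -` B)"
     by eventually_elim (use 3 in auto)
   qed auto
   moreover have "(\<integral>\<^sup>+r. ennreal (r ^ (DIM('a) - 1)) * indicator ({0..1} \<inter> {x<..}) r \<partial>lborel)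
     = (\<integral>\<^sup>+r. ennreal (r ^ (DIM('a) - 1)) * indicator {0..1} r \<partial>lborel)"
   proof (rule nn_integral_cong_AE)
    have "AE z::real in lborel. z \<noteq> 0" by (rule AE_lborel_singleton)
    then show "AE r in lborel. ennreal (r ^ (DIM('a) - 1)) * indicator ({0..1} \<inter> {x<..}) r
     = ennreal (r ^ (DIM('a) - 1)) * indicator {0..1} r"
     by eventually_elim (use 3 in \<open>auto simp: indicator_def\<close>)
   qed
   ultimately show ?thesis unfolding L R using I[of 0]
    by (simp add: zero_power ennreal_of_nat_eq_real_of_nat mult.assoc ennreal_mult'[symmetric] mult.left_commute)
  next
   case 4
   have "ball 0 1 \<inter> sgn -` B \<inter> {z. x < norm z} = (ball 0 1 \<inter> sgn -` B) - (cball 0 x \<inter> sgn -` B)"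
    by auto
   moreover have "emeasure lborel ((ball 0 1 \<inter> sgn -` B) - (cball 0 x \<inter> sgn -` B))
     = emeasure lborel (ball 0 1 \<inter> sgn -` B) - emeasure lborel (cball 0 x \<inter> sgn -` B)"
   proof (rule emeasure_Diff)
    show "emeasure lborel (cball 0 x \<inter> sgn -` B) \<noteq> \<infinity>"
     using emeasure_cone_scale[OF assms \<open>0 < x\<close>] emeasure_cone_cball[OF assms] mfin
     by (simp add: m_def ennreal_mult_eq_top_iff)
    show "cball 0 x \<inter> sgn -` B \<subseteq> ball 0 1 \<inter> sgn -` B" using 4 by auto
   qed auto
   ultimately have "emeasure lborel (ball 0 1 \<inter> sgn -` B \<inter> {z. x < norm z}) = m - ennreal (x ^ DIM('a)) * m"
    using emeasure_cone_scale[OF assms \<open>0 < x\<close>] emeasure_cone_cball[OF assms] by (simp add: m_def)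
   also have "\<dots> = ennreal (1 - x ^ DIM('a)) * m"
   proof -
    obtain q where q: "m = ennreal q" "q \<ge> 0" using mfin by (cases m) auto
    have "x ^ DIM('a) \<le> 1" using 4 by (simp add: power_le_one)
    then show ?thesis using q 4
     by (simp add: ennreal_mult'[symmetric] ennreal_minus algebra_simps)
   qed
   finally have 1: "emeasure ?L {x<..} = ennreal (1 - x ^ DIM('a)) * m" unfolding L .
   have "(\<integral>\<^sup>+r. ennreal (r ^ (DIM('a) - 1)) * indicator ({0..1} \<inter> {x<..}) r \<partial>lborel)
     = (\<integral>\<^sup>+r. ennreal (r ^ (DIM('a) - 1)) * indicator {x..1} r \<partial>lborel)"
   proof (rule nn_integral_cong_AE)
    have "AE z::real in lborel. z \<noteq> x" by (rule AE_lborel_singleton)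
    then show "AE r in lborel. ennreal (r ^ (DIM('a) - 1)) * indicator ({0..1} \<inter> {x<..}) r
     = ennreal (r ^ (DIM('a) - 1)) * indicator {x..1} r"
     by eventually_elim (use 4 in \<open>auto simp: indicator_def\<close>)
   qed
   then have "emeasure ?R {x<..} = DIM('a) * m * ennreal ((1 - x ^ DIM('a)) / DIM('a))"
    unfolding R using I[of x] 4 by simp
   also have "\<dots> = ennreal (1 - x ^ DIM('a)) * m"
    by (simp add: ennreal_of_nat_eq_real_of_nat mult.assoc ennreal_mult'[symmetric] mult.left_commute
      mult.commute)
   finally show ?thesis using 1 by simp
  qed
 qed
 show "emeasure ?L {x<..} = emeasure ?R {x<..}" for x by (rule eq)
 show "emeasure ?L {x<..} < \<infinity>" for x
 proof -
  have "emeasure lborel (ball 0 1 \<inter> sgn -` B \<inter> {z. x < norm z}) \<le> m"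
   unfolding m_def by (rule emeasure_mono) auto
  then show ?thesis unfolding L using mfin by (simp add: order.strict_trans1)
 qed
qed simp_all


lemma measurable_power_unit_interval [measurable]:
 "(\<lambda>r. ennreal (r ^ n)) \<in> borel_measurable unit_lebesgue"
 by (rule measurable_restrict_space1) simp

text \<open>A product measure is determined by its values on rectangles. For
  \<open>A \<times> B\<close> the set \<open>B\<close> of directions is kept fixed, and the claim
  becomes \<open>polar_measure_slice\<close> evaluated at the set \<open>A\<close> of radii.\<close>

lemma polar_measure:
 "density unit_lebesgue (\<lambda>r. ennreal (r ^ (DIM('a) - 1))) \<Otimes>\<^sub>M sphere_measure =
  distr (ball_measure :: 'a::euclidean_space measure) (unit_lebesgue \<Otimes>\<^sub>M sphere_measure)
   (\<lambda>x. (norm x, sgn x))" (is "?R \<Otimes>\<^sub>M _ = distr _ ?N ?f")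
proof (rule pair_measure_eqI)
 have f: "?f \<in> ball_measure \<rightarrow>\<^sub>M ?N"
 proof (rule measurable_Pair)
  show "norm \<in> (ball_measure :: 'a measure) \<rightarrow>\<^sub>M unit_lebesgue"
   by (rule measurable_restrict_space2) (auto simp: space_restrict_space intro!: measurable_restrict_space1)
  show "sgn \<in> (ball_measure :: 'a measure) \<rightarrow>\<^sub>M sphere_measure"
   by (rule measurable_restrict_space1) (simp add: measurable_sgn)
 qed
 show "sigma_finite_measure (sphere_measure :: 'a measure)" by unfold_locales
 have "finite_measure ?R"
 proof
  have "emeasure ?R (space ?R) = (\<integral>\<^sup>+r. ennreal (r ^ (DIM('a) - 1)) * indicator (space unit_lebesgue) r \<partial>unit_lebesgue)"
   unfolding space_density by (rule emeasure_density[OF _ sets.top]) simp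
  also have "\<dots> \<le> (\<integral>\<^sup>+r. 1 \<partial>unit_lebesgue)"
   by (rule nn_integral_mono) (auto simp: space_restrict_space power_le_one split: split_indicator)
  also have "\<dots> < \<infinity>" using unit_interval.emeasure_finite by (simp add: less_top[symmetric])
  finally show "emeasure ?R (space ?R) \<noteq> \<infinity>" by simp
 qed
 then show "sigma_finite_measure ?R" by (simp add: finite_measure_def)
 show "sets (?R \<Otimes>\<^sub>M sphere_measure) = sets (distr ball_measure ?N ?f)"
  by (simp add: sets_pair_measure_cong[of ?R "unit_lebesgue" sphere_measure sphere_measure])
 fix A B assume A: "A \<in> sets ?R" and B: "B \<in> sets (sphere_measure :: 'a measure)"
 then have A': "A \<in> sets borel" "A \<subseteq> {0..1}" by (auto simp: sets_restrict_space)
 have B'[measurable]: "B \<in> sets (borel :: 'a measure)" using B by simp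
 have sB[measurable]: "sgn -` B \<in> sets (borel :: 'a measure)"
  using measurable_sets[OF measurable_sgn B'] by auto
 have "emeasure ?R A = (\<integral>\<^sup>+r. ennreal (r ^ (DIM('a) - 1)) * indicator A r \<partial>unit_lebesgue)"
  using A by (subst emeasure_density) auto
 also have "\<dots> = (\<integral>\<^sup>+r. ennreal (r ^ (DIM('a) - 1)) * indicator A r * indicator {0..1} r \<partial>lborel)"
  by (subst nn_integral_restrict_space) auto
 finally have RA: "emeasure ?R A = (\<integral>\<^sup>+r. ennreal (r ^ (DIM('a) - 1)) * indicator A r * indicator {0..1} r \<partial>lborel)" .
 have [measurable]: "A \<in> sets borel" by (fact A')
 have "emeasure (distr ball_measure ?N ?f) (A \<times> B) = emeasure ball_measure (?f -` (A \<times> B) \<inter> ball 0 1)"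
  using A B by (subst emeasure_distr[OF f]) (auto simp: space_restrict_space intro!: pair_measureI)
 also have "\<dots> = emeasure lborel (?f -` (A \<times> B) \<inter> ball 0 1)"
  by (rule emeasure_restrict_space) auto
 also have "?f -` (A \<times> B) \<inter> ball 0 1 = ball 0 1 \<inter> sgn -` B \<inter> norm -` A" by auto
 also have "emeasure lborel \<dots> = (\<integral>\<^sup>+z. indicator (ball 0 1 \<inter> sgn -` B) z * indicator (norm -` A) z \<partial>lborel)"
  by (subst nn_integral_indicator[symmetric])
    (auto simp: indicator_def intro!: nn_integral_cong sets.Int measurable_sets[of norm borel borel, simplified])
 also have "\<dots> = emeasure (distr (density lborel (indicator (ball 0 1 \<inter> sgn -` B))) borel norm) A"
 proof (subst emeasure_distr)
  have "norm -` A \<in> sets (borel :: 'a measure)" using measurable_sets[of norm borel borel A] by simp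
  then have "emeasure (density lborel (indicator (ball 0 1 \<inter> sgn -` B))) (norm -` A)
    = (\<integral>\<^sup>+z. indicator (ball 0 1 \<inter> sgn -` B) z * indicator (norm -` A) z \<partial>lborel)"
   by (intro emeasure_density) (auto intro!: borel_measurable_indicator)
  then show "(\<integral>\<^sup>+z. indicator (ball 0 1 \<inter> sgn -` B) z * indicator (norm -` A) z \<partial>lborel) =
   emeasure (density lborel (indicator (ball 0 1 \<inter> sgn -` B))) (norm -` A \<inter> space (density lborel (indicator (ball 0 1 \<inter> sgn -` B))))"
   by simp
 qed auto
 also have "\<dots> = (\<integral>\<^sup>+r. emeasure sphere_measure B * (ennreal (r ^ (DIM('a) - 1)) * indicator A r * indicator {0..1} r) \<partial>lborel)"
  unfolding polar_measure_slice[OF B']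
  by (subst emeasure_density) (auto intro!: nn_integral_cong simp: indicator_def)
 also have "\<dots> = emeasure sphere_measure B * emeasure ?R A"
  unfolding RA by (subst nn_integral_cmult) auto
 finally show "emeasure ?R A * emeasure sphere_measure B = emeasure (distr ball_measure ?N ?f) (A \<times> B)"
  by (simp add: mult.commute)
qed

lemma measurable_cylinder:
 assumes "f \<in> borel_measurable (borel \<Otimes>\<^sub>M (borel :: 'a::euclidean_space measure))"
 shows "f \<in> borel_measurable cylinder_measure"
proof -
 have "(\<lambda>x. (fst x, snd x)) \<in> (cylinder_measure :: (real \<times> 'a) measure) \<rightarrow>\<^sub>M borel \<Otimes>\<^sub>M borel"
 proof (rule measurable_Pair)
  have "(\<lambda>x. x) \<in> unit_lebesgue \<rightarrow>\<^sub>M borel" by (rule measurable_restrict_space1) simp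
  from measurable_compose[OF measurable_fst this]
  show "fst \<in> (cylinder_measure :: (real \<times> 'a) measure) \<rightarrow>\<^sub>M borel" .
  show "snd \<in> (cylinder_measure :: (real \<times> 'a) measure) \<rightarrow>\<^sub>M borel"
   using measurable_snd[of "unit_lebesgue" "sphere_measure :: 'a measure"]
   by (simp cong: measurable_cong_sets)
 qed
 from measurable_compose[OF this assms] show ?thesis by simp
qed

text \<open>Polar coordinates in the direction in which integrals are pulled back. The value 0 in
  the conditional keeps the map inside the open ball; it is taken where
  \<open>norm (r *\<^sub>R z) \<ge> 1\<close>, a null set of the cylinder.\<close>

lemma polar_distr:
 "ball_measure = distr (density (cylinder_measure :: (real \<times> 'a::euclidean_space) measure)
   (\<lambda>(r, z). ennreal (r ^ (DIM('a) - 1)))) ball_measure (\<lambda>(r, z). if norm (r *\<^sub>R z) < 1 then r *\<^sub>R z else 0)"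
 (is "_ = distr ?D _ ?g")
proof -
 let ?R = "density unit_lebesgue (\<lambda>r. ennreal (r ^ (DIM('a) - 1)))"
 let ?f = "\<lambda>x :: 'a. (norm x, sgn x)"
 have D: "?D = ?R \<Otimes>\<^sub>M sphere_measure"
 proof -
  have "?R \<Otimes>\<^sub>M density sphere_measure (\<lambda>_. 1) =
    density (unit_lebesgue \<Otimes>\<^sub>M sphere_measure) (\<lambda>(x,y). ennreal (x ^ (DIM('a) - 1)) * 1)"
   by (rule pair_measure_density) (simp_all add: density_1 sphere_measure.sigma_finite_measure_axioms)
  from this[symmetric] show ?thesis by (simp add: density_1)
 qed
 have f: "?f \<in> ball_measure \<rightarrow>\<^sub>M cylinder_measure"
 proof (rule measurable_Pair)
  show "norm \<in> (ball_measure :: 'a measure) \<rightarrow>\<^sub>M unit_lebesgue"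
   by (rule measurable_restrict_space2) (auto simp: space_restrict_space intro!: measurable_restrict_space1)
  show "sgn \<in> (ball_measure :: 'a measure) \<rightarrow>\<^sub>M sphere_measure"
   by (rule measurable_restrict_space1) (simp add: measurable_sgn)
 qed
 have g: "?g \<in> cylinder_measure \<rightarrow>\<^sub>M ball_measure"
 proof (rule measurable_restrict_space2)
  have "?g \<in> borel_measurable cylinder_measure" by (rule measurable_cylinder) measurable
  then show "?g \<in> cylinder_measure \<rightarrow>\<^sub>M lborel" by simp
 qed auto
 have "distr ?D ball_measure ?g = distr (distr ball_measure cylinder_measure ?f) ball_measure ?g"
  unfolding D polar_measure ..
 also have "\<dots> = distr ball_measure ball_measure (?g \<circ> ?f)"
  by (rule distr_distr[OF g f])
 also have "\<dots> = distr ball_measure ball_measure (\<lambda>x. x)"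
 proof (rule distr_cong)
  fix x :: 'a assume "x \<in> space ball_measure"
  then show "(?g \<circ> ?f) x = x" by (cases "x = 0") (auto simp: space_restrict_space sgn_div_norm)
 qed simp_all
 also have "\<dots> = ball_measure" by (rule distr_id)
 finally show ?thesis by simp
qed

text \<open>Up to a null set the cylinder consists of the points with 0 < r < 1 and |y| = 1, where r
  y has norm r and direction y; identities in polar coordinates are checked only there.\<close>

lemma AE_cylinder:
 assumes "\<And>r y. r \<in> {0..<1} \<Longrightarrow> 0 < r \<Longrightarrow> norm y = 1 \<Longrightarrow> P r y"
 shows "AE (r, y) in (cylinder_measure :: (real \<times> 'a::euclidean_space) measure). P r y"
proof -
 have "AE r in lborel. r \<in> {0..1} \<longrightarrow> 0 < r \<and> r < (1::real)"
  using AE_lborel_singleton[of "0::real"] AE_lborel_singleton[of "1::real"] by eventually_elim auto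
 then have "AE r in unit_lebesgue. 0 < r \<and> r < (1::real)"
  by (subst AE_restrict_space_iff) simp_all
 then have 1: "AE r in unit_lebesgue. AE y in (sphere_measure :: 'a measure). 0 < r \<and> r < (1::real) \<and> norm y = 1"
  by (rule eventually_mono) (rule eventually_mono[OF AE_sphere_measure_norm], auto)
 have "AE x in (cylinder_measure :: (real \<times> 'a) measure). 0 < fst x \<and> fst x < 1 \<and> norm (snd x) = 1"
 proof (rule cylinder.AE_pair_measure)
  have "(\<lambda>x::real \<times> 'a. if 0 < fst x \<and> fst x < 1 \<and> norm (snd x) = 1 then 1 else 0::real) \<in> borel_measurable (borel \<Otimes>\<^sub>M borel)"
   by measurable
  from measurable_sets[OF measurable_cylinder[OF this], of "{1}"]
  have "(\<lambda>x::real \<times> 'a. if 0 < fst x \<and> fst x < 1 \<and> norm (snd x) = 1 then 1 else 0::real) -` {1} \<inter> space cylinder_measure \<in> sets cylinder_measure"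
   by simp
  also have "(\<lambda>x::real \<times> 'a. if 0 < fst x \<and> fst x < 1 \<and> norm (snd x) = 1 then 1 else 0::real) -` {1} \<inter> space cylinder_measure
   = {x \<in> space cylinder_measure. 0 < fst x \<and> fst x < 1 \<and> norm (snd x) = 1}" by (auto split: if_splits)
  finally show "{x \<in> space (cylinder_measure :: (real \<times> 'a) measure). 0 < fst x \<and> fst x < 1 \<and> norm (snd x) = 1} \<in> sets cylinder_measure" .
 qed (use 1 in simp)
 then show ?thesis by eventually_elim (use assms in auto)
qed

lemma
 fixes f :: "'a::euclidean_space \<Rightarrow> 'b::{banach, second_countable_topology}"
 assumes f[measurable]: "f \<in> borel_measurable borel"
 shows integrable_polar: "integrable ball_measure f \<longleftrightarrow>
   integrable cylinder_measure (\<lambda>(r, y). r ^ (DIM('a) - 1) *\<^sub>R f (r *\<^sub>R y))"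
  and integral_polar: "(\<integral>x. f x \<partial>ball_measure) =
   (\<integral>(r, y). r ^ (DIM('a) - 1) *\<^sub>R f (r *\<^sub>R y) \<partial>cylinder_measure)"
proof -
 let ?g = "\<lambda>(r::real, y::'a). if norm (r *\<^sub>R y) < 1 then r *\<^sub>R y else 0"
 let ?d = "\<lambda>(r, y::'a). r ^ (DIM('a) - 1)"
 have g: "?g \<in> cylinder_measure \<rightarrow>\<^sub>M ball_measure"
 proof (rule measurable_restrict_space2)
  have "?g \<in> borel_measurable cylinder_measure" by (rule measurable_cylinder) measurable
  then show "?g \<in> cylinder_measure \<rightarrow>\<^sub>M lborel" by simp
 qed auto
 have fb: "f \<in> borel_measurable ball_measure" by (rule measurable_restrict_space1) simp
 have fg[measurable]: "(\<lambda>x. f (?g x)) \<in> borel_measurable cylinder_measure"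
  by (rule measurable_cylinder) measurable
 have d[measurable]: "?d \<in> borel_measurable cylinder_measure"
  by (rule measurable_cylinder) measurable
 have m[measurable]: "(\<lambda>(r, y). r ^ (DIM('a) - 1) *\<^sub>R f (r *\<^sub>R y)) \<in> borel_measurable cylinder_measure"
  by (rule measurable_cylinder) measurable
 have ae: "AE x in (cylinder_measure :: (real \<times> 'a) measure). 0 \<le> ?d x \<and>
   ?d x *\<^sub>R f (?g x) = (case x of (r, y) \<Rightarrow> r ^ (DIM('a) - 1) *\<^sub>R f (r *\<^sub>R y))"
  using AE_cylinder[where P="\<lambda>r y::'a. 0 \<le> r ^ (DIM('a) - 1) \<and>
   r ^ (DIM('a) - 1) *\<^sub>R f (?g (r, y)) = r ^ (DIM('a) - 1) *\<^sub>R f (r *\<^sub>R y)"]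
  by (auto simp: case_prod_beta)
 have eq: "(case x of (r, y::'a) \<Rightarrow> ennreal (r ^ (DIM('a) - 1))) = ennreal (?d x)" for x
  by (cases x) simp
 have D: "(ball_measure :: 'a measure) = distr (density cylinder_measure (\<lambda>x. ennreal (?d x))) ball_measure ?g"
  using polar_distr[where 'a='a] unfolding eq by simp
 have gd: "?g \<in> density cylinder_measure (\<lambda>x. ennreal (?d x)) \<rightarrow>\<^sub>M ball_measure"
  using g by (simp cong: measurable_cong_sets)
 have "integrable ball_measure f \<longleftrightarrow> integrable (density cylinder_measure (\<lambda>x. ennreal (?d x))) (\<lambda>x. f (?g x))"
  by (subst D) (rule integrable_distr_eq[OF gd fb])
 also have "\<dots> \<longleftrightarrow> integrable cylinder_measure (\<lambda>x. ?d x *\<^sub>R f (?g x))"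
  using ae by (intro integrable_density[OF fg d]) (auto elim: eventually_mono)
 also have "\<dots> \<longleftrightarrow> integrable cylinder_measure (\<lambda>(r, y). r ^ (DIM('a) - 1) *\<^sub>R f (r *\<^sub>R y))"
  using ae d fg by (intro integrable_cong_AE m) (auto elim: eventually_mono intro!: borel_measurable_scaleR simp del: One_nat_def)
 finally show "integrable ball_measure f \<longleftrightarrow>
   integrable cylinder_measure (\<lambda>(r, y). r ^ (DIM('a) - 1) *\<^sub>R f (r *\<^sub>R y))" .
 have "(\<integral>x. f x \<partial>ball_measure) = (\<integral>x. f (?g x) \<partial>density cylinder_measure (\<lambda>x. ennreal (?d x)))"
  by (subst D) (rule integral_distr[OF gd fb])
 also have "\<dots> = (\<integral>x. ?d x *\<^sub>R f (?g x) \<partial>cylinder_measure)"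
  using ae by (intro integral_density[OF fg d]) (auto elim: eventually_mono)
 also have "\<dots> = (\<integral>(r, y). r ^ (DIM('a) - 1) *\<^sub>R f (r *\<^sub>R y) \<partial>cylinder_measure)"
  using ae d fg by (intro integral_cong_AE m) (auto elim: eventually_mono intro!: borel_measurable_scaleR simp del: One_nat_def)
 finally show "(\<integral>x. f x \<partial>ball_measure) =
   (\<integral>(r, y). r ^ (DIM('a) - 1) *\<^sub>R f (r *\<^sub>R y) \<partial>cylinder_measure)" .
qed

section \<open>Elements of \<open>L\<^sup>2\<close> and their representatives\<close>

lemma rep_l2_sphere_square_integrable [simp]: "L2_sphere (rep c)"
 using Quotient_rep_reflp[OF Quotient_l2_sphere, of c] by (simp add: ae_eq_sphere_def)

lemma rep_l2_sphere_measurable [measurable]: "rep c \<in> borel_measurable borel"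
 using rep_l2_sphere_square_integrable[of c]
 unfolding square_integrable_def measurable_cong_sets[OF sets_sphere_measure refl] by blast

lemma abs_rep_l2_sphere [simp]: "cls (rep c) = c"
 using Quotient_abs_rep[OF Quotient_l2_sphere] .

lemma abs_l2_sphere_eq_iff:
 assumes "L2_sphere f" "L2_sphere g"
 shows "cls f = cls g \<longleftrightarrow> (AE x in sphere_measure. f x = g x)"
 using assms Quotient_rel[OF Quotient_l2_sphere, of f g] unfolding ae_eq_sphere_def by blast

lemma AE_rep_abs_l2_sphere:
 assumes "L2_sphere f"
 shows "AE x in sphere_measure. rep (cls f) x = f x"
 using abs_l2_sphere_eq_iff[OF rep_l2_sphere_square_integrable[of "cls f"] assms] by simp

lemma inner_abs_l2_sphere:
 assumes "L2_sphere f" "L2_sphere g"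
 shows "cls f \<bullet> cls g = (\<oint>x. f x * g x)"
 using assms unfolding inner_l2_sphere_def by (subst l2_inner.abs_eq) (auto simp: ae_eq_sphere_def)

lemma inner_l2_sphere_eq: "c \<bullet> d = (\<oint>x. rep c x * rep d x)"
 using inner_abs_l2_sphere[of "rep c" "rep d"] by simp

lemma inner_l2_sphere_abs:
 assumes "L2_sphere f"
 shows "c \<bullet> cls f = (\<oint>x. rep c x * f x)"
 using inner_abs_l2_sphere[of "rep c" f] assms by simp

lemma norm_abs_l2_sphere:
 assumes "L2_sphere f"
 shows "(norm (cls f))\<^sup>2 = (\<oint>x. (f x)\<^sup>2)"
 using inner_abs_l2_sphere[OF assms assms] by (simp add: power2_norm_eq_inner) (simp add: power2_eq_square)

lemma norm_l2_sphere_eq: "(norm c)\<^sup>2 = (\<oint>x. (rep c x)\<^sup>2)"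
 using norm_abs_l2_sphere[of "rep c"] by simp

lemma square_integrable_diff:
 fixes f g :: "'b \<Rightarrow> real"
 assumes "square_integrable M f" "square_integrable M g"
 shows "square_integrable M (\<lambda>x. f x - g x)"
 using square_integrable_add[OF assms(1) square_integrable_uminus[OF assms(2)]] by simp

lemma abs_l2_sphere_add:
 assumes "L2_sphere f" "L2_sphere g"
 shows "cls (\<lambda>x. f x + g x) = cls f + cls g"
 using assms by (subst plus_l2_sphere.abs_eq) (auto simp: ae_eq_sphere_def)

lemma abs_l2_sphere_scale:
 assumes "L2_sphere f"
 shows "cls (\<lambda>x. r * f x) = r *\<^sub>R cls f"
 using assms by (subst scaleR_l2_sphere.abs_eq) (auto simp: ae_eq_sphere_def)

lemma abs_l2_sphere_diff:
 assumes "L2_sphere f" "L2_sphere g"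
 shows "cls (\<lambda>x. f x - g x) = cls f - cls g"
 using abs_l2_sphere_add[OF assms(1) square_integrable_uminus[OF assms(2)]]
  abs_l2_sphere_scale[OF assms(2), of "-1"] by simp

lemma abs_l2_sphere_zero: "cls (\<lambda>_. 0) = 0"
 unfolding zero_l2_sphere_def ..

lemma square_integrable_integrable_sphere:
 fixes f :: "'a::euclidean_space \<Rightarrow> real"
 assumes "L2_sphere f" shows "integrable sphere_measure f"
proof (rule sphere_measure.square_integrable_imp_integrable)
 show "f \<in> borel_measurable sphere_measure" "integrable sphere_measure (\<lambda>x. (f x)\<^sup>2)"
  using assms unfolding square_integrable_def by simp_all
qed

lemma continuous_bounded_on_sphere:
 fixes f :: "'a::euclidean_space \<Rightarrow> 'b::real_normed_vector"
 assumes "continuous_on UNIV f"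
 obtains B where "0 < B" "\<And>x. norm x = 1 \<Longrightarrow> norm (f x) \<le> B"
proof -
 have "compact (f ` sphere 0 1)"
  by (rule compact_continuous_image[OF continuous_on_subset[OF assms]]) auto
 then have "bounded (f ` sphere 0 1)" by (rule compact_imp_bounded)
 then obtain B where "0 < B" "\<forall>y\<in>f ` sphere 0 1. norm y \<le> B" unfolding bounded_pos by blast
 then show ?thesis by (intro that[of B]) auto
qed

lemma integrable_sphere_continuous:
 fixes f :: "'a::euclidean_space \<Rightarrow> 'b::{banach, second_countable_topology}"
 assumes "continuous_on UNIV f"
 shows "integrable sphere_measure f"
proof -
 obtain B where B: "\<And>x. norm x = 1 \<Longrightarrow> norm (f x) \<le> B"
  using continuous_bounded_on_sphere[OF assms] by blast
 show ?thesis
 proof (rule sphere_measure.integrable_const_bound)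
  show "AE x in sphere_measure. norm (f x) \<le> B"
   using AE_sphere_measure_norm by eventually_elim (rule B)
  show "f \<in> borel_measurable sphere_measure"
   using borel_measurable_continuous_onI[OF assms] by simp
 qed
qed

lemma square_integrable_sphere_continuous:
 fixes f :: "'a::euclidean_space \<Rightarrow> real"
 assumes "continuous_on UNIV f"
 shows "L2_sphere f"
 unfolding square_integrable_def
proof
 show "f \<in> borel_measurable sphere_measure" using borel_measurable_continuous_onI[OF assms] by simp
 show "integrable sphere_measure (\<lambda>x. (norm (f x))\<^sup>2)"
  by (intro integrable_sphere_continuous continuous_intros assms)
qed

lemma square_integrable_mult_continuous:
 fixes f g :: "'a::euclidean_space \<Rightarrow> real"
 assumes f: "L2_sphere f" and g: "continuous_on UNIV g"
 shows "L2_sphere (\<lambda>x. g x * f x)"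
proof -
 obtain B where B: "\<And>x. norm x = 1 \<Longrightarrow> norm (g x) \<le> B"
  using continuous_bounded_on_sphere[OF g] by blast
 have m: "f \<in> borel_measurable sphere_measure" "g \<in> borel_measurable sphere_measure"
  using f borel_measurable_continuous_onI[OF g] by (auto simp: square_integrable_def)
 have "integrable sphere_measure (\<lambda>x. (norm (g x * f x))\<^sup>2)"
 proof (rule Bochner_Integration.integrable_bound)
  show "integrable sphere_measure (\<lambda>x. B\<^sup>2 * (norm (f x))\<^sup>2)"
   using f by (auto simp: square_integrable_def)
  show "AE x in sphere_measure. norm ((norm (g x * f x))\<^sup>2) \<le> norm (B\<^sup>2 * (norm (f x))\<^sup>2)"
   using AE_sphere_measure_norm
  proof eventually_elim
   case (elim x)
   have "\<bar>g x\<bar>\<^sup>2 \<le> B\<^sup>2" using power_mono[OF B[OF elim], of 2] by simp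
   then show ?case by (simp add: power_mult_distrib abs_mult mult_right_mono)
  qed
 qed (use m in auto)
 then show ?thesis using m by (auto simp: square_integrable_def)
qed

lemma norm_abs_l2_sphere_le:
 fixes f :: "'a::euclidean_space \<Rightarrow> real"
 assumes f: "L2_sphere f" and le: "AE x in sphere_measure. \<bar>f x\<bar> \<le> e" and "0 \<le> e"
 shows "norm (cls f) \<le> e * sqrt (measure sphere_measure (UNIV :: 'a set))"
proof -
 have "(norm (cls f))\<^sup>2 \<le> (\<integral>x. e\<^sup>2 \<partial>(sphere_measure :: 'a measure))"
  unfolding norm_abs_l2_sphere[OF f]
 proof (rule integral_mono_AE)
  show "integrable sphere_measure (\<lambda>x. (f x)\<^sup>2)" using f by (auto simp: square_integrable_def)
  show "AE x in sphere_measure. (f x)\<^sup>2 \<le> e\<^sup>2"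
   using le by eventually_elim (use power_mono[of "\<bar>_\<bar>" e 2] in fastforce)
 qed simp
 also have "\<dots> = (e * sqrt (measure sphere_measure (UNIV :: 'a set)))\<^sup>2"
  by (simp add: power_mult_distrib mult.commute)
 finally show ?thesis by (rule power2_le_imp_le) (simp add: \<open>0 \<le> e\<close>)
qed

section \<open>Density of continuous functions and of plane waves\<close>

lemma square_add_le: "((a::real) + b)\<^sup>2 \<le> 2 * a\<^sup>2 + 2 * b\<^sup>2"
 using zero_le_power2[of "a - b"] by (simp add: power2_sum power2_diff)

lemma borel_between_compact_open:
 fixes M :: "'b::euclidean_space measure"
 assumes sets: "sets M = sets borel" and fin: "finite_measure M" and A: "A \<in> sets borel" and e: "0 < (e::real)"
 obtains K U where "K \<subseteq> A" "compact K" "A \<subseteq> U" "open U" "measure M U < measure M K + e"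
proof -
 interpret finite_measure M by (rule fin)
 have fin: "emeasure M B \<noteq> top" for B using emeasure_finite by simp
 have fin': "emeasure M (space M) \<noteq> \<infinity>" using fin by simp
 have "emeasure M A < emeasure M A + ennreal (e/2)"
  using e fin[of A] ennreal_add_left_cancel_less[of "emeasure M A" 0 "ennreal (e/2)"] by (simp add: less_top)
 then have "(INF U\<in>{U. A \<subseteq> U \<and> open U}. emeasure M U) < emeasure M A + ennreal (e/2)"
  using outer_regular[OF sets fin' A] by simp
 then obtain U where U: "A \<subseteq> U" "open U" "emeasure M U < emeasure M A + ennreal (e/2)"
  unfolding INF_less_iff by blast
 have "\<exists>K. K \<subseteq> A \<and> compact K \<and> emeasure M A \<le> emeasure M K + ennreal (e/3)"
 proof (rule ccontr)
  assume no: "\<not> ?thesis"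
  have "emeasure M A + ennreal (e/3) = (SUP K\<in>{K. K \<subseteq> A \<and> compact K}. emeasure M K + ennreal (e/3))"
   unfolding inner_regular[OF sets fin' A] by (rule ennreal_SUP_add_left[symmetric]) auto
  also have "\<dots> \<le> emeasure M A"
   using no by (intro SUP_least) (auto simp: not_le intro: less_imp_le)
  finally show False using fin[of A] e
   ennreal_add_left_cancel_less[of "emeasure M A" 0 "ennreal (e/3)"] by (simp add: less_top leD)
 qed
 then obtain K where K: "K \<subseteq> A" "compact K" "emeasure M A \<le> emeasure M K + ennreal (e/3)" by blast
 have mU: "measure M U < measure M A + e/2" using U(3) e
  by (simp add: emeasure_eq_measure ennreal_plus[symmetric] ennreal_less_iff del: ennreal_plus)
 have mK: "measure M A \<le> measure M K + e/3" using K(3) e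
  by (simp add: emeasure_eq_measure ennreal_plus[symmetric] del: ennreal_plus)
 show ?thesis by (rule that[OF K(1,2) U(1,2)]) (use mU mK e in simp)
qed

text \<open>The approximable functions \<open>D\<close> form a vector space containing the
  indicators of Borel sets, by regularity and Urysohn's lemma, hence all simple functions; dominated
  convergence does the rest. An arbitrary finite Borel measure is allowed because the result is
  applied both to the sphere and to a time interval times the sphere.\<close>

lemma continuous_dense_square_integrable:
 fixes M :: "'b::euclidean_space measure" and f :: "'b \<Rightarrow> real"
 assumes sets: "sets M = sets borel" and fin: "finite_measure M"
  and f: "square_integrable M f" and e: "0 < e"
 obtains p where "continuous_on UNIV p" "bounded (range p)" "square_integrable M p"
  "(\<integral>x. (f x - p x)\<^sup>2 \<partial>M) < e"
proof -
 interpret finite_measure M by fact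
 note [measurable_cong] = sets
 have spM: "space M = UNIV" using sets_eq_imp_space_eq[OF sets] by simp
 define D where "D f \<longleftrightarrow> square_integrable M f \<and>
  (\<forall>e>0. \<exists>p. continuous_on UNIV p \<and> bounded (range p) \<and> square_integrable M p \<and> (\<integral>x. (f x - p x)\<^sup>2 \<partial>M) < e)"
  for f :: "'b \<Rightarrow> real"
 have bsq: "square_integrable M p" if p: "continuous_on UNIV p" "bounded (range p)" for p :: "'b \<Rightarrow> real"
 proof -
  obtain B where B: "\<And>x. \<bar>p x\<bar> \<le> B" using p(2) by (auto simp: bounded_iff)
  have m[measurable]: "p \<in> borel_measurable M"
   using borel_measurable_continuous_onI[OF p(1)] by simp
  have "integrable M (\<lambda>x. (norm (p x))\<^sup>2)"
  proof (rule integrable_const_bound)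
   show "AE x in M. norm ((norm (p x))\<^sup>2) \<le> B\<^sup>2"
   proof (rule AE_I2)
    fix x
    have "\<bar>p x\<bar>\<^sup>2 \<le> B\<^sup>2" by (rule power_mono[OF B]) simp
    then show "norm ((norm (p x))\<^sup>2) \<le> B\<^sup>2" by simp
   qed
  qed measurable
  then show ?thesis using m by (simp add: square_integrable_def)
 qed
 have int2: "integrable M (\<lambda>x. (u x - v x)\<^sup>2)" if "square_integrable M u" "square_integrable M v" for u v :: "'b \<Rightarrow> real"
  using square_integrable_diff[OF that] by (auto simp: square_integrable_def)
 have Dadd: "D (\<lambda>x. u x + v x)" if u: "D u" and v: "D v" for u v
  unfolding D_def
 proof (intro conjI allI impI)
  show sq: "square_integrable M (\<lambda>x. u x + v x)" using u v by (auto simp: D_def intro: square_integrable_add)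
  fix e :: real assume e: "0 < e"
  then have "0 < e / 4" by simp
  with u v obtain p q where p: "continuous_on UNIV p" "bounded (range p)" "square_integrable M p" "(\<integral>x. (u x - p x)\<^sup>2 \<partial>M) < e / 4"
   and q: "continuous_on UNIV q" "bounded (range q)" "square_integrable M q" "(\<integral>x. (v x - q x)\<^sup>2 \<partial>M) < e / 4"
   unfolding D_def by meson
  have us: "square_integrable M u" "square_integrable M v" using u v by (auto simp: D_def)
  have pq: "continuous_on UNIV (\<lambda>x. p x + q x)" "bounded (range (\<lambda>x. p x + q x))"
   using p(1) q(1) bounded_plus_comp[OF p(2) q(2)] by (auto intro: continuous_intros)
  have "(\<integral>x. (u x + v x - (p x + q x))\<^sup>2 \<partial>M) \<le> (\<integral>x. 2 * (u x - p x)\<^sup>2 + 2 * (v x - q x)\<^sup>2 \<partial>M)"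
  proof (rule integral_mono)
   show "integrable M (\<lambda>x. (u x + v x - (p x + q x))\<^sup>2)" by (rule int2[OF sq bsq[OF pq]])
   show "integrable M (\<lambda>x. 2 * (u x - p x)\<^sup>2 + 2 * (v x - q x)\<^sup>2)"
    using int2[OF us(1) p(3)] int2[OF us(2) q(3)] by auto
   show "(u x + v x - (p x + q x))\<^sup>2 \<le> 2 * (u x - p x)\<^sup>2 + 2 * (v x - q x)\<^sup>2" for x
    using square_add_le[of "u x - p x" "v x - q x"] by (simp add: algebra_simps)
  qed
  also have "\<dots> = 2 * (\<integral>x. (u x - p x)\<^sup>2 \<partial>M) + 2 * (\<integral>x. (v x - q x)\<^sup>2 \<partial>M)"
   using int2[OF us(1) p(3)] int2[OF us(2) q(3)] by simp
  also have "\<dots> < e" using p(4) q(4) by simp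
  finally show "\<exists>p. continuous_on UNIV p \<and> bounded (range p) \<and> square_integrable M p \<and> (\<integral>x. (u x + v x - p x)\<^sup>2 \<partial>M) < e"
   using pq bsq[OF pq] by blast
 qed
 have Dscale: "D (\<lambda>x. r * u x)" if u: "D u" for u and r :: real
  unfolding D_def
 proof (intro conjI allI impI)
  show sq: "square_integrable M (\<lambda>x. r * u x)" using u by (auto simp: D_def intro: square_integrable_scale)
  fix e :: real assume e: "0 < e"
  then have "0 < e / (r\<^sup>2 + 1)" by (simp add: add_nonneg_pos)
  with u obtain p where p: "continuous_on UNIV p" "bounded (range p)" "square_integrable M p" "(\<integral>x. (u x - p x)\<^sup>2 \<partial>M) < e / (r\<^sup>2 + 1)"
   unfolding D_def by meson
  have rp: "continuous_on UNIV (\<lambda>x. r * p x)" "bounded (range (\<lambda>x. r * p x))"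
   using p(1) bounded_scaling[OF p(2), of r] by (auto intro: continuous_intros simp: image_image)
  have "(\<integral>x. (r * u x - r * p x)\<^sup>2 \<partial>M) = r\<^sup>2 * (\<integral>x. (u x - p x)\<^sup>2 \<partial>M)"
   by (simp flip: right_diff_distrib add: power_mult_distrib)
  also have "\<dots> \<le> (r\<^sup>2 + 1) * (\<integral>x. (u x - p x)\<^sup>2 \<partial>M)"
   by (intro mult_right_mono) auto
  also have "\<dots> < e" using p(4) by (simp add: pos_less_divide_eq add_nonneg_pos mult.commute)
  finally show "\<exists>p. continuous_on UNIV p \<and> bounded (range p) \<and> square_integrable M p \<and> (\<integral>x. (r * u x - p x)\<^sup>2 \<partial>M) < e"
   using rp bsq[OF rp] by blast
 qed
 have Dind: "D (indicator A)" if A: "A \<in> sets borel" for A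
  unfolding D_def
 proof (intro conjI allI impI)
  show sq: "square_integrable M (indicator A :: 'b \<Rightarrow> real)"
  proof -
   have [measurable]: "A \<in> sets M" using A sets by simp
   have "integrable M (\<lambda>x. (norm (indicator A x :: real))\<^sup>2)"
    by (rule integrable_const_bound[where B=1]) (auto simp: indicator_def intro!: AE_I2)
   moreover have "(indicator A :: 'b \<Rightarrow> real) \<in> borel_measurable M" by measurable
   ultimately show ?thesis unfolding square_integrable_def by (intro conjI)
  qed
  fix e :: real assume e: "0 < e"
  obtain K U where K: "K \<subseteq> A" "compact K" and U: "A \<subseteq> U" "open U" and KU: "measure M U < measure M K + e"
   by (rule borel_between_compact_open[OF sets fin A e])
  have meas: "U \<in> sets M" "K \<in> sets M" using U K sets by (auto simp: borel_compact)
  have "closed K" using K(2) by (rule compact_imp_closed)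
  then obtain p :: "'b \<Rightarrow> real" where p: "continuous_on UNIV p" "\<And>x. x \<in> UNIV \<Longrightarrow> p x \<in> closed_segment 0 1"
    "\<And>x. x \<in> -U \<Longrightarrow> p x = 0" "\<And>x. x \<in> K \<Longrightarrow> p x = 1"
   using Urysohn_local[of UNIV "-U" K 0 "1::real" thesis] U K by (simp add: closed_def) blast
  have p01: "0 \<le> p x" "p x \<le> 1" for x using p(2)[of x] by (auto simp: closed_segment_eq_real_ivl)
  have b: "bounded (range p)" using p01 by (auto simp: bounded_iff intro!: exI[of _ 1])
  have "(\<integral>x. (indicator A x - p x)\<^sup>2 \<partial>M) \<le> (\<integral>x. indicator (U - K) x \<partial>M)"
  proof (rule integral_mono)
   show "integrable M (\<lambda>x. (indicator A x - p x)\<^sup>2)" by (rule int2[OF sq bsq[OF p(1) b]])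
   show "integrable M (indicator (U - K) :: 'b \<Rightarrow> real)"
    using meas by (auto simp: integrable_indicator_iff emeasure_eq_measure)
   fix x
   have "\<bar>indicator A x - p x\<bar> \<le> 1" using p01[of x] by (auto simp: indicator_def)
   then have "(indicator A x - p x)\<^sup>2 \<le> 1" by (simp add: abs_square_le_1)
   moreover have "(indicator A x - p x)\<^sup>2 = 0" if "x \<notin> U - K"
    using that p(3,4)[of x] U(1) K(1) by (auto simp: indicator_def)
   ultimately show "(indicator A x - p x)\<^sup>2 \<le> indicator (U - K) x" by (auto simp: indicator_def)
  qed
  also have "\<dots> = measure M (U - K)" using meas by simp
  also have "\<dots> = measure M U - measure M K" using U K meas by (intro finite_measure_Diff) auto
  also have "\<dots> < e" using KU by simp
  finally show "\<exists>p. continuous_on UNIV p \<and> bounded (range p) \<and> square_integrable M p \<and> (\<integral>x. (indicator A x - p x)\<^sup>2 \<partial>M) < e"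
   using p(1) b bsq[OF p(1) b] by blast
 qed
 have Dsum: "D (\<lambda>x. \<Sum>i\<in>I. u i x)" if "finite I" "\<And>i. i \<in> I \<Longrightarrow> D (u i)" for I :: "real set" and u
  using that
 proof (induction I)
  case empty
  have "D (\<lambda>x. 0 * indicator {} x)" by (rule Dscale[OF Dind]) simp
  then show ?case by simp
 next
  case (insert i I)
  then show ?case using Dadd[of "u i" "\<lambda>x. \<Sum>i\<in>I. u i x"] by simp
 qed
 have fm[measurable]: "f \<in> borel_measurable M" using f by (simp add: square_integrable_def)
 obtain F where F: "\<And>i. simple_function M (F i)" "\<And>x. (\<lambda>i. F i x) \<longlonglongrightarrow> f x" "\<And>i x. dist (F i x) 0 \<le> 2 * dist (f x) 0"
  using borel_measurable_implies_sequence_metric[OF fm, of 0] spM by auto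
 have DF: "D (F i)" for i
 proof -
  have "D (\<lambda>x. \<Sum>y\<in>F i ` UNIV. y * indicator (F i -` {y}) x)"
  proof (rule Dsum)
   show "finite (F i ` UNIV)" using simple_functionD(1)[OF F(1)[of i]] spM by simp
   fix y show "D (\<lambda>x. y * indicator (F i -` {y}) x)"
    using simple_functionD(2)[OF F(1)[of i], of "{y}"] spM sets by (intro Dscale Dind) simp
  qed
  moreover have "(\<Sum>y\<in>F i ` UNIV. y * indicator (F i -` {y}) x) = F i x" for x
  proof -
   have "(\<Sum>y\<in>F i ` UNIV. y * indicator (F i -` {y}) x) = (\<Sum>y\<in>{F i x}. y * indicator (F i -` {y}) x)"
    using simple_functionD(1)[OF F(1)[of i]] spM
    by (intro sum.mono_neutral_right) (auto simp: indicator_def)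
   then show ?thesis by simp
  qed
  ultimately show ?thesis by simp
 qed
 \<comment> \<open>The simple functions satisfy |F_i| \<le> 2|f|, so |f - F_i| \<le> 3|f| and 9 f^2
   dominates.\<close>
 have "(\<lambda>i. \<integral>x. (f x - F i x)\<^sup>2 \<partial>M) \<longlonglongrightarrow> (\<integral>x. 0 \<partial>M)"
 proof (rule integral_dominated_convergence)
  show "integrable M (\<lambda>x. 9 * (f x)\<^sup>2)" using f by (auto simp: square_integrable_def)
  show "(\<lambda>x. (f x - F i x)\<^sup>2) \<in> borel_measurable M" for i
   using borel_measurable_simple_function[OF F(1)[of i]] by measurable
  show "AE x in M. (\<lambda>i. (f x - F i x)\<^sup>2) \<longlonglongrightarrow> 0"
  proof (rule AE_I2)
   fix x
   have "(\<lambda>i. (f x - F i x)\<^sup>2) \<longlonglongrightarrow> (f x - f x)\<^sup>2" by (intro tendsto_intros F)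
   then show "(\<lambda>i. (f x - F i x)\<^sup>2) \<longlonglongrightarrow> 0" by simp
  qed
  show "AE x in M. norm ((f x - F i x)\<^sup>2) \<le> 9 * (f x)\<^sup>2" for i
  proof (rule AE_I2)
   fix x
   have "\<bar>f x - F i x\<bar> \<le> 3 * \<bar>f x\<bar>" using F(3)[of i x] by simp
   then have "\<bar>f x - F i x\<bar>\<^sup>2 \<le> (3 * \<bar>f x\<bar>)\<^sup>2" by (rule power_mono) simp
   then show "norm ((f x - F i x)\<^sup>2) \<le> 9 * (f x)\<^sup>2" by (simp add: power_mult_distrib)
  qed
 qed simp
 then have "\<forall>\<^sub>F i in sequentially. (\<integral>x. (f x - F i x)\<^sup>2 \<partial>M) < e / 4"
  using e by (intro order_tendstoD(2)) auto
 then obtain i where i: "(\<integral>x. (f x - F i x)\<^sup>2 \<partial>M) < e / 4"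
  by (auto simp: eventually_sequentially)
 have "0 < e / 4" using e by simp
 with DF[of i] obtain p where p: "continuous_on UNIV p" "bounded (range p)" "square_integrable M p"
   "(\<integral>x. (F i x - p x)\<^sup>2 \<partial>M) < e / 4"
  unfolding D_def by meson
 have sF: "square_integrable M (F i)" using DF[of i] by (simp add: D_def)
 have "(\<integral>x. (f x - p x)\<^sup>2 \<partial>M) \<le> (\<integral>x. 2 * (f x - F i x)\<^sup>2 + 2 * (F i x - p x)\<^sup>2 \<partial>M)"
 proof (rule integral_mono)
  show "integrable M (\<lambda>x. (f x - p x)\<^sup>2)" by (rule int2[OF f p(3)])
  show "integrable M (\<lambda>x. 2 * (f x - F i x)\<^sup>2 + 2 * (F i x - p x)\<^sup>2)"
   using int2[OF f sF] int2[OF sF p(3)] by auto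
  show "(f x - p x)\<^sup>2 \<le> 2 * (f x - F i x)\<^sup>2 + 2 * (F i x - p x)\<^sup>2" for x
   using square_add_le[of "f x - F i x" "F i x - p x"] by simp
 qed
 also have "\<dots> = 2 * (\<integral>x. (f x - F i x)\<^sup>2 \<partial>M) + 2 * (\<integral>x. (F i x - p x)\<^sup>2 \<partial>M)"
  using int2[OF f sF] int2[OF sF p(3)] by simp
 also have "\<dots> < e" using i p(4) by simp
 finally show ?thesis using p that by blast
qed

section \<open>Density of powers of linear forms, and separability\<close>

lemma subspace_closure:
 fixes S :: "'b::real_normed_vector set"
 assumes "subspace S" shows "subspace (closure S)"
 unfolding subspace_def
proof (intro conjI ballI allI)
 show "0 \<in> closure S" using assms closure_subset by (auto simp: subspace_def)
 fix x y assume "x \<in> closure S" "y \<in> closure S"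
 then obtain f g where "\<forall>n. f n \<in> S" "f \<longlonglongrightarrow> x" "\<forall>n. g n \<in> S" "g \<longlonglongrightarrow> y"
  unfolding closure_sequential by blast
 then show "x + y \<in> closure S" using assms unfolding closure_sequential
  by (intro exI[of _ "\<lambda>n. f n + g n"]) (auto intro: tendsto_add simp: subspace_def)
next
 fix c x assume "x \<in> closure S"
 then obtain f where "\<forall>n. f n \<in> S" "f \<longlonglongrightarrow> x" unfolding closure_sequential by blast
 then show "c *\<^sub>R x \<in> closure S" using assms unfolding closure_sequential
  by (intro exI[of _ "\<lambda>n. c *\<^sub>R f n"]) (auto intro: tendsto_scaleR simp: subspace_def)
qed

text \<open>Powers of one linear form are restrictions of polynomials, hence C^1 test functions, and
  for fixed \<open>a\<close> their span is stable under the spherical Laplacian.\<close>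

definition plane_wave :: "'a::euclidean_space \<Rightarrow> nat \<Rightarrow> 'a l2_sphere" where
 "plane_wave a j = cls (\<lambda>x. (x \<bullet> a) ^ j)"

text \<open>Integer vectors keep the family countable, which gives separability, and are closed
  under addition, so that products of exponentials exp(x.a) are again of this form; containing the
  basis, they still separate points.\<close>

definition integral_lattice :: "'a::euclidean_space set" where
 "integral_lattice = {a. \<forall>b\<in>Basis. a \<bullet> b \<in> \<int>}"

definition plane_waves :: "'a::euclidean_space l2_sphere set" where
 "plane_waves = {plane_wave a j | a j. a \<in> integral_lattice}"

lemma countable_integral_lattice: "countable (integral_lattice :: 'a::euclidean_space set)"
proof (rule countable_subset)
 show "countable ((\<lambda>g. \<Sum>b\<in>Basis. of_int (g b) *\<^sub>R b) ` (PiE (Basis :: 'a set) (\<lambda>_. UNIV :: int set)))"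
  by (intro countable_image countable_PiE) auto
 show "(integral_lattice :: 'a set) \<subseteq> (\<lambda>g. \<Sum>b\<in>Basis. of_int (g b) *\<^sub>R b) ` (PiE (Basis :: 'a set) (\<lambda>_. UNIV :: int set))"
 proof
  fix a :: 'a assume "a \<in> integral_lattice"
  then have eq: "b \<in> Basis \<Longrightarrow> of_int \<lfloor>a \<bullet> b\<rfloor> = a \<bullet> b" for b
   by (fastforce simp: integral_lattice_def elim: Ints_cases)
  have "(\<Sum>b\<in>Basis. of_int (restrict (\<lambda>b. \<lfloor>a \<bullet> b\<rfloor>) Basis b) *\<^sub>R b) = (\<Sum>b\<in>Basis. (a \<bullet> b) *\<^sub>R b)"
   by (rule sum.cong) (auto simp: eq)
  then have "a = (\<Sum>b\<in>Basis. of_int (restrict (\<lambda>b. \<lfloor>a \<bullet> b\<rfloor>) Basis b) *\<^sub>R b)"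
   by (simp add: euclidean_representation)
  then show "a \<in> (\<lambda>g. \<Sum>b\<in>Basis. of_int (g b) *\<^sub>R b) ` (PiE (Basis :: 'a set) (\<lambda>_. UNIV :: int set))"
   by (intro image_eqI[where x="restrict (\<lambda>b. \<lfloor>a \<bullet> b\<rfloor>) Basis"]) auto
 qed
qed

lemma countable_plane_waves: "countable (plane_waves :: 'a::euclidean_space l2_sphere set)"
proof -
 have "plane_waves = (\<lambda>(a, j). plane_wave a j) ` ((integral_lattice :: 'a set) \<times> UNIV)"
  by (auto simp: plane_waves_def)
 then show ?thesis using countable_integral_lattice by (metis countable_SIGMA countable_image uncountable_def countableI_type)
qed

text \<open>Products of powers of different linear forms are not powers of a linear form, so the
  algebra for Stone-Weierstrass is built from exponentials; their Taylor expansions lead back to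
  plane waves.\<close>

inductive exponential_sum :: "('a::euclidean_space \<Rightarrow> real) \<Rightarrow> bool" where
 base: "a \<in> integral_lattice \<Longrightarrow> exponential_sum (\<lambda>x. c * exp (x \<bullet> a))"
| add: "exponential_sum f \<Longrightarrow> exponential_sum g \<Longrightarrow> exponential_sum (\<lambda>x. f x + g x)"

lemma exponential_sum_continuous: "exponential_sum f \<Longrightarrow> continuous_on S f"
 by (induction rule: exponential_sum.induct) (auto intro!: continuous_intros)

lemma exponential_sum_mult:
 "exponential_sum f \<Longrightarrow> exponential_sum g \<Longrightarrow> exponential_sum (\<lambda>x. f x * g x)"
proof (induction rule: exponential_sum.induct)
 case (base a c)
 from \<open>exponential_sum g\<close> show ?case
 proof (induction rule: exponential_sum.induct)
  case (base b c')
  have "exponential_sum (\<lambda>x. (c * c') * exp (x \<bullet> (a + b)))"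
   using base \<open>a \<in> integral_lattice\<close>
   by (intro exponential_sum.base) (auto simp: integral_lattice_def inner_add_left)
  then show ?case by (simp add: inner_add_right exp_add mult_ac)
 next
  case (add f g)
  then show ?case using exponential_sum.add[OF add.IH] by (simp add: distrib_left)
 qed
next
 case (add f h)
 then show ?case using exponential_sum.add[OF add.IH(1) add.IH(2)] by (simp add: distrib_right)
qed

lemma continuous_plane_wave: "continuous_on S (\<lambda>x::'a::euclidean_space. (x \<bullet> a) ^ j)"
 by (intro continuous_intros)

text \<open>The Taylor polynomials of exp(x.a) converge pointwise and are bounded by exp |x.a|, so
  dominated convergence gives convergence in L^2.\<close>

lemma plane_wave_exp_in_closure:
 assumes a: "a \<in> integral_lattice"
 shows "cls (\<lambda>x. exp (x \<bullet> a)) \<in> closure (span plane_waves)"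
proof -
 define s where "s n x = (\<Sum>j<n. (x \<bullet> a) ^ j / fact j)" for n and x :: 'a
 have sc: "continuous_on UNIV (s n)" for n
  unfolding s_def by (intro continuous_intros) auto
 have ssq: "L2_sphere (s n)" for n
  by (rule square_integrable_sphere_continuous[OF sc])
 have esq: "L2_sphere (\<lambda>x. exp (x \<bullet> a))"
  by (intro square_integrable_sphere_continuous continuous_intros)
 have sspan: "cls (s n) \<in> span plane_waves" for n
 proof (induction n)
  case 0
  then show ?case unfolding s_def by (simp add: abs_l2_sphere_zero span_zero)
 next
  case (Suc n)
  have eq: "s (Suc n) = (\<lambda>x. s n x + (1 / fact n) * (x \<bullet> a) ^ n)"
   by (auto simp: s_def)
  have pw: "L2_sphere (\<lambda>x. (x \<bullet> a) ^ n)"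
   by (rule square_integrable_sphere_continuous[OF continuous_plane_wave])
  have "cls (s (Suc n)) = cls (s n) + (1 / fact n) *\<^sub>R plane_wave a n"
   unfolding eq plane_wave_def
   by (simp only: abs_l2_sphere_add[OF ssq square_integrable_scale[OF pw]] abs_l2_sphere_scale[OF pw])
  also have "\<dots> \<in> span plane_waves"
   using a by (intro span_add Suc span_scale span_base) (auto simp: plane_waves_def)
  finally show ?case .
 qed
 have "(\<lambda>n. \<integral>x. (exp (x \<bullet> a) - s n x)\<^sup>2 \<partial>sphere_measure) \<longlonglongrightarrow> (\<integral>x. 0 \<partial>(sphere_measure :: 'a measure))"
 proof (rule integral_dominated_convergence)
  show "integrable sphere_measure (\<lambda>x. (2 * exp \<bar>x \<bullet> a\<bar>)\<^sup>2)"
   by (intro integrable_sphere_continuous continuous_intros)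
  show "(\<lambda>x. (exp (x \<bullet> a) - s n x)\<^sup>2) \<in> borel_measurable sphere_measure" for n
   using borel_measurable_continuous_onI[OF sc[of n]] by measurable
  show "AE x in sphere_measure. (\<lambda>n. (exp (x \<bullet> a) - s n x)\<^sup>2) \<longlonglongrightarrow> 0"
  proof (rule AE_I2)
   fix x
   have "(\<lambda>n. s n x) \<longlonglongrightarrow> exp (x \<bullet> a)"
    using exp_converges[of "x \<bullet> a"] by (simp add: sums_def s_def divide_inverse mult.commute)
   then have "(\<lambda>n. (exp (x \<bullet> a) - s n x)\<^sup>2) \<longlonglongrightarrow> (exp (x \<bullet> a) - exp (x \<bullet> a))\<^sup>2"
    by (intro tendsto_intros)
   then show "(\<lambda>n. (exp (x \<bullet> a) - s n x)\<^sup>2) \<longlonglongrightarrow> 0" by simp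
  qed
  show "AE x in sphere_measure. norm ((exp (x \<bullet> a) - s n x)\<^sup>2) \<le> (2 * exp \<bar>x \<bullet> a\<bar>)\<^sup>2" for n
  proof (rule AE_I2)
   fix x
   have sums: "(\<lambda>n. \<bar>x \<bullet> a\<bar> ^ n / fact n) sums exp \<bar>x \<bullet> a\<bar>"
    using exp_converges[of "\<bar>x \<bullet> a\<bar>"] by (simp add: divide_inverse mult.commute)
   have "\<bar>s n x\<bar> \<le> (\<Sum>j<n. \<bar>x \<bullet> a\<bar> ^ j / fact j)"
    unfolding s_def by (rule order_trans[OF sum_abs]) (simp add: power_abs)
   also have "\<dots> \<le> exp \<bar>x \<bullet> a\<bar>"
    using sum_le_suminf[OF sums_summable[OF sums], of "{..<n}"] sums_unique[OF sums] by simp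
   finally have "\<bar>exp (x \<bullet> a) - s n x\<bar> \<le> 2 * exp \<bar>x \<bullet> a\<bar>"
    using exp_le_cancel_iff[of "x \<bullet> a" "\<bar>x \<bullet> a\<bar>"] exp_gt_zero[of "x \<bullet> a"] by linarith
   then have "\<bar>exp (x \<bullet> a) - s n x\<bar>\<^sup>2 \<le> (2 * exp \<bar>x \<bullet> a\<bar>)\<^sup>2" by (rule power_mono) simp
   then show "norm ((exp (x \<bullet> a) - s n x)\<^sup>2) \<le> (2 * exp \<bar>x \<bullet> a\<bar>)\<^sup>2" by simp
  qed
 qed simp
 moreover have "(norm (cls (\<lambda>x. exp (x \<bullet> a)) - cls (s n)))\<^sup>2 = (\<oint>x. (exp (x \<bullet> a) - s n x)\<^sup>2)" for n
  using norm_abs_l2_sphere[OF square_integrable_diff[OF esq ssq[of n]]] abs_l2_sphere_diff[OF esq ssq[of n]] by simp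
 ultimately have "(\<lambda>n. (norm (cls (\<lambda>x. exp (x \<bullet> a)) - cls (s n)))\<^sup>2) \<longlonglongrightarrow> 0" by simp
 then have "(\<lambda>n. sqrt ((norm (cls (\<lambda>x. exp (x \<bullet> a)) - cls (s n)))\<^sup>2)) \<longlonglongrightarrow> sqrt 0"
  by (rule tendsto_real_sqrt)
 then have "(\<lambda>n. norm (cls (s n) - cls (\<lambda>x. exp (x \<bullet> a)))) \<longlonglongrightarrow> 0"
  by (simp add: norm_minus_commute)
 then have "(\<lambda>n. cls (s n)) \<longlonglongrightarrow> cls (\<lambda>x. exp (x \<bullet> a))"
  using Lim_null tendsto_norm_zero_iff by blast
 then show ?thesis using sspan unfolding closure_sequential by (intro exI[of _ "\<lambda>n. cls (s n)"] conjI allI)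
qed

lemma exponential_sum_in_closure:
 "exponential_sum f \<Longrightarrow> cls f \<in> closure (span plane_waves)"
proof (induction rule: exponential_sum.induct)
 case (base a c)
 have esq: "L2_sphere (\<lambda>x. exp (x \<bullet> a))"
  by (intro square_integrable_sphere_continuous continuous_intros)
 show ?case unfolding abs_l2_sphere_scale[OF esq]
  by (intro subspace_scale subspace_closure subspace_span plane_wave_exp_in_closure base)
next
 case (add f g)
 note sq = square_integrable_sphere_continuous[OF exponential_sum_continuous]
 show ?case unfolding abs_l2_sphere_add[OF sq[OF add.hyps(1)] sq[OF add.hyps(2)]]
  by (intro subspace_add subspace_closure subspace_span add.IH)
qed

text \<open>Stone-Weierstrass approximates a continuous function uniformly on the unit sphere. As
  the area is finite this is an approximation in L^2, where continuous functions are dense. The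
  denominator \<open>m + 1\<close> is positive whatever the area is.\<close>

theorem plane_waves_dense: "closure (span plane_waves) = (UNIV :: 'a::euclidean_space l2_sphere set)"
proof -
 define m where "m = sqrt (measure sphere_measure (UNIV :: 'a set))"
 have mu: "0 \<le> m" by (simp add: m_def)
 have cont: "cls p \<in> closure (span plane_waves)" if p: "continuous_on UNIV p" for p :: "'a \<Rightarrow> real"
 proof -
  have "cls p \<in> closure (closure (span plane_waves))"
   unfolding closure_approachable
  proof (intro allI impI)
   fix e :: real assume e: "0 < e"
   have "0 < e / (m + 1)" using e mu by simp
   have "\<exists>g. exponential_sum g \<and> (\<forall>x\<in>sphere (0::'a) 1. \<bar>p x - g x\<bar> < e / (m + 1))"
   proof (rule Stone_Weierstrass_HOL)
    show "exponential_sum (\<lambda>x::'a. c)" for c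
     using exponential_sum.base[of 0 c] by (simp add: integral_lattice_def)
    show "continuous_on (sphere 0 1) f" if "exponential_sum f" for f :: "'a \<Rightarrow> real"
     using that by (rule exponential_sum_continuous)
    show "exponential_sum (\<lambda>x. f x + g x)" if "exponential_sum f \<and> exponential_sum g" for f g :: "'a \<Rightarrow> real"
     using that exponential_sum.add by blast
    show "exponential_sum (\<lambda>x. f x * g x)" if "exponential_sum f \<and> exponential_sum g" for f g :: "'a \<Rightarrow> real"
     using that exponential_sum_mult by blast
    show "\<exists>f. exponential_sum f \<and> f x \<noteq> f y" if xy: "x \<in> sphere 0 1 \<and> y \<in> sphere 0 1 \<and> x \<noteq> y" for x y :: 'a
    proof -
     obtain b where b: "b \<in> Basis" "x \<bullet> b \<noteq> y \<bullet> b" using xy by (metis euclidean_eqI)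
     have "b \<in> integral_lattice" using b by (auto simp: integral_lattice_def inner_Basis)
     from exponential_sum.base[OF this, of 1] b show ?thesis by (intro exI[of _ "\<lambda>x. 1 * exp (x \<bullet> b)"]) simp
    qed
    show "continuous_on (sphere 0 1) p" using p continuous_on_subset by blast
   qed (use \<open>0 < e / (m + 1)\<close> in auto)
   then obtain g where g: "exponential_sum g" "\<And>x. norm x = 1 \<Longrightarrow> \<bar>p x - g x\<bar> < e / (m + 1)" by auto
   have psq: "L2_sphere p" and gsq: "L2_sphere g"
    using p exponential_sum_continuous[OF g(1)] by (auto intro: square_integrable_sphere_continuous)
   have "norm (cls (\<lambda>x. p x - g x)) \<le> e / (m + 1) * m"
    unfolding m_def
   proof (rule norm_abs_l2_sphere_le[OF square_integrable_diff[OF psq gsq]])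
    show "AE x in sphere_measure. \<bar>p x - g x\<bar> \<le> e / (sqrt (measure sphere_measure (UNIV :: 'a set)) + 1)"
     using AE_sphere_measure_norm by eventually_elim (use g(2) in \<open>fastforce simp: m_def\<close>)
   qed (use e in simp)
   also have "\<dots> < e" using e mu by (simp add: field_simps)
   finally have "dist (cls g) (cls p) < e"
    unfolding abs_l2_sphere_diff[OF psq gsq] by (simp add: dist_norm norm_minus_commute)
   then show "\<exists>y\<in>closure (span plane_waves). dist y (cls p) < e"
    using exponential_sum_in_closure[OF g(1)] by blast
  qed
  then show ?thesis by simp
 qed
 have "c \<in> closure (closure (span plane_waves))" for c :: "'a l2_sphere"
  unfolding closure_approachable
 proof (intro allI impI)
  fix e :: real assume e: "0 < e"
  obtain p where p: "continuous_on UNIV p" "L2_sphere p"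
    "(\<oint>x. (rep c x - p x)\<^sup>2) < e\<^sup>2"
   using continuous_dense_square_integrable[of sphere_measure "rep c" "e\<^sup>2"] e
    sphere_measure.finite_measure_axioms[where 'a='a] by auto
  have "(norm (c - cls p))\<^sup>2 < e\<^sup>2"
   using p(3) norm_abs_l2_sphere[OF square_integrable_diff[OF rep_l2_sphere_square_integrable p(2)], of c]
    abs_l2_sphere_diff[OF rep_l2_sphere_square_integrable p(2), of c] by simp
  then have "norm (c - cls p) < e" using e by (simp add: power2_less_imp_less)
  then show "\<exists>y\<in>closure (span plane_waves). dist y c < e"
   using cont[OF p(1)] by (auto simp: dist_norm norm_minus_commute)
 qed
 then show ?thesis by auto
qed

text \<open>Rational combinations of the countably many plane waves suffice: real coefficients are
  approximated one summand at a time.\<close>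

lemma countable_dense_l2_sphere:
 obtains D :: "'a::euclidean_space l2_sphere set" where "countable D" "closure D = UNIV"
proof -
 define comb where "comb xs = sum_list (map (\<lambda>(q, x). q *\<^sub>R x) xs)" for xs :: "(real \<times> 'a l2_sphere) list"
 define D where "D = comb ` lists (\<rat> \<times> plane_waves)"
 have "countable D"
  unfolding D_def by (intro countable_image countable_lists countable_SIGMA countable_rat countable_plane_waves)
 moreover have "y \<in> closure D" if "y \<in> span plane_waves" for y
  using that
 proof (induction rule: span_induct_alt)
  case base
  have "comb [] \<in> D" unfolding D_def by (rule imageI) simp
  then show ?case using closure_subset by (auto simp: comb_def)
 next
  case (step c x y)
  show ?case unfolding closure_approachable
  proof (intro allI impI)
   fix e :: real assume e: "0 < e"
   obtain d where d: "d \<in> D" "dist d y < e / 2"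
    using step(2) e unfolding closure_approachable by (meson half_gt_zero)
   obtain xs where xs: "xs \<in> lists (\<rat> \<times> plane_waves)" "d = comb xs" using d(1) by (auto simp: D_def)
   have pos: "0 < e / (2 * (norm x + 1))" using e by (simp add: add_nonneg_pos)
   obtain q where q: "q \<in> \<rat>" "\<bar>q - c\<bar> < e / (2 * (norm x + 1))"
    using rational_approximation[OF pos, of c] by blast
   have "comb ((q, x) # xs) \<in> D" unfolding D_def using q(1) step(1) xs(1) by (intro imageI) auto
   moreover have "dist (comb ((q, x) # xs)) (c *\<^sub>R x + y) < e"
   proof -
    have "dist (comb ((q, x) # xs)) (c *\<^sub>R x + y) = norm ((q - c) *\<^sub>R x + (d - y))"
     by (simp add: comb_def xs(2) dist_norm algebra_simps)
    also have "\<dots> \<le> \<bar>q - c\<bar> * norm x + dist d y"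
     by (rule order_trans[OF norm_triangle_ineq]) (simp add: dist_norm)
    also have "\<bar>q - c\<bar> * norm x \<le> e / (2 * (norm x + 1)) * norm x"
     using q(2) by (intro mult_right_mono) auto
    also have "\<dots> = (e / 2) * (norm x / (norm x + 1))"
     using norm_ge_zero[of x] by (simp add: divide_simps)
    also have "\<dots> \<le> (e / 2) * 1" using e by (intro mult_left_mono) (auto simp: divide_simps add_nonneg_pos)
    finally show ?thesis using d(2) by simp
   qed
   ultimately show "\<exists>z\<in>D. dist z (c *\<^sub>R x + y) < e" by blast
  qed
 qed
 then have "closure (span plane_waves) \<subseteq> closure D" by (intro closure_minimal) auto
 then have "closure D = UNIV" using plane_waves_dense by auto
 ultimately show ?thesis using that by blast
qed

text \<open>Second countability makes sums and scalar products of Borel curves in L^2 Borel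
  measurable, which the treatment of time derivatives relies on.\<close>

instance l2_sphere :: (euclidean_space) second_countable_topology
proof
 obtain D :: "'a l2_sphere set" where D: "countable D" "closure D = UNIV"
  by (rule countable_dense_l2_sphere)
 define B where "B = (\<lambda>(d, n). ball d (1 / real (Suc n))) ` (D \<times> (UNIV :: nat set))"
 have "topological_basis B"
 proof (rule topological_basisI)
  show "open b" if "b \<in> B" for b using that by (auto simp: B_def)
  fix U :: "'a l2_sphere set" and x assume U: "open U" "x \<in> U"
  then obtain e where e: "0 < e" "ball x e \<subseteq> U" by (auto simp: open_contains_ball)
  obtain n where n: "1 / real (Suc n) < e / 2" using nat_approx_posE[of "e/2"] e(1) by auto
  have "x \<in> closure D" "0 < 1 / real (Suc n)" using D(2) by auto
  then obtain d where d: "d \<in> D" "dist d x < 1 / real (Suc n)"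
   unfolding closure_approachable by blast
  have "ball d (1 / real (Suc n)) \<subseteq> ball x e"
  proof
   fix y assume "y \<in> ball d (1 / real (Suc n))"
   then show "y \<in> ball x e" using d(2) n dist_triangle[of x y d] by (simp add: dist_commute)
  qed
  then show "\<exists>b\<in>B. x \<in> b \<and> b \<subseteq> U"
   using d e(2) by (intro bexI[of _ "ball d (1 / real (Suc n))"]) (auto simp: B_def)
 qed
 moreover have "countable B" unfolding B_def by (intro countable_image countable_SIGMA D(1)) simp
 ultimately show "\<exists>B :: 'a l2_sphere set set. countable B \<and> open = generate_topology B"
  using topological_basis_imp_subbasis[of B] by (intro exI[of _ B] conjI)
qed

section \<open>The divergence theorem on the sphere\<close>

lemma integral_lborel_translation:
 fixes f :: "'a::euclidean_space \<Rightarrow> 'b::{banach, second_countable_topology}"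
 assumes [measurable]: "f \<in> borel_measurable borel"
 shows "(\<integral>x. f (c + x) \<partial>lborel) = (\<integral>x. f x \<partial>lborel)"
proof -
 have "(\<integral>x. f x \<partial>lborel) = (\<integral>x. f x \<partial>distr lborel borel ((+) c))"
  by (simp add: lborel_distr_plus)
 also have "\<dots> = (\<integral>x. f (c + x) \<partial>lborel)" by (rule integral_distr) auto
 finally show ?thesis by simp
qed

lemma GDERIV_line:
 fixes e :: "'a::real_inner"
 assumes "GDERIV H (x + s *\<^sub>R e) :> d"
 shows "((\<lambda>s. H (x + s *\<^sub>R e)) has_vector_derivative (d \<bullet> e)) (at s within S)"
proof -
 have "((\<lambda>s. H (x + s *\<^sub>R e)) has_derivative (\<lambda>h. inner (h *\<^sub>R e) d)) (at s within S)"
 proof (rule has_derivative_compose[where g=H])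
  show "((\<lambda>s. x + s *\<^sub>R e) has_derivative (\<lambda>h. h *\<^sub>R e)) (at s within S)"
   by (auto intro!: derivative_eq_intros)
  show "(H has_derivative (\<lambda>h. inner h d)) (at (x + s *\<^sub>R e))"
   using assms by (simp add: gderiv_def)
 qed
 then show ?thesis by (simp add: has_vector_derivative_def inner_commute)
qed

text \<open>Averaging over the translations by s e, 0 \<le> s \<le> 1, replaces the directional
  derivative by the increment H(x + e) - H(x), whose integral vanishes by translation invariance;
  nothing is differentiated under the integral.\<close>

lemma integral_gradient_eq_0:
 fixes H :: "'a::euclidean_space \<Rightarrow> real"
 assumes C1: "C1_gradient H DH" and out: "\<And>x. 1 \<le> norm x \<Longrightarrow> H x = 0" "\<And>x. 1 \<le> norm x \<Longrightarrow> DH x = 0"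
 shows "(\<integral>x. DH x \<bullet> e \<partial>lborel) = 0"
proof -
 have gd: "\<And>x. GDERIV H x :> DH x" and cD: "continuous_on UNIV DH"
  using C1 by (auto simp: C1_gradient_def)
 have cH: "continuous_on UNIV H"
  using gd by (auto intro!: continuous_at_imp_continuous_on has_derivative_continuous simp: gderiv_def)
 have m[measurable]: "H \<in> borel_measurable borel" "DH \<in> borel_measurable borel"
  using cH cD by (auto intro: borel_measurable_continuous_onI)
 define F where "F = (\<lambda>(x, s). DH (x + s *\<^sub>R e) \<bullet> e)"
 have cF: "continuous_on UNIV F" unfolding F_def case_prod_beta
  by (intro continuous_intros continuous_on_compose2[OF cD]) auto
 \<comment> \<open>A point of norm larger than 1 + |e| stays outside the unit ball under these
   translations, so the integrand has compact support.\<close>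
 have intF: "integrable (lborel \<Otimes>\<^sub>M lborel) (\<lambda>(x, s). indicator {0..1} s *\<^sub>R F (x, s))"
 proof -
  let ?S = "cball (0::'a) (1 + norm e) \<times> {0..1::real}"
  have "integrable lborel (\<lambda>p. indicator ?S p *\<^sub>R F p)"
   by (rule borel_integrable_compact) (auto intro: compact_Times continuous_on_subset[OF cF])
  moreover have "(\<lambda>p. indicator ?S p *\<^sub>R F p) = (\<lambda>(x, s). indicator {0..1} s *\<^sub>R F (x, s))"
  proof (rule ext, clarify)
   fix x s
   show "indicator ?S (x, s) *\<^sub>R F (x, s) = indicator {0..1} s *\<^sub>R F (x, s)"
   proof (cases "norm x \<le> 1 + norm e \<or> s \<notin> {0..1}")
    case True then show ?thesis by (auto simp: indicator_def)
   next
    case False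
    then have "norm (s *\<^sub>R e) \<le> norm e" by (auto simp: mult_left_le_one_le)
    moreover have "norm x \<le> norm (x + s *\<^sub>R e) + norm (s *\<^sub>R e)"
     using norm_triangle_ineq4[of "x + s *\<^sub>R e" "s *\<^sub>R e"] by simp
    ultimately have "1 \<le> norm (x + s *\<^sub>R e)" using False by linarith
    then show ?thesis by (simp add: F_def out(2))
   qed
  qed
  ultimately show ?thesis by (simp add: lborel_prod)
 qed
 have iH: "integrable lborel H"
 proof -
  have "integrable lborel (\<lambda>x. indicator (cball 0 1) x *\<^sub>R H x)"
   by (rule borel_integrable_compact) (auto intro: continuous_on_subset[OF cH])
  moreover have "(\<lambda>x. indicator (cball 0 1) x *\<^sub>R H x) = H"
   by (rule ext) (auto simp: indicator_def out(1))
  ultimately show ?thesis by simp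
 qed
 have iH': "integrable lborel (\<lambda>x. H (e + x))"
 proof -
  have "integrable (distr lborel borel ((+) e)) H" using iH by (simp add: lborel_distr_plus)
  then show ?thesis by (subst (asm) integrable_distr_eq) auto
 qed
 have "(\<integral>x. DH x \<bullet> e \<partial>lborel) = (\<integral>s. indicator {0..1::real} s *\<^sub>R (\<integral>x. DH x \<bullet> e \<partial>lborel) \<partial>lborel)"
  by simp
 also have "\<dots> = (\<integral>s. (\<integral>x. indicator {0..1} s *\<^sub>R F (x, s) \<partial>lborel) \<partial>lborel)"
 proof (rule Bochner_Integration.integral_cong[OF refl])
  fix s :: real
  have "(\<integral>x. DH (s *\<^sub>R e + x) \<bullet> e \<partial>lborel) = (\<integral>x. DH x \<bullet> e \<partial>lborel)"
   by (rule integral_lborel_translation) measurable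
  then show "indicator {0..1} s *\<^sub>R (\<integral>x. DH x \<bullet> e \<partial>lborel) = (\<integral>x. indicator {0..1} s *\<^sub>R F (x, s) \<partial>lborel)"
   by (simp add: F_def add.commute)
 qed
 also have "\<dots> = integral\<^sup>L (lborel \<Otimes>\<^sub>M lborel) (\<lambda>(x, s). indicator {0..1} s *\<^sub>R F (x, s))"
  by (rule lborel_pair.integral_snd[OF intF])
 also have "\<dots> = (\<integral>x. (\<integral>s. indicator {0..1} s *\<^sub>R F (x, s) \<partial>lborel) \<partial>lborel)"
  using lborel_pair.integral_fst[OF intF] by simp
 also have "\<dots> = (\<integral>x. H (e + x) - H x \<partial>lborel)"
 proof (rule Bochner_Integration.integral_cong[OF refl])
  fix x
  have "(\<integral>s. indicator {0..1} s *\<^sub>R F (x, s) \<partial>lborel) = H (x + 1 *\<^sub>R e) - H (x + 0 *\<^sub>R e)"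
  proof (rule integral_FTC_atLeastAtMost)
   show "((\<lambda>s. H (x + s *\<^sub>R e)) has_vector_derivative F (x, s)) (at s within {0..1})" for s
    unfolding F_def by (simp add: GDERIV_line gd)
   show "continuous_on {0..1} (\<lambda>s. F (x, s))"
    by (intro continuous_on_compose2[OF cF] continuous_intros) auto
  qed simp
  then show "(\<integral>s. indicator {0..1} s *\<^sub>R F (x, s) \<partial>lborel) = H (e + x) - H x" by (simp add: add.commute)
 qed
 also have "\<dots> = 0"
  using iH iH' integral_lborel_translation[of H e] by simp
 finally show ?thesis .
qed

text \<open>A radial cutoff living on [1/2, 1]: it vanishes near 0, where x/|x| is singular, and
  from 1 on, for compact support; squaring the positive part makes it C^1.\<close>

definition bump :: "real \<Rightarrow> real" where
 "bump s = (max 0 ((s - 1/2) * (1 - s)))\<^sup>2"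

definition bump' :: "real \<Rightarrow> real" where
 "bump' s = 2 * max 0 ((s - 1/2) * (1 - s)) * (3/2 - 2 * s)"

lemma DERIV_max_square: "((\<lambda>y. (max 0 y)\<^sup>2) has_real_derivative 2 * max 0 y) (at (y::real))"
proof -
 consider "y < 0" | "0 < y" | "y = 0" by linarith
 then show ?thesis
 proof cases
  case 1
  have "((\<lambda>y. 0) has_real_derivative 0) (at y)" by simp
  then have "((\<lambda>y. (max 0 y)\<^sup>2) has_real_derivative 0) (at y)"
   by (rule DERIV_cong_ev[THEN iffD1, rotated -1])
    (use 1 in \<open>auto intro!: eventually_mono[OF order_tendstoD(2)[OF tendsto_ident_at]] simp: eventually_at_filter
     intro: eventually_mono[OF eventually_nhds_in_open[of "{..<0}"]]\<close>)
  then show ?thesis using 1 by simp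
 next
  case 2
  have "((\<lambda>y. y\<^sup>2) has_real_derivative 2 * y) (at y)" by (auto intro!: derivative_eq_intros)
  then have "((\<lambda>y. (max 0 y)\<^sup>2) has_real_derivative 2 * y) (at y)"
   by (rule DERIV_cong_ev[THEN iffD1, rotated -1])
    (use 2 in \<open>auto intro: eventually_mono[OF eventually_nhds_in_open[of "{0<..}"]]\<close>)
  then show ?thesis using 2 by simp
 next
  case 3
  have "((\<lambda>h. ((max 0 (0 + h))\<^sup>2 - (max 0 0)\<^sup>2) / h) \<longlongrightarrow> 0) (at (0::real))"
  proof (rule Lim_null_comparison)
   show "\<forall>\<^sub>F h in at 0. norm (((max 0 (0 + h))\<^sup>2 - (max 0 0)\<^sup>2) / h) \<le> \<bar>h::real\<bar>"
    by (rule always_eventually) (auto simp: max_def power2_eq_square)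
   show "((\<lambda>h. \<bar>h\<bar>) \<longlongrightarrow> 0) (at (0::real))" by (auto intro!: tendsto_eq_intros)
  qed
  then show ?thesis using 3 by (simp add: DERIV_def)
 qed
qed

lemma DERIV_bump: "(bump has_real_derivative bump' s) (at s)"
 unfolding bump_def[abs_def] bump'_def
 by (rule DERIV_cong[OF DERIV_chain2[OF DERIV_max_square]])
  (auto intro!: derivative_eq_intros simp: algebra_simps)

lemma bump_cont: "continuous_on S bump" "continuous_on S bump'"
 unfolding bump_def[abs_def] bump'_def[abs_def] by (intro continuous_intros)+

lemma bump_zero: "s \<le> 1/2 \<or> 1 \<le> s \<Longrightarrow> bump s = 0 \<and> bump' s = 0"
proof -
 assume "s \<le> 1/2 \<or> 1 \<le> s"
 then have "(s - 1/2) * (1 - s) \<le> 0" by (auto intro: mult_nonpos_nonneg mult_nonneg_nonpos)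
 then show ?thesis by (simp add: bump_def bump'_def max_def)
qed

lemma bump_nonneg: "0 \<le> bump s" by (simp add: bump_def)

lemma bump_pos: "1/2 < s \<Longrightarrow> s < 1 \<Longrightarrow> 0 < bump s"
 by (simp add: bump_def max_def)

lemma has_derivative_sgn:
 fixes x :: "'a::euclidean_space"
 assumes "x \<noteq> 0"
 shows "(sgn has_derivative (\<lambda>h. (1 / norm x) *\<^sub>R tangential (sgn x) h)) (at x)"
proof -
 have "((\<lambda>x. inverse (norm x) *\<^sub>R x) has_derivative
   (\<lambda>h. inverse (norm x) *\<^sub>R h + (- (inverse (norm x) * inner h (sgn x) * inverse (norm x))) *\<^sub>R x)) (at x)"
  using assms by (auto intro!: derivative_eq_intros has_derivative_norm)
 moreover have "(\<lambda>x::'a. inverse (norm x) *\<^sub>R x) = sgn" by (auto simp: sgn_div_norm)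
 moreover have "inverse (norm x) *\<^sub>R h + (- (inverse (norm x) * inner h (sgn x) * inverse (norm x))) *\<^sub>R x
   = (1 / norm x) *\<^sub>R tangential (sgn x) h" for h
  using assms by (simp add: tangential_def sgn_div_norm divide_inverse scaleR_diff_right mult.assoc)
 ultimately show ?thesis by simp
qed

lemma tangential_inner: "tangential y v \<bullet> w = v \<bullet> w - (v \<bullet> y) * (y \<bullet> w)"
 by (simp add: tangential_def inner_diff_left)

lemma tangential_symmetric: "tangential y v \<bullet> w = v \<bullet> tangential y w"
 by (simp add: tangential_def inner_diff_left inner_diff_right inner_commute)

lemma continuous_on_tangential:
 assumes "continuous_on S f" "continuous_on S g"
 shows "continuous_on S (\<lambda>x. tangential (f x) (g x))"
 unfolding tangential_def by (intro continuous_intros assms)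

lemma integral_cylinder_mult:
 fixes A :: "real \<Rightarrow> real" and B :: "'a::euclidean_space \<Rightarrow> real"
 assumes A: "integrable unit_lebesgue A" and B: "integrable sphere_measure B"
 shows "integrable cylinder_measure (\<lambda>(r, z). A r * B z)"
  and "(\<integral>(r, z). A r * B z \<partial>cylinder_measure) = (\<integral>r. A r \<partial>unit_lebesgue) * (\<oint>z. B z)"
proof -
 have [measurable]: "A \<in> borel_measurable unit_lebesgue" "B \<in> borel_measurable sphere_measure"
  using A B by auto
 have m: "(\<lambda>(r, z). A r * B z) \<in> borel_measurable cylinder_measure" by measurable
 show i: "integrable cylinder_measure (\<lambda>(r, z). A r * B z)"
 proof (rule cylinder.Fubini_integrable[OF m])
  show "integrable unit_lebesgue (\<lambda>x. \<integral>y. norm (case (x, y) of (r, z) \<Rightarrow> A r * B z) \<partial>sphere_measure)"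
   using A by (simp add: abs_mult)
  show "AE x in unit_lebesgue. integrable sphere_measure (\<lambda>y. case (x, y) of (r, z) \<Rightarrow> A r * B z)"
   using B by simp
 qed
 have "(\<integral>(r, z). A r * B z \<partial>cylinder_measure) = (\<integral>r. \<integral>z. A r * B z \<partial>sphere_measure \<partial>unit_lebesgue)"
  using cylinder.integral_fst'[OF i] by simp
 then show "(\<integral>(r, z). A r * B z \<partial>cylinder_measure) = (\<integral>r. A r \<partial>unit_lebesgue) * (\<oint>z. B z)"
  by simp
qed

lemma integrable_unit_interval_continuous:
 fixes A :: "real \<Rightarrow> real"
 assumes "continuous_on {0..1} A"
 shows "integrable unit_lebesgue A"
 using borel_integrable_compact[of "{0..1}" A] assms by (subst integrable_restrict_space) auto

lemma C1_gradient_continuous: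
 assumes "C1_gradient f Df"
 shows "continuous_on S f" "continuous_on S Df"
proof -
 show "continuous_on S Df"
  using assms unfolding C1_gradient_def by (blast intro: continuous_on_subset)
 show "continuous_on S f"
  using assms by (auto intro!: continuous_at_imp_continuous_on has_derivative_continuous
   simp: gderiv_def C1_gradient_def)
qed

text \<open>Near the origin everything vanishes identically, and elsewhere the chain rule applies;
  the derivative of x/|x| is the tangential projection divided by |x|, which is how tangential
  gradients enter.\<close>

lemma C1_gradient_radial_extension:
 fixes f :: "'a::euclidean_space \<Rightarrow> real"
 assumes "C1_gradient f Df"
 shows "C1_gradient (\<lambda>x. bump (norm x) * f (sgn x))
  (\<lambda>x. (bump' (norm x) * f (sgn x)) *\<^sub>R sgn x + (bump (norm x) / norm x) *\<^sub>R tangential (sgn x) (Df (sgn x)))"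
  (is "C1_gradient ?H ?D")
proof -
 note cf = C1_gradient_continuous[OF assms]
 have small: "\<forall>\<^sub>F y in nhds x. ?H y = 0 \<and> ?D y = 0" if "norm x < 1/2" for x
 proof -
  have "\<forall>\<^sub>F y in nhds x. y \<in> ball 0 (1/2)" using that by (intro eventually_nhds_in_open) auto
  then show ?thesis
  proof eventually_elim
   case (elim y)
   then have "bump (norm y) = 0 \<and> bump' (norm y) = 0" by (intro bump_zero) auto
   then show ?case by simp
  qed
 qed
 have gd: "GDERIV ?H x :> ?D x" for x
 proof (cases "norm x < 1/2")
  case True
  have "?D x = 0" using eventually_nhds_x_imp_x[OF small[OF True]] by simp
  moreover have "(?H has_derivative (\<lambda>h. 0)) (at x)"
  proof (rule has_derivative_transform_eventually)
   show "((\<lambda>_. 0::real) has_derivative (\<lambda>h. 0)) (at x)" by simp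
   show "\<forall>\<^sub>F y in at x. 0 = ?H y"
    using small[OF True] by (auto simp: eventually_at_filter elim!: eventually_mono)
   show "0 = ?H x" using eventually_nhds_x_imp_x[OF small[OF True]] by simp
  qed simp
  ultimately show ?thesis unfolding gderiv_def by simp
 next
  case False
  then have x: "x \<noteq> 0" by auto
  have "(f has_derivative (\<lambda>h. inner h (Df (sgn x)))) (at (sgn x))"
   using assms by (auto simp: C1_gradient_def gderiv_def)
  from has_derivative_compose[OF has_derivative_sgn[OF x] this]
  have d1: "((\<lambda>x. f (sgn x)) has_derivative (\<lambda>h. inner ((1 / norm x) *\<^sub>R tangential (sgn x) h) (Df (sgn x)))) (at x)" .
  have "(bump has_derivative (\<lambda>h. bump' (norm x) * h)) (at (norm x))"
   using DERIV_bump[of "norm x"] by (simp add: has_field_derivative_def)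
  from has_derivative_compose[OF has_derivative_norm[OF x] this]
  have d2: "((\<lambda>x. bump (norm x)) has_derivative (\<lambda>h. bump' (norm x) * inner h (sgn x))) (at x)" .
  have "(?H has_derivative (\<lambda>h. inner h (?D x))) (at x)"
   by (rule has_derivative_subst[OF has_derivative_mult[OF d2 d1]])
     (rule ext, simp add: inner_add_right tangential_symmetric algebra_simps)
  then show ?thesis by (simp add: gderiv_def)
 qed
 have "isCont ?D x" for x
 proof (cases "norm x < 1/2")
  case True
  have "isCont (\<lambda>_. 0) x" by simp
  then show ?thesis
   by (rule isCont_cong[THEN iffD1, rotated]) (use small[OF True] in \<open>auto elim: eventually_mono\<close>)
 next
  case False
  then have x: "x \<in> UNIV - {0}" by auto
  have "continuous_on (UNIV - {0}) ?D"
   by (intro continuous_intros continuous_on_tangential continuous_on_compose2[OF cf(1)[of UNIV]]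
      continuous_on_compose2[OF cf(2)[of UNIV]] continuous_on_compose2[OF bump_cont(1)[of UNIV]]
      continuous_on_compose2[OF bump_cont(2)[of UNIV]]) auto
  then show ?thesis using x by (simp add: continuous_on_eq_continuous_at open_delete)
 qed
 then show ?thesis using gd by (simp add: C1_gradient_def continuous_at_imp_continuous_on)
qed

text \<open>The gradient of bump(|x|) f(x/|x|) integrates to zero over the whole space. In polar
  coordinates it splits into a radial and a tangential part, each a radial integral (of
  \<open>A1\<close>, \<open>A0\<close>) times a spherical one. Integrating the derivative of r^(d-1)
  bump(r) over [0,1] shows that the integral of \<open>A1\<close> is -(d-1) times that of
  \<open>A0\<close>, and the latter is not zero, so it can be divided out.\<close>

theorem divergence_sphere:
 fixes f :: "'a::euclidean_space \<Rightarrow> real"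
 assumes C1: "C1_gradient f Df"
 shows "(\<oint>p. tangential p (Df p) \<bullet> e) = (real DIM('a) - 1) * (\<oint>p. f p * (p \<bullet> e))"
proof -
 let ?d = "DIM('a)"
 let ?I = "unit_lebesgue"
 note cf = C1_gradient_continuous[OF C1, of UNIV]
 define D where "D x = (bump' (norm x) * f (sgn x)) *\<^sub>R sgn x + (bump (norm x) / norm x) *\<^sub>R tangential (sgn x) (Df (sgn x))" for x
 define H where "H x = bump (norm x) * f (sgn x)" for x
 have C: "C1_gradient H D"
  using C1_gradient_radial_extension[OF C1] by (simp add: H_def[abs_def] D_def[abs_def])
 note cD = C1_gradient_continuous[OF C, of UNIV]
 have out: "H x = 0" "D x = 0" if "1 \<le> norm x" for x
  using bump_zero[of "norm x"] that by (auto simp: H_def D_def)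
 have mD[measurable]: "D \<in> borel_measurable borel" using cD(2) by (rule borel_measurable_continuous_onI)
 define A1 where "A1 r = r ^ (?d - 1) * bump' r" for r :: real
 define A0 where "A0 r = r ^ (?d - 1) * (bump r / r)" for r :: real
 have cA1: "continuous_on {0..1} A1" unfolding A1_def by (intro continuous_intros bump_cont)
 \<comment> \<open>At 0 the quotient has the default value 0, in agreement with the vanishing of
   \<open>bump\<close> on a neighbourhood.\<close>
 have cq: "continuous_on UNIV (\<lambda>r. bump r / r)"
 proof -
  have "isCont (\<lambda>r. bump r / r) x" for x
  proof (cases "x < 1/2")
   case True
   have "isCont (\<lambda>_. 0) x" by simp
   moreover have "\<forall>\<^sub>F y in nhds x. 0 = bump y / y"
    using eventually_nhds_in_open[of "{..<1/2}" x] True by (auto elim!: eventually_mono simp: bump_zero)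
   ultimately show ?thesis by (subst (asm) isCont_cong)
  next
   case False
   then have "x \<in> {0<..}" by auto
   moreover have "continuous_on {0<..} (\<lambda>r. bump r / r)" by (intro continuous_intros bump_cont) auto
   ultimately show ?thesis by (simp add: continuous_on_eq_continuous_at)
  qed
  then show ?thesis by (simp add: continuous_at_imp_continuous_on)
 qed
 have cA0: "continuous_on {0..1} A0" unfolding A0_def by (intro continuous_intros continuous_on_subset[OF cq]) auto
 note iA = integrable_unit_interval_continuous[OF cA1] integrable_unit_interval_continuous[OF cA0]
 define B1 where "B1 p = f p * (p \<bullet> e)" for p
 define B0 where "B0 p = tangential p (Df p) \<bullet> e" for p
 have iB: "integrable sphere_measure B1" "integrable sphere_measure B0"
  unfolding B1_def[abs_def] B0_def[abs_def]
  by (intro integrable_sphere_continuous continuous_intros continuous_on_tangential cf)+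
 have "0 = (\<integral>x. D x \<bullet> e \<partial>lborel)"
  by (rule integral_gradient_eq_0[OF C out, symmetric])
 also have "\<dots> = (\<integral>x. indicator (ball 0 1) x *\<^sub>R (D x \<bullet> e) \<partial>lborel)"
  by (rule Bochner_Integration.integral_cong[OF refl]) (auto simp: indicator_def out)
 also have "\<dots> = (\<integral>x. D x \<bullet> e \<partial>ball_measure)"
  by (subst integral_restrict_space) auto
 also have "\<dots> = (\<integral>(r, p). r ^ (?d - 1) *\<^sub>R (D (r *\<^sub>R p) \<bullet> e) \<partial>cylinder_measure)"
  by (rule integral_polar) measurable
 also have "\<dots> = (\<integral>x. (case x of (r, p) \<Rightarrow> A1 r * B1 p) + (case x of (r, p) \<Rightarrow> A0 r * B0 p) \<partial>cylinder_measure)"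
 proof (rule integral_cong_AE)
  show "(\<lambda>(r, p). r ^ (?d - 1) *\<^sub>R (D (r *\<^sub>R p) \<bullet> e)) \<in> borel_measurable cylinder_measure"
   by (rule measurable_cylinder) measurable
  show "(\<lambda>x. (case x of (r, p) \<Rightarrow> A1 r * B1 p) + (case x of (r, p) \<Rightarrow> A0 r * B0 p)) \<in> borel_measurable cylinder_measure"
   using integral_cylinder_mult(1)[OF iA(1) iB(1)] integral_cylinder_mult(1)[OF iA(2) iB(2)] by auto
  have "AE (r, p) in cylinder_measure. r ^ (?d - 1) *\<^sub>R (D (r *\<^sub>R p) \<bullet> e) = A1 r * B1 p + A0 r * B0 p"
  proof (rule AE_cylinder)
   fix r :: real and p :: 'a assume r: "0 < r" "norm p = 1"
   then have "norm (r *\<^sub>R p) = r" "sgn (r *\<^sub>R p) = p" by (auto simp: sgn_div_norm)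
   then show "r ^ (?d - 1) *\<^sub>R (D (r *\<^sub>R p) \<bullet> e) = A1 r * B1 p + A0 r * B0 p"
    unfolding D_def A1_def B1_def A0_def B0_def by (simp add: inner_add_left algebra_simps)
  qed
  then show "AE x in cylinder_measure. (case x of (r, p) \<Rightarrow> r ^ (?d - 1) *\<^sub>R (D (r *\<^sub>R p) \<bullet> e)) =
    (case x of (r, p) \<Rightarrow> A1 r * B1 p) + (case x of (r, p) \<Rightarrow> A0 r * B0 p)"
   by eventually_elim (simp add: case_prod_beta)
 qed
 also have "\<dots> = (\<integral>r. A1 r \<partial>?I) * (\<oint>p. B1 p) + (\<integral>r. A0 r \<partial>?I) * (\<oint>p. B0 p)"
  by (subst Bochner_Integration.integral_add)
   (use integral_cylinder_mult[OF iA(1) iB(1)] integral_cylinder_mult[OF iA(2) iB(2)] in auto)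
 finally have eq: "(\<integral>r. A1 r \<partial>?I) * (\<oint>p. B1 p) + (\<integral>r. A0 r \<partial>?I) * (\<oint>p. B0 p) = 0"
  by simp
 have "(\<integral>r. A1 r + (real ?d - 1) * A0 r \<partial>?I) = (\<integral>r. indicator {0..1} r *\<^sub>R (A1 r + (real ?d - 1) * A0 r) \<partial>lborel)"
  by (subst integral_restrict_space) auto
 also have "\<dots> = 1 ^ (?d - 1) * bump 1 - 0 ^ (?d - 1) * bump 0"
 proof (rule integral_FTC_atLeastAtMost)
  fix r :: real
  have "((\<lambda>r. r ^ (?d - 1) * bump r) has_real_derivative (real (?d - 1) * r ^ (?d - 1 - 1) * bump r + bump' r * r ^ (?d - 1))) (at r)"
   by (rule DERIV_mult'[THEN DERIV_cong, OF DERIV_pow DERIV_bump]) (simp add: algebra_simps)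
  \<comment> \<open>The exponent d - 2 is a truncated difference, so r = 0 and d = 1 are treated
    apart; \<open>bump\<close> and its derivative vanish in the first case, the factor d - 1 in the
    second.\<close>
  moreover have "real (?d - 1) * r ^ (?d - 1 - 1) * bump r + bump' r * r ^ (?d - 1) = A1 r + (real ?d - 1) * A0 r"
  proof (cases "r = 0 \<or> ?d = 1")
   case True
   then show ?thesis by (auto simp: A1_def A0_def bump_zero)
  next
   case False
   then have "?d - 1 = Suc (?d - 1 - 1)"
    using DIM_positive[where 'a='a] by linarith
   then have "r ^ (?d - 1) = r * r ^ (?d - 1 - 1)"
    by (metis power_Suc)
   then show ?thesis using False DIM_positive[where 'a='a]
    by (simp add: A1_def A0_def of_nat_diff field_simps)
  qed
  ultimately show "((\<lambda>r. r ^ (?d - 1) * bump r) has_vector_derivative (A1 r + (real ?d - 1) * A0 r)) (at r within {0..1})"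
   by (simp add: has_real_derivative_iff_has_vector_derivative has_vector_derivative_at_within)
 qed (auto intro!: continuous_intros cA0 cA1)
 also have "\<dots> = 0" by (simp add: bump_zero)
 finally have A: "(\<integral>r. A1 r \<partial>?I) = - ((real ?d - 1) * (\<integral>r. A0 r \<partial>?I))"
  using iA by simp
 have "(\<integral>r. A0 r \<partial>?I) \<noteq> 0"
 proof
  assume 0: "(\<integral>r. A0 r \<partial>?I) = 0"
  have nn: "AE r in ?I. 0 \<le> A0 r"
   by (rule AE_I2) (auto simp: A0_def space_restrict_space intro!: mult_nonneg_nonneg divide_nonneg_nonneg bump_nonneg)
  have "AE r in ?I. A0 r = 0"
   using integral_nonneg_eq_0_iff_AE[OF iA(2) nn] 0 by simp
  then have "AE r in lborel. r \<in> {0..1} \<longrightarrow> A0 r = 0" by (subst (asm) AE_restrict_space_iff) auto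
  then have "AE r in lborel. r \<notin> {1/2<..<1::real}"
  proof eventually_elim
   case (elim r)
   show ?case
   proof
    assume r: "r \<in> {1/2<..<1}"
    then have "0 < A0 r" using bump_pos[of r] by (auto simp: A0_def)
    then show False using elim r by auto
   qed
  qed
  moreover have "{1/2<..<1::real} \<in> sets lborel" by simp
  ultimately have "{1/2<..<1::real} \<in> null_sets lborel" using AE_iff_null_sets by blast
  then have "emeasure lborel {1/2<..<1::real} = 0" by (rule null_setsD1)
  moreover have "emeasure lborel {1/2<..<1::real} = ennreal (1 - 1/2)" by (rule emeasure_lborel_Ioo) simp
  ultimately show False by simp
 qed
 then have "(\<oint>p. B0 p) = (real ?d - 1) * (\<oint>p. B1 p)"
 proof -
  have "(\<integral>r. A0 r \<partial>?I) * ((\<oint>p. B0 p) - (real ?d - 1) * (\<oint>p. B1 p)) = 0"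
  proof -
   have "x * (z - d * y) = 0" if "- (d * x) * y + x * z = 0" for x y z d :: real
    using that by algebra
   from this[OF eq[unfolded A]] show ?thesis .
  qed
  then show ?thesis using \<open>(\<integral>r. A0 r \<partial>?I) \<noteq> 0\<close> by simp
 qed
 then show ?thesis by (simp add: B0_def B1_def)
qed

section \<open>Tangential derivatives\<close>

text \<open>Density lets identities in L^2 be proved by testing against plane waves, without
  handling representatives.\<close>

lemma l2_sphere_eqI_plane_waves:
 fixes c d :: "'a::euclidean_space l2_sphere"
 assumes "\<And>a j. c \<bullet> plane_wave a j = d \<bullet> plane_wave a j"
 shows "c = d"
proof -
 have "plane_waves \<subseteq> {p. (c - d) \<bullet> p = 0}"
  using assms by (auto simp: plane_waves_def inner_diff_left)
 then have "span plane_waves \<subseteq> {p. (c - d) \<bullet> p = 0}"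
  by (rule span_minimal) (auto simp: subspace_def inner_add_right)
 moreover have "closed {p. (c - d) \<bullet> p = 0}"
  by (intro closed_Collect_eq continuous_intros)
 ultimately have "closure (span plane_waves) \<subseteq> {p. (c - d) \<bullet> p = 0}"
  by (rule closure_minimal)
 then have "(c - d) \<bullet> (c - d) = 0" unfolding plane_waves_dense by blast
 then show ?thesis by simp
qed

text \<open>Multiplication by the coordinate y.e, a bounded symmetric operator on L^2. It carries
  the mean curvature term, so that integration by parts becomes an identity between scalar
  products.\<close>

definition mult_coord :: "'a::euclidean_space \<Rightarrow> 'a l2_sphere \<Rightarrow> 'a l2_sphere" where
 "mult_coord e f = cls (\<lambda>y. (y \<bullet> e) * rep f y)"

lemma continuous_coord: "continuous_on S (\<lambda>y. y \<bullet> (e::'a::euclidean_space))"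
 by (intro continuous_intros)

lemma square_integrable_mult_coord:
 "L2_sphere f \<Longrightarrow> L2_sphere (\<lambda>y. (y \<bullet> e) * f y)"
 by (rule square_integrable_mult_continuous[OF _ continuous_coord])

lemma mult_coord_abs:
 assumes "L2_sphere f"
 shows "mult_coord e (cls f) = cls (\<lambda>y. (y \<bullet> e) * f y)"
 unfolding mult_coord_def
 by (subst abs_l2_sphere_eq_iff)
  (use AE_rep_abs_l2_sphere[OF assms] in \<open>auto intro!: square_integrable_mult_coord assms elim!: eventually_mono\<close>)

lemma inner_mult_coord: "c \<bullet> mult_coord e f = (\<oint>y. rep c y * rep f y * (y \<bullet> e))"
 unfolding mult_coord_def
 by (subst inner_l2_sphere_abs[OF square_integrable_mult_coord[OF rep_l2_sphere_square_integrable]]) (simp add: mult_ac)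

lemma mult_coord_symmetric: "mult_coord e f \<bullet> g = f \<bullet> mult_coord e g"
 by (simp add: inner_commute[of _ g] inner_mult_coord mult_ac)

lemma mult_coord_add: "mult_coord e (f + g) = mult_coord e f + mult_coord e g"
 by (rule l2_sphere_eqI_plane_waves) (simp add: mult_coord_symmetric inner_add_left)

lemma mult_coord_scale: "mult_coord e (r *\<^sub>R f) = r *\<^sub>R mult_coord e f"
 by (rule l2_sphere_eqI_plane_waves) (simp add: mult_coord_symmetric)

lemma norm_mult_coord:
 assumes "norm e = 1" shows "norm (mult_coord e f) \<le> norm f"
proof -
 have "(norm (mult_coord e f))\<^sup>2 = (\<oint>y. ((y \<bullet> e) * rep f y)\<^sup>2)"
  unfolding mult_coord_def by (rule norm_abs_l2_sphere) (intro square_integrable_mult_coord rep_l2_sphere_square_integrable)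
 also have "\<dots> \<le> (\<oint>y. (rep f y)\<^sup>2)"
 proof (rule integral_mono_AE)
  show "integrable sphere_measure (\<lambda>y. ((y \<bullet> e) * rep f y)\<^sup>2)"
   using square_integrable_mult_coord[OF rep_l2_sphere_square_integrable, of e f] by (simp add: square_integrable_def)
  show "integrable sphere_measure (\<lambda>y. (rep f y)\<^sup>2)"
   using rep_l2_sphere_square_integrable[of f] by (simp add: square_integrable_def)
  show "AE y in sphere_measure. ((y \<bullet> e) * rep f y)\<^sup>2 \<le> (rep f y)\<^sup>2"
   using AE_sphere_measure_norm
  proof eventually_elim
   case (elim y)
   have "\<bar>y \<bullet> e\<bar> \<le> 1" using Cauchy_Schwarz_ineq2[of y e] elim assms by simp
   then have "(y \<bullet> e)\<^sup>2 \<le> 1" by (simp add: abs_square_le_1)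
   then show ?case by (simp add: power_mult_distrib mult_left_le_one_le)
  qed
 qed
 also have "\<dots> = (norm f)\<^sup>2" by (simp add: norm_l2_sphere_eq)
 finally show ?thesis by (rule power2_le_imp_le) simp
qed

lemma has_tangential_derivative_iff:
 fixes c :: "'a::euclidean_space l2_sphere"
 shows "has_tangential_derivative c e g \<longleftrightarrow> (\<forall>f Df. C1_gradient f Df \<longrightarrow>
  c \<bullet> cls (\<lambda>y. tangential y (Df y) \<bullet> e) =
   - (g \<bullet> cls f) + (real DIM('a) - 1) * (c \<bullet> mult_coord e (cls f)))"
proof -
 have "c \<bullet> cls (\<lambda>y. tangential y (Df y) \<bullet> e) = (\<oint>y. rep c y * (tangential y (Df y) \<bullet> e))
   \<and> g \<bullet> cls f = (\<oint>y. rep g y * f y)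
   \<and> c \<bullet> mult_coord e (cls f) = (\<oint>y. rep c y * f y * (y \<bullet> e))"
  if "C1_gradient f Df" for f Df
 proof (intro conjI)
  note cont = C1_gradient_continuous[OF that]
  have sq: "L2_sphere f" by (rule square_integrable_sphere_continuous[OF cont(1)])
  show "c \<bullet> cls (\<lambda>y. tangential y (Df y) \<bullet> e) = (\<oint>y. rep c y * (tangential y (Df y) \<bullet> e))"
   by (intro inner_l2_sphere_abs square_integrable_sphere_continuous continuous_intros continuous_on_tangential cont)
  show "g \<bullet> cls f = (\<oint>y. rep g y * f y)"
   by (rule inner_l2_sphere_abs[OF sq])
  show "c \<bullet> mult_coord e (cls f) = (\<oint>y. rep c y * f y * (y \<bullet> e))"
   unfolding mult_coord_abs[OF sq]
   by (subst inner_l2_sphere_abs[OF square_integrable_mult_coord[OF sq]]) (simp add: mult_ac)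
 qed
 note eqs = this
 show ?thesis unfolding has_tangential_derivative_def
 proof (intro all_cong1 iffI impI)
  fix f :: "'a \<Rightarrow> real" and Df :: "'a \<Rightarrow> 'a" assume C: "C1_gradient f Df"
  {
   assume "C1_gradient f Df \<longrightarrow>
    (\<oint>y. rep c y * (tangential y (Df y) \<bullet> e)) =
    - (\<oint>y. rep g y * f y)
    + (real DIM('a) - 1) * (\<oint>y. rep c y * f y * (y \<bullet> e))"
   then show "c \<bullet> cls (\<lambda>y. tangential y (Df y) \<bullet> e) =
    - (g \<bullet> cls f) + (real DIM('a) - 1) * (c \<bullet> mult_coord e (cls f))"
    using C eqs[OF C] by simp
  next
   assume "C1_gradient f Df \<longrightarrow> c \<bullet> cls (\<lambda>y. tangential y (Df y) \<bullet> e) =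
    - (g \<bullet> cls f) + (real DIM('a) - 1) * (c \<bullet> mult_coord e (cls f))"
   then show "(\<oint>y. rep c y * (tangential y (Df y) \<bullet> e)) =
    - (\<oint>y. rep g y * f y)
    + (real DIM('a) - 1) * (\<oint>y. rep c y * f y * (y \<bullet> e))"
    using C eqs[OF C] by simp
  }
 qed
qed

lemma C1_gradient_plane_wave:
 "C1_gradient (\<lambda>x::'a::euclidean_space. (x \<bullet> a) ^ j) (\<lambda>x. (real j * (x \<bullet> a) ^ (j - 1)) *\<^sub>R a)"
 unfolding C1_gradient_def gderiv_def
proof (intro conjI allI)
 fix x
 show "((\<lambda>x. (x \<bullet> a) ^ j) has_derivative (\<lambda>h. h \<bullet> (real j * (x \<bullet> a) ^ (j - 1)) *\<^sub>R a)) (at x)"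
  by (auto intro!: derivative_eq_intros simp: mult_ac)
qed (intro continuous_intros)

lemma C1_gradient_mult:
 assumes "C1_gradient f Df" "C1_gradient g Dg"
 shows "C1_gradient (\<lambda>x. f x * g x) (\<lambda>x. f x *\<^sub>R Dg x + g x *\<^sub>R Df x)"
proof -
 note c = C1_gradient_continuous[OF assms(1), of UNIV] C1_gradient_continuous[OF assms(2), of UNIV]
 have "GDERIV (\<lambda>x. f x * g x) x :> f x *\<^sub>R Dg x + g x *\<^sub>R Df x" for x
  using assms GDERIV_mult[of f x "Df x" g "Dg x"] by (auto simp: C1_gradient_def)
 then show ?thesis using c by (auto simp: C1_gradient_def intro!: continuous_intros)
qed

text \<open>This is the divergence theorem for the product of \<open>p\<close> with the test
  function.\<close>

lemma has_tangential_derivative_C1: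
 fixes p :: "'a::euclidean_space \<Rightarrow> real"
 assumes C1: "C1_gradient p Dp"
 shows "has_tangential_derivative (cls p) e (cls (\<lambda>y. tangential y (Dp y) \<bullet> e))"
 unfolding has_tangential_derivative_iff
proof (intro allI impI)
 fix f Df assume "C1_gradient f (Df :: 'a \<Rightarrow> 'a)"
 note C2 = this
 note c = C1_gradient_continuous[OF C1, of UNIV] C1_gradient_continuous[OF C2, of UNIV]
 let ?Tp = "\<lambda>y. tangential y (Dp y) \<bullet> e" and ?Tf = "\<lambda>y. tangential y (Df y) \<bullet> e"
 have cT: "continuous_on UNIV ?Tp" "continuous_on UNIV ?Tf"
  by (intro continuous_intros continuous_on_tangential c)+
 note sq = c(1,3)[THEN square_integrable_sphere_continuous] cT[THEN square_integrable_sphere_continuous]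
 have "(\<oint>y. tangential y (p y *\<^sub>R Df y + f y *\<^sub>R Dp y) \<bullet> e)
   = (real DIM('a) - 1) * (\<oint>y. (p y * f y) * (y \<bullet> e))"
  by (rule divergence_sphere[OF C1_gradient_mult[OF C1 C2]])
 also have "(\<lambda>y. tangential y (p y *\<^sub>R Df y + f y *\<^sub>R Dp y) \<bullet> e) = (\<lambda>y. p y * ?Tf y + ?Tp y * f y)"
  by (rule ext) (simp add: tangential_inner inner_add_left algebra_simps)
 also have "(\<oint>y. p y * ?Tf y + ?Tp y * f y) = (\<oint>y. p y * ?Tf y) + (\<oint>y. ?Tp y * f y)"
  by (intro Bochner_Integration.integral_add square_integrable_mult_integrable sq)
 finally have eq: "(\<oint>y. p y * ?Tf y) + (\<oint>y. ?Tp y * f y)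
   = (real DIM('a) - 1) * (\<oint>y. (p y * f y) * (y \<bullet> e))" .
 show "cls p \<bullet> cls ?Tf = - (cls ?Tp \<bullet> cls f)
   + (real DIM('a) - 1) * (cls p \<bullet> mult_coord e (cls f))"
 proof -
  have "cls p \<bullet> mult_coord e (cls f) = (\<oint>y. p y * ((y \<bullet> e) * f y))"
   unfolding mult_coord_abs[OF sq(2)] by (rule inner_abs_l2_sphere[OF sq(1) square_integrable_mult_coord[OF sq(2)]])
  also have "\<dots> = (\<oint>y. (p y * f y) * (y \<bullet> e))"
   by (rule Bochner_Integration.integral_cong) (simp_all add: mult_ac)
  finally have k: "cls p \<bullet> mult_coord e (cls f) = (\<oint>y. (p y * f y) * (y \<bullet> e))" .
  show ?thesis
   unfolding inner_abs_l2_sphere[OF sq(1) sq(4)] inner_abs_l2_sphere[OF sq(3) sq(2)] k using eq by simp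
 qed
qed

lemma has_tangential_derivative_unique:
 assumes "has_tangential_derivative c e g" "has_tangential_derivative c e g'"
 shows "g = g'"
proof (rule l2_sphere_eqI_plane_waves)
 fix a j
 show "g \<bullet> plane_wave a j = g' \<bullet> plane_wave a j"
  using assms C1_gradient_plane_wave[of a j] unfolding has_tangential_derivative_iff plane_wave_def by fastforce
qed

lemma tangential_derivative_eq: "has_tangential_derivative c e g \<Longrightarrow> tangential_derivative e c = g"
 unfolding tangential_derivative_def using has_tangential_derivative_unique by blast

lemma H1_sphere_derivative:
 assumes "c \<in> H1_sphere" "e \<in> Basis"
 shows "has_tangential_derivative c e (tangential_derivative e c)"
 using assms tangential_derivative_eq unfolding H1_sphere_def by fastforce

lemma has_tangential_derivative_add:
 fixes c :: "'a::euclidean_space l2_sphere"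
 shows "has_tangential_derivative c e g \<Longrightarrow> has_tangential_derivative c' e g' \<Longrightarrow> has_tangential_derivative (c + c') e (g + g')"
 unfolding has_tangential_derivative_iff
proof (intro allI impI)
 fix f :: "'a \<Rightarrow> real" and Df :: "'a \<Rightarrow> 'a" assume C: "C1_gradient f Df"
  and *: "\<forall>f Df. C1_gradient f Df \<longrightarrow> c \<bullet> cls (\<lambda>y. tangential y (Df y) \<bullet> e) =
   - (g \<bullet> cls f) + (real DIM('a) - 1) * (c \<bullet> mult_coord e (cls f))"
  and **: "\<forall>f Df. C1_gradient f Df \<longrightarrow> c' \<bullet> cls (\<lambda>y. tangential y (Df y) \<bullet> e) =
   - (g' \<bullet> cls f) + (real DIM('a) - 1) * (c' \<bullet> mult_coord e (cls f))"
 from * C have 1: "c \<bullet> cls (\<lambda>y. tangential y (Df y) \<bullet> e) =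
   - (g \<bullet> cls f) + (real DIM('a) - 1) * (c \<bullet> mult_coord e (cls f))" by blast
 from ** C have 2: "c' \<bullet> cls (\<lambda>y. tangential y (Df y) \<bullet> e) =
   - (g' \<bullet> cls f) + (real DIM('a) - 1) * (c' \<bullet> mult_coord e (cls f))" by blast
 show "(c + c') \<bullet> cls (\<lambda>y. tangential y (Df y) \<bullet> e) =
   - ((g + g') \<bullet> cls f) + (real DIM('a) - 1) * ((c + c') \<bullet> mult_coord e (cls f))"
  unfolding inner_add_left 1 2 by (simp add: distrib_left)
qed

lemma has_tangential_derivative_scale:
 fixes c :: "'a::euclidean_space l2_sphere"
 shows "has_tangential_derivative c e g \<Longrightarrow> has_tangential_derivative (r *\<^sub>R c) e (r *\<^sub>R g)"
 unfolding has_tangential_derivative_iff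
proof (intro allI impI)
 fix f :: "'a \<Rightarrow> real" and Df :: "'a \<Rightarrow> 'a" assume C: "C1_gradient f Df"
  and *: "\<forall>f Df. C1_gradient f Df \<longrightarrow> c \<bullet> cls (\<lambda>y. tangential y (Df y) \<bullet> e) =
   - (g \<bullet> cls f) + (real DIM('a) - 1) * (c \<bullet> mult_coord e (cls f))"
 then have "c \<bullet> cls (\<lambda>y. tangential y (Df y) \<bullet> e) =
   - (g \<bullet> cls f) + (real DIM('a) - 1) * (c \<bullet> mult_coord e (cls f))" by blast
 then show "r *\<^sub>R c \<bullet> cls (\<lambda>y. tangential y (Df y) \<bullet> e) =
   - (r *\<^sub>R g \<bullet> cls f) + (real DIM('a) - 1) * (r *\<^sub>R c \<bullet> mult_coord e (cls f))"
  unfolding inner_scaleR_left by (simp add: right_diff_distrib mult.left_commute)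
qed

lemma has_tangential_derivative_zero: "has_tangential_derivative 0 e 0"
 unfolding has_tangential_derivative_iff by simp

lemma subspace_H1_sphere: "subspace H1_sphere"
 unfolding subspace_def H1_sphere_def
 using has_tangential_derivative_zero has_tangential_derivative_add has_tangential_derivative_scale by blast

lemma tangential_derivative_add:
 "c \<in> H1_sphere \<Longrightarrow> d \<in> H1_sphere \<Longrightarrow> e \<in> Basis \<Longrightarrow>
  tangential_derivative e (c + d) = tangential_derivative e c + tangential_derivative e d"
 by (intro tangential_derivative_eq has_tangential_derivative_add H1_sphere_derivative)

lemma tangential_derivative_scale:
 "c \<in> H1_sphere \<Longrightarrow> e \<in> Basis \<Longrightarrow> tangential_derivative e (r *\<^sub>R c) = r *\<^sub>R tangential_derivative e c"
 by (intro tangential_derivative_eq has_tangential_derivative_scale H1_sphere_derivative)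

lemma tangential_derivative_diff:
 assumes "c \<in> H1_sphere" "d \<in> H1_sphere" "e \<in> Basis"
 shows "tangential_derivative e (c - d) = tangential_derivative e c - tangential_derivative e d"
 using tangential_derivative_add[of c "(-1) *\<^sub>R d" e] tangential_derivative_scale[of d e "-1"] assms
  subspace_scale[OF subspace_H1_sphere, of d "-1"] by simp

lemma tangential_derivative_zero: "tangential_derivative e 0 = 0"
 by (intro tangential_derivative_eq has_tangential_derivative_zero)

lemma plane_wave_derivative:
 "has_tangential_derivative (plane_wave a j) e
  (cls (\<lambda>y. real j * (y \<bullet> a) ^ (j - 1) * (a \<bullet> e - (y \<bullet> a) * (y \<bullet> e))))"
proof -
 have "(\<lambda>y. tangential y ((real j * (y \<bullet> a) ^ (j - 1)) *\<^sub>R a) \<bullet> e)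
  = (\<lambda>y. real j * (y \<bullet> a) ^ (j - 1) * (a \<bullet> e - (y \<bullet> a) * (y \<bullet> e)))"
  unfolding tangential_inner by (rule ext) (simp add: inner_commute right_diff_distrib mult_ac)
 then show ?thesis
  using has_tangential_derivative_C1[OF C1_gradient_plane_wave[of a j], of e] by (simp add: plane_wave_def)
qed

lemma plane_waves_H1:
 fixes a :: "'a::euclidean_space"
 shows "plane_wave a j \<in> H1_sphere" and "span plane_waves \<subseteq> (H1_sphere :: 'a l2_sphere set)"
proof -
 have pw: "plane_wave a j \<in> H1_sphere" for a :: 'a and j
  using plane_wave_derivative by (auto simp: H1_sphere_def)
 then show "plane_wave a j \<in> H1_sphere" .
 from pw show "span plane_waves \<subseteq> (H1_sphere :: 'a l2_sphere set)"
  by (intro span_minimal subspace_H1_sphere) (auto simp: plane_waves_def)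
qed

text \<open>Each plane wave is an admissible C^1 test function, and both sides are linear in
  \<open>p\<close>. A density argument later replaces \<open>p\<close> by an arbitrary function in
  H^1.\<close>

lemma plane_waves_by_parts:
 fixes f :: "'a::euclidean_space l2_sphere"
 assumes f: "has_tangential_derivative f e g" and e: "e \<in> Basis" and p: "p \<in> span plane_waves"
 shows "f \<bullet> tangential_derivative e p = - (g \<bullet> p) + (real DIM('a) - 1) * (f \<bullet> mult_coord e p)"
proof -
 have "p \<in> H1_sphere \<and> f \<bullet> tangential_derivative e p = - (g \<bullet> p) + (real DIM('a) - 1) * (f \<bullet> mult_coord e p)"
  using p
 proof (induction rule: span_induct_alt)
  case base
  show ?case using mult_coord_scale[of e 0 0] subspace_0[OF subspace_H1_sphere]
   by (simp add: tangential_derivative_zero)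
 next
  case (step r x y)
  obtain a j where x: "x = plane_wave a j" using step(1) by (auto simp: plane_waves_def)
  have "f \<bullet> tangential_derivative e x = - (g \<bullet> x) + (real DIM('a) - 1) * (f \<bullet> mult_coord e x)"
  proof -
   have "f \<bullet> cls (\<lambda>z. tangential z ((real j * (z \<bullet> a) ^ (j - 1)) *\<^sub>R a) \<bullet> e) =
     - (g \<bullet> cls (\<lambda>x. (x \<bullet> a) ^ j)) + (real DIM('a) - 1) * (f \<bullet> mult_coord e (cls (\<lambda>x. (x \<bullet> a) ^ j)))"
    using f C1_gradient_plane_wave[of a j] unfolding has_tangential_derivative_iff by blast
   then show ?thesis
    using tangential_derivative_eq[OF has_tangential_derivative_C1[OF C1_gradient_plane_wave[of a j], of e]]
    by (simp add: x plane_wave_def)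
  qed
  moreover have "x \<in> H1_sphere" by (simp add: x plane_waves_H1)
  moreover have "y \<in> H1_sphere \<and> f \<bullet> tangential_derivative e y = - (g \<bullet> y) + (real DIM('a) - 1) * (f \<bullet> mult_coord e y)"
   using step by blast
  ultimately show ?case
   using subspace_scale[OF subspace_H1_sphere, of x r] subspace_add[OF subspace_H1_sphere, of "r *\<^sub>R x" y] e
   by (simp add: tangential_derivative_add tangential_derivative_scale mult_coord_add mult_coord_scale inner_add_right distrib_left
    right_diff_distrib mult.left_commute)
 qed
 then show ?thesis ..
qed


section \<open>Integration by parts for two functions in \<open>H\<^sup>1\<close>\<close>

text \<open>Gram-Schmidt by induction: the projection \<open>p'\<close> of the new vector
  \<open>b\<close> onto the old span is subtracted first, and the projection of \<open>c\<close> is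
  then corrected along b' = b - p'.\<close>

lemma finite_span_projection:
 fixes c :: "'b::real_inner"
 assumes "finite S"
 shows "\<exists>p\<in>span S. \<forall>q\<in>span S. (c - p) \<bullet> q = 0"
 using assms
proof (induction S arbitrary: c)
 case empty
 show ?case by (intro bexI[of _ 0]) auto
next
 case (insert b S)
 obtain p where p: "p \<in> span S" "\<forall>q\<in>span S. (c - p) \<bullet> q = 0" using insert.IH by blast
 obtain p' where p': "p' \<in> span S" "\<forall>q\<in>span S. (b - p') \<bullet> q = 0" using insert.IH by blast
 define b' where "b' = b - p'"
 have sub: "span S \<subseteq> span (insert b S)" by (intro span_mono) auto
 have b': "b' \<in> span (insert b S)"
  unfolding b'_def using subsetD[OF sub p'(1)] by (intro span_diff) (auto intro: span_base)
 \<comment> \<open>If \<open>b' = 0\<close>, division by zero gives \<open>r = 0\<close> and no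
   correction is made.\<close>
 define r where "r = (c \<bullet> b') / (b' \<bullet> b')"
 have rb: "r * (b' \<bullet> b') = c \<bullet> b'" by (cases "b' = 0") (auto simp: r_def)
 show ?case
 proof (intro bexI[of _ "p + r *\<^sub>R b'"] ballI)
  show "p + r *\<^sub>R b' \<in> span (insert b S)" using p(1) sub b' by (intro span_add span_scale) auto
  fix q assume "q \<in> span (insert b S)"
  then obtain k where k: "q - k *\<^sub>R b \<in> span S" unfolding span_insert by blast
  define s where "s = q - k *\<^sub>R b + k *\<^sub>R p'"
  have s: "s \<in> span S" unfolding s_def using k p'(1) by (intro span_add span_scale)
  have q: "q = s + k *\<^sub>R b'" by (simp add: s_def b'_def algebra_simps)
  have z: "(c - p) \<bullet> s = 0" "b' \<bullet> s = 0" "p \<bullet> b' = 0"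
   using p p' s by (auto simp: b'_def inner_commute)
  have "(c - (p + r *\<^sub>R b')) \<bullet> q = (c - p) \<bullet> s - r * (b' \<bullet> s) + k * (c \<bullet> b' - p \<bullet> b' - r * (b' \<bullet> b'))"
   unfolding q by (simp add: inner_add_right inner_diff_left inner_add_left algebra_simps)
  then show "(c - (p + r *\<^sub>R b')) \<bullet> q = 0" using z rb by simp
 qed
qed

text \<open>The spherical Laplacian maps \<open>(\<theta> \<bullet> a)\<^sup>j\<close> to a combination of powers of the same linear form.\<close>

definition wave_laplacian :: "'a::euclidean_space \<Rightarrow> nat \<Rightarrow> 'a l2_sphere" where
 "wave_laplacian a j = (real j * (real j + real DIM('a) - 2)) *\<^sub>R plane_wave a j
   - (real j * (real j - 1) * (a \<bullet> a)) *\<^sub>R plane_wave a (j - 2)"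

text \<open>With t = y.a, integrating by parts in a single direction leaves the span of the powers
  of t; only the sum over an orthonormal basis collapses, on |y| = 1, to multiples of t^j and
  t^(j-2). The sign is that of minus the Laplacian.\<close>

lemma plane_wave_laplacian:
 fixes c :: "'a::euclidean_space l2_sphere"
 assumes c: "c \<in> H1_sphere"
 shows "(\<Sum>e\<in>Basis. tangential_derivative e c \<bullet> tangential_derivative e (plane_wave a j)) = c \<bullet> wave_laplacian a j"
proof -
 let ?d = "real DIM('a)"
 define q where "q e x = (real j * (x \<bullet> a) ^ (j - 1)) * (a \<bullet> e - (x \<bullet> a) * (x \<bullet> e))" for e x :: 'a
 define Dq where "Dq e x = (real j * (x \<bullet> a) ^ (j - 1)) *\<^sub>R (- ((x \<bullet> e) *\<^sub>R a + (x \<bullet> a) *\<^sub>R e))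
   + (a \<bullet> e - (x \<bullet> a) * (x \<bullet> e)) *\<^sub>R ((real j * (real (j - 1) * (x \<bullet> a) ^ (j - 1 - 1))) *\<^sub>R a)" for e x :: 'a
 have Cq: "C1_gradient (q e) (Dq e)" for e
  unfolding q_def[abs_def] Dq_def[abs_def]
 proof (rule C1_gradient_mult)
  show "C1_gradient (\<lambda>x. real j * (x \<bullet> a) ^ (j - 1)) (\<lambda>x. (real j * (real (j - 1) * (x \<bullet> a) ^ (j - 1 - 1))) *\<^sub>R a)"
   unfolding C1_gradient_def gderiv_def
  proof (intro conjI allI)
   fix x
   show "((\<lambda>x. real j * (x \<bullet> a) ^ (j - 1)) has_derivative (\<lambda>h. h \<bullet> (real j * (real (j - 1) * (x \<bullet> a) ^ (j - 1 - 1))) *\<^sub>R a)) (at x)"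
    by (rule derivative_eq_intros refl)+ (simp add: mult_ac)
  qed (intro continuous_intros)
  show "C1_gradient (\<lambda>x. a \<bullet> e - (x \<bullet> a) * (x \<bullet> e)) (\<lambda>x. - ((x \<bullet> e) *\<^sub>R a + (x \<bullet> a) *\<^sub>R e))"
   unfolding C1_gradient_def gderiv_def
  proof (intro conjI allI)
   fix x
   show "((\<lambda>x. a \<bullet> e - (x \<bullet> a) * (x \<bullet> e)) has_derivative (\<lambda>h. h \<bullet> (- ((x \<bullet> e) *\<^sub>R a + (x \<bullet> a) *\<^sub>R e)))) (at x)"
    by (rule derivative_eq_intros refl)+ (simp add: fun_eq_iff inner_add_right inner_diff_right mult_ac)
  qed (intro continuous_intros)
 qed
 note cont = C1_gradient_continuous[OF Cq, of UNIV]
 have td: "tangential_derivative e (plane_wave a j) = cls (q e)" for e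
  using tangential_derivative_eq[OF plane_wave_derivative[of a j e]] by (simp add: q_def[abs_def] mult.assoc)
 \<comment> \<open>\<open>u e\<close> is the formal adjoint of the tangential derivative applied to
   \<open>q e\<close>; its first summand is the curvature term.\<close>
 define u where "u e y = (?d - 1) * (q e y * (y \<bullet> e)) - tangential y (Dq e y) \<bullet> e" for e y
 have cu: "continuous_on UNIV (u e)" for e
  unfolding u_def[abs_def] by (intro continuous_intros continuous_on_tangential cont)
 have one: "tangential_derivative e c \<bullet> cls (q e) = c \<bullet> cls (u e)" if e: "e \<in> Basis" for e
 proof -
  have "c \<bullet> cls (\<lambda>y. tangential y (Dq e y) \<bullet> e) =
   - (tangential_derivative e c \<bullet> cls (q e)) + (?d - 1) * (c \<bullet> mult_coord e (cls (q e)))"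
   using H1_sphere_derivative[OF c e] Cq[of e] unfolding has_tangential_derivative_iff by blast
  moreover have "cls (u e) = (?d - 1) *\<^sub>R mult_coord e (cls (q e)) - cls (\<lambda>y. tangential y (Dq e y) \<bullet> e)"
  proof -
   have sq: "L2_sphere (q e)" "L2_sphere (\<lambda>y. tangential y (Dq e y) \<bullet> e)"
     "L2_sphere (\<lambda>y. q e y * (y \<bullet> e))"
    by (intro square_integrable_sphere_continuous continuous_intros continuous_on_tangential cont)+
   have "cls (u e) = cls (\<lambda>y. (?d - 1) * (q e y * (y \<bullet> e))) - cls (\<lambda>y. tangential y (Dq e y) \<bullet> e)"
    unfolding u_def[abs_def] by (rule abs_l2_sphere_diff[OF square_integrable_scale[OF sq(3)] sq(2)])
   then show ?thesis unfolding abs_l2_sphere_scale[OF sq(3)] mult_coord_abs[OF sq(1)] by (simp add: mult.commute)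
  qed
  ultimately show ?thesis by (simp add: inner_diff_right)
 qed
 have usq: "L2_sphere (u e)" for e by (rule square_integrable_sphere_continuous[OF cu])
 define L where "L y = (real j * (real j + ?d - 2)) * (y \<bullet> a) ^ j - (real j * (real j - 1) * (a \<bullet> a)) * (y \<bullet> a) ^ (j - 2)" for y :: 'a
 have key: "(\<Sum>e\<in>Basis. u e y) = L y" if y: "norm y = 1" for y
 proof -
  define t where "t = y \<bullet> a"
  define m where "m = real j * (real (j - 1) * t ^ (j - 1 - 1))"
  define b where "b = real j * t ^ (j - 1)"
  have yy: "y \<bullet> y = 1" using y by (simp add: norm_eq_1)
  have u: "u e y = ((?d - 1) * b + 2 * m * t + b) * ((a \<bullet> e) * (y \<bullet> e)) - ((?d - 1) * b * t + m * t * t + 2 * b * t) * ((y \<bullet> e) * (y \<bullet> e))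
    - m * ((a \<bullet> e) * (a \<bullet> e)) + b * t" if e: "e \<in> Basis" for e
  proof -
   have ee: "e \<bullet> e = 1" using e by (simp add: inner_same_Basis)
   have D: "Dq e y = b *\<^sub>R (- ((y \<bullet> e) *\<^sub>R a + t *\<^sub>R e)) + (a \<bullet> e - t * (y \<bullet> e)) *\<^sub>R (m *\<^sub>R a)"
    by (simp add: Dq_def m_def b_def t_def)
   have q: "q e y = b * (a \<bullet> e - t * (y \<bullet> e))" by (simp add: q_def b_def t_def)
   have D1: "Dq e y \<bullet> e = - b * ((y \<bullet> e) * (a \<bullet> e) + t) + (a \<bullet> e - t * (y \<bullet> e)) * m * (a \<bullet> e)"
    unfolding D by (simp add: inner_add_left inner_diff_left ee algebra_simps)
   have D2: "Dq e y \<bullet> y = - b * ((y \<bullet> e) * t + t * (y \<bullet> e)) + (a \<bullet> e - t * (y \<bullet> e)) * m * t"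
    unfolding D by (simp add: inner_add_left inner_diff_left t_def inner_commute algebra_simps)
   show ?thesis unfolding u_def tangential_inner D1 D2 q by (simp add: algebra_simps)
  qed
  have s1: "(\<Sum>e\<in>Basis. (a \<bullet> e) * (y \<bullet> e)) = t" by (simp add: t_def euclidean_inner[of y a] mult.commute)
  have s2: "(\<Sum>e\<in>Basis. (y \<bullet> e) * (y \<bullet> e)) = 1" using yy euclidean_inner[of y y] by simp
  have s3: "(\<Sum>e\<in>Basis. (a \<bullet> e) * (a \<bullet> e)) = a \<bullet> a" using euclidean_inner[of a a] by simp
  have "(\<Sum>e\<in>Basis. u e y) = (\<Sum>e\<in>Basis. ((?d - 1) * b + 2 * m * t + b) * ((a \<bullet> e) * (y \<bullet> e)) - ((?d - 1) * b * t + m * t * t + 2 * b * t) * ((y \<bullet> e) * (y \<bullet> e))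
    - m * ((a \<bullet> e) * (a \<bullet> e)) + b * t)"
   by (rule sum.cong[OF refl u])
  also have "\<dots> = ((?d - 1) * b + 2 * m * t + b) * t - ((?d - 1) * b * t + m * t * t + 2 * b * t) * 1 - m * (a \<bullet> a) + ?d * (b * t)"
   unfolding sum.distrib sum_subtractf sum_distrib_left[symmetric] s1 s2 s3 by simp
  also have "\<dots> = (m * t) * t + (?d - 1) * (b * t) - m * (a \<bullet> a)" by (simp add: algebra_simps)
  also have "b * t = real j * t ^ j" by (cases j) (auto simp: b_def)
  also have "m * t * t = real j * (real j - 1) * t ^ j"
  proof (cases "j < 2")
   case True
   then show ?thesis by (auto simp: m_def less_2_cases_iff)
  next
   case False
   then obtain i where "j = Suc (Suc i)" by (metis Suc_pred add_2_eq_Suc le_add_diff_inverse not_less)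
   then show ?thesis by (simp add: m_def)
  qed
  also have "m = real j * (real j - 1) * t ^ (j - 2)"
   by (cases j) (auto simp: m_def numeral_2_eq_2)
  finally show ?thesis unfolding L_def t_def[symmetric] by (simp add: algebra_simps)
 qed
 have csq: "continuous_on UNIV L" unfolding L_def[abs_def] by (intro continuous_intros)
 have pw: "L2_sphere (\<lambda>y. (y \<bullet> a) ^ i)" for i
  by (rule square_integrable_sphere_continuous[OF continuous_plane_wave])
 have "(\<Sum>e\<in>Basis. tangential_derivative e c \<bullet> tangential_derivative e (plane_wave a j)) = (\<Sum>e\<in>Basis. c \<bullet> cls (u e))"
  unfolding td by (rule sum.cong[OF refl one])
 also have "\<dots> = (\<Sum>e\<in>Basis. \<integral>y. rep c y * u e y \<partial>sphere_measure)"
  by (simp add: inner_l2_sphere_abs[OF usq])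
 also have "\<dots> = (\<oint>y. (\<Sum>e\<in>Basis. rep c y * u e y))"
  by (rule Bochner_Integration.integral_sum[symmetric])
   (intro square_integrable_mult_integrable rep_l2_sphere_square_integrable usq)
 also have "\<dots> = (\<oint>y. rep c y * L y)"
 proof (rule integral_cong_AE)
  have [measurable]: "u e \<in> borel_measurable borel" "L \<in> borel_measurable borel" for e
   using cu csq by (auto intro: borel_measurable_continuous_onI)
  show "(\<lambda>y. \<Sum>e\<in>Basis. rep c y * u e y) \<in> borel_measurable sphere_measure" by measurable
  show "(\<lambda>y. rep c y * L y) \<in> borel_measurable sphere_measure" by measurable
  show "AE y in sphere_measure. (\<Sum>e\<in>Basis. rep c y * u e y) = rep c y * L y"
   using AE_sphere_measure_norm by eventually_elim (simp add: sum_distrib_left[symmetric] key)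
 qed
 also have "\<dots> = c \<bullet> cls L"
  by (rule inner_l2_sphere_abs[symmetric, OF square_integrable_sphere_continuous[OF csq]])
 also have "cls L = wave_laplacian a j"
  unfolding L_def[abs_def] wave_laplacian_def plane_wave_def
  unfolding abs_l2_sphere_diff[OF square_integrable_scale[OF pw] square_integrable_scale[OF pw]] abs_l2_sphere_scale[OF pw] ..
 finally show ?thesis .
qed

text \<open>The Laplacian lowers the power and keeps the direction, so adding all lower powers of
  the finitely many linear forms involved gives a finite dimensional invariant space.\<close>

lemma plane_wave_subspace:
 fixes t :: "'a::euclidean_space l2_sphere set"
 assumes "finite t" "t \<subseteq> plane_waves"
 obtains S where "finite S" "t \<subseteq> S" "S \<subseteq> plane_waves"
  "\<And>p. p \<in> span S \<Longrightarrow> \<exists>q\<in>span S. \<forall>c\<in>H1_sphere.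
    (\<Sum>e\<in>Basis. tangential_derivative e c \<bullet> tangential_derivative e p) = c \<bullet> q"
proof -
 have "\<forall>x\<in>t. \<exists>a j. a \<in> integral_lattice \<and> x = plane_wave a j" using assms(2) unfolding plane_waves_def by blast
 then obtain a j where aj: "\<And>x. x \<in> t \<Longrightarrow> a x \<in> integral_lattice \<and> x = plane_wave (a x) (j x)"
  by metis
 define S where "S = (\<Union>x\<in>t. plane_wave (a x) ` {..j x})"
 have fin: "finite S" using assms(1) by (simp add: S_def)
 have tS: "t \<subseteq> S"
 proof
  fix x assume "x \<in> t"
  then show "x \<in> S" using aj[of x] unfolding S_def by (intro UN_I[of x]) auto
 qed
 have Spw: "S \<subseteq> plane_waves" using aj by (auto simp: S_def plane_waves_def)
 have SH: "span S \<subseteq> H1_sphere" using span_mono[OF Spw] plane_waves_H1(2) by blast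
 have "p \<in> H1_sphere \<and> (\<exists>q\<in>span S. \<forall>c\<in>H1_sphere.
    (\<Sum>e\<in>Basis. tangential_derivative e c \<bullet> tangential_derivative e p) = c \<bullet> q)" if "p \<in> span S" for p
  using that
 proof (induction rule: span_induct_alt)
  case base
  show ?case using subspace_0[OF subspace_H1_sphere]
   by (intro conjI bexI[of _ 0]) (auto simp: tangential_derivative_zero span_zero)
 next
  case (step r x y)
  obtain z i where z: "z \<in> t" "i \<le> j z" "x = plane_wave (a z) i" using step(1) by (auto simp: S_def)
  have xH: "x \<in> H1_sphere" using z(3) by (simp add: plane_waves_H1)
  have L: "wave_laplacian (a z) i \<in> span S"
  proof -
   have "plane_wave (a z) l \<in> S" if "l \<le> j z" for l
    unfolding S_def using z(1) that by (intro UN_I[of z] imageI) auto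
   then show ?thesis
    unfolding wave_laplacian_def using z(2) by (intro span_diff span_scale span_base) auto
  qed
  obtain q where q: "q \<in> span S" "\<forall>c\<in>H1_sphere. (\<Sum>e\<in>Basis. tangential_derivative e c \<bullet> tangential_derivative e y) = c \<bullet> q"
   and yH: "y \<in> H1_sphere" using step(2) by blast
  show ?case
  proof (intro conjI bexI[of _ "r *\<^sub>R wave_laplacian (a z) i + q"] ballI)
   show "r *\<^sub>R x + y \<in> H1_sphere" using xH yH by (intro subspace_add subspace_scale subspace_H1_sphere)
   show "r *\<^sub>R wave_laplacian (a z) i + q \<in> span S" using L q(1) by (intro span_add span_scale)
   fix c :: "'a l2_sphere" assume c: "c \<in> H1_sphere"
   have "(\<Sum>e\<in>Basis. tangential_derivative e c \<bullet> tangential_derivative e (r *\<^sub>R x + y))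
    = (\<Sum>e\<in>Basis. r * (tangential_derivative e c \<bullet> tangential_derivative e x) + tangential_derivative e c \<bullet> tangential_derivative e y)"
    using xH yH subspace_scale[OF subspace_H1_sphere xH, of r]
    by (intro sum.cong) (simp_all add: tangential_derivative_add tangential_derivative_scale inner_add_right)
   also have "\<dots> = r * (c \<bullet> wave_laplacian (a z) i) + c \<bullet> q"
    using plane_wave_laplacian[OF c, of "a z" i] q(2) c by (simp add: sum.distrib sum_distrib_left[symmetric] z(3))
   finally show "(\<Sum>e\<in>Basis. tangential_derivative e c \<bullet> tangential_derivative e (r *\<^sub>R x + y)) = c \<bullet> (r *\<^sub>R wave_laplacian (a z) i + q)"
    by (simp add: inner_add_right)
  qed
 qed
 then show ?thesis using that[OF fin tS Spw] by blast
qed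

text \<open>A Galerkin argument. For the L^2 projection \<open>p\<close> of \<open>c\<close> onto a
  Laplacian invariant space, with \<open>q\<close> minus the Laplacian of \<open>p\<close>, the
  Dirichlet energy of \<open>p\<close> is p.q = c.q, which is the Dirichlet product of
  \<open>c\<close> and \<open>p\<close>; hence it is at most the energy of \<open>c\<close>. The
  space is chosen to contain a good L^2 approximation \<open>p0\<close>, and the projection is at
  least as close to \<open>c\<close>.\<close>

lemma H1_approximation:
 fixes c :: "'a::euclidean_space l2_sphere"
 assumes c: "c \<in> H1_sphere" and d: "0 < d"
 obtains p where "p \<in> span plane_waves" "norm (c - p) < d"
  "(\<Sum>e\<in>Basis. (norm (tangential_derivative e p))\<^sup>2) \<le> (\<Sum>e\<in>Basis. (norm (tangential_derivative e c))\<^sup>2)"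
proof -
 have "c \<in> closure (span plane_waves)" by (simp add: plane_waves_dense)
 then obtain p0 where p0: "p0 \<in> span plane_waves" "dist p0 c < d" unfolding closure_approachable using d by blast
 obtain t where t: "finite t" "t \<subseteq> plane_waves" "p0 \<in> span t"
  using p0(1) unfolding span_explicit by (blast intro: span_sum span_scale span_base)
 obtain S where S: "finite S" "t \<subseteq> S" "S \<subseteq> plane_waves"
  and cl: "\<And>p. p \<in> span S \<Longrightarrow> \<exists>q\<in>span S. \<forall>c\<in>H1_sphere.
    (\<Sum>e\<in>Basis. tangential_derivative e c \<bullet> tangential_derivative e p) = c \<bullet> q"
  using plane_wave_subspace[OF t(1,2)] by blast
 obtain p where p: "p \<in> span S" and orth: "\<forall>q\<in>span S. (c - p) \<bullet> q = 0"
  using finite_span_projection[OF S(1)] by blast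
 have ppw: "p \<in> span plane_waves" using span_mono[OF S(3)] p by blast
 then have pH: "p \<in> H1_sphere" using plane_waves_H1(2) by blast
 have "p - p0 \<in> span S" using p t(3) span_mono[OF S(2)] by (intro span_diff) auto
 then have "(c - p) \<bullet> (p - p0) = 0" using orth by blast
 then have "(norm (c - p0))\<^sup>2 = (norm (c - p))\<^sup>2 + (norm (p - p0))\<^sup>2"
  using norm_add_Pythagorean[of "c - p" "p - p0"] by (simp add: orthogonal_def)
 then have "(norm (c - p))\<^sup>2 \<le> (norm (c - p0))\<^sup>2" by simp
 then have "norm (c - p) \<le> norm (c - p0)" by (rule power2_le_imp_le) simp
 then have near: "norm (c - p) < d" using p0(2) by (simp add: dist_norm norm_minus_commute)
 obtain q where q: "q \<in> span S" "\<forall>c\<in>H1_sphere. (\<Sum>e\<in>Basis. tangential_derivative e c \<bullet> tangential_derivative e p) = c \<bullet> q"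
  using cl[OF p] by blast
 define X where "X = (\<Sum>e\<in>Basis. (norm (tangential_derivative e p))\<^sup>2)"
 define Y where "Y = (\<Sum>e\<in>Basis. (norm (tangential_derivative e c))\<^sup>2)"
 have "X = p \<bullet> q" using q(2) pH by (auto simp: X_def power2_norm_eq_inner)
 also have "\<dots> = c \<bullet> q" using orth q(1) by (simp add: inner_diff_left)
 also have "\<dots> = (\<Sum>e\<in>Basis. tangential_derivative e c \<bullet> tangential_derivative e p)" using q(2) c by simp
 also have "\<dots> \<le> (\<Sum>e\<in>Basis. ((norm (tangential_derivative e c))\<^sup>2 + (norm (tangential_derivative e p))\<^sup>2) / 2)"
 proof (rule sum_mono)
  fix e :: 'a
  have "0 \<le> (norm (tangential_derivative e c - tangential_derivative e p))\<^sup>2" by simp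
  then show "tangential_derivative e c \<bullet> tangential_derivative e p \<le> ((norm (tangential_derivative e c))\<^sup>2 + (norm (tangential_derivative e p))\<^sup>2) / 2"
   by (simp add: power2_norm_eq_inner inner_diff_left inner_diff_right inner_commute)
 qed
 also have "\<dots> = (Y + X) / 2" by (simp add: X_def Y_def sum.distrib sum_divide_distrib[symmetric])
 finally have "X \<le> Y" by simp
 then show ?thesis using that[OF ppw near] by (simp add: X_def Y_def)
qed

text \<open>The defect \<open>B\<close> is symmetric and vanishes when one argument lies in H^1 and
  the other is a combination of plane waves, so \<open>c\<close> may be replaced by c - p. The
  gradients of the approximations \<open>p\<close> are known to be bounded, not to converge;
  therefore \<open>f\<close> is split as g + (f - g), the derivative being moved onto
  \<open>g\<close> while f - g is small in L^2.\<close>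

theorem H1_integration_by_parts:
 fixes c f :: "'a::euclidean_space l2_sphere"
 assumes c: "c \<in> H1_sphere" and f: "f \<in> H1_sphere" and e: "e \<in> Basis"
 shows "c \<bullet> tangential_derivative e f = - (tangential_derivative e c \<bullet> f) + (real DIM('a) - 1) * (c \<bullet> mult_coord e f)"
proof -
 let ?d = "real DIM('a)"
 let ?T = "tangential_derivative e"
 define B where "B x y = x \<bullet> ?T y + ?T x \<bullet> y - (?d - 1) * (x \<bullet> mult_coord e y)" for x y
 have ne: "norm e = 1" using e by simp
 have d1: "1 \<le> ?d" using DIM_positive[where 'a='a] by linarith
 define M where "M = sqrt (\<Sum>e\<in>Basis. (norm (tangential_derivative e c))\<^sup>2)"
 have Bp: "B x p = 0" if "x \<in> H1_sphere" "p \<in> span plane_waves" for x p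
  using plane_waves_by_parts[OF H1_sphere_derivative[OF that(1) e] e that(2)] by (simp add: B_def)
 have Bsym: "B x y = B y x" for x y
  using mult_coord_symmetric[of e x y] by (simp add: B_def inner_commute)
 have Tle: "norm (?T p) \<le> M" if "(\<Sum>e\<in>Basis. (norm (tangential_derivative e p))\<^sup>2) \<le> (\<Sum>e\<in>Basis. (norm (tangential_derivative e c))\<^sup>2)" for p
 proof -
  have "(norm (?T p))\<^sup>2 \<le> (\<Sum>e\<in>Basis. (norm (tangential_derivative e p))\<^sup>2)"
   using e by (intro member_le_sum) auto
  then show ?thesis using that unfolding M_def by (simp add: real_le_rsqrt)
 qed
 have small: "\<bar>B c f\<bar> \<le> a" if a: "0 < a" for a
 proof -
  have M: "0 \<le> M" unfolding M_def by (intro real_sqrt_ge_zero sum_nonneg) auto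
  \<comment> \<open>Order of choice: first \<open>g\<close>, with a tolerance making 2 M q \<le>
    a/2; then \<open>p\<close>, whose tolerance \<open>D\<close> depends on the derivative of
    \<open>g\<close> and makes D C \<le> a/2.\<close>
  define q where "q = a / (4 * M + 1)"
  have q: "0 < q" using a M by (simp add: q_def)
  have "f \<in> closure (span plane_waves)" by (simp add: plane_waves_dense)
  then obtain g where g: "g \<in> span plane_waves" "dist g f < q" unfolding closure_approachable using q by blast
  have ng: "norm (f - g) \<le> q" using g(2) by (simp add: dist_norm norm_minus_commute)
  have gH: "g \<in> H1_sphere" using g(1) plane_waves_H1(2) by blast
  define C where "C = norm (?T f) + (?d - 1) * norm f + norm (?T g) + (?d - 1) * norm g"
  have C: "0 \<le> C" using d1 by (auto simp: C_def)
  define D where "D = a / (2 * C + 2)"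
  have D: "0 < D" using a C by (simp add: D_def)
  obtain p where p: "p \<in> span plane_waves" "norm (c - p) < D" "norm (?T p) \<le> M"
   using H1_approximation[OF c D] Tle by metis
  have pH: "p \<in> H1_sphere" using p(1) plane_waves_H1(2) by blast
  have cp: "c - p \<in> H1_sphere" using c pH by (intro subspace_diff subspace_H1_sphere)
  have Tcp: "?T (c - p) = ?T c - ?T p" using c pH e by (rule tangential_derivative_diff)
  have "B c f = B (c - p) f + B p f"
   unfolding B_def Tcp by (simp add: inner_diff_left algebra_simps)
  also have "B p f = 0" using Bp[OF f p(1)] Bsym by simp
  also have "B (c - p) f + 0 = (c - p) \<bullet> ?T f - (?d - 1) * ((c - p) \<bullet> mult_coord e f) + ?T (c - p) \<bullet> (f - g) + ?T (c - p) \<bullet> g"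
   by (simp add: B_def inner_diff_right)
  also have "?T (c - p) \<bullet> g = - ((c - p) \<bullet> ?T g) + (?d - 1) * ((c - p) \<bullet> mult_coord e g)"
   using Bp[OF cp g(1)] by (simp add: B_def)
  finally have eq: "B c f = (c - p) \<bullet> ?T f - (?d - 1) * ((c - p) \<bullet> mult_coord e f) + ?T (c - p) \<bullet> (f - g)
   + (- ((c - p) \<bullet> ?T g) + (?d - 1) * ((c - p) \<bullet> mult_coord e g))" .
  have b: "\<bar>(c - p) \<bullet> x\<bar> \<le> D * norm x" for x
   using Cauchy_Schwarz_ineq2[of "c - p" x] mult_right_mono[of "norm (c - p)" D "norm x"] p(2) by simp
  have b': "\<bar>(?d - 1) * ((c - p) \<bullet> mult_coord e x)\<bar> \<le> (?d - 1) * (D * norm x)" for x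
  proof -
   have "\<bar>(c - p) \<bullet> mult_coord e x\<bar> \<le> D * norm x"
    using b[of "mult_coord e x"] norm_mult_coord[OF ne, of x] D mult_left_mono[of "norm (mult_coord e x)" "norm x" D] by linarith
   then show ?thesis using d1 by (simp add: abs_mult mult_left_mono)
  qed
  have b2: "\<bar>?T (c - p) \<bullet> (f - g)\<bar> \<le> 2 * M * q"
  proof -
   have "norm (?T (c - p)) \<le> 2 * M"
    unfolding Tcp using norm_triangle_ineq4[of "?T c" "?T p"] Tle[of c] p(3) by simp
   then show ?thesis
    using Cauchy_Schwarz_ineq2[of "?T (c - p)" "f - g"] mult_mono[of "norm (?T (c - p))" "2 * M" "norm (f - g)" q] ng M by simp
  qed
  have "\<bar>B c f\<bar> \<le> D * norm (?T f) + (?d - 1) * (D * norm f) + 2 * M * q + (D * norm (?T g) + (?d - 1) * (D * norm g))"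
   unfolding eq using b[of "?T f"] b'[of f] b2 b[of "?T g"] b'[of g] by linarith
  also have "\<dots> = D * C + 2 * M * q" by (simp add: C_def algebra_simps)
  also have "D * C \<le> a / 2" using C a by (simp add: D_def divide_simps)
  also have "2 * M * q \<le> a / 2" using M a by (simp add: q_def divide_simps)
  finally show ?thesis by simp
 qed
 have "B c f = 0"
 proof (rule ccontr)
  assume "B c f \<noteq> 0"
  then show False using small[of "\<bar>B c f\<bar> / 2"] by simp
 qed
 then show ?thesis by (simp add: B_def)
qed

section \<open>The norms of \<open>H\<^sup>1\<close> and \<open>H\<^sup>2\<close>\<close>

lemma H2_sphere_H1: "c \<in> H2_sphere \<Longrightarrow> c \<in> H1_sphere"
 by (simp add: H2_sphere_def)

lemma H2_sphere_derivative: "c \<in> H2_sphere \<Longrightarrow> e \<in> Basis \<Longrightarrow> tangential_derivative e c \<in> H1_sphere"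
 by (simp add: H2_sphere_def)

lemma subspace_H2_sphere: "subspace H2_sphere"
 unfolding subspace_def H2_sphere_def
 using subspace_0[OF subspace_H1_sphere] subspace_add[OF subspace_H1_sphere] subspace_scale[OF subspace_H1_sphere]
 by (auto simp: tangential_derivative_zero tangential_derivative_add tangential_derivative_scale)

lemma norm_H1_eq: "norm_H1 c = sqrt ((norm c)\<^sup>2 + (L2_set (\<lambda>e. norm (tangential_derivative e c)) Basis)\<^sup>2)"
 by (simp add: norm_H1_def L2_set_def sum_nonneg)

lemma norm_H2_eq: "norm_H2 c = sqrt ((norm c)\<^sup>2 + (L2_set (\<lambda>e. norm_H1 (tangential_derivative e c)) Basis)\<^sup>2)"
 by (simp add: norm_H2_def L2_set_def sum_nonneg)

lemma norm_H1_nonneg: "0 \<le> norm_H1 c"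
 by (simp add: norm_H1_eq)

lemma norm_H2_nonneg: "0 \<le> norm_H2 c"
 by (simp add: norm_H2_eq)

lemma norm_H1_zero: "norm_H1 0 = 0"
 by (simp add: norm_H1_eq tangential_derivative_zero L2_set_def)

lemma norm_H2_zero: "norm_H2 0 = 0"
 by (simp add: norm_H2_eq tangential_derivative_zero norm_H1_zero L2_set_def)

lemma sqrt_sum_squares_mono:
 assumes "0 \<le> a" "a \<le> a'" "0 \<le> b" "b \<le> b'"
 shows "sqrt (a\<^sup>2 + b\<^sup>2) \<le> sqrt (a'\<^sup>2 + b'\<^sup>2)"
 using assms by (intro real_sqrt_le_mono add_mono power_mono) auto

lemma norm_H1_triangle:
 assumes "c \<in> H1_sphere" "d \<in> H1_sphere"
 shows "norm_H1 (c + d) \<le> norm_H1 c + norm_H1 d"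
proof -
 let ?L = "\<lambda>c. L2_set (\<lambda>e. norm (tangential_derivative e c)) Basis"
 have "?L (c + d) \<le> L2_set (\<lambda>e. norm (tangential_derivative e c) + norm (tangential_derivative e d)) Basis"
  by (rule L2_set_mono) (simp_all add: tangential_derivative_add assms norm_triangle_ineq)
 also have "\<dots> \<le> ?L c + ?L d" by (rule L2_set_triangle_ineq)
 finally have L: "?L (c + d) \<le> ?L c + ?L d" .
 have "norm_H1 (c + d) \<le> sqrt ((norm c + norm d)\<^sup>2 + (?L c + ?L d)\<^sup>2)"
  unfolding norm_H1_eq by (rule sqrt_sum_squares_mono) (simp_all add: norm_triangle_ineq L)
 also have "\<dots> \<le> norm_H1 c + norm_H1 d"
  unfolding norm_H1_eq by (rule real_sqrt_sum_squares_triangle_ineq)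
 finally show ?thesis .
qed

lemma norm_H2_triangle:
 assumes "c \<in> H2_sphere" "d \<in> H2_sphere"
 shows "norm_H2 (c + d) \<le> norm_H2 c + norm_H2 d"
proof -
 let ?L = "\<lambda>c. L2_set (\<lambda>e. norm_H1 (tangential_derivative e c)) Basis"
 have "?L (c + d) \<le> L2_set (\<lambda>e. norm_H1 (tangential_derivative e c) + norm_H1 (tangential_derivative e d)) Basis"
  by (rule L2_set_mono)
   (simp_all add: tangential_derivative_add assms H2_sphere_H1 norm_H1_triangle H2_sphere_derivative norm_H1_nonneg)
 also have "\<dots> \<le> ?L c + ?L d" by (rule L2_set_triangle_ineq)
 finally have L: "?L (c + d) \<le> ?L c + ?L d" .
 have "norm_H2 (c + d) \<le> sqrt ((norm c + norm d)\<^sup>2 + (?L c + ?L d)\<^sup>2)"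
  unfolding norm_H2_eq by (rule sqrt_sum_squares_mono) (simp_all add: norm_triangle_ineq L)
 also have "\<dots> \<le> norm_H2 c + norm_H2 d"
  unfolding norm_H2_eq by (rule real_sqrt_sum_squares_triangle_ineq)
 finally show ?thesis .
qed

lemma norm_H1_scale:
 assumes "c \<in> H1_sphere" shows "norm_H1 (r *\<^sub>R c) = \<bar>r\<bar> * norm_H1 c"
proof -
 have "L2_set (\<lambda>e. norm (tangential_derivative e (r *\<^sub>R c))) Basis = L2_set (\<lambda>e. \<bar>r\<bar> * norm (tangential_derivative e c)) Basis"
  by (rule L2_set_cong) (simp_all add: tangential_derivative_scale assms)
 also have "\<dots> = \<bar>r\<bar> * L2_set (\<lambda>e. norm (tangential_derivative e c)) Basis"
  by (rule L2_set_right_distrib[symmetric]) simp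
 finally show ?thesis
  by (simp add: norm_H1_eq power_mult_distrib distrib_left[symmetric] real_sqrt_mult)
qed

lemma norm_H2_scale:
 assumes "c \<in> H2_sphere" shows "norm_H2 (r *\<^sub>R c) = \<bar>r\<bar> * norm_H2 c"
proof -
 have "L2_set (\<lambda>e. norm_H1 (tangential_derivative e (r *\<^sub>R c))) Basis = L2_set (\<lambda>e. \<bar>r\<bar> * norm_H1 (tangential_derivative e c)) Basis"
  by (rule L2_set_cong) (simp_all add: tangential_derivative_scale norm_H1_scale H2_sphere_derivative H2_sphere_H1 assms)
 also have "\<dots> = \<bar>r\<bar> * L2_set (\<lambda>e. norm_H1 (tangential_derivative e c)) Basis"
  by (rule L2_set_right_distrib[symmetric]) simp
 finally show ?thesis
  by (simp add: norm_H2_eq power_mult_distrib distrib_left[symmetric] real_sqrt_mult)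
qed

lemma norm_le_norm_H1: "norm c \<le> norm_H1 c"
 unfolding norm_H1_eq by (rule real_le_rsqrt) simp

lemma norm_tangential_derivative_le_H1:
 assumes "e \<in> Basis" shows "norm (tangential_derivative e c) \<le> norm_H1 c"
proof -
 have "norm (tangential_derivative e c) \<le> L2_set (\<lambda>e. norm (tangential_derivative e c)) Basis"
  using assms by (intro member_le_L2_set) auto
 also have "\<dots> \<le> norm_H1 c" unfolding norm_H1_eq by (rule real_le_rsqrt) simp
 finally show ?thesis .
qed

lemma norm_H1_tangential_derivative_le_H2:
 assumes "e \<in> Basis" shows "norm_H1 (tangential_derivative e c) \<le> norm_H2 c"
proof -
 have "norm_H1 (tangential_derivative e c) \<le> L2_set (\<lambda>e. norm_H1 (tangential_derivative e c)) Basis"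
  using assms by (intro member_le_L2_set) auto
 also have "\<dots> \<le> norm_H2 c" unfolding norm_H2_eq by (rule real_le_rsqrt) simp
 finally show ?thesis .
qed

lemma norm_tangential_derivative_le_H2:
 assumes "e \<in> Basis" shows "norm (tangential_derivative e c) \<le> norm_H2 c"
 using norm_H1_tangential_derivative_le_H2[OF assms, of c] norm_le_norm_H1[of "tangential_derivative e c"] by linarith

text \<open>
 The interpolation behind this criterion: \<open>\<parallel>\<nabla>(v - c)\<parallel>\<^sup>2 = - \<langle>\<Delta>v, v - c\<rangle> - \<langle>\<nabla>c, \<nabla>(v - c)\<rangle>\<close>, where the
 first term is controlled by \<open>\<parallel>v - c\<parallel> \<parallel>v\<parallel>\<^bsub>H\<^sup>2\<^esub>\<close> and the second one by weak convergence.
\<close>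

theorem H1_convergence:
 fixes v :: "nat \<Rightarrow> 'a::euclidean_space l2_sphere"
 assumes v: "\<And>n. v n \<in> H2_sphere" and c: "c \<in> H1_sphere"
  and lim: "(\<lambda>n. norm (v n - c)) \<longlonglongrightarrow> 0" and prod: "(\<lambda>n. norm (v n - c) * norm_H2 (v n)) \<longlonglongrightarrow> 0"
 shows "(\<lambda>n. norm_H1 (v n - c)) \<longlonglongrightarrow> 0"
proof -
 let ?d = "real DIM('a)"
 let ?T = "tangential_derivative"
 have d1: "1 \<le> ?d" using DIM_positive[where 'a='a] by linarith
 define w where "w n = v n - c" for n
 have w: "w n \<in> H1_sphere" for n
  unfolding w_def by (intro subspace_diff subspace_H1_sphere c H2_sphere_H1[OF v])
 have Tw: "?T e (w n) = ?T e (v n) - ?T e c" if "e \<in> Basis" for e n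
  unfolding w_def using that by (intro tangential_derivative_diff c H2_sphere_H1[OF v])
 define X where "X n = (\<Sum>e\<in>Basis. (norm (?T e (w n)))\<^sup>2)" for n
 define a where "a n = ?d * ?d * (norm (w n) * norm_H2 (v n))" for n
 have a0: "a \<longlonglongrightarrow> 0"
  unfolding a_def w_def using tendsto_mult[OF tendsto_const prod, of "?d * ?d"] by simp
 have one: "\<bar>?T e (v n) \<bullet> ?T e (w n)\<bar> \<le> ?d * (norm (w n) * norm_H2 (v n))" if e: "e \<in> Basis" for e n
 proof -
  have TvH: "?T e (v n) \<in> H1_sphere" using v e by (rule H2_sphere_derivative)
  have "?T e (v n) \<bullet> ?T e (w n) = - (?T e (?T e (v n)) \<bullet> w n) + (?d - 1) * (?T e (v n) \<bullet> mult_coord e (w n))"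
   by (rule H1_integration_by_parts[OF TvH w e])
  moreover have "\<bar>?T e (?T e (v n)) \<bullet> w n\<bar> \<le> norm_H2 (v n) * norm (w n)"
  proof -
   have "norm (?T e (?T e (v n))) \<le> norm_H2 (v n)"
    using norm_tangential_derivative_le_H1[OF e, of "?T e (v n)"] norm_H1_tangential_derivative_le_H2[OF e, of "v n"] by linarith
   then show ?thesis
    using Cauchy_Schwarz_ineq2[of "?T e (?T e (v n))" "w n"] by (meson mult_right_mono norm_ge_zero order_trans)
  qed
  moreover have "\<bar>?T e (v n) \<bullet> mult_coord e (w n)\<bar> \<le> norm_H2 (v n) * norm (w n)"
  proof -
   have "norm e = 1" using e by simp
   then have "norm (?T e (v n)) * norm (mult_coord e (w n)) \<le> norm_H2 (v n) * norm (w n)"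
    by (intro mult_mono norm_tangential_derivative_le_H2 norm_mult_coord e norm_H2_nonneg) auto
   then show ?thesis using Cauchy_Schwarz_ineq2[of "?T e (v n)" "mult_coord e (w n)"] by linarith
  qed
  moreover have "\<bar>(?d - 1) * (?T e (v n) \<bullet> mult_coord e (w n))\<bar> = (?d - 1) * \<bar>?T e (v n) \<bullet> mult_coord e (w n)\<bar>"
   using d1 by (simp add: abs_mult)
  ultimately have "\<bar>?T e (v n) \<bullet> ?T e (w n)\<bar> \<le> norm_H2 (v n) * norm (w n) + (?d - 1) * (norm_H2 (v n) * norm (w n))"
   using mult_left_mono[of "\<bar>?T e (v n) \<bullet> mult_coord e (w n)\<bar>" "norm_H2 (v n) * norm (w n)" "?d - 1"] d1 by linarith
  then show ?thesis by (simp add: algebra_simps)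
 qed
 define Y where "Y n = (\<Sum>e\<in>Basis. ?T e c \<bullet> ?T e (w n))" for n
 have XY: "X n \<le> a n - Y n" for n
 proof -
  have "X n = (\<Sum>e\<in>Basis. ?T e (v n) \<bullet> ?T e (w n)) - Y n"
   unfolding X_def Y_def sum_subtractf[symmetric]
   by (rule sum.cong) (simp_all add: Tw power2_norm_eq_inner inner_diff_left)
  moreover have "(\<Sum>e\<in>Basis. ?T e (v n) \<bullet> ?T e (w n)) \<le> (\<Sum>e\<in>(Basis::'a set). ?d * (norm (w n) * norm_H2 (v n)))"
   by (rule sum_mono) (use one in \<open>force dest: abs_le_D1\<close>)
  ultimately show ?thesis by (simp add: a_def mult.assoc)
 qed
 define Z where "Z = (\<Sum>e\<in>Basis. (norm (?T e c))\<^sup>2)"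
 have "Bseq a" using a0 by (intro convergent_imp_Bseq convergentI)
 then obtain A where A: "\<And>n. \<bar>a n\<bar> \<le> A" by (auto simp: Bseq_def)
 \<comment> \<open>The product in -Y is at most (Z + X)/2, and the part X/2 is absorbed on the left.
   This bound on the gradients has to precede the weak convergence, which rests on it.\<close>
 have Xb: "X n \<le> 2 * A + Z" for n
 proof -
  have "- Y n \<le> (\<Sum>e\<in>Basis. ((norm (?T e c))\<^sup>2 + (norm (?T e (w n)))\<^sup>2) / 2)"
   unfolding Y_def sum_negf[symmetric]
  proof (rule sum_mono)
   fix e
   have "0 \<le> (norm (?T e c + ?T e (w n)))\<^sup>2" by simp
   then show "- (?T e c \<bullet> ?T e (w n)) \<le> ((norm (?T e c))\<^sup>2 + (norm (?T e (w n)))\<^sup>2) / 2"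
    by (simp add: power2_norm_eq_inner inner_add_left inner_add_right inner_commute)
  qed
  also have "\<dots> = (Z + X n) / 2" by (simp add: X_def Z_def sum.distrib sum_divide_distrib[symmetric])
  finally have "- Y n \<le> (Z + X n) / 2" .
  then show ?thesis using XY[of n] A[of n] by (simp add: field_simps) 
 qed
 define M where "M = sqrt (2 * A + Z) + 1"
 have "0 \<le> X 0" unfolding X_def by (intro sum_nonneg) simp
 then have "0 \<le> 2 * A + Z" using Xb[of 0] by linarith
 then have M: "0 < M" unfolding M_def using real_sqrt_ge_zero[of "2 * A + Z"] by linarith
 have TM: "norm (?T e (w n)) \<le> M" if "e \<in> Basis" for e n
 proof -
  have "(norm (?T e (w n)))\<^sup>2 \<le> X n" unfolding X_def using that by (intro member_le_sum) auto
  then have "norm (?T e (w n)) \<le> sqrt (2 * A + Z)" using Xb[of n] by (intro real_le_rsqrt) linarith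
  then show ?thesis by (simp add: M_def)
 qed
 \<comment> \<open>As the gradients are bounded, it suffices to test with combinations
   \<open>f\<close> of plane waves; the derivative is then moved onto \<open>f\<close>, and
   \<open>w n\<close> tends to 0 in L^2.\<close>
 have weak: "(\<lambda>n. ?T e c \<bullet> ?T e (w n)) \<longlonglongrightarrow> 0" if e: "e \<in> Basis" for e
 proof (rule LIMSEQ_I)
  fix q :: real assume q: "0 < q"
  have "?T e c \<in> closure (span plane_waves)" by (simp add: plane_waves_dense)
  moreover have "0 < q / (2 * M)" using q M by simp
  ultimately obtain f where f: "f \<in> span plane_waves" "dist f (?T e c) < q / (2 * M)"
   unfolding closure_approachable by blast
  define C where "C = norm (?T e f) + (?d - 1) * norm (mult_coord e f) + 1"
  have C: "0 < C" unfolding C_def using d1 by (intro add_nonneg_pos) auto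
  have "0 < q / (2 * C)" using q C by simp
  then obtain N where N: "\<And>n. N \<le> n \<Longrightarrow> norm (w n) < q / (2 * C)"
   using LIMSEQ_D[OF lim] unfolding w_def by fastforce
  show "\<exists>N. \<forall>n\<ge>N. norm (?T e c \<bullet> ?T e (w n) - 0) < q"
  proof (intro exI allI impI)
   fix n assume n: "N \<le> n"
   have "w n \<bullet> ?T e f = - (?T e (w n) \<bullet> f) + (?d - 1) * (w n \<bullet> mult_coord e f)"
    by (rule plane_waves_by_parts[OF H1_sphere_derivative[OF w e] e f(1)])
   then have "?T e c \<bullet> ?T e (w n) = (?T e c - f) \<bullet> ?T e (w n) + (- (w n \<bullet> ?T e f) + (?d - 1) * (w n \<bullet> mult_coord e f))"
    using inner_diff_left[of "?T e c" f "?T e (w n)"] inner_commute[of f "?T e (w n)"] by linarith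
   moreover have "\<bar>(?T e c - f) \<bullet> ?T e (w n)\<bar> \<le> q / (2 * M) * M"
   proof -
    have "norm (?T e c - f) * norm (?T e (w n)) \<le> q / (2 * M) * M"
     using f(2) q M by (intro mult_mono TM e) (auto simp: dist_norm norm_minus_commute)
    then show ?thesis using Cauchy_Schwarz_ineq2[of "?T e c - f" "?T e (w n)"] by linarith
   qed
   moreover have "q / (2 * M) * M = q / 2" using M by simp
   moreover have "\<bar>- (w n \<bullet> ?T e f) + (?d - 1) * (w n \<bullet> mult_coord e f)\<bar> \<le> norm (w n) * C"
   proof -
    have "\<bar>(?d - 1) * (w n \<bullet> mult_coord e f)\<bar> \<le> (?d - 1) * (norm (w n) * norm (mult_coord e f))"
     using d1 Cauchy_Schwarz_ineq2[of "w n" "mult_coord e f"] by (simp add: abs_mult mult_left_mono)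
    moreover have "norm (w n) * C = norm (w n) * norm (?T e f) + (?d - 1) * (norm (w n) * norm (mult_coord e f)) + norm (w n)"
     by (simp add: C_def algebra_simps)
    ultimately show ?thesis using Cauchy_Schwarz_ineq2[of "w n" "?T e f"] norm_ge_zero[of "w n"] by linarith
   qed
   moreover have "norm (w n) * C < q / 2" using N[OF n] C by (simp add: field_simps)
   ultimately show "norm (?T e c \<bullet> ?T e (w n) - 0) < q" by simp
  qed
 qed
 have Y0: "Y \<longlonglongrightarrow> 0" unfolding Y_def by (rule tendsto_null_sum) (rule weak)
 have X0: "X \<longlonglongrightarrow> 0"
 proof (rule tendsto_sandwich)
  show "\<forall>\<^sub>F n in sequentially. 0 \<le> X n" by (simp add: X_def sum_nonneg)
  show "\<forall>\<^sub>F n in sequentially. X n \<le> a n - Y n" by (simp add: XY)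
  show "(\<lambda>n. a n - Y n) \<longlonglongrightarrow> 0" using tendsto_diff[OF a0 Y0] by simp
 qed simp
 have "(\<lambda>n. sqrt ((norm (w n))\<^sup>2 + X n)) \<longlonglongrightarrow> sqrt (0\<^sup>2 + 0)"
  using lim unfolding w_def[symmetric] by (intro tendsto_intros X0)
 then show ?thesis by (simp add: norm_H1_def X_def w_def)
qed

section \<open>Jointly measurable representatives\<close>

lemma integral_abs_le_norm:
 fixes f :: "'a::euclidean_space \<Rightarrow> real"
 assumes f: "L2_sphere f"
 shows "(\<oint>x. \<bar>f x\<bar>) \<le> norm (cls f) * sqrt (measure sphere_measure (UNIV :: 'a set))"
proof -
 have f': "L2_sphere (\<lambda>x. \<bar>f x\<bar>)" using f by (auto simp: square_integrable_def)
 have one: "L2_sphere (\<lambda>x::'a. 1 :: real)"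
  by (rule square_integrable_sphere_continuous) simp
 have "(\<oint>x. \<bar>f x\<bar>) = cls (\<lambda>x. \<bar>f x\<bar>) \<bullet> cls (\<lambda>x. 1)"
  by (simp add: inner_abs_l2_sphere[OF f' one])
 also have "\<dots> \<le> norm (cls (\<lambda>x. \<bar>f x\<bar>)) * norm (cls (\<lambda>x::'a. 1 :: real))"
  by (rule norm_cauchy_schwarz)
 also have "norm (cls (\<lambda>x. \<bar>f x\<bar>)) = norm (cls f)"
  using norm_abs_l2_sphere[OF f] norm_abs_l2_sphere[OF f'] by (metis (mono_tags, lifting) norm_ge_zero power2_abs power2_eq_imp_eq Bochner_Integration.integral_cong)
 also have "norm (cls (\<lambda>x::'a. 1 :: real)) \<le> 1 * sqrt (measure sphere_measure (UNIV :: 'a set))"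
  by (rule norm_abs_l2_sphere_le[OF one]) auto
 finally show ?thesis by (simp add: mult_left_mono)
qed

text \<open>A curve in L^2 gives only a class for each r, and arbitrary choices of representatives
  lose joint measurability. Countably valued approximations with error below 2^-j, taken from a
  dense sequence, are jointly measurable; their errors are summable in L^1, so for each r they
  converge almost everywhere and \<open>lim\<close> is a representative.\<close>

lemma joint_representative:
 fixes w :: "real \<Rightarrow> 'a::euclidean_space l2_sphere"
 assumes [measurable]: "w \<in> borel_measurable borel"
 obtains W where "(\<lambda>(r, z). W r z) \<in> borel_measurable (borel \<Otimes>\<^sub>M borel)"
  "\<And>r. L2_sphere (W r)" "\<And>r. cls (W r) = w r"
proof -
 obtain D :: "'a l2_sphere set" where D: "countable D" "closure D = UNIV" by (rule countable_dense_l2_sphere)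
 then have "D \<noteq> {}" by auto
 define d where "d = from_nat_into D"
 have d: "\<exists>n. dist (d n) x < e" if eps: "0 < e" for x e
 proof -
  have "x \<in> closure D" using D(2) by simp
  then obtain y where "y \<in> D" "dist y x < e" unfolding closure_approachable using eps by blast
  then show ?thesis using from_nat_into_surj[OF D(1)] unfolding d_def by metis
 qed
 \<comment> \<open>Taking the least admissible index makes the choice a Borel function of r.\<close>
 define idx where "idx j r = (LEAST n. dist (d n) (w r) < (1/2) ^ j)" for j r
 have idx: "dist (d (idx j r)) (w r) < (1/2) ^ j" for j r
  unfolding idx_def by (rule LeastI_ex) (rule d, simp)
 have [measurable]: "idx j \<in> borel \<rightarrow>\<^sub>M count_space UNIV" for j
  unfolding idx_def by measurable
 define S where "S j r = rep (d (idx j r))" for j r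
 have mS: "(\<lambda>x. S j (fst x) (snd x)) \<in> borel_measurable (borel \<Otimes>\<^sub>M borel)" for j
  unfolding S_def
 proof (rule measurable_compose_countable[where f="\<lambda>i x. rep (d i) (snd x)" and g="\<lambda>x. idx j (fst x)"])
  show "(\<lambda>x. rep (d i) (snd x)) \<in> borel_measurable (borel \<Otimes>\<^sub>M borel)" for i by measurable
  show "(\<lambda>x. idx j (fst x)) \<in> borel \<Otimes>\<^sub>M borel \<rightarrow>\<^sub>M count_space UNIV" by measurable
 qed
 define W where "W r z = lim (\<lambda>j. S j r z)" for r z
 have mW: "(\<lambda>(r, z). W r z) \<in> borel_measurable (borel \<Otimes>\<^sub>M borel)"
  unfolding W_def case_prod_beta by (rule borel_measurable_lim_metric) (rule mS)
 define m where "m = sqrt (measure sphere_measure (UNIV :: 'a set))"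
 have ae: "AE z in sphere_measure. W r z = rep (w r) z" for r
 proof -
  define g where "g j z = \<bar>S j r z - rep (w r) z\<bar>" for j z
  have sq: "L2_sphere (\<lambda>z. S j r z - rep (w r) z)" for j
   unfolding S_def by (intro square_integrable_diff rep_l2_sphere_square_integrable)
  have mg[measurable]: "g j \<in> borel_measurable sphere_measure" for j
  proof -
   have "(\<lambda>z. S j r z - rep (w r) z) \<in> borel_measurable sphere_measure"
    using sq[of j] unfolding square_integrable_def by blast
   from borel_measurable_abs[OF this] show ?thesis unfolding g_def[abs_def] .
  qed
  have gi: "integrable sphere_measure (g j)" for j
   using square_integrable_integrable_sphere[OF sq[of j]] unfolding g_def by (rule integrable_abs)
  have gle: "(\<oint>z. g j z) \<le> (1/2) ^ j * m" for j
  proof -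
   have "cls (\<lambda>z. S j r z - rep (w r) z) = d (idx j r) - w r"
    unfolding S_def by (subst abs_l2_sphere_diff) simp_all
   then have "(\<oint>z. g j z) \<le> norm (d (idx j r) - w r) * m"
    using integral_abs_le_norm[OF sq[of j]] by (simp add: g_def m_def)
   also have "\<dots> \<le> (1/2) ^ j * m"
    using idx[of j r] by (intro mult_right_mono) (auto simp: dist_norm m_def)
   finally show ?thesis .
  qed
  have sm: "summable (\<lambda>j. (1/2::real) ^ j * m)" by (intro summable_mult2 summable_geometric) simp
  have "(\<integral>\<^sup>+z. (\<Sum>j. ennreal (g j z)) \<partial>sphere_measure) = (\<Sum>j. \<integral>\<^sup>+z. ennreal (g j z) \<partial>sphere_measure)"
   by (rule nn_integral_suminf) measurable
  also have "\<dots> \<le> (\<Sum>j. ennreal ((1/2) ^ j * m))"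
  proof (rule suminf_le)
   show "(\<integral>\<^sup>+z. ennreal (g j z) \<partial>sphere_measure) \<le> ennreal ((1/2) ^ j * m)" for j
   proof -
    have "(\<integral>\<^sup>+z. ennreal (g j z) \<partial>sphere_measure) = ennreal (\<oint>z. g j z)"
     by (rule nn_integral_eq_integral[OF gi[of j]]) (simp add: g_def)
    then show ?thesis using ennreal_leI[OF gle[of j]] by simp
   qed
  qed auto
  also have "\<dots> = ennreal (\<Sum>j. (1/2) ^ j * m)"
   by (rule suminf_ennreal2[OF _ sm]) (simp add: m_def)
  also have "\<dots> < \<infinity>" by simp
  finally have "AE z in sphere_measure. (\<Sum>j. ennreal (g j z)) \<noteq> \<infinity>"
   by (intro nn_integral_PInf_AE) (auto simp: less_top)
  then show ?thesis
  proof eventually_elim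
   case (elim z)
   have "summable (\<lambda>j. g j z)"
    by (rule summable_suminf_not_top) (use elim in \<open>auto simp: g_def\<close>)
   then have "(\<lambda>j. g j z) \<longlonglongrightarrow> 0" by (rule summable_LIMSEQ_zero)
   then have "(\<lambda>j. S j r z - rep (w r) z) \<longlonglongrightarrow> 0"
    unfolding g_def using tendsto_rabs_zero_iff by blast
   then have "(\<lambda>j. S j r z) \<longlonglongrightarrow> rep (w r) z" using Lim_null by blast
   then show ?case unfolding W_def by (rule limI)
  qed
 qed
 have mWr: "W r \<in> borel_measurable sphere_measure" for r
  using measurable_compose[OF measurable_Pair1'[of r borel borel] mW] by simp
 have sqW: "L2_sphere (W r)" for r
 proof -
  have "integrable sphere_measure (\<lambda>z. (norm (rep (w r) z))\<^sup>2)"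
   using rep_l2_sphere_square_integrable[of "w r"] unfolding square_integrable_def by simp
  then have "integrable sphere_measure (\<lambda>z. (norm (W r z))\<^sup>2)"
   by (rule integrable_cong_AE_imp) (use ae[of r] mWr[of r] in \<open>auto elim: eventually_mono\<close>)
  then show ?thesis using mWr by (simp add: square_integrable_def)
 qed
 have "cls (W r) = w r" for r
  using abs_l2_sphere_eq_iff[OF sqW rep_l2_sphere_square_integrable, of r "w r"] ae[of r] by simp
 then show ?thesis using that mW sqW by blast
qed

section \<open>Curves as functions on the cylinder\<close>

interpretation unit_square: pair_sigma_finite "unit_lebesgue" "unit_lebesgue" ..

lemma integral_unit_interval:
 fixes f :: "real \<Rightarrow> 'b::{banach, second_countable_topology}"
 shows "(\<integral>r. f r \<partial>unit_lebesgue) = (LINT r:{0..1}|lborel. f r)"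
 by (subst integral_restrict_space) (auto simp: set_lebesgue_integral_def)

lemma integrable_unit_interval:
 fixes f :: "real \<Rightarrow> 'b::{banach, second_countable_topology}"
 shows "integrable unit_lebesgue f \<longleftrightarrow> set_integrable lborel {0..1} f"
 by (subst integrable_restrict_space) (auto simp: set_integrable_def)

text \<open>Here \<open>u\<close> is only a primitive of an integrable function, normalised at 1;
  Fubini on the triangle r \<le> s replaces the product rule.\<close>

lemma integral_by_parts_primitive:
 fixes g u p p' :: "real \<Rightarrow> real"
 assumes g: "integrable unit_lebesgue g"
  and u: "\<And>r. r \<in> {0..1} \<Longrightarrow> u r = u 1 - (LINT s:{r..1}|lborel. g s)"
  and p: "\<And>r. r \<in> {0..1} \<Longrightarrow> (p has_real_derivative p' r) (at r)" and p': "continuous_on {0..1} p'"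
 shows "integrable unit_lebesgue (\<lambda>r. u r * p' r)"
  and "(\<integral>r. u r * p' r \<partial>unit_lebesgue) =
   u 1 * p 1 - u 0 * p 0 - (\<integral>r. g r * p r \<partial>unit_lebesgue)"
proof -
 let ?I = "unit_lebesgue"
 have pc: "continuous_on {0..1} p"
  using p DERIV_isCont by (intro continuous_at_imp_continuous_on) blast
 note ip' = integrable_unit_interval_continuous[OF p']
 have "bounded (p ` {0..1})" by (intro compact_imp_bounded compact_continuous_image pc compact_Icc)
 then obtain C where C: "\<And>r. r \<in> {0..1} \<Longrightarrow> \<bar>p r\<bar> \<le> C"
  unfolding bounded_iff by (metis imageI real_norm_def)
 have gm: "g \<in> borel_measurable ?I" using g by auto
 have pm: "p \<in> borel_measurable ?I"
  using integrable_unit_interval_continuous[OF pc] by auto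
 have gp: "integrable ?I (\<lambda>r. g r * p r)"
 proof (rule Bochner_Integration.integrable_bound)
  show "integrable ?I (\<lambda>r. C * g r)" using g by simp
  show "AE r in ?I. norm (g r * p r) \<le> norm (C * g r)"
  proof (rule AE_I2)
   fix r assume "r \<in> space ?I"
   then have "\<bar>p r\<bar> \<le> C" using C by (simp add: space_restrict_space)
   then show "norm (g r * p r) \<le> norm (C * g r)"
    using mult_right_mono[of "\<bar>p r\<bar>" "\<bar>C\<bar>" "\<bar>g r\<bar>"] by (simp add: abs_mult mult.commute)
  qed
 qed (use gm pm in auto)
 define f where "f = (\<lambda>(r, s). if r \<le> s then p' r * g s else 0)"
 have [measurable]: "p' \<in> borel_measurable ?I" "g \<in> borel_measurable ?I" using ip' g by auto
 have idm: "(\<lambda>x. x) \<in> ?I \<rightarrow>\<^sub>M borel" by (rule measurable_restrict_space1) simp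
 have le_m: "{x \<in> space (?I \<Otimes>\<^sub>M ?I). fst x \<le> snd x} \<in> sets (?I \<Otimes>\<^sub>M ?I)"
  using borel_measurable_le[OF measurable_compose[OF measurable_fst idm] measurable_compose[OF measurable_snd idm]] .
 have fm: "f \<in> borel_measurable (?I \<Otimes>\<^sub>M ?I)"
  unfolding f_def case_prod_beta by (rule measurable_If) (use le_m in measurable)
 have fi: "integrable (?I \<Otimes>\<^sub>M ?I) f"
 proof (rule Bochner_Integration.integrable_bound[OF _ fm])
  have m: "(\<lambda>(r, s). p' r * g s) \<in> borel_measurable (?I \<Otimes>\<^sub>M ?I)" by measurable
  show "integrable (?I \<Otimes>\<^sub>M ?I) (\<lambda>(r, s). p' r * g s)"
  proof (rule unit_square.Fubini_integrable[OF m])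
   show "integrable ?I (\<lambda>r. \<integral>s. norm (case (r, s) of (r, s) \<Rightarrow> p' r * g s) \<partial>?I)"
    using ip' by (simp add: abs_mult)
   show "AE r in ?I. integrable ?I (\<lambda>s. case (r, s) of (r, s) \<Rightarrow> p' r * g s)" using g by simp
  qed
  show "AE x in ?I \<Otimes>\<^sub>M ?I. norm (f x) \<le> norm (case x of (r, s) \<Rightarrow> p' r * g s)"
   by (rule AE_I2) (auto simp: f_def)
 qed
 have inner_s: "(\<integral>s. f (r, s) \<partial>?I) = p' r * (LINT s:{r..1}|lborel. g s)" if r: "r \<in> {0..1}" for r
 proof -
  have "(\<integral>s. f (r, s) \<partial>?I) = (\<integral>s. indicator {0..1} s *\<^sub>R f (r, s) \<partial>lborel)"
   by (rule integral_restrict_space) simp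
  also have "\<dots> = (\<integral>s. p' r * (indicator {r..1} s *\<^sub>R g s) \<partial>lborel)"
   by (rule Bochner_Integration.integral_cong[OF refl]) (use r in \<open>auto simp: f_def indicator_def\<close>)
  finally show ?thesis by (simp add: set_lebesgue_integral_def)
 qed
 have inner_r: "(\<integral>r. f (r, s) \<partial>?I) = g s * (p s - p 0)" if s: "s \<in> {0..1}" for s
 proof -
  have "(\<integral>r. f (r, s) \<partial>?I) = (\<integral>r. indicator {0..1} r *\<^sub>R f (r, s) \<partial>lborel)"
   by (rule integral_restrict_space) simp
  also have "\<dots> = (\<integral>r. g s * (indicator {0..s} r *\<^sub>R p' r) \<partial>lborel)"
   by (rule Bochner_Integration.integral_cong[OF refl]) (use s in \<open>auto simp: f_def indicator_def\<close>)
  also have "\<dots> = g s * (\<integral>r. indicator {0..s} r *\<^sub>R p' r \<partial>lborel)" by simp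
  also have "(\<integral>r. indicator {0..s} r *\<^sub>R p' r \<partial>lborel) = p s - p 0"
  proof (rule integral_FTC_atLeastAtMost)
   show "continuous_on {0..s} p'" using s by (intro continuous_on_subset[OF p']) auto
   fix r assume "0 \<le> r" "r \<le> s"
   then show "(p has_vector_derivative p' r) (at r within {0..s})"
    using s p[of r] by (auto simp: has_real_derivative_iff_has_vector_derivative intro: has_vector_derivative_at_within)
  qed (use s in simp)
  finally show ?thesis .
 qed
 have sp: "space ?I = {0..1}" by (simp add: space_restrict_space)
 have eqU: "u r * p' r = u 1 * p' r - (\<integral>s. f (r, s) \<partial>?I)" if "r \<in> space ?I" for r
 proof -
  have r: "r \<in> {0..1}" using that by (simp add: sp)
  show ?thesis unfolding inner_s[OF r] by (subst u[OF r]) (simp add: algebra_simps)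
 qed
 have iF: "integrable ?I (\<lambda>r. \<integral>s. f (r, s) \<partial>?I)" by (rule unit_square.integrable_fst'[OF fi])
 have "integrable ?I (\<lambda>r. u 1 * p' r - (\<integral>s. f (r, s) \<partial>?I))" using ip' iF by auto
 then show "integrable ?I (\<lambda>r. u r * p' r)"
  by (rule Bochner_Integration.integrable_cong[THEN iffD1, rotated -1]) (simp_all add: eqU)
 have "(\<integral>r. u r * p' r \<partial>?I) = (\<integral>r. u 1 * p' r - (\<integral>s. f (r, s) \<partial>?I) \<partial>?I)"
  by (rule Bochner_Integration.integral_cong) (simp_all add: eqU)
 also have "\<dots> = u 1 * (\<integral>r. p' r \<partial>?I) - (\<integral>r. (\<integral>s. f (r, s) \<partial>?I) \<partial>?I)"
  using ip' iF by simp
 also have "(\<integral>r. p' r \<partial>?I) = p 1 - p 0"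
 proof -
  have "(\<integral>r. p' r \<partial>?I) = (\<integral>r. indicator {0..1} r *\<^sub>R p' r \<partial>lborel)" by (rule integral_restrict_space) simp
  also have "\<dots> = p 1 - p 0"
   by (rule integral_FTC_atLeastAtMost)
    (use p p' in \<open>auto simp: has_real_derivative_iff_has_vector_derivative intro: has_vector_derivative_at_within\<close>)
  finally show ?thesis .
 qed
 also have "(\<integral>r. (\<integral>s. f (r, s) \<partial>?I) \<partial>?I) = (\<integral>s. (\<integral>r. f (r, s) \<partial>?I) \<partial>?I)"
  using unit_square.Fubini_integral[of "\<lambda>r s. f (r, s)"] fi by simp
 also have "\<dots> = (\<integral>s. g s * p s - g s * p 0 \<partial>?I)"
  by (rule Bochner_Integration.integral_cong) (auto simp: inner_r sp right_diff_distrib)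
 also have "\<dots> = (\<integral>s. g s * p s \<partial>?I) - (\<integral>s. g s \<partial>?I) * p 0" using g gp by simp
 also have "(\<integral>s. g s \<partial>?I) = u 1 - u 0" using u[of 0] by (simp add: integral_unit_interval)
 finally show "(\<integral>r. u r * p' r \<partial>?I) = u 1 * p 1 - u 0 * p 0 - (\<integral>r. g r * p r \<partial>?I)"
  by (simp add: algebra_simps)
qed

text \<open>The bridge between curves in L^2 and Sobolev functions on the cylinder. The primitive
  formula along almost every direction, stronger than a weak radial derivative, gives
  \<open>u r\<close> a meaning for every r and makes \<open>u 1\<close> the trace; the condition
  survives dilations in r, from which the traces on smaller spheres are obtained.\<close>

definition cylinder_curve ::
  "(real \<Rightarrow> 'a::euclidean_space \<Rightarrow> real) \<Rightarrow> (real \<Rightarrow> 'a \<Rightarrow> real) \<Rightarrow> (real \<Rightarrow> 'a \<Rightarrow> 'a) \<Rightarrow> bool" where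
 "cylinder_curve u g t \<longleftrightarrow>
   (\<lambda>(r, y). u r y) \<in> borel_measurable (borel \<Otimes>\<^sub>M borel) \<and>
   (\<lambda>(r, y). g r y) \<in> borel_measurable (borel \<Otimes>\<^sub>M borel) \<and>
   (\<lambda>(r, y). t r y) \<in> borel_measurable (borel \<Otimes>\<^sub>M borel) \<and>
   L2_cylinder u \<and>
   L2_cylinder g \<and>
   L2_cylinder t \<and>
   (\<forall>r\<in>{0..1}. L2_sphere (u r)) \<and>
   (AE y in sphere_measure. \<forall>r\<in>{0..1}. u r y = u 1 y - (LINT s:{r..1}|lborel. g s y)) \<and>
   (AE r in lborel. r \<in> {0..1} \<longrightarrow> (\<forall>e\<in>Basis. \<forall>f Df. C1_gradient f Df \<longrightarrow>
    (\<oint>y. u r y * (tangential y (Df y) \<bullet> e)) =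
    - (\<oint>y. (t r y \<bullet> e) * f y)
    + (real DIM('a) - 1) * (\<oint>y. u r y * f y * (y \<bullet> e))))"

lemma cylinder_square_integrable_imp_integrable:
 fixes f :: "real \<times> 'a::euclidean_space \<Rightarrow> 'b::euclidean_space"
 assumes "square_integrable cylinder_measure f"
 shows "integrable cylinder_measure f"
proof (rule Bochner_Integration.integrable_bound)
 show "integrable (cylinder_measure :: (real \<times> 'a) measure) (\<lambda>x. 1 + (norm (f x))\<^sup>2)"
  using assms by (auto simp: square_integrable_def)
 show "f \<in> borel_measurable cylinder_measure" using assms by (simp add: square_integrable_def)
 show "AE x in cylinder_measure. norm (f x) \<le> norm (1 + (norm (f x))\<^sup>2)"
 proof (rule AE_I2)
  fix x
  have "0 \<le> (norm (f x) - 1/2)\<^sup>2" by simp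
  then show "norm (f x) \<le> norm (1 + (norm (f x))\<^sup>2)" by (simp add: power2_diff power2_eq_square[of "1/2::real"])
 qed
qed

lemma integrable_cylinder_mult_continuous:
 fixes f :: "real \<times> 'a::euclidean_space \<Rightarrow> 'b::euclidean_space" and h :: "real \<times> 'a \<Rightarrow> real"
 assumes f: "integrable cylinder_measure f" and h: "continuous_on UNIV h"
 shows "integrable cylinder_measure (\<lambda>x. h x *\<^sub>R f x)"
proof -
 have "compact (h ` ({0..1} \<times> sphere 0 1))"
  by (intro compact_continuous_image continuous_on_subset[OF h] compact_Times) auto
 then obtain B where B: "\<And>r y. r \<in> {0..1} \<Longrightarrow> norm y = 1 \<Longrightarrow> \<bar>h (r, y)\<bar> \<le> B"
  using compact_imp_bounded by (fastforce simp: bounded_iff)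
 have hm: "h \<in> borel_measurable cylinder_measure"
  by (rule measurable_cylinder) (simp add: borel_prod borel_measurable_continuous_onI[OF h])
 show ?thesis
 proof (rule Bochner_Integration.integrable_bound)
  show "integrable cylinder_measure (\<lambda>x. B *\<^sub>R f x)" using f by simp
  show "(\<lambda>x. h x *\<^sub>R f x) \<in> borel_measurable cylinder_measure" using hm f by auto
  have "AE (r, y) in cylinder_measure. norm (h (r, y) *\<^sub>R f (r, y)) \<le> norm (B *\<^sub>R f (r, y))"
  proof (rule AE_cylinder)
   fix r :: real and y :: 'a assume "r \<in> {0..<1}" "norm y = 1"
   then have "\<bar>h (r, y)\<bar> \<le> \<bar>B\<bar>" using B[of r y] by auto
   then show "norm (h (r, y) *\<^sub>R f (r, y)) \<le> norm (B *\<^sub>R f (r, y))" by (simp add: mult_right_mono)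
  qed
  then show "AE x in cylinder_measure. norm (h x *\<^sub>R f x) \<le> norm (B *\<^sub>R f x)"
   by eventually_elim (simp add: case_prod_beta)
 qed
qed

lemma AE_unit_interval:
 assumes "AE r in lborel. r \<in> {0..1::real} \<longrightarrow> P r"
 shows "AE r in unit_lebesgue. P r"
 using assms by (subst AE_restrict_space_iff) auto

lemma AE_unit_interval_pos: "AE r in unit_lebesgue. 0 < r \<and> r \<le> 1"
proof (rule AE_unit_interval)
 show "AE r in lborel. r \<in> {0..1::real} \<longrightarrow> 0 < r \<and> r \<le> 1"
  using AE_lborel_singleton[of "0::real"] by eventually_elim auto
qed

lemma C1_gradient_slices:
 assumes "C1_gradient f (Df :: real \<times> 'a::euclidean_space \<Rightarrow> real \<times> 'a)"
 shows "C1_gradient (\<lambda>x. f (r, x)) (\<lambda>x. snd (Df (r, x)))"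
  and "((\<lambda>r. f (r, y)) has_real_derivative fst (Df (r, y))) (at r)"
proof -
 have d: "(f has_derivative (\<lambda>h. inner h (Df p))) (at p)" for p
  using assms unfolding C1_gradient_def gderiv_def by blast
 have c: "continuous_on UNIV Df" using assms by (simp add: C1_gradient_def)
 have 1: "((\<lambda>x. f (r, x)) has_derivative (\<lambda>h. inner (0, h) (Df (r, x)))) (at x)" for x
  by (rule has_derivative_compose[OF _ d]) (auto intro!: derivative_eq_intros)
 then show "C1_gradient (\<lambda>x. f (r, x)) (\<lambda>x. snd (Df (r, x)))"
  by (auto simp: C1_gradient_def gderiv_def inner_prod_def intro!: continuous_intros continuous_on_compose2[OF c])
 have 2: "((\<lambda>r. f (r, y)) has_derivative (\<lambda>h. inner (h, 0) (Df (r, y)))) (at r)"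
  by (rule has_derivative_compose[OF _ d]) (auto intro!: derivative_eq_intros)
 then show "((\<lambda>r. f (r, y)) has_real_derivative fst (Df (r, y))) (at r)"
  by (simp add: has_field_derivative_def inner_prod_def mult_commute_abs)
qed

text \<open>The boundary term at r = 1 is retained because it becomes the trace; at r = 0 the test
  functions in polar coordinates vanish through their weight r^n.\<close>

lemma cylinder_radial_by_parts:
 assumes C: "cylinder_curve u g t"
  and p: "\<And>r y. ((\<lambda>r. p (r, y)) has_real_derivative p' (r, y)) (at r)"
  and c: "continuous_on UNIV p" "continuous_on UNIV p'"
  and p0: "\<And>y. p (0, y) = 0"
 shows "(\<integral>(r, y). u r y * p' (r, y) \<partial>cylinder_measure) =
  (\<oint>y. u 1 y * p (1, y :: 'a::euclidean_space)) - (\<integral>(r, y). g r y * p (r, y) \<partial>cylinder_measure)"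
proof -
 let ?I = "unit_lebesgue"
 have sq: "L2_cylinder u" "L2_cylinder g"
  and sq1: "L2_sphere (u 1)"
  and ac: "AE y in sphere_measure. \<forall>r\<in>{0..1}. u r y = u 1 y - (LINT s:{r..1}|lborel. g s y)"
  using C by (auto simp: cylinder_curve_def)
 have iu: "integrable cylinder_measure (\<lambda>(r, y). u r y * p' (r, y))"
  using integrable_cylinder_mult_continuous[OF cylinder_square_integrable_imp_integrable[OF sq(1)] c(2)]
  by (simp add: case_prod_unfold mult.commute)
 have ig: "integrable cylinder_measure (\<lambda>(r, y). g r y * p (r, y))"
  using integrable_cylinder_mult_continuous[OF cylinder_square_integrable_imp_integrable[OF sq(2)] c(1)]
  by (simp add: case_prod_unfold mult.commute)
 have ig0: "AE y in sphere_measure. integrable ?I (\<lambda>r. g r y)"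
  using cylinder.AE_integrable_snd[OF cylinder_square_integrable_imp_integrable[OF sq(2)]] by simp
 have c1: "continuous_on UNIV (\<lambda>y. p (1, y))"
  by (intro continuous_on_compose2[OF c(1)] continuous_intros) auto
 have i1: "integrable sphere_measure (\<lambda>y. u 1 y * p (1, y))"
  by (rule square_integrable_mult_integrable[OF sq1 square_integrable_sphere_continuous[OF c1]])
 have "(\<integral>(r, y). u r y * p' (r, y) \<partial>cylinder_measure) = (\<integral>y. \<integral>r. u r y * p' (r, y) \<partial>?I \<partial>sphere_measure)"
  by (rule cylinder.integral_snd[OF iu, symmetric])
 also have "\<dots> = (\<oint>y. u 1 y * p (1, y) - (\<integral>r. g r y * p (r, y) \<partial>?I))"
 proof (rule integral_cong_AE)
  show "(\<lambda>y. \<integral>r. u r y * p' (r, y) \<partial>?I) \<in> borel_measurable sphere_measure"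
   using cylinder.integrable_snd[OF iu] by auto
  show "(\<lambda>y. u 1 y * p (1, y) - (\<integral>r. g r y * p (r, y) \<partial>?I)) \<in> borel_measurable sphere_measure"
   using cylinder.integrable_snd[OF ig] i1 by auto
  show "AE y in sphere_measure. (\<integral>r. u r y * p' (r, y) \<partial>?I) = u 1 y * p (1, y) - (\<integral>r. g r y * p (r, y) \<partial>?I)"
   using ac ig0
  proof eventually_elim
   case (elim y)
   have "(\<integral>r. u r y * p' (r, y) \<partial>?I) = u 1 y * p (1, y) - u 0 y * p (0, y) - (\<integral>r. g r y * p (r, y) \<partial>?I)"
   proof (rule integral_by_parts_primitive(2)[OF elim(2)])
    show "continuous_on {0..1} (\<lambda>r. p' (r, y))"
     by (intro continuous_on_compose2[OF c(2)] continuous_intros) auto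
    show "u r y = u 1 y - (LINT s:{r..1}|lborel. g s y)" if "r \<in> {0..1}" for r
     using elim(1) that by blast
   qed (rule p)
   then show ?case by (simp add: p0)
  qed
 qed
 also have "\<dots> = (\<oint>y. u 1 y * p (1, y)) - (\<integral>y. \<integral>r. g r y * p (r, y) \<partial>?I \<partial>sphere_measure)"
  by (rule Bochner_Integration.integral_diff[OF i1 cylinder.integrable_snd[OF ig]])
 also have "(\<integral>y. \<integral>r. g r y * p (r, y) \<partial>?I \<partial>sphere_measure) = (\<integral>(r, y). g r y * p (r, y) \<partial>cylinder_measure)"
  by (rule cylinder.integral_snd[OF ig])
 finally show ?thesis .
qed

text \<open>The weight \<open>p\<close> is needed because the test function in polar coordinates is \<open>x \<mapsto> f(r x)\<close>, with
 gradient \<open>r Df(r x)\<close>.\<close>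

lemma cylinder_tangential_by_parts:
 fixes p q :: "real \<Rightarrow> real" and e :: "'a::euclidean_space"
 assumes C: "cylinder_curve u g t" and e: "e \<in> Basis"
  and f: "\<And>r. 0 < r \<Longrightarrow> r \<le> 1 \<Longrightarrow> C1_gradient (\<lambda>y. f (r, y)) (\<lambda>y. q r *\<^sub>R Df (r, y))"
  and c: "continuous_on UNIV f" "continuous_on UNIV Df" "continuous_on UNIV p" "continuous_on UNIV q"
 shows "(\<integral>(r, y). (p r * q r) * (u r y * (tangential y (Df (r, y)) \<bullet> e)) \<partial>cylinder_measure) =
  - (\<integral>(r, y). p r * (f (r, y) * (t r y \<bullet> e)) \<partial>cylinder_measure)
  + (real DIM('a) - 1) * (\<integral>(r, y). p r * (u r y * f (r, y) * (y \<bullet> e)) \<partial>cylinder_measure)"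
proof -
 let ?I = "unit_lebesgue"
 have sq: "L2_cylinder u" "L2_cylinder t"
  and td: "AE r in lborel. r \<in> {0..1} \<longrightarrow> (\<forall>e\<in>Basis. \<forall>f Df. C1_gradient f Df \<longrightarrow>
    (\<oint>y. u r y * (tangential y (Df y) \<bullet> e)) =
    - (\<oint>y. (t r y \<bullet> e) * f y)
    + (real DIM('a) - 1) * (\<oint>y. u r y * f y * (y \<bullet> e)))"
  using C by (auto simp: cylinder_curve_def)
 note iu = cylinder_square_integrable_imp_integrable[OF sq(1)]
 have it: "integrable cylinder_measure (\<lambda>(r, y). t r y \<bullet> e)"
  using integrable_inner_left[OF cylinder_square_integrable_imp_integrable[OF sq(2)], of e] by (simp add: case_prod_unfold)
 have c': "continuous_on UNIV (\<lambda>x::real \<times> 'a. p (fst x))" "continuous_on UNIV (\<lambda>x::real \<times> 'a. q (fst x))"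
  by (intro continuous_on_compose2[OF c(3)] continuous_on_compose2[OF c(4)] continuous_intros, auto)+
 have i1: "integrable cylinder_measure (\<lambda>(r, y). (p r * q r) * (u r y * (tangential y (Df (r, y)) \<bullet> e)))"
 proof -
  have "continuous_on UNIV (\<lambda>x. p (fst x) * q (fst x) * (tangential (snd x) (Df x) \<bullet> e))"
   by (intro continuous_intros continuous_on_tangential c c')
  from integrable_cylinder_mult_continuous[OF iu this] show ?thesis by (simp add: case_prod_unfold mult_ac)
 qed
 have i2: "integrable cylinder_measure (\<lambda>(r, y). p r * (f (r, y) * (t r y \<bullet> e)))"
 proof -
  have "continuous_on UNIV (\<lambda>x. p (fst x) * f x)" by (intro continuous_intros c c')
  from integrable_cylinder_mult_continuous[OF it this] show ?thesis by (simp add: case_prod_unfold mult_ac)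
 qed
 have i3: "integrable cylinder_measure (\<lambda>(r, y). p r * (u r y * f (r, y) * (y \<bullet> e)))"
 proof -
  have "continuous_on UNIV (\<lambda>x. p (fst x) * (f x * (snd x \<bullet> e)))" by (intro continuous_intros c c')
  from integrable_cylinder_mult_continuous[OF iu this] show ?thesis by (simp add: case_prod_unfold mult_ac)
 qed
 have "(\<integral>(r, y). (p r * q r) * (u r y * (tangential y (Df (r, y)) \<bullet> e)) \<partial>cylinder_measure)
  = (\<integral>r. \<integral>y. (p r * q r) * (u r y * (tangential y (Df (r, y)) \<bullet> e)) \<partial>sphere_measure \<partial>?I)"
  by (rule cylinder.integral_fst[OF i1, symmetric])
 also have "\<dots> = (\<integral>r. - (\<oint>y. p r * (f (r, y) * (t r y \<bullet> e)))
   + (real DIM('a) - 1) * (\<oint>y. p r * (u r y * f (r, y) * (y \<bullet> e))) \<partial>?I)"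
 proof (rule integral_cong_AE)
  show "(\<lambda>r. \<integral>y. (p r * q r) * (u r y * (tangential y (Df (r, y)) \<bullet> e)) \<partial>sphere_measure) \<in> borel_measurable ?I"
   using cylinder.integrable_fst[OF i1] by auto
  show "(\<lambda>r. - (\<oint>y. p r * (f (r, y) * (t r y \<bullet> e)))
   + (real DIM('a) - 1) * (\<oint>y. p r * (u r y * f (r, y) * (y \<bullet> e)))) \<in> borel_measurable ?I"
   using cylinder.integrable_fst[OF i2] cylinder.integrable_fst[OF i3] by auto
  show "AE r in ?I. (\<oint>y. (p r * q r) * (u r y * (tangential y (Df (r, y)) \<bullet> e))) =
    - (\<oint>y. p r * (f (r, y) * (t r y \<bullet> e)))
    + (real DIM('a) - 1) * (\<oint>y. p r * (u r y * f (r, y) * (y \<bullet> e)))"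
   using AE_unit_interval[OF td] AE_unit_interval_pos
  proof eventually_elim
   case (elim r)
   have "(\<oint>y. u r y * (tangential y (q r *\<^sub>R Df (r, y)) \<bullet> e)) =
    - (\<oint>y. (t r y \<bullet> e) * f (r, y))
    + (real DIM('a) - 1) * (\<oint>y. u r y * f (r, y) * (y \<bullet> e))"
    using elim(1) e f[of r] elim(2) by blast
   moreover have "(\<oint>y. u r y * (tangential y (q r *\<^sub>R Df (r, y)) \<bullet> e))
     = q r * (\<oint>y. u r y * (tangential y (Df (r, y)) \<bullet> e))"
    unfolding integral_mult_right_zero[symmetric]
    by (rule Bochner_Integration.integral_cong) (simp_all add: tangential_inner algebra_simps)
   ultimately have "p r * (q r * (\<oint>y. u r y * (tangential y (Df (r, y)) \<bullet> e))) =
    - (p r * (\<oint>y. f (r, y) * (t r y \<bullet> e)))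
    + (real DIM('a) - 1) * (p r * (\<oint>y. u r y * f (r, y) * (y \<bullet> e)))"
    by (simp add: mult.commute[of "t r _ \<bullet> e"] distrib_left mult.left_commute right_diff_distrib)
   then show ?case by (simp add: mult.assoc)
  qed
 qed
 also have "\<dots> = - (\<integral>r. \<integral>y. p r * (f (r, y) * (t r y \<bullet> e)) \<partial>sphere_measure \<partial>?I)
   + (real DIM('a) - 1) * (\<integral>r. \<integral>y. p r * (u r y * f (r, y) * (y \<bullet> e)) \<partial>sphere_measure \<partial>?I)"
 proof -
  have j: "integrable ?I (\<lambda>r. \<integral>y. p r * (f (r, y) * (t r y \<bullet> e)) \<partial>sphere_measure)"
   "integrable ?I (\<lambda>r. \<integral>y. p r * (u r y * f (r, y) * (y \<bullet> e)) \<partial>sphere_measure)"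
   using cylinder.integrable_fst[OF i2] cylinder.integrable_fst[OF i3] by auto
  show ?thesis
   using Bochner_Integration.integral_add[OF integrable_minus[OF j(1)] integrable_mult_right[OF j(2), of "real DIM('a) - 1"]]
   by (simp only: integral_minus integral_mult_right_zero)
 qed
 also have "(\<integral>r. \<integral>y. p r * (f (r, y) * (t r y \<bullet> e)) \<partial>sphere_measure \<partial>?I)
  = (\<integral>(r, y). p r * (f (r, y) * (t r y \<bullet> e)) \<partial>cylinder_measure)"
  by (rule cylinder.integral_fst[OF i2])
 also have "(\<integral>r. \<integral>y. p r * (u r y * f (r, y) * (y \<bullet> e)) \<partial>sphere_measure \<partial>?I)
  = (\<integral>(r, y). p r * (u r y * f (r, y) * (y \<bullet> e)) \<partial>cylinder_measure)"
  by (rule cylinder.integral_fst[OF i3])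
 finally show ?thesis .
qed

theorem cylinder_curve_weak_derivatives:
 fixes u :: "real \<Rightarrow> 'a::euclidean_space \<Rightarrow> real"
 assumes C: "cylinder_curve u g t"
 shows "weak_derivatives_cylinder u g t"
proof -
 have sq: "L2_cylinder u" "L2_cylinder g"
   "L2_cylinder t"
  using C by (auto simp: cylinder_curve_def)
 note iu = cylinder_square_integrable_imp_integrable[OF sq(1)]
 note it = cylinder_square_integrable_imp_integrable[OF sq(3)]
 have "(\<integral>(r, y). u r y * fst (Df (r, y)) \<partial>cylinder_measure) = - (\<integral>(r, y). g r y * f (r, y) \<partial>cylinder_measure) \<and>
  (\<integral>(r, y). u r y *\<^sub>R tangential y (snd (Df (r, y))) \<partial>cylinder_measure) =
      - (\<integral>(r, y). f (r, y) *\<^sub>R t r y \<partial>cylinder_measure)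
      + (real DIM('a) - 1) *\<^sub>R (\<integral>(r, y). (u r y * f (r, y)) *\<^sub>R y \<partial>cylinder_measure)"
  if C1: "C1_gradient f Df" and supp: "a > 0" "b < 1" "\<And>r x. r \<le> a \<or> b \<le> r \<Longrightarrow> f (r, x) = 0"
  for f and Df :: "real \<times> 'a \<Rightarrow> real \<times> 'a" and a b :: real
 proof
  note c = C1_gradient_continuous[OF C1, of UNIV]
  have z: "f (0, x) = 0" "f (1, x) = 0" for x using supp by auto
  have "(\<integral>(r, y). u r y * fst (Df (r, y)) \<partial>cylinder_measure) =
    (\<oint>y. u 1 y * f (1, y)) - (\<integral>(r, y). g r y * f (r, y) \<partial>cylinder_measure)"
   by (rule cylinder_radial_by_parts[OF C, of f "\<lambda>x. fst (Df x)"])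
    (use C1_gradient_slices(2)[OF C1] z c in \<open>auto intro: continuous_intros\<close>)
  then show "(\<integral>(r, y). u r y * fst (Df (r, y)) \<partial>cylinder_measure) = - (\<integral>(r, y). g r y * f (r, y) \<partial>cylinder_measure)"
   by (simp add: z)
  have cs: "continuous_on UNIV (\<lambda>x. snd (Df x))" using c by (intro continuous_intros)
  have j1: "integrable cylinder_measure (\<lambda>(r, y). u r y *\<^sub>R tangential y (snd (Df (r, y))))"
  proof -
   have "integrable cylinder_measure (\<lambda>x. \<Sum>e\<in>Basis. ((tangential (snd x) (snd (Df x)) \<bullet> e) *\<^sub>R (case x of (r, y) \<Rightarrow> u r y)) *\<^sub>R e)"
    by (intro Bochner_Integration.integrable_sum integrable_scaleR_left integrable_cylinder_mult_continuous[OF iu] continuous_intros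
      continuous_on_tangential cs)
   moreover have "(\<lambda>x. \<Sum>e\<in>Basis. ((tangential (snd x) (snd (Df x)) \<bullet> e) *\<^sub>R (case x of (r, y) \<Rightarrow> u r y)) *\<^sub>R e)
    = (\<lambda>(r, y). u r y *\<^sub>R tangential y (snd (Df (r, y))))"
   proof (rule ext)
    fix x :: "real \<times> 'a"
    obtain r y where x: "x = (r, y)" by (cases x)
    have "(\<Sum>e\<in>Basis. ((tangential y (snd (Df (r, y))) \<bullet> e) * u r y) *\<^sub>R e) = u r y *\<^sub>R (\<Sum>e\<in>Basis. (tangential y (snd (Df (r, y))) \<bullet> e) *\<^sub>R e)"
     by (simp add: scaleR_sum_right mult.commute)
    then show "(\<Sum>e\<in>Basis. ((tangential (snd x) (snd (Df x)) \<bullet> e) *\<^sub>R (case x of (r, y) \<Rightarrow> u r y)) *\<^sub>R e)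
     = (case x of (r, y) \<Rightarrow> u r y *\<^sub>R tangential y (snd (Df (r, y))))"
     unfolding x by (simp add: euclidean_representation)
   qed
   ultimately show ?thesis by simp
  qed
  have j2: "integrable cylinder_measure (\<lambda>(r, y). f (r, y) *\<^sub>R t r y)"
   using integrable_cylinder_mult_continuous[OF it c(1)] by (simp add: case_prod_unfold)
  have j3: "integrable cylinder_measure (\<lambda>(r, y). (u r y * f (r, y)) *\<^sub>R y)"
  proof -
   have "integrable cylinder_measure (\<lambda>x. \<Sum>e\<in>Basis. ((f x * (snd x \<bullet> e)) *\<^sub>R (case x of (r, y) \<Rightarrow> u r y)) *\<^sub>R e)"
    by (intro Bochner_Integration.integrable_sum integrable_scaleR_left integrable_cylinder_mult_continuous[OF iu] continuous_intros c(1))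
   moreover have "(\<lambda>x. \<Sum>e\<in>Basis. ((f x * (snd x \<bullet> e)) *\<^sub>R (case x of (r, y) \<Rightarrow> u r y)) *\<^sub>R e)
    = (\<lambda>(r, y). (u r y * f (r, y)) *\<^sub>R y)"
   proof (rule ext)
    fix x :: "real \<times> 'a"
    obtain r y where x: "x = (r, y)" by (cases x)
    have "(\<Sum>e\<in>Basis. (f (r, y) * (y \<bullet> e) * u r y) *\<^sub>R e) = (u r y * f (r, y)) *\<^sub>R (\<Sum>e\<in>Basis. (y \<bullet> e) *\<^sub>R e)"
     by (simp add: scaleR_sum_right mult_ac)
    then show "(\<Sum>e\<in>Basis. ((f x * (snd x \<bullet> e)) *\<^sub>R (case x of (r, y) \<Rightarrow> u r y)) *\<^sub>R e)
     = (case x of (r, y) \<Rightarrow> (u r y * f (r, y)) *\<^sub>R y)"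
     unfolding x by (simp add: euclidean_representation)
   qed
   ultimately show ?thesis by simp
  qed
  show "(\<integral>(r, y). u r y *\<^sub>R tangential y (snd (Df (r, y))) \<partial>cylinder_measure) =
      - (\<integral>(r, y). f (r, y) *\<^sub>R t r y \<partial>cylinder_measure)
      + (real DIM('a) - 1) *\<^sub>R (\<integral>(r, y). (u r y * f (r, y)) *\<^sub>R y \<partial>cylinder_measure)"
  proof (rule euclidean_eqI)
   fix e :: 'a assume e: "e \<in> Basis"
   have "(\<integral>(r, y). (1 * 1) * (u r y * (tangential y (snd (Df (r, y))) \<bullet> e)) \<partial>cylinder_measure) =
    - (\<integral>(r, y). 1 * (f (r, y) * (t r y \<bullet> e)) \<partial>cylinder_measure)
    + (real DIM('a) - 1) * (\<integral>(r, y). 1 * (u r y * f (r, y) * (y \<bullet> e)) \<partial>cylinder_measure)"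
    by (rule cylinder_tangential_by_parts[OF C e, where p="\<lambda>_. 1" and q="\<lambda>_. 1" and Df="\<lambda>x. snd (Df x)"])
     (use C1_gradient_slices(1)[OF C1] c(1) cs in \<open>auto\<close>)
   then show "(\<integral>(r, y). u r y *\<^sub>R tangential y (snd (Df (r, y))) \<partial>cylinder_measure) \<bullet> e =
      (- (\<integral>(r, y). f (r, y) *\<^sub>R t r y \<partial>cylinder_measure)
      + (real DIM('a) - 1) *\<^sub>R (\<integral>(r, y). (u r y * f (r, y)) *\<^sub>R y \<partial>cylinder_measure)) \<bullet> e"
    using integral_inner_left[OF j1, of e] integral_inner_left[OF j2, of e] integral_inner_left[OF j3, of e]
    by (simp add: inner_add_left inner_diff_left case_prod_unfold)
  qed
 qed
 then show ?thesis using sq unfolding weak_derivatives_cylinder_def by blast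
qed

section \<open>Traces and slices\<close>

interpretation ball_measure: finite_measure "ball_measure :: 'a::euclidean_space measure"
proof
 have "emeasure ball_measure (space (ball_measure :: 'a measure)) = emeasure lborel (ball (0::'a) 1)"
  by (subst emeasure_restrict_space) (auto simp: space_restrict_space)
 then show "emeasure (ball_measure :: 'a measure) (space ball_measure) \<noteq> \<infinity>"
  using emeasure_lborel_ball_finite[of "0::'a" 1] by (simp add: less_top)
qed

lemma measurable_ball_measure: "f \<in> borel_measurable borel \<Longrightarrow> f \<in> borel_measurable ball_measure"
 by (rule measurable_restrict_space1) simp

lemma bounded_continuous_ball:
 fixes h :: "'a::euclidean_space \<Rightarrow> 'b::real_normed_vector"
 assumes "continuous_on UNIV h"
 obtains B where "\<And>x. norm x < 1 \<Longrightarrow> norm (h x) \<le> B"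
proof -
 have "bounded (h ` cball 0 1)"
  by (intro compact_imp_bounded compact_continuous_image continuous_on_subset[OF assms]) auto
 then obtain B where "\<forall>y\<in>h ` cball 0 1. norm y \<le> B" unfolding bounded_iff by blast
 then show ?thesis by (intro that[of B]) auto
qed

lemma integrable_ball_continuous_scaleR:
 fixes f :: "'a::euclidean_space \<Rightarrow> 'b::euclidean_space" and h :: "'a \<Rightarrow> real"
 assumes f: "integrable ball_measure f" and h: "continuous_on UNIV h"
 shows "integrable ball_measure (\<lambda>x. h x *\<^sub>R f x)"
proof -
 obtain B where B: "\<And>x. norm x < 1 \<Longrightarrow> norm (h x) \<le> B" using bounded_continuous_ball[OF h] by blast
 have hm: "h \<in> borel_measurable ball_measure"
  by (rule measurable_ball_measure[OF borel_measurable_continuous_onI[OF h]])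
 show ?thesis
 proof (rule Bochner_Integration.integrable_bound)
  show "integrable ball_measure (\<lambda>x. B *\<^sub>R f x)" using f by simp
  show "(\<lambda>x. h x *\<^sub>R f x) \<in> borel_measurable ball_measure" using hm f by auto
  show "AE x in ball_measure. norm (h x *\<^sub>R f x) \<le> norm (B *\<^sub>R f x)"
  proof (rule AE_I2)
   fix x :: 'a assume "x \<in> space ball_measure"
   then have "\<bar>h x\<bar> \<le> \<bar>B\<bar>" using B[of x] by (auto simp: space_restrict_space)
   then show "norm (h x *\<^sub>R f x) \<le> norm (B *\<^sub>R f x)" by (simp add: mult_right_mono)
  qed
 qed
qed

lemma integrable_ball_scaleR_continuous:
 fixes f :: "'a::euclidean_space \<Rightarrow> real" and h :: "'a \<Rightarrow> 'b::euclidean_space"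
 assumes f: "integrable ball_measure f" and h: "continuous_on UNIV h"
 shows "integrable ball_measure (\<lambda>x. f x *\<^sub>R h x)"
proof -
 obtain B where B: "\<And>x. norm x < 1 \<Longrightarrow> norm (h x) \<le> B" using bounded_continuous_ball[OF h] by blast
 have hm: "h \<in> borel_measurable ball_measure"
  by (rule measurable_ball_measure[OF borel_measurable_continuous_onI[OF h]])
 show ?thesis
 proof (rule Bochner_Integration.integrable_bound)
  show "integrable ball_measure (\<lambda>x. B *\<^sub>R f x)" using f by simp
  show "(\<lambda>x. f x *\<^sub>R h x) \<in> borel_measurable ball_measure" using hm f by auto
  show "AE x in ball_measure. norm (f x *\<^sub>R h x) \<le> norm (B *\<^sub>R f x)"
  proof (rule AE_I2)
   fix x :: 'a assume "x \<in> space ball_measure"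
   then have "norm (h x) \<le> \<bar>B\<bar>" using B[of x] by (auto simp: space_restrict_space)
   then show "norm (f x *\<^sub>R h x) \<le> norm (B *\<^sub>R f x)"
    using mult_left_mono[of "norm (h x)" "\<bar>B\<bar>" "\<bar>f x\<bar>"] by (simp add: mult.commute)
  qed
 qed
qed

lemma square_integrable_polar:
 fixes f :: "'a::euclidean_space \<Rightarrow> 'b::euclidean_space" and b :: "real \<times> 'a \<Rightarrow> real"
 assumes f: "f \<in> borel_measurable borel" and b: "integrable cylinder_measure b"
  and le: "\<And>r y. 0 < r \<Longrightarrow> r < 1 \<Longrightarrow> norm y = 1 \<Longrightarrow> r ^ (DIM('a) - 1) * (norm (f (r *\<^sub>R y)))\<^sup>2 \<le> b (r, y)"
 shows "square_integrable ball_measure f"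
proof -
 note [measurable] = f
 have m: "(\<lambda>x. (norm (f x))\<^sup>2) \<in> borel_measurable borel" by measurable
 have "integrable cylinder_measure (\<lambda>(r, y). r ^ (DIM('a) - 1) *\<^sub>R (norm (f (r *\<^sub>R y)))\<^sup>2)"
 proof (rule Bochner_Integration.integrable_bound[OF b])
  show "(\<lambda>(r, y). r ^ (DIM('a) - 1) *\<^sub>R (norm (f (r *\<^sub>R y)))\<^sup>2) \<in> borel_measurable cylinder_measure"
   by (rule measurable_cylinder) measurable
  have "AE (r, y) in cylinder_measure. norm (r ^ (DIM('a) - 1) *\<^sub>R (norm (f (r *\<^sub>R y)))\<^sup>2) \<le> norm (b (r, y))"
  proof (rule AE_cylinder)
   fix r :: real and y :: 'a assume r: "r \<in> {0..<1}" "0 < r" "norm y = 1"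
   have "0 \<le> r ^ (DIM('a) - 1) * (norm (f (r *\<^sub>R y)))\<^sup>2" using r by simp
   then show "norm (r ^ (DIM('a) - 1) *\<^sub>R (norm (f (r *\<^sub>R y)))\<^sup>2) \<le> norm (b (r, y))"
    using le[of r y] r by simp
  qed
  then show "AE x in cylinder_measure. norm (case x of (r, y) \<Rightarrow> r ^ (DIM('a) - 1) *\<^sub>R (norm (f (r *\<^sub>R y)))\<^sup>2) \<le> norm (b x)"
   by eventually_elim (simp add: case_prod_unfold)
 qed
 then have "integrable ball_measure (\<lambda>x. (norm (f x))\<^sup>2)"
  using integrable_polar[OF m] by simp
 then show ?thesis using measurable_ball_measure[OF f] by (simp add: square_integrable_def)
qed

lemma ball_square_integrable_imp_integrable:
 fixes f :: "'a::euclidean_space \<Rightarrow> 'b::euclidean_space"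
 assumes "square_integrable ball_measure f"
 shows "integrable ball_measure f"
proof (rule Bochner_Integration.integrable_bound)
 show "integrable (ball_measure :: 'a measure) (\<lambda>x. 1 + (norm (f x))\<^sup>2)"
  using assms by (auto simp: square_integrable_def)
 show "f \<in> borel_measurable ball_measure" using assms by (simp add: square_integrable_def)
 show "AE x in ball_measure. norm (f x) \<le> norm (1 + (norm (f x))\<^sup>2)"
 proof (rule AE_I2)
  fix x
  have "0 \<le> (norm (f x) - 1/2)\<^sup>2" by simp
  then show "norm (f x) \<le> norm (1 + (norm (f x))\<^sup>2)" by (simp add: power2_diff power2_eq_square[of "1/2::real"])
 qed
qed

text \<open>The gradient of r^k u(r, y): its tangential part is r^(k-1) t, its radial part k r^(k-1)
  u + r^k g. The quotient \<open>norm x ^ k / norm x\<close> stands for r^(k-1), so that k = 0 gives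
  1/r.\<close>

definition polar_gradient ::
  "nat \<Rightarrow> (real \<Rightarrow> 'a::euclidean_space \<Rightarrow> real) \<Rightarrow> (real \<Rightarrow> 'a \<Rightarrow> real) \<Rightarrow> (real \<Rightarrow> 'a \<Rightarrow> 'a) \<Rightarrow> 'a \<Rightarrow> 'a" where
 "polar_gradient k u g t x =
   (norm x ^ k / norm x) *\<^sub>R ((real k * u (norm x) (sgn x)) *\<^sub>R sgn x + t (norm x) (sgn x))
   + (norm x ^ k * g (norm x) (sgn x)) *\<^sub>R sgn x"

lemma norm_sgn_polar:
 assumes "0 < r" "norm y = 1"
 shows "norm (r *\<^sub>R y) = r" "sgn (r *\<^sub>R (y::'a::euclidean_space)) = y"
 using assms by (auto simp: sgn_div_norm)

text \<open>The volume density r^(d-1) compensates the factor r^(k-1) of the gradient: the exponent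
  d - 1 + 2k - 2 is nonnegative exactly when 3 \<le> 2k + d.\<close>

lemma power_weight_le:
 fixes r :: real
 assumes "0 < r" "r < 1" "3 \<le> 2 * k + d" "1 \<le> d"
 shows "r ^ (d - 1) * (r ^ k)\<^sup>2 \<le> 1" "r ^ (d - 1) * (r ^ k / r)\<^sup>2 \<le> 1"
proof -
 have eq: "r ^ (d - 1) * (r ^ k)\<^sup>2 = r ^ (d - 1 + 2 * k)"
  by (simp add: power_add power_mult mult.commute)
 show "r ^ (d - 1) * (r ^ k)\<^sup>2 \<le> 1" unfolding eq using assms by (intro power_le_one) auto
 have "r ^ (d - 1 + 2 * k) \<le> r\<^sup>2" using assms by (intro power_decreasing) auto
 then show "r ^ (d - 1) * (r ^ k / r)\<^sup>2 \<le> 1"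
  using assms eq by (simp add: power_divide divide_le_eq)
qed

lemma norm_add3_squared_le:
 fixes a b c :: "'b::real_normed_vector"
 shows "(norm (a + b + c))\<^sup>2 \<le> 3 * ((norm a)\<^sup>2 + (norm b)\<^sup>2 + (norm c)\<^sup>2)"
proof -
 have "norm (a + b + c) \<le> norm a + norm b + norm c"
  using norm_triangle_ineq[of "a + b" c] norm_triangle_ineq[of a b] by linarith
 then have "(norm (a + b + c))\<^sup>2 \<le> (norm a + norm b + norm c)\<^sup>2" by (rule power_mono) simp
 also have "\<dots> \<le> 3 * ((norm a)\<^sup>2 + (norm b)\<^sup>2 + (norm c)\<^sup>2)"
  using zero_le_power2[of "norm a - norm b"] zero_le_power2[of "norm a - norm c"] zero_le_power2[of "norm b - norm c"]
  by (simp add: power2_eq_square algebra_simps)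
 finally show ?thesis .
qed

context
 fixes u g :: "real \<Rightarrow> 'a::euclidean_space \<Rightarrow> real" and t :: "real \<Rightarrow> 'a \<Rightarrow> 'a" and k :: nat
 assumes C: "cylinder_curve u g t" and d: "2 \<le> DIM('a)" "3 \<le> 2 * k + DIM('a)"
begin

lemma cylinder_curve_facts:
 shows "(\<lambda>(r, y). u r y) \<in> borel_measurable (borel \<Otimes>\<^sub>M borel)"
  "(\<lambda>(r, y). g r y) \<in> borel_measurable (borel \<Otimes>\<^sub>M borel)"
  "(\<lambda>(r, y). t r y) \<in> borel_measurable (borel \<Otimes>\<^sub>M borel)"
  "L2_cylinder u"
  "L2_cylinder g"
  "L2_cylinder t"
  "L2_sphere (u 1)"
 using C by (auto simp: cylinder_curve_def)

lemma measurable_polar: "polar k u \<in> borel_measurable borel"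
  "polar_gradient k u g t \<in> borel_measurable borel"
proof -
 have p: "(\<lambda>x::'a. (norm x, sgn x)) \<in> borel \<rightarrow>\<^sub>M borel \<Otimes>\<^sub>M borel" by measurable
 have [measurable]: "(\<lambda>x. u (norm x) (sgn x)) \<in> borel_measurable borel"
   "(\<lambda>x. g (norm x) (sgn x)) \<in> borel_measurable borel"
   "(\<lambda>x. t (norm x) (sgn x)) \<in> borel_measurable borel"
  using measurable_compose[OF p cylinder_curve_facts(1)] measurable_compose[OF p cylinder_curve_facts(2)]
   measurable_compose[OF p cylinder_curve_facts(3)] by simp_all
 show "polar k u \<in> borel_measurable borel" unfolding polar_def[abs_def] by measurable
 show "polar_gradient k u g t \<in> borel_measurable borel" unfolding polar_gradient_def[abs_def] by measurable
qed

lemma polar_square_integrable: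
 "square_integrable ball_measure (polar k u)" "square_integrable ball_measure (polar_gradient k u g t)"
proof -
 have iu: "integrable cylinder_measure (\<lambda>x. (u (fst x) (snd x))\<^sup>2)"
  and ig: "integrable cylinder_measure (\<lambda>x. (g (fst x) (snd x))\<^sup>2)"
  and it: "integrable cylinder_measure (\<lambda>x. (norm (t (fst x) (snd x)))\<^sup>2)"
  using cylinder_curve_facts(4-6) by (simp_all add: square_integrable_def case_prod_unfold)
 show "square_integrable ball_measure (polar k u)"
 proof (rule square_integrable_polar[OF measurable_polar(1) iu])
  fix r :: real and y :: 'a assume r: "0 < r" "r < 1" "norm y = 1"
  have "r ^ (DIM('a) - 1) * (r ^ k)\<^sup>2 * (u r y)\<^sup>2 \<le> 1 * (u r y)\<^sup>2"
   by (rule mult_right_mono) (use power_weight_le(1)[of r k "DIM('a)"] r d in auto)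
  then show "r ^ (DIM('a) - 1) * (norm (polar k u (r *\<^sub>R y)))\<^sup>2 \<le> (u (fst (r, y)) (snd (r, y)))\<^sup>2"
   unfolding polar_def norm_sgn_polar[OF r(1,3)] by (simp add: power_mult_distrib mult.assoc)
 qed
 have i: "integrable cylinder_measure (\<lambda>x. 3 * ((real k)\<^sup>2 * (u (fst x) (snd x))\<^sup>2 + (norm (t (fst x) (snd x)))\<^sup>2 + (g (fst x) (snd x))\<^sup>2))"
  by (intro integrable_mult_right Bochner_Integration.integrable_add iu ig it)
 show "square_integrable ball_measure (polar_gradient k u g t)"
 proof (rule square_integrable_polar[OF measurable_polar(2) i])
  fix r :: real and y :: 'a assume r: "0 < r" "r < 1" "norm y = 1"
  let ?a = "(r ^ k / r) *\<^sub>R ((real k * u r y) *\<^sub>R y)" and ?b = "(r ^ k / r) *\<^sub>R t r y" and ?c = "(r ^ k * g r y) *\<^sub>R y"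
  have w: "r ^ (DIM('a) - 1) * (r ^ k)\<^sup>2 \<le> 1" "r ^ (DIM('a) - 1) * (r ^ k / r)\<^sup>2 \<le> 1"
   using power_weight_le[of r k "DIM('a)"] r d by auto
  have "polar_gradient k u g t (r *\<^sub>R y) = ?a + ?b + ?c"
   unfolding polar_gradient_def norm_sgn_polar[OF r(1,3)] by (simp add: scaleR_add_right)
  then have "r ^ (DIM('a) - 1) * (norm (polar_gradient k u g t (r *\<^sub>R y)))\<^sup>2
    \<le> r ^ (DIM('a) - 1) * (3 * ((norm ?a)\<^sup>2 + (norm ?b)\<^sup>2 + (norm ?c)\<^sup>2))"
   using norm_add3_squared_le[of ?a ?b ?c] r by (intro mult_left_mono) auto
  also have "\<dots> = 3 * ((r ^ (DIM('a) - 1) * (r ^ k / r)\<^sup>2) * ((real k)\<^sup>2 * (u r y)\<^sup>2) + (r ^ (DIM('a) - 1) * (r ^ k / r)\<^sup>2) * (norm (t r y))\<^sup>2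
    + (r ^ (DIM('a) - 1) * (r ^ k)\<^sup>2) * (g r y)\<^sup>2)"
   using r by (simp add: power_mult_distrib power_divide abs_mult algebra_simps)
  also have "\<dots> \<le> 3 * (1 * ((real k)\<^sup>2 * (u r y)\<^sup>2) + 1 * (norm (t r y))\<^sup>2 + 1 * (g r y)\<^sup>2)"
   by (intro mult_left_mono add_mono mult_right_mono w) auto
  finally show "r ^ (DIM('a) - 1) * (norm (polar_gradient k u g t (r *\<^sub>R y)))\<^sup>2
   \<le> 3 * ((real k)\<^sup>2 * (u (fst (r, y)) (snd (r, y)))\<^sup>2 + (norm (t (fst (r, y)) (snd (r, y))))\<^sup>2 + (g (fst (r, y)) (snd (r, y)))\<^sup>2)"
   by simp
 qed
qed

text \<open>In polar coordinates both integrals become combinations of \<open>?F1\<close> to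
  \<open>?F5\<close>. The radial ones are related by parts with the test function \<open>l\<close>,
  the tangential ones on each sphere. The zeroth order term \<open>?F2\<close> receives -n from the
  weight r^n, d - 1 from the curvature and k from the derivative of r^k; these cancel because n = k
  + d - 1.\<close>

lemma polar_Gauss_Green_component:
 fixes q :: "'a \<Rightarrow> real"
 assumes C1: "C1_gradient q Dq" and e: "e \<in> Basis"
 shows "(\<integral>x. polar k u x * (Dq x \<bullet> e) \<partial>ball_measure) + (\<integral>x. q x * (polar_gradient k u g t x \<bullet> e) \<partial>ball_measure) =
  (\<oint>y. u 1 y * q y * (y \<bullet> e))"
proof -
 let ?d = "DIM('a)"
 define n where "n = k + (?d - 1)"
 obtain m where m: "n = Suc m" using d by (cases n) (auto simp: n_def)
 have dd: "real ?d - 1 = real (?d - 1)" using d by (simp add: of_nat_diff)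
 have rn: "r ^ (?d - 1) * r ^ k = r ^ m * r" for r :: real
 proof -
  have "?d - 1 + k = Suc m" unfolding m[symmetric] n_def by simp
  then have "r ^ (?d - 1 + k) = r ^ Suc m" by (rule arg_cong)
  then show ?thesis by (simp only: power_add power_Suc2)
 qed
 note c = C1_gradient_continuous[OF C1, of UNIV]
 have cs: "continuous_on UNIV (\<lambda>x::real \<times> 'a. q (fst x *\<^sub>R snd x))" "continuous_on UNIV (\<lambda>x::real \<times> 'a. Dq (fst x *\<^sub>R snd x))"
  by (intro continuous_on_compose2[OF c(1)] continuous_on_compose2[OF c(2)] continuous_intros, auto)+
 define l where "l x = fst x ^ n * q (fst x *\<^sub>R snd x) * (snd x \<bullet> e)" for x :: "real \<times> 'a"
 define l' where "l' x = (real n * fst x ^ m * q (fst x *\<^sub>R snd x) + fst x ^ n * (Dq (fst x *\<^sub>R snd x) \<bullet> snd x)) * (snd x \<bullet> e)" for x :: "real \<times> 'a"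
 have cl: "continuous_on UNIV l" "continuous_on UNIV l'"
  unfolding l_def[abs_def] l'_def[abs_def] by (intro continuous_intros cs)+
 have gd: "GDERIV q x :> Dq x" for x using C1 by (simp add: C1_gradient_def)
 have Dl: "((\<lambda>r. l (r, y)) has_real_derivative l' (r, y)) (at r)" for r y
 proof -
  have "((\<lambda>r. q (r *\<^sub>R y)) has_real_derivative (Dq (r *\<^sub>R y) \<bullet> y)) (at r)"
   using GDERIV_line[of q 0 r y "Dq (r *\<^sub>R y)" UNIV] gd by (simp add: has_real_derivative_iff_has_vector_derivative)
  then have "((\<lambda>r. r ^ n * q (r *\<^sub>R y) * (y \<bullet> e)) has_real_derivative
    ((real n * r ^ m) * q (r *\<^sub>R y) + (Dq (r *\<^sub>R y) \<bullet> y) * r ^ n) * (y \<bullet> e)) (at r)"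
   by (intro DERIV_cmult_right DERIV_mult DERIV_cong[OF DERIV_pow]) (simp_all add: m)
  then show ?thesis by (simp add: l_def l'_def mult.commute[of "Dq _ \<bullet> _"])
 qed
 note iu = cylinder_square_integrable_imp_integrable[OF cylinder_curve_facts(4)]
 note ig = cylinder_square_integrable_imp_integrable[OF cylinder_curve_facts(5)]
 have it: "integrable cylinder_measure (\<lambda>(r, y). t r y \<bullet> e)"
  using integrable_inner_left[OF cylinder_square_integrable_imp_integrable[OF cylinder_curve_facts(6)], of e]
  by (simp add: case_prod_unfold)
 have cp: "continuous_on UNIV (\<lambda>x::real \<times> 'a. fst x ^ m)" by (intro continuous_intros)
 let ?F1 = "\<lambda>(r, y). u r y * l' (r, y)"
 let ?F2 = "\<lambda>(r, y). r ^ m * (u r y * q (r *\<^sub>R y) * (y \<bullet> e))"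
 let ?F3 = "\<lambda>(r, y). (r ^ m * r) * (u r y * (tangential y (Dq (r *\<^sub>R y)) \<bullet> e))"
 let ?F4 = "\<lambda>(r, y). r ^ m * (q (r *\<^sub>R y) * (t r y \<bullet> e))"
 let ?F5 = "\<lambda>(r, y). g r y * l (r, y)"
 have i1: "integrable cylinder_measure ?F1"
  using integrable_cylinder_mult_continuous[OF iu cl(2)] by (simp add: case_prod_unfold mult_ac)
 have i2: "integrable cylinder_measure ?F2"
 proof -
  have "continuous_on UNIV (\<lambda>x::real \<times> 'a. fst x ^ m * (q (fst x *\<^sub>R snd x) * (snd x \<bullet> e)))" by (intro continuous_intros cs)
  from integrable_cylinder_mult_continuous[OF iu this] show ?thesis by (simp add: case_prod_unfold mult_ac)
 qed
 have i3: "integrable cylinder_measure ?F3"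
 proof -
  have "continuous_on UNIV (\<lambda>x::real \<times> 'a. fst x ^ m * fst x * (tangential (snd x) (Dq (fst x *\<^sub>R snd x)) \<bullet> e))"
   by (intro continuous_intros continuous_on_tangential cs)
  from integrable_cylinder_mult_continuous[OF iu this] show ?thesis by (simp add: case_prod_unfold mult_ac)
 qed
 have i4: "integrable cylinder_measure ?F4"
 proof -
  have "continuous_on UNIV (\<lambda>x::real \<times> 'a. fst x ^ m * q (fst x *\<^sub>R snd x))" by (intro continuous_intros cs)
  from integrable_cylinder_mult_continuous[OF it this] show ?thesis by (simp add: case_prod_unfold mult_ac)
 qed
 have i5: "integrable cylinder_measure ?F5"
  using integrable_cylinder_mult_continuous[OF ig cl(1)] by (simp add: case_prod_unfold mult_ac)
 have R: "integral\<^sup>L cylinder_measure ?F1 = (\<oint>y. u 1 y * l (1, y)) - integral\<^sup>L cylinder_measure ?F5"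
  by (rule cylinder_radial_by_parts[OF C Dl cl]) (simp add: l_def m)
 have T: "integral\<^sup>L cylinder_measure ?F3 = - integral\<^sup>L cylinder_measure ?F4 + (real ?d - 1) * integral\<^sup>L cylinder_measure ?F2"
 proof -
  have "(\<integral>(r, y). (r ^ m * r) * (u r y * (tangential y ((\<lambda>x. Dq (fst x *\<^sub>R snd x)) (r, y)) \<bullet> e)) \<partial>cylinder_measure) =
   - (\<integral>(r, y). r ^ m * ((\<lambda>x. q (fst x *\<^sub>R snd x)) (r, y) * (t r y \<bullet> e)) \<partial>cylinder_measure)
   + (real DIM('a) - 1) * (\<integral>(r, y). r ^ m * (u r y * (\<lambda>x. q (fst x *\<^sub>R snd x)) (r, y) * (y \<bullet> e)) \<partial>cylinder_measure)"
  proof (rule cylinder_tangential_by_parts[OF C e])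
   fix r :: real
   have "GDERIV (\<lambda>y. q (r *\<^sub>R y)) y :> r *\<^sub>R Dq (r *\<^sub>R y)" for y
    unfolding gderiv_def
   proof (rule has_derivative_subst[OF has_derivative_compose[where g=q and f="\<lambda>y. r *\<^sub>R y"]])
    show "((\<lambda>y. r *\<^sub>R y) has_derivative (\<lambda>h. r *\<^sub>R h)) (at y)" by (auto intro!: derivative_eq_intros)
    show "(q has_derivative (\<lambda>h. inner h (Dq (r *\<^sub>R y)))) (at (r *\<^sub>R y))" using gd by (simp add: gderiv_def)
   qed simp
   moreover have "continuous_on UNIV (\<lambda>y. r *\<^sub>R Dq (r *\<^sub>R y))"
    by (intro continuous_intros continuous_on_compose2[OF c(2)]) auto
   ultimately show "C1_gradient (\<lambda>y. (\<lambda>x. q (fst x *\<^sub>R snd x)) (r, y)) (\<lambda>y. r *\<^sub>R (\<lambda>x. Dq (fst x *\<^sub>R snd x)) (r, y))"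
    by (simp add: C1_gradient_def)
  qed (auto intro!: continuous_intros cs)
  then show ?thesis by simp
 qed
 have [measurable]: "q \<in> borel_measurable borel" "Dq \<in> borel_measurable borel"
  using c by (auto intro: borel_measurable_continuous_onI)
 note [measurable] = measurable_polar
 have h1: "(\<integral>x. polar k u x * (Dq x \<bullet> e) \<partial>ball_measure) = (\<integral>x. ?F1 x - real n * ?F2 x + ?F3 x \<partial>cylinder_measure)"
 proof -
  have mb: "(\<lambda>x. polar k u x * (Dq x \<bullet> e)) \<in> borel_measurable borel" by measurable
  have "(\<integral>x. polar k u x * (Dq x \<bullet> e) \<partial>ball_measure) =
   (\<integral>(r, y). r ^ (?d - 1) *\<^sub>R (polar k u (r *\<^sub>R y) * (Dq (r *\<^sub>R y) \<bullet> e)) \<partial>cylinder_measure)"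
   by (rule integral_polar[OF mb])
  also have "\<dots> = (\<integral>x. ?F1 x - real n * ?F2 x + ?F3 x \<partial>cylinder_measure)"
  proof (rule integral_cong_AE)
   show "(\<lambda>(r, y). r ^ (?d - 1) *\<^sub>R (polar k u (r *\<^sub>R y) * (Dq (r *\<^sub>R y) \<bullet> e))) \<in> borel_measurable cylinder_measure"
    by (rule measurable_cylinder) measurable
   show "(\<lambda>x. ?F1 x - real n * ?F2 x + ?F3 x) \<in> borel_measurable cylinder_measure"
    using i1 i2 i3 by (intro borel_measurable_add borel_measurable_diff borel_measurable_times borel_measurable_const borel_measurable_integrable)
   have "AE (r, y) in cylinder_measure. r ^ (?d - 1) *\<^sub>R (polar k u (r *\<^sub>R y) * (Dq (r *\<^sub>R y) \<bullet> e)) = ?F1 (r, y) - real n * ?F2 (r, y) + ?F3 (r, y)"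
   proof (rule AE_cylinder)
    fix r :: real and y :: 'a assume r: "0 < r" "norm y = 1"
    have "r ^ (?d - 1) *\<^sub>R (polar k u (r *\<^sub>R y) * (Dq (r *\<^sub>R y) \<bullet> e)) = (r ^ m * r) * u r y * (Dq (r *\<^sub>R y) \<bullet> e)"
     unfolding polar_def norm_sgn_polar[OF r] by (simp add: rn[symmetric])
    also have "\<dots> = ?F1 (r, y) - real n * ?F2 (r, y) + ?F3 (r, y)"
     by (simp add: l'_def tangential_inner m algebra_simps)
    finally show "r ^ (?d - 1) *\<^sub>R (polar k u (r *\<^sub>R y) * (Dq (r *\<^sub>R y) \<bullet> e)) = ?F1 (r, y) - real n * ?F2 (r, y) + ?F3 (r, y)" .
   qed
   then show "AE x in cylinder_measure. (case x of (r, y) \<Rightarrow> r ^ (?d - 1) *\<^sub>R (polar k u (r *\<^sub>R y) * (Dq (r *\<^sub>R y) \<bullet> e))) = ?F1 x - real n * ?F2 x + ?F3 x"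
    by eventually_elim (simp add: case_prod_unfold)
  qed
  finally show ?thesis .
 qed
 have h2: "(\<integral>x. q x * (polar_gradient k u g t x \<bullet> e) \<partial>ball_measure) = (\<integral>x. real k * ?F2 x + ?F4 x + ?F5 x \<partial>cylinder_measure)"
 proof -
  have mb: "(\<lambda>x. q x * (polar_gradient k u g t x \<bullet> e)) \<in> borel_measurable borel" by measurable
  have "(\<integral>x. q x * (polar_gradient k u g t x \<bullet> e) \<partial>ball_measure) =
   (\<integral>(r, y). r ^ (?d - 1) *\<^sub>R (q (r *\<^sub>R y) * (polar_gradient k u g t (r *\<^sub>R y) \<bullet> e)) \<partial>cylinder_measure)"
   by (rule integral_polar[OF mb])
  also have "\<dots> = (\<integral>x. real k * ?F2 x + ?F4 x + ?F5 x \<partial>cylinder_measure)"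
  proof (rule integral_cong_AE)
   show "(\<lambda>(r, y). r ^ (?d - 1) *\<^sub>R (q (r *\<^sub>R y) * (polar_gradient k u g t (r *\<^sub>R y) \<bullet> e))) \<in> borel_measurable cylinder_measure"
    by (rule measurable_cylinder) measurable
   show "(\<lambda>x. real k * ?F2 x + ?F4 x + ?F5 x) \<in> borel_measurable cylinder_measure"
    using i2 i4 i5 by (intro borel_measurable_add borel_measurable_times borel_measurable_const borel_measurable_integrable)
   have "AE (r, y) in cylinder_measure. r ^ (?d - 1) *\<^sub>R (q (r *\<^sub>R y) * (polar_gradient k u g t (r *\<^sub>R y) \<bullet> e)) = real k * ?F2 (r, y) + ?F4 (r, y) + ?F5 (r, y)"
   proof (rule AE_cylinder)
    fix r :: real and y :: 'a assume r: "0 < r" "norm y = 1"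
    have rm: "r ^ (?d - 1) * (r ^ k / r) = r ^ m" using rn[of r] r by (simp add: field_simps)
    have "r ^ (?d - 1) *\<^sub>R (q (r *\<^sub>R y) * (polar_gradient k u g t (r *\<^sub>R y) \<bullet> e)) =
     (r ^ (?d - 1) * (r ^ k / r)) * (q (r *\<^sub>R y) * (real k * u r y * (y \<bullet> e) + t r y \<bullet> e)) + (r ^ (?d - 1) * r ^ k) * (q (r *\<^sub>R y) * (g r y * (y \<bullet> e)))"
     unfolding polar_gradient_def norm_sgn_polar[OF r] by (simp add: inner_add_left algebra_simps)
    also have "\<dots> = real k * ?F2 (r, y) + ?F4 (r, y) + ?F5 (r, y)"
     unfolding rn rm by (simp add: l_def m algebra_simps)
    finally show "r ^ (?d - 1) *\<^sub>R (q (r *\<^sub>R y) * (polar_gradient k u g t (r *\<^sub>R y) \<bullet> e)) = real k * ?F2 (r, y) + ?F4 (r, y) + ?F5 (r, y)" .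
   qed
   then show "AE x in cylinder_measure. (case x of (r, y) \<Rightarrow> r ^ (?d - 1) *\<^sub>R (q (r *\<^sub>R y) * (polar_gradient k u g t (r *\<^sub>R y) \<bullet> e))) = real k * ?F2 x + ?F4 x + ?F5 x"
    by eventually_elim (simp add: case_prod_unfold)
  qed
  finally show ?thesis .
 qed
 have h1': "(\<integral>x. ?F1 x - real n * ?F2 x + ?F3 x \<partial>cylinder_measure) =
   integral\<^sup>L cylinder_measure ?F1 - real n * integral\<^sup>L cylinder_measure ?F2 + integral\<^sup>L cylinder_measure ?F3"
  by (subst Bochner_Integration.integral_add[OF Bochner_Integration.integrable_diff[OF i1 integrable_mult_right[OF i2]] i3],
    subst Bochner_Integration.integral_diff[OF i1 integrable_mult_right[OF i2]], subst integral_mult_right_zero) (rule refl)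
 have h2': "(\<integral>x. real k * ?F2 x + ?F4 x + ?F5 x \<partial>cylinder_measure) =
   real k * integral\<^sup>L cylinder_measure ?F2 + integral\<^sup>L cylinder_measure ?F4 + integral\<^sup>L cylinder_measure ?F5"
  by (subst Bochner_Integration.integral_add[OF Bochner_Integration.integrable_add[OF integrable_mult_right[OF i2] i4] i5],
    subst Bochner_Integration.integral_add[OF integrable_mult_right[OF i2] i4], subst integral_mult_right_zero) (rule refl)
 have coef: "real n = real k + (real ?d - 1)" unfolding n_def dd by (rule of_nat_add)
 have "(\<oint>y. u 1 y * l (1, y)) = (\<oint>y. u 1 y * q y * (y \<bullet> e))"
  by (rule Bochner_Integration.integral_cong) (simp_all add: l_def)
 moreover have "A1 - n * A2 + A3 + (k * A2 + A4 + A5) = U"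
  if "A1 = U - A5" "A3 = - A4 + D * A2" "n = k + D" for A1 A2 A3 A4 A5 U D n k :: real
  using that by (simp add: distrib_right)
 from this[OF R T coef] have "integral\<^sup>L cylinder_measure ?F1 - real n * integral\<^sup>L cylinder_measure ?F2 + integral\<^sup>L cylinder_measure ?F3 +
   (real k * integral\<^sup>L cylinder_measure ?F2 + integral\<^sup>L cylinder_measure ?F4 + integral\<^sup>L cylinder_measure ?F5) =
   (\<oint>y. u 1 y * l (1, y))" .
 ultimately show ?thesis unfolding h1 h2 h1' h2' by (rule trans[rotated])
qed

text \<open>Gauss-Green for all test functions settles both requirements at once: for those
  vanishing near the sphere the boundary integral drops out, which identifies the weak
  gradient.\<close>

theorem cylinder_curve_trace: "has_trace (polar k u) (cls (u 1))"
proof -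
 let ?h = "polar k u" and ?Dh = "polar_gradient k u g t"
 note ih = ball_square_integrable_imp_integrable[OF polar_square_integrable(1)]
 note iDh = ball_square_integrable_imp_integrable[OF polar_square_integrable(2)]
 have GG: "(\<integral>x. ?h x *\<^sub>R Dq x \<partial>ball_measure) + (\<integral>x. q x *\<^sub>R ?Dh x \<partial>ball_measure) =
      (\<oint>y. (rep (cls (u 1)) y * q y) *\<^sub>R y)"
  if C1: "C1_gradient q Dq" for q Dq
 proof (rule euclidean_eqI)
  fix e :: 'a assume e: "e \<in> Basis"
  note c = C1_gradient_continuous[OF C1, of UNIV]
  note j1 = integrable_ball_scaleR_continuous[OF ih c(2)]
  note j2 = integrable_ball_continuous_scaleR[OF iDh c(1)]
  have r1: "integrable sphere_measure (\<lambda>y. (rep (cls (u 1)) y * q y) *\<^sub>R y)"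
  proof -
   have "integrable sphere_measure (\<lambda>y. \<Sum>b\<in>Basis. (rep (cls (u 1)) y * (q y * (y \<bullet> b))) *\<^sub>R b)"
    by (intro Bochner_Integration.integrable_sum integrable_scaleR_left square_integrable_mult_integrable rep_l2_sphere_square_integrable
       square_integrable_sphere_continuous continuous_intros c(1))
   moreover have "(\<lambda>y. \<Sum>b\<in>Basis. (rep (cls (u 1)) y * (q y * (y \<bullet> b))) *\<^sub>R b)
    = (\<lambda>y. (rep (cls (u 1)) y * q y) *\<^sub>R y)"
   proof (rule ext)
    fix y :: 'a
    have "(\<Sum>b\<in>Basis. (rep (cls (u 1)) y * (q y * (y \<bullet> b))) *\<^sub>R b) =
     (rep (cls (u 1)) y * q y) *\<^sub>R (\<Sum>b\<in>Basis. (y \<bullet> b) *\<^sub>R b)"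
     by (simp add: scaleR_sum_right mult.assoc)
    then show "(\<Sum>b\<in>Basis. (rep (cls (u 1)) y * (q y * (y \<bullet> b))) *\<^sub>R b) = (rep (cls (u 1)) y * q y) *\<^sub>R y"
     by (simp add: euclidean_representation)
   qed
   ultimately show ?thesis by simp
  qed
  have "(\<oint>y. (rep (cls (u 1)) y * q y) *\<^sub>R y) \<bullet> e =
   (\<oint>y. rep (cls (u 1)) y * q y * (y \<bullet> e))"
   using integral_inner_left[OF r1, of e] by simp
  also have "\<dots> = (\<oint>y. u 1 y * q y * (y \<bullet> e))"
  proof (rule integral_cong_AE)
   have [measurable]: "q \<in> borel_measurable borel" using c by (auto intro: borel_measurable_continuous_onI)
   have [measurable]: "u 1 \<in> borel_measurable borel"
    using cylinder_curve_facts(7) unfolding square_integrable_def measurable_cong_sets[OF sets_sphere_measure refl] by blast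
   show "(\<lambda>y. rep (cls (u 1)) y * q y * (y \<bullet> e)) \<in> borel_measurable sphere_measure" by measurable
   show "(\<lambda>y. u 1 y * q y * (y \<bullet> e)) \<in> borel_measurable sphere_measure" by measurable
   show "AE y in sphere_measure. rep (cls (u 1)) y * q y * (y \<bullet> e) = u 1 y * q y * (y \<bullet> e)"
    using AE_rep_abs_l2_sphere[OF cylinder_curve_facts(7)] by eventually_elim simp
  qed
  finally show "((\<integral>x. ?h x *\<^sub>R Dq x \<partial>ball_measure) + (\<integral>x. q x *\<^sub>R ?Dh x \<partial>ball_measure)) \<bullet> e =
      (\<oint>y. (rep (cls (u 1)) y * q y) *\<^sub>R y) \<bullet> e"
   using polar_Gauss_Green_component[OF C1 e] integral_inner_left[OF j1, of e] integral_inner_left[OF j2, of e]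
   by (simp add: inner_add_left)
 qed
 have "weak_gradient_ball ?h ?Dh"
  unfolding weak_gradient_ball_def
 proof (intro conjI allI impI polar_square_integrable)
  fix q :: "'a \<Rightarrow> real" and Dq assume H: "C1_gradient q Dq \<and> (\<exists>j<1. \<forall>x. j \<le> norm x \<longrightarrow> q x = 0)"
  then have z: "q y = 0" if "norm y = 1" for y using that by fastforce
  have "(\<oint>y. (rep (cls (u 1)) y * q y) *\<^sub>R y) = 0"
   by (rule integral_eq_zero_AE) (use AE_sphere_measure_norm in \<open>auto elim!: eventually_mono simp: z\<close>)
  then show "(\<integral>x. ?h x *\<^sub>R Dq x \<partial>ball_measure) = - (\<integral>x. q x *\<^sub>R ?Dh x \<partial>ball_measure)"
   using GG[of q Dq] H by (simp add: eq_neg_iff_add_eq_0)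
 qed
 then show ?thesis unfolding has_trace_def using GG by blast
qed

end

section \<open>Dilations and traces on smaller spheres\<close>

lemma cylinder_integrable_dilate:
 fixes f :: "real \<times> 'a::euclidean_space \<Rightarrow> real"
 assumes f[measurable]: "f \<in> borel_measurable (borel \<Otimes>\<^sub>M borel)" and i: "integrable cylinder_measure f"
  and a: "0 < a" "a \<le> 1"
 shows "integrable cylinder_measure (\<lambda>(r, y). f (a * r, y))"
proof (rule integrableI_bounded)
 let ?I = "unit_lebesgue"
 show m: "(\<lambda>(r, y). f (a * r, y)) \<in> borel_measurable cylinder_measure"
  by (rule measurable_cylinder) measurable
 define F where "F r = (\<integral>\<^sup>+y. ennreal (norm (f (r, y))) \<partial>sphere_measure)" for r
 have F[measurable]: "F \<in> borel_measurable borel" unfolding F_def by measurable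
 define H where "H r = F r * indicator {0..1} r" for r
 have H[measurable]: "H \<in> borel_measurable borel" unfolding H_def by measurable
 have "(\<integral>\<^sup>+x. ennreal (norm (f x)) \<partial>cylinder_measure) = (\<integral>\<^sup>+r. \<integral>\<^sup>+y. ennreal (norm (f (r, y))) \<partial>sphere_measure \<partial>?I)"
  by (rule sphere_measure.nn_integral_fst[symmetric]) (use measurable_cylinder[OF f] in measurable)
 also have "\<dots> = (\<integral>\<^sup>+r. H r \<partial>lborel)"
  unfolding H_def F_def by (rule nn_integral_restrict_space) simp
 finally have H1: "(\<integral>\<^sup>+r. H r \<partial>lborel) < \<infinity>" using i unfolding integrable_iff_bounded by simp
 have H2: "(\<integral>\<^sup>+r. H r \<partial>lborel) = ennreal a * (\<integral>\<^sup>+r. H (0 + a * r) \<partial>lborel)"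
  using nn_integral_real_affine[OF H, of a 0] a by simp
 have "(\<integral>\<^sup>+x. ennreal (norm (case x of (r, y) \<Rightarrow> f (a * r, y))) \<partial>cylinder_measure)
   = (\<integral>\<^sup>+r. \<integral>\<^sup>+y. ennreal (norm (case (r, y) of (r, y) \<Rightarrow> f (a * r, y))) \<partial>sphere_measure \<partial>?I)"
  by (rule sphere_measure.nn_integral_fst[symmetric]) (use m in measurable)
 also have "\<dots> = (\<integral>\<^sup>+r. F (a * r) \<partial>?I)" by (simp add: F_def)
 also have "\<dots> = (\<integral>\<^sup>+r. F (a * r) * indicator {0..1} r \<partial>lborel)"
  by (rule nn_integral_restrict_space) simp
 also have "\<dots> \<le> (\<integral>\<^sup>+r. H (0 + a * r) \<partial>lborel)"
  by (rule nn_integral_mono) (use a in \<open>auto simp: H_def indicator_def mult_le_one\<close>)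
 also have "\<dots> < \<infinity>"
  using H1 H2 a by (auto simp: ennreal_mult_less_top ennreal_mult_eq_top_iff less_top)
 finally show "(\<integral>\<^sup>+x. ennreal (norm (case x of (r, y) \<Rightarrow> f (a * r, y))) \<partial>cylinder_measure) < \<infinity>" .
qed

lemma AE_dilate:
 assumes P: "AE r in lborel. r \<in> {0..1::real} \<longrightarrow> P r" and a: "0 < a" "a \<le> 1"
 shows "AE r in lborel. r \<in> {0..1} \<longrightarrow> P (a * r)"
proof -
 obtain N where N: "{r \<in> space lborel. \<not> (r \<in> {0..1} \<longrightarrow> P r)} \<subseteq> N" "emeasure lborel N = 0" "N \<in> sets lborel"
  using P by (rule AE_E)
 then have "AE r in lborel. r \<notin> N" by (intro AE_not_in null_setsI)
 moreover have "Measurable.pred borel (\<lambda>r. r \<notin> N)" using N(3) by simp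
 ultimately have "AE r in lborel. 0 + a * r \<notin> N" using AE_borel_affine[of a "\<lambda>r. r \<notin> N" 0] a by simp
 then show ?thesis
 proof eventually_elim
  case (elim r)
  show ?case
  proof
   assume "r \<in> {0..1}"
   then have "a * r \<in> {0..1}" using a by (auto simp: mult_le_one)
   then show "P (a * r)" using elim N(1) by auto
  qed
 qed
qed

lemma set_integral_dilate:
 fixes f :: "real \<Rightarrow> real"
 assumes f: "integrable unit_lebesgue f" and p: "0 < p" "p \<le> 1" and r: "r \<in> {0..1}"
 shows "(LINT s:{p * r..1}|lborel. f s) = p * (LINT s:{r..1}|lborel. f (p * s)) + (LINT s:{p..1}|lborel. f s)"
proof -
 have fi: "set_integrable lborel {0..1} f" using f integrable_unit_interval by blast
 have sub: "set_integrable lborel {a..b} f" if "0 \<le> a" "b \<le> 1" for a b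
  by (rule set_integrable_subset[OF fi]) (use that in auto)
 have rp: "p * r \<le> p" "0 \<le> p * r" using r p by (auto simp: mult_left_le)
 have i1: "integrable lborel (\<lambda>s. indicator {p * r..p} s *\<^sub>R f s)" and i2: "integrable lborel (\<lambda>s. indicator {p..1} s *\<^sub>R f s)"
  and i3: "integrable lborel (\<lambda>s. indicator {p * r..1} s *\<^sub>R f s)"
  using sub[of "p * r" p] sub[of p 1] sub[of "p * r" 1] rp p by (auto simp: set_integrable_def)
 have "(LINT s:{p * r..1}|lborel. f s) = (\<integral>s. indicator {p * r..p} s *\<^sub>R f s + indicator {p..1} s *\<^sub>R f s \<partial>lborel)"
  unfolding set_lebesgue_integral_def
 proof (rule integral_cong_AE)
  show "(\<lambda>s. indicator {p * r..1} s *\<^sub>R f s) \<in> borel_measurable lborel" using i3 by auto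
  show "(\<lambda>s. indicator {p * r..p} s *\<^sub>R f s + indicator {p..1} s *\<^sub>R f s) \<in> borel_measurable lborel"
   using borel_measurable_add[OF borel_measurable_integrable[OF i1] borel_measurable_integrable[OF i2]] .
  show "AE s in lborel. indicator {p * r..1} s *\<^sub>R f s = indicator {p * r..p} s *\<^sub>R f s + indicator {p..1} s *\<^sub>R f s"
   using AE_lborel_singleton[of p]
  proof eventually_elim
   case (elim s)
   have "p \<le> s \<Longrightarrow> p * r \<le> s" using rp(1) by linarith
   then show ?case using elim p by (auto simp: indicator_def)
  qed
 qed
 also have "\<dots> = (\<integral>s. indicator {p * r..p} s *\<^sub>R f s \<partial>lborel) + (LINT s:{p..1}|lborel. f s)"
  unfolding set_lebesgue_integral_def by (rule Bochner_Integration.integral_add[OF i1 i2])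
 also have "(\<integral>s. indicator {p * r..p} s *\<^sub>R f s \<partial>lborel) = \<bar>p\<bar> *\<^sub>R (\<integral>s. indicator {p * r..p} (0 + p * s) *\<^sub>R f (0 + p * s) \<partial>lborel)"
  using p by (intro lborel_integral_real_affine) auto
 also have "\<dots> = p * (LINT s:{r..1}|lborel. f (p * s))"
  using p unfolding set_lebesgue_integral_def
  by (auto intro!: Bochner_Integration.integral_cong simp: indicator_def)
 finally show ?thesis .
qed

text \<open>If h is \<open>polar k u\<close>, then x \<mapsto> h(q x) is \<open>polar k\<close> of
  the rescaled curve: the power q^k comes from the factor r^k, one further q in the radial
  derivative from the chain rule. Traces of the rescaled curves are therefore slices of h.\<close>

theorem cylinder_curve_dilate:
 fixes u :: "real \<Rightarrow> 'a::euclidean_space \<Rightarrow> real"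
 assumes C: "cylinder_curve u g t" and q: "0 < q" "q \<le> 1"
 shows "cylinder_curve (\<lambda>r y. q ^ k * u (q * r) y) (\<lambda>r y. q ^ Suc k * g (q * r) y) (\<lambda>r y. q ^ k *\<^sub>R t (q * r) y)"
proof -
 have mu[measurable]: "(\<lambda>(r, y). u r y) \<in> borel_measurable (borel \<Otimes>\<^sub>M borel)"
  and mg[measurable]: "(\<lambda>(r, y). g r y) \<in> borel_measurable (borel \<Otimes>\<^sub>M borel)"
  and mt[measurable]: "(\<lambda>(r, y). t r y) \<in> borel_measurable (borel \<Otimes>\<^sub>M borel)"
  and squ: "L2_cylinder u"
  and sqg: "L2_cylinder g"
  and sqt: "L2_cylinder t"
  and sqs: "\<And>r. r \<in> {0..1} \<Longrightarrow> L2_sphere (u r)"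
  and ac: "AE y in sphere_measure. \<forall>r\<in>{0..1}. u r y = u 1 y - (LINT s:{r..1}|lborel. g s y)"
  and td: "AE r in lborel. r \<in> {0..1} \<longrightarrow> (\<forall>e\<in>Basis. \<forall>h Dh. C1_gradient h Dh \<longrightarrow>
    (\<oint>y. u r y * (tangential y (Dh y) \<bullet> e)) =
    - (\<oint>y. (t r y \<bullet> e) * h y)
    + (real DIM('a) - 1) * (\<oint>y. u r y * h y * (y \<bullet> e)))"
  using C by (auto simp: cylinder_curve_def)
 have p: "(\<lambda>x::real \<times> 'a. (q * fst x, snd x)) \<in> borel \<Otimes>\<^sub>M borel \<rightarrow>\<^sub>M borel \<Otimes>\<^sub>M borel" by measurable
 have m: "(\<lambda>x. u (q * fst x) (snd x)) \<in> borel_measurable (borel \<Otimes>\<^sub>M borel)"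
   "(\<lambda>x. g (q * fst x) (snd x)) \<in> borel_measurable (borel \<Otimes>\<^sub>M borel)"
   "(\<lambda>x. t (q * fst x) (snd x)) \<in> borel_measurable (borel \<Otimes>\<^sub>M borel)"
  using measurable_compose[OF p mu] measurable_compose[OF p mg] measurable_compose[OF p mt] by simp_all
 have m1: "(\<lambda>(r, y). q ^ k * u (q * r) y) \<in> borel_measurable (borel \<Otimes>\<^sub>M borel)"
   "(\<lambda>(r, y). q ^ Suc k * g (q * r) y) \<in> borel_measurable (borel \<Otimes>\<^sub>M borel)"
   "(\<lambda>(r, y). q ^ k *\<^sub>R t (q * r) y) \<in> borel_measurable (borel \<Otimes>\<^sub>M borel)"
  unfolding case_prod_unfold by (intro borel_measurable_times borel_measurable_scaleR borel_measurable_const m)+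
 have sq: "square_integrable cylinder_measure (\<lambda>(r, y). c *\<^sub>R f (q * r) y)"
  if f: "(\<lambda>(r, y). f r y) \<in> borel_measurable (borel \<Otimes>\<^sub>M borel)" "L2_cylinder f"
  for f :: "real \<Rightarrow> 'a \<Rightarrow> 'b::euclidean_space" and c
 proof -
  have n: "(\<lambda>x. (norm (f (fst x) (snd x)))\<^sup>2) \<in> borel_measurable (borel \<Otimes>\<^sub>M borel)"
   using f(1) by (intro borel_measurable_power borel_measurable_norm) (simp add: case_prod_unfold)
  have "integrable cylinder_measure (\<lambda>x. (norm (f (fst x) (snd x)))\<^sup>2)"
   using f(2) by (simp add: square_integrable_def case_prod_unfold)
  from cylinder_integrable_dilate[OF n this q]
  have "integrable cylinder_measure (\<lambda>x. (norm (f (q * fst x) (snd x)))\<^sup>2)" by (simp add: case_prod_unfold)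
  then have "integrable cylinder_measure (\<lambda>x. c\<^sup>2 * (norm (f (q * fst x) (snd x)))\<^sup>2)" by simp
  moreover have "(\<lambda>x. c *\<^sub>R f (q * fst x) (snd x)) \<in> borel_measurable cylinder_measure"
   using measurable_compose[OF p f(1)] by (intro measurable_cylinder borel_measurable_scaleR borel_measurable_const) simp
  ultimately show ?thesis by (simp add: square_integrable_def case_prod_unfold power_mult_distrib)
 qed
 have sq1: "square_integrable cylinder_measure (\<lambda>(r, y). q ^ k * u (q * r) y)"
   "square_integrable cylinder_measure (\<lambda>(r, y). q ^ Suc k * g (q * r) y)"
   "square_integrable cylinder_measure (\<lambda>(r, y). q ^ k *\<^sub>R t (q * r) y)"
  using sq[OF mu squ, of "q ^ k"] sq[OF mg sqg, of "q ^ Suc k"] sq[OF mt sqt, of "q ^ k"] by simp_all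
 have sqs1: "L2_sphere (\<lambda>y. q ^ k * u (q * r) y)" if "r \<in> {0..1}" for r
  using that q by (intro square_integrable_scale sqs) (auto simp: mult_le_one)
 have ig0: "AE y in sphere_measure. integrable unit_lebesgue (\<lambda>r. g r y)"
  using cylinder.AE_integrable_snd[OF cylinder_square_integrable_imp_integrable[OF sqg]] by simp
 have ac1: "AE y in sphere_measure. \<forall>r\<in>{0..1}. q ^ k * u (q * r) y = q ^ k * u (q * 1) y - (LINT s:{r..1}|lborel. q ^ Suc k * g (q * s) y)"
  using ac ig0
 proof eventually_elim
  case (elim y)
  show ?case
  proof
   fix r :: real assume r: "r \<in> {0..1}"
   have "q * r \<in> {0..1}" "q \<in> {0..1}" using r q by (auto simp: mult_le_one)
   then have u1: "u (q * r) y = u 1 y - (LINT s:{q * r..1}|lborel. g s y)"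
    and u2: "u q y = u 1 y - (LINT s:{q..1}|lborel. g s y)" using elim(1) by blast+
   have "u (q * r) y = u q y - q * (LINT s:{r..1}|lborel. g (q * s) y)"
    unfolding u1 u2 set_integral_dilate[OF elim(2) q r] by simp
   moreover have "(LINT s:{r..1}|lborel. q ^ Suc k * g (q * s) y) = q ^ Suc k * (LINT s:{r..1}|lborel. g (q * s) y)"
    by (rule set_integral_mult_right)
   ultimately show "q ^ k * u (q * r) y = q ^ k * u (q * 1) y - (LINT s:{r..1}|lborel. q ^ Suc k * g (q * s) y)"
    by (simp only: mult_1_right right_diff_distrib power_Suc mult.assoc mult.left_commute)
  qed
 qed
 have td1: "AE r in lborel. r \<in> {0..1} \<longrightarrow> (\<forall>e\<in>Basis. \<forall>h Dh. C1_gradient h Dh \<longrightarrow>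
    (\<oint>y. (q ^ k * u (q * r) y) * (tangential y (Dh y) \<bullet> e)) =
    - (\<oint>y. ((q ^ k *\<^sub>R t (q * r) y) \<bullet> e) * h y)
    + (real DIM('a) - 1) * (\<oint>y. (q ^ k * u (q * r) y) * h y * (y \<bullet> e)))"
  using AE_dilate[OF td q]
 proof eventually_elim
  case (elim r)
  show ?case
  proof (intro impI ballI allI)
   fix e :: 'a and h :: "'a \<Rightarrow> real" and Dh :: "'a \<Rightarrow> 'a" assume a: "r \<in> {0..1}" "e \<in> Basis" "C1_gradient h Dh"
   then have "(\<oint>y. u (q * r) y * (tangential y (Dh y) \<bullet> e)) =
    - (\<oint>y. (t (q * r) y \<bullet> e) * h y)
    + (real DIM('a) - 1) * (\<oint>y. u (q * r) y * h y * (y \<bullet> e))"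
    using elim by blast
   then have "q ^ k * (\<oint>y. u (q * r) y * (tangential y (Dh y) \<bullet> e)) =
    - (q ^ k * (\<oint>y. (t (q * r) y \<bullet> e) * h y))
    + (real DIM('a) - 1) * (q ^ k * (\<oint>y. u (q * r) y * h y * (y \<bullet> e)))"
    by (simp add: right_diff_distrib mult.left_commute)
   then show "(\<oint>y. (q ^ k * u (q * r) y) * (tangential y (Dh y) \<bullet> e)) =
    - (\<oint>y. ((q ^ k *\<^sub>R t (q * r) y) \<bullet> e) * h y)
    + (real DIM('a) - 1) * (\<oint>y. (q ^ k * u (q * r) y) * h y * (y \<bullet> e))"
    by (simp add: mult.assoc)
  qed
 qed
 show ?thesis unfolding cylinder_curve_def using m1 sq1 sqs1 ac1 td1 by blast
qed

theorem cylinder_curve_slice: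
 fixes u :: "real \<Rightarrow> 'a::euclidean_space \<Rightarrow> real"
 assumes C: "cylinder_curve u g t" and d: "2 \<le> DIM('a)" "3 \<le> 2 * k + DIM('a)" and a: "0 < a" "a \<le> 1"
 shows "has_slice (polar k u) a (a ^ k *\<^sub>R cls (u a))"
proof -
 have sq: "L2_sphere (u a)" using C a by (auto simp: cylinder_curve_def)
 have eq: "(\<lambda>x. polar k u (a *\<^sub>R x)) = polar k (\<lambda>r y. a ^ k * u (a * r) y)"
  using a by (intro ext) (simp add: polar_def sgn_scaleR power_mult_distrib mult_ac)
 have "has_trace (polar k (\<lambda>r y. a ^ k * u (a * r) y)) (cls (\<lambda>y. a ^ k * u (a * 1) y))"
  by (rule cylinder_curve_trace[OF cylinder_curve_dilate[OF C a] d])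
 then show ?thesis
  unfolding has_slice_def eq using abs_l2_sphere_scale[OF sq, of "a ^ k"] by simp
qed

section \<open>Curves in L^2 realised as functions on the cylinder\<close>

lemma unit_interval_jensen:
 fixes h :: "real \<Rightarrow> real"
 assumes h: "integrable unit_lebesgue h" and h2: "integrable unit_lebesgue (\<lambda>s. (h s)\<^sup>2)"
 shows "(\<integral>s. h s \<partial>unit_lebesgue)\<^sup>2 \<le> (\<integral>s. (h s)\<^sup>2 \<partial>unit_lebesgue)"
proof -
 let ?I = "unit_lebesgue"
 define m where "m = (\<integral>s. h s \<partial>?I)"
 have one: "(\<integral>s. c \<partial>?I) = c" for c :: real
  unfolding integral_unit_interval set_lebesgue_integral_def by simp
 have i1: "integrable ?I (\<lambda>s. 2 * m * h s)" and i2: "integrable ?I (\<lambda>s. m\<^sup>2)" using h by auto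
 have "0 \<le> (\<integral>s. (h s - m)\<^sup>2 \<partial>?I)" by simp
 also have "\<dots> = (\<integral>s. ((h s)\<^sup>2 - 2 * m * h s) + m\<^sup>2 \<partial>?I)"
  by (rule Bochner_Integration.integral_cong) (simp_all add: power2_diff algebra_simps)
 also have "\<dots> = (\<integral>s. (h s)\<^sup>2 \<partial>?I) - 2 * m * m + m\<^sup>2"
  by (subst Bochner_Integration.integral_add[OF Bochner_Integration.integrable_diff[OF h2 i1] i2],
    subst Bochner_Integration.integral_diff[OF h2 i1], subst one, subst integral_mult_right_zero) (simp add: m_def)
 finally show ?thesis by (simp add: m_def power2_eq_square)
qed

lemma joint_square_integrable:
 fixes W :: "real \<Rightarrow> 'a::euclidean_space \<Rightarrow> real"
 assumes m: "(\<lambda>(r, y). W r y) \<in> borel_measurable (borel \<Otimes>\<^sub>M borel)" and sq: "\<And>r. L2_sphere (W r)"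
  and i: "set_integrable lborel {0..1} (\<lambda>r. (norm (cls (W r)))\<^sup>2)"
 shows "L2_cylinder W"
proof -
 have m2: "(\<lambda>x. (W (fst x) (snd x))\<^sup>2) \<in> borel_measurable cylinder_measure"
  using m by (intro measurable_cylinder borel_measurable_power) (simp add: case_prod_unfold)
 have "integrable cylinder_measure (\<lambda>x. (W (fst x) (snd x))\<^sup>2)"
 proof (rule cylinder.Fubini_integrable[OF m2])
  show "integrable unit_lebesgue (\<lambda>r. \<integral>y. norm ((W (fst (r, y)) (snd (r, y)))\<^sup>2) \<partial>sphere_measure)"
   using i by (simp add: integrable_unit_interval norm_abs_l2_sphere[OF sq])
  show "AE r in unit_lebesgue. integrable sphere_measure (\<lambda>y. (W (fst (r, y)) (snd (r, y)))\<^sup>2)"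
   using sq by (simp add: square_integrable_def)
 qed
 then show ?thesis using measurable_cylinder[OF m] by (simp add: square_integrable_def case_prod_unfold)
qed

text \<open>A jointly measurable representative \<open>g\<close> is taken for the derivative and
  integrated back from r = 1, so \<open>u\<close> satisfies the primitive formula by construction.
  Testing with an arbitrary \<open>x\<close> and Fubini show that \<open>u r\<close> represents
  \<open>w r\<close>.\<close>

theorem curve_representation:
 fixes w w' :: "real \<Rightarrow> 'a::euclidean_space l2_sphere" and T :: "'a \<Rightarrow> real \<Rightarrow> 'a l2_sphere"
 assumes mw': "w' \<in> borel_measurable borel" and mT: "\<And>e. e \<in> Basis \<Longrightarrow> T e \<in> borel_measurable borel"
  and iw': "set_integrable lborel {0..1} (\<lambda>r. (norm (w' r))\<^sup>2)"
  and iT: "\<And>e. e \<in> Basis \<Longrightarrow> set_integrable lborel {0..1} (\<lambda>r. (norm (T e r))\<^sup>2)"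
  and prim: "\<And>r x. r \<in> {0..1} \<Longrightarrow> w r \<bullet> x = w 1 \<bullet> x - (LINT s:{r..1}|lborel. w' s \<bullet> x)"
  and td: "AE r in lborel. r \<in> {0..1} \<longrightarrow> (\<forall>e\<in>Basis. has_tangential_derivative (w r) e (T e r))"
 obtains u g t where "cylinder_curve u g t" "\<And>r. r \<in> {0..1} \<Longrightarrow> cls (u r) = w r"
  "\<And>r. L2_sphere (g r)" "\<And>r. cls (g r) = w' r"
proof -
 let ?I = "unit_lebesgue"
 obtain g where mg: "(\<lambda>(r, z). g r z) \<in> borel_measurable (borel \<Otimes>\<^sub>M borel)"
  and gs: "\<And>r. L2_sphere (g r)" and ga: "\<And>r. cls (g r) = w' r"
  using joint_representative[OF mw'] by blast
 have "\<forall>e\<in>Basis. \<exists>J. (\<lambda>(r, z). J r z) \<in> borel_measurable (borel \<Otimes>\<^sub>M borel) \<and>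
   (\<forall>r. L2_sphere (J r)) \<and> (\<forall>r. cls (J r) = T e r)"
  using joint_representative[OF mT] by metis
 then obtain J where mJ: "\<And>e. e \<in> Basis \<Longrightarrow> (\<lambda>(r, z). J e r z) \<in> borel_measurable (borel \<Otimes>\<^sub>M borel)"
  and Js: "\<And>e r. e \<in> Basis \<Longrightarrow> L2_sphere (J e r)"
  and Ja: "\<And>e r. e \<in> Basis \<Longrightarrow> cls (J e r) = T e r"
  by (subst (asm) bchoice_iff) blast
 have sqg: "L2_cylinder g"
  by (rule joint_square_integrable[OF mg gs]) (simp add: ga iw')
 have sqJ: "square_integrable cylinder_measure (\<lambda>(r, z). J e r z)" if "e \<in> Basis" for e
  by (rule joint_square_integrable[OF mJ[OF that] Js[OF that]]) (simp add: Ja that iT)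
 define u where "u r z = rep (w 1) z - (LINT s:{r..1}|lborel. g s z)" for r z
 define t where "t r z = (\<Sum>e\<in>Basis. J e r z *\<^sub>R e)" for r z
 have te: "t r z \<bullet> e = J e r z" if "e \<in> Basis" for r z e
  using that by (simp add: t_def inner_sum_left inner_Basis if_distrib cong: if_cong)
 have mt: "(\<lambda>(r, z). t r z) \<in> borel_measurable (borel \<Otimes>\<^sub>M borel)"
  unfolding t_def case_prod_unfold
  by (intro borel_measurable_sum borel_measurable_scaleR borel_measurable_const) (use mJ in \<open>simp add: case_prod_unfold\<close>)
 have mu: "(\<lambda>(r, z). u r z) \<in> borel_measurable (borel \<Otimes>\<^sub>M borel)"
 proof -
  have q: "(\<lambda>p::(real \<times> 'a) \<times> real. (snd p, snd (fst p))) \<in> (borel \<Otimes>\<^sub>M borel) \<Otimes>\<^sub>M lborel \<rightarrow>\<^sub>M borel \<Otimes>\<^sub>M borel"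
   by measurable
  have [measurable]: "(\<lambda>p::(real \<times> 'a) \<times> real. g (snd p) (snd (fst p))) \<in> borel_measurable ((borel \<Otimes>\<^sub>M borel) \<Otimes>\<^sub>M lborel)"
   using measurable_compose[OF q mg] by simp
  have "(\<lambda>p::(real \<times> 'a) \<times> real. (if fst (fst p) \<le> snd p \<and> snd p \<le> 1 then 1 else 0) *\<^sub>R g (snd p) (snd (fst p)))
    \<in> borel_measurable ((borel \<Otimes>\<^sub>M borel) \<Otimes>\<^sub>M lborel)" by measurable
  then have "(\<lambda>(x, s). (if fst x \<le> s \<and> s \<le> 1 then 1 else 0) *\<^sub>R g s (snd x))
    \<in> borel_measurable ((borel \<Otimes>\<^sub>M borel) \<Otimes>\<^sub>M lborel)" by (simp add: case_prod_unfold)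
  then have "(\<lambda>x::real \<times> 'a. \<integral>s. (if fst x \<le> s \<and> s \<le> 1 then 1 else 0) *\<^sub>R g s (snd x) \<partial>lborel) \<in> borel_measurable (borel \<Otimes>\<^sub>M borel)"
   by (rule lborel.borel_measurable_lebesgue_integral)
  moreover have "(\<integral>s. (if fst x \<le> s \<and> s \<le> 1 then 1 else 0) *\<^sub>R g s (snd x) \<partial>lborel) = (LINT s:{fst x..1}|lborel. g s (snd x))" for x :: "real \<times> 'a"
   unfolding set_lebesgue_integral_def by (intro Bochner_Integration.integral_cong) (auto simp: indicator_def)
  ultimately have "(\<lambda>x::real \<times> 'a. LINT s:{fst x..1}|lborel. g s (snd x)) \<in> borel_measurable (borel \<Otimes>\<^sub>M borel)" by (simp only:)
  then show ?thesis unfolding u_def case_prod_unfold by measurable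
 qed
 define Q where "Q z = (\<integral>s. (g s z)\<^sup>2 \<partial>?I)" for z
 have ig2: "integrable cylinder_measure (\<lambda>(r, z). (g r z)\<^sup>2)"
  using sqg by (simp add: square_integrable_def case_prod_unfold)
 have iQ: "integrable sphere_measure Q"
  using cylinder.integrable_snd[OF ig2] by (simp add: Q_def[abs_def])
 have ig: "integrable cylinder_measure (\<lambda>(r, z). g r z)" by (rule cylinder_square_integrable_imp_integrable[OF sqg])
 \<comment> \<open>Jensen's inequality bounds the square of \<open>u\<close> by \<open>b\<close> for
   all r at once, in almost every direction; this gives square integrability of each slice and on
   the cylinder.\<close>
 define b where "b z = 2 * (rep (w 1) z)\<^sup>2 + 2 * Q z" for z
 have ib: "integrable sphere_measure b"
  using iQ rep_l2_sphere_square_integrable[of "w 1"] unfolding b_def[abs_def] by (simp add: square_integrable_def)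
 have bound: "AE z in sphere_measure. \<forall>r\<in>{0..1}. (u r z)\<^sup>2 \<le> b z"
  using cylinder.AE_integrable_snd[OF ig] cylinder.AE_integrable_snd[OF ig2]
 proof eventually_elim
  case (elim z)
  show ?case
  proof
   fix r :: real assume r: "r \<in> {0..1}"
   define h where "h s = indicator {r..1} s * g s z" for s
   have ind: "(\<lambda>s. indicator {r..1} s :: real) \<in> borel_measurable ?I" by (rule measurable_restrict_space1) simp
   have gm: "(\<lambda>s. g s z) \<in> borel_measurable ?I" using elim(1) by auto
   have hi: "integrable ?I h"
    by (rule Bochner_Integration.integrable_bound[OF elim(1)])
     (use ind gm in \<open>auto simp: h_def[abs_def] indicator_def intro!: AE_I2\<close>)
   have hi2: "integrable ?I (\<lambda>s. (h s)\<^sup>2)"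
    by (rule Bochner_Integration.integrable_bound[OF elim(2)])
     (use ind gm in \<open>auto simp: h_def[abs_def] indicator_def intro!: AE_I2\<close>)
   have eq: "(LINT s:{r..1}|lborel. g s z) = (\<integral>s. h s \<partial>?I)"
    unfolding integral_unit_interval set_lebesgue_integral_def h_def
    by (rule Bochner_Integration.integral_cong) (use r in \<open>auto simp: indicator_def\<close>)
   have "(\<integral>s. h s \<partial>?I)\<^sup>2 \<le> (\<integral>s. (h s)\<^sup>2 \<partial>?I)" by (rule unit_interval_jensen[OF hi hi2])
   also have "\<dots> \<le> Q z" unfolding Q_def
    by (rule integral_mono[OF hi2 elim(2)]) (auto simp: h_def indicator_def)
   finally have "(LINT s:{r..1}|lborel. g s z)\<^sup>2 \<le> Q z" unfolding eq .
   then show "(u r z)\<^sup>2 \<le> b z"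
    using square_add_le[of "rep (w 1) z" "- (LINT s:{r..1}|lborel. g s z)"] by (simp add: u_def b_def)
  qed
 qed
 have mur: "u r \<in> borel_measurable sphere_measure" for r
  using measurable_compose[OF measurable_Pair1'[of r borel borel] mu] by simp
 have us: "L2_sphere (u r)" if "r \<in> {0..1}" for r
 proof -
  have "integrable sphere_measure (\<lambda>z. (norm (u r z))\<^sup>2)"
  proof (rule Bochner_Integration.integrable_bound[OF ib])
   show "AE z in sphere_measure. norm ((norm (u r z))\<^sup>2) \<le> norm (b z)"
    using bound
   proof eventually_elim
    case (elim z)
    then have "(u r z)\<^sup>2 \<le> b z" using that by blast
    then show ?case by simp
   qed
  qed (use mur in measurable)
  then show ?thesis using mur by (simp add: square_integrable_def)
 qed
 have squ: "L2_cylinder u"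
 proof -
  have ibc: "integrable cylinder_measure (\<lambda>(r::real, z). 1 * b z)"
   by (rule integral_cylinder_mult(1)[OF _ ib]) simp
  have bm: "b \<in> borel_measurable borel" using ib by auto
  have "integrable cylinder_measure (\<lambda>x. (norm (u (fst x) (snd x)))\<^sup>2)"
  proof (rule Bochner_Integration.integrable_bound[OF ibc])
   show "(\<lambda>x. (norm (u (fst x) (snd x)))\<^sup>2) \<in> borel_measurable cylinder_measure"
    using mu by (intro measurable_cylinder borel_measurable_power borel_measurable_norm) (simp add: case_prod_unfold)
   show "AE x in cylinder_measure. norm ((norm (u (fst x) (snd x)))\<^sup>2) \<le> norm (case x of (r, z) \<Rightarrow> 1 * b z)"
   proof (rule cylinder.AE_pair_measure)
    have m1: "(\<lambda>x. (norm (u (fst x) (snd x)))\<^sup>2) \<in> borel_measurable cylinder_measure"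
     using mu by (intro measurable_cylinder borel_measurable_power borel_measurable_norm) (simp add: case_prod_unfold)
    have m2: "(\<lambda>(r::real, z). 1 * b z) \<in> borel_measurable cylinder_measure" using ibc by auto
    show "{x \<in> space cylinder_measure. norm ((norm (u (fst x) (snd x)))\<^sup>2) \<le> norm (case x of (r, z) \<Rightarrow> 1 * b z)} \<in> sets cylinder_measure"
     by (rule borel_measurable_le) (use m1 m2 in measurable)
    show "AE r in ?I. AE z in sphere_measure. norm ((norm (u (fst (r, z)) (snd (r, z))))\<^sup>2) \<le> norm (case (r, z) of (r, z) \<Rightarrow> 1 * b z)"
    proof (rule AE_I2)
     fix r :: real assume "r \<in> space ?I"
     then have r: "r \<in> {0..1}" by (simp add: space_restrict_space)
     show "AE z in sphere_measure. norm ((norm (u (fst (r, z)) (snd (r, z))))\<^sup>2) \<le> norm (case (r, z) of (r, z) \<Rightarrow> 1 * b z)"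
      using bound
     proof eventually_elim
      case (elim z)
      then have "(u r z)\<^sup>2 \<le> b z" using r by blast
      then show ?case by simp
     qed
    qed
   qed
  qed
  then show ?thesis using measurable_cylinder[OF mu] by (simp add: square_integrable_def case_prod_unfold)
 qed
 have sqt: "L2_cylinder t"
 proof -
  have "integrable cylinder_measure (\<lambda>x. \<Sum>e\<in>Basis. (J e (fst x) (snd x))\<^sup>2)"
   using sqJ by (intro Bochner_Integration.integrable_sum) (simp add: square_integrable_def case_prod_unfold)
  moreover have "(norm (t r z))\<^sup>2 = (\<Sum>e\<in>Basis. (J e r z)\<^sup>2)" for r z
  proof -
   have "(norm (t r z))\<^sup>2 = (\<Sum>e\<in>Basis. (t r z \<bullet> e) * (t r z \<bullet> e))"
    unfolding power2_norm_eq_inner by (rule euclidean_inner)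
   also have "\<dots> = (\<Sum>e\<in>Basis. (J e r z)\<^sup>2)"
    by (rule sum.cong) (simp_all add: te power2_eq_square)
   finally show ?thesis .
  qed
  ultimately show ?thesis using measurable_cylinder[OF mt] by (simp add: square_integrable_def case_prod_unfold)
 qed
 have ua: "cls (u r) = w r" if r: "r \<in> {0..1}" for r
 proof (rule vector_eq_rdot[THEN iffD1], rule allI)
  fix x :: "'a l2_sphere"
  have sqx: "square_integrable cylinder_measure (\<lambda>y::real \<times> 'a. rep x (snd y))"
  proof -
   have "integrable cylinder_measure (\<lambda>(r::real, z). 1 * (rep x z)\<^sup>2)"
    by (rule integral_cylinder_mult(1)) (use rep_l2_sphere_square_integrable[of x] in \<open>auto simp: square_integrable_def\<close>)
   moreover have "(\<lambda>y::real \<times> 'a. rep x (snd y)) \<in> borel_measurable cylinder_measure"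
    by (rule measurable_cylinder) measurable
   ultimately show ?thesis by (simp add: square_integrable_def case_prod_unfold)
  qed
  have igx: "integrable cylinder_measure (\<lambda>y. (case y of (r, z) \<Rightarrow> g r z) * rep x (snd y))"
   by (rule square_integrable_mult_integrable[OF sqg sqx])
  have ik: "integrable cylinder_measure (\<lambda>(s, z). indicator {r..1} s * (g s z * rep x z))"
  proof (rule Bochner_Integration.integrable_bound[OF igx])
   have "(\<lambda>y::real \<times> 'a. indicator {r..1} (fst y) :: real) \<in> borel_measurable cylinder_measure"
    by (rule measurable_cylinder) measurable
   from borel_measurable_times[OF this borel_measurable_integrable[OF igx]]
   show "(\<lambda>(s, z). indicator {r..1} s * (g s z * rep x z)) \<in> borel_measurable cylinder_measure"
    by (simp add: case_prod_unfold)
  qed (auto intro!: AE_I2 simp: indicator_def)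
  have ix: "integrable sphere_measure (\<lambda>z. rep (w 1) z * rep x z)"
   by (intro square_integrable_mult_integrable rep_l2_sphere_square_integrable)
  have in1: "(\<integral>s. indicator {r..1} s * (g s z * rep x z) \<partial>?I) = (LINT s:{r..1}|lborel. g s z) * rep x z" for z
  proof -
   have "(\<integral>s. indicator {r..1} s * (g s z * rep x z) \<partial>?I) = (\<integral>s. (indicator {r..1} s *\<^sub>R g s z) * rep x z \<partial>lborel)"
    unfolding integral_unit_interval set_lebesgue_integral_def
    by (rule Bochner_Integration.integral_cong) (use r in \<open>auto simp: indicator_def\<close>)
   then show ?thesis by (simp add: set_lebesgue_integral_def)
  qed
  have in2: "(\<oint>z. indicator {r..1} s * (g s z * rep x z)) = indicator {r..1} s * (w' s \<bullet> x)" for s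
   using inner_abs_l2_sphere[OF gs[of s] rep_l2_sphere_square_integrable[of x]] by (simp add: ga)
  have j: "integrable sphere_measure (\<lambda>z. (LINT s:{r..1}|lborel. g s z) * rep x z)"
   using cylinder.integrable_snd[OF ik] by (simp add: in1)
  have "cls (u r) \<bullet> x = (\<oint>z. u r z * rep x z)"
   using inner_abs_l2_sphere[OF us[OF r] rep_l2_sphere_square_integrable[of x]] by simp
  also have "\<dots> = (\<oint>z. rep (w 1) z * rep x z - (LINT s:{r..1}|lborel. g s z) * rep x z)"
   by (rule Bochner_Integration.integral_cong) (simp_all add: u_def left_diff_distrib)
  also have "\<dots> = w 1 \<bullet> x - (\<oint>z. (LINT s:{r..1}|lborel. g s z) * rep x z)"
   by (subst Bochner_Integration.integral_diff[OF ix j]) (simp add: inner_l2_sphere_eq)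
  also have "(\<oint>z. (LINT s:{r..1}|lborel. g s z) * rep x z) =
   (\<integral>z. \<integral>s. indicator {r..1} s * (g s z * rep x z) \<partial>?I \<partial>sphere_measure)" by (simp add: in1)
  also have "\<dots> = (\<integral>s. \<integral>z. indicator {r..1} s * (g s z * rep x z) \<partial>sphere_measure \<partial>?I)"
   by (rule cylinder.Fubini_integral[OF ik])
  also have "\<dots> = (LINT s:{r..1}|lborel. w' s \<bullet> x)"
   unfolding in2 integral_unit_interval set_lebesgue_integral_def
   by (rule Bochner_Integration.integral_cong) (use r in \<open>auto simp: indicator_def\<close>)
  finally show "cls (u r) \<bullet> x = w r \<bullet> x" using prim[OF r, of x] by simp
 qed
 have u1: "u 1 z = rep (w 1) z" for z
 proof -
  have "(LINT s:{1..1::real}|lborel. g s z) = 0"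
   unfolding set_lebesgue_integral_def
  proof (rule integral_eq_zero_AE)
   show "AE s in lborel. indicator {1..1} s *\<^sub>R g s z = 0"
    using AE_lborel_singleton[of "1::real"] by (rule eventually_mono) (auto simp: indicator_def)
  qed
  then show ?thesis by (simp add: u_def)
 qed
 have ac: "AE z in sphere_measure. \<forall>r\<in>{0..1}. u r z = u 1 z - (LINT s:{r..1}|lborel. g s z)"
  unfolding u1 by (simp add: u_def)
 have td1: "AE r in lborel. r \<in> {0..1} \<longrightarrow> (\<forall>e\<in>Basis. \<forall>f Df. C1_gradient f Df \<longrightarrow>
    (\<oint>z. u r z * (tangential z (Df z) \<bullet> e)) =
    - (\<oint>z. (t r z \<bullet> e) * f z)
    + (real DIM('a) - 1) * (\<oint>z. u r z * f z * (z \<bullet> e)))"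
  using td
 proof eventually_elim
  case (elim r)
  show ?case
  proof (intro impI ballI allI)
   fix e :: 'a and f :: "'a \<Rightarrow> real" and Df :: "'a \<Rightarrow> 'a" assume a: "r \<in> {0..1}" "e \<in> Basis" "C1_gradient f Df"
   note c = C1_gradient_continuous[OF a(3), of UNIV]
   have sqf: "L2_sphere f" by (rule square_integrable_sphere_continuous[OF c(1)])
   have sqT: "L2_sphere (\<lambda>z. tangential z (Df z) \<bullet> e)"
    by (intro square_integrable_sphere_continuous continuous_intros continuous_on_tangential c)
   have "w r \<bullet> cls (\<lambda>z. tangential z (Df z) \<bullet> e) =
    - (T e r \<bullet> cls f) + (real DIM('a) - 1) * (w r \<bullet> mult_coord e (cls f))"
    using elim a unfolding has_tangential_derivative_iff by blast
   moreover have "w r \<bullet> cls (\<lambda>z. tangential z (Df z) \<bullet> e) = (\<oint>z. u r z * (tangential z (Df z) \<bullet> e))"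
    unfolding ua[OF a(1), symmetric] by (rule inner_abs_l2_sphere[OF us[OF a(1)] sqT])
   moreover have "T e r \<bullet> cls f = (\<oint>z. (t r z \<bullet> e) * f z)"
    unfolding Ja[OF a(2), symmetric] te[OF a(2)] by (rule inner_abs_l2_sphere[OF Js[OF a(2)] sqf])
   moreover have "w r \<bullet> mult_coord e (cls f) = (\<oint>z. u r z * f z * (z \<bullet> e))"
    unfolding ua[OF a(1), symmetric] mult_coord_abs[OF sqf] inner_abs_l2_sphere[OF us[OF a(1)] square_integrable_mult_coord[OF sqf]]
    by (rule Bochner_Integration.integral_cong) (simp_all add: mult_ac)
   ultimately show "(\<oint>z. u r z * (tangential z (Df z) \<bullet> e)) =
    - (\<oint>z. (t r z \<bullet> e) * f z)
    + (real DIM('a) - 1) * (\<oint>z. u r z * f z * (z \<bullet> e))" by simp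
  qed
 qed
 have "cylinder_curve u g t"
  unfolding cylinder_curve_def using mu mg mt squ sqg sqt us ac td1 by blast
 then show ?thesis using that ua gs ga by blast
qed

section \<open>Strong solutions: restarting and extending the flow\<close>

lemma H1_curve_mono:
 assumes "H1_curve a b u u'" "a \<le> a'" "b' \<le> b"
 shows "H1_curve a' b' u u'"
proof -
 have sub: "{a'<..<b'} \<subseteq> {a<..<b}" using assms by auto
 have "set_borel_measurable lborel {a'<..<b'} u'"
 proof -
  have m: "(\<lambda>x. indicator {a<..<b} x *\<^sub>R u' x) \<in> borel_measurable borel"
   using assms(1) by (simp add: H1_curve_def set_borel_measurable_def)
  have "(\<lambda>x. indicator {a'<..<b'} x *\<^sub>R (indicator {a<..<b} x *\<^sub>R u' x)) \<in> borel_measurable borel"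
   by (intro borel_measurable_scaleR m) simp
  moreover have "(\<lambda>x. indicator {a'<..<b'} x *\<^sub>R (indicator {a<..<b} x *\<^sub>R u' x)) = (\<lambda>x. indicator {a'<..<b'} x *\<^sub>R u' x)"
   using sub by (intro ext) (auto simp: indicator_def)
  ultimately show ?thesis by (simp add: set_borel_measurable_def)
 qed
 moreover have "set_integrable lborel {a'<..<b'} (\<lambda>t. (norm (u t))\<^sup>2)" "set_integrable lborel {a'<..<b'} (\<lambda>t. (norm (u' t))\<^sup>2)"
  using assms(1) by (auto simp: H1_curve_def intro: set_integrable_subset[OF _ _ sub])
 moreover have "\<forall>s t. a' < s \<and> s \<le> t \<and> t < b' \<longrightarrow> (u' has_integral (u t - u s)) {s..t}"
  using assms by (auto simp: H1_curve_def)
 ultimately show ?thesis by (simp add: H1_curve_def)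
qed

lemma set_integrable_shift:
 fixes f :: "real \<Rightarrow> real"
 assumes "set_integrable lborel {a<..<b} f"
 shows "set_integrable lborel {a - c<..<b - c} (\<lambda>t. f (c + t))"
proof -
 have "integrable lborel (\<lambda>x. indicator {a<..<b} (c + 1 * x) *\<^sub>R f (c + 1 * x))"
  using assms unfolding set_integrable_def by (rule lborel_integrable_real_affine) simp
 moreover have "(\<lambda>x. indicator {a<..<b} (c + 1 * x) *\<^sub>R f (c + 1 * x)) = (\<lambda>x. indicator {a - c<..<b - c} x *\<^sub>R f (c + x))"
  by (intro ext) (auto simp: indicator_def)
 ultimately show ?thesis by (simp add: set_integrable_def)
qed

lemma H1_curve_shift:
 assumes "H1_curve a b u u'"
 shows "H1_curve (a - c) (b - c) (\<lambda>t. u (c + t)) (\<lambda>t. u' (c + t))"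
proof -
 have "set_borel_measurable lborel {a - c<..<b - c} (\<lambda>t. u' (c + t))"
 proof -
  have m: "(\<lambda>x. indicator {a<..<b} x *\<^sub>R u' x) \<in> borel_measurable borel"
   using assms by (simp add: H1_curve_def set_borel_measurable_def)
  have "(\<lambda>x. indicator {a<..<b} (c + x) *\<^sub>R u' (c + x)) \<in> borel_measurable borel"
   by (rule measurable_compose[OF _ m]) measurable
  moreover have "(\<lambda>x. indicator {a<..<b} (c + x) *\<^sub>R u' (c + x)) = (\<lambda>x. indicator {a - c<..<b - c} x *\<^sub>R u' (c + x))"
   by (intro ext) (auto simp: indicator_def)
  ultimately show ?thesis by (simp add: set_borel_measurable_def)
 qed
 moreover have "set_integrable lborel {a - c<..<b - c} (\<lambda>t. (norm (u (c + t)))\<^sup>2)" "set_integrable lborel {a - c<..<b - c} (\<lambda>t. (norm (u' (c + t)))\<^sup>2)"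
  using assms by (auto simp: H1_curve_def intro: set_integrable_shift[where f="\<lambda>t. (norm (u t))\<^sup>2"] set_integrable_shift[where f="\<lambda>t. (norm (u' t))\<^sup>2"])
 moreover have "((\<lambda>t. u' (c + t)) has_integral (u (c + t) - u (c + s))) {s..t}" if "a - c < s" "s \<le> t" "t < b - c" for s t
 proof -
  have "(u' has_integral (u (c + t) - u (c + s))) {c + s..c + t}"
   using assms that by (auto simp: H1_curve_def)
  from has_integral_shift_real_ivl[OF this, of c] show ?thesis by (simp add: add.commute)
 qed
 ultimately show ?thesis by (simp add: H1_curve_def)
qed

lemma AE_shift:
 assumes "AE t in lborel. P (t :: real)"
 shows "AE t in lborel. P (c + t)"
proof -
 obtain N where N: "{r \<in> space lborel. \<not> P r} \<subseteq> N" "emeasure lborel N = 0" "N \<in> sets lborel"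
  using assms by (rule AE_E)
 then have "AE r in lborel. r \<notin> N" by (intro AE_not_in null_setsI)
 moreover have "Measurable.pred borel (\<lambda>r. r \<notin> N)" using N(3) by simp
 ultimately have "AE r in lborel. c + 1 * r \<notin> N" using AE_borel_affine[of 1 "\<lambda>r. r \<notin> N" c] by simp
 then show ?thesis by eventually_elim (use N(1) in auto)
qed

text \<open>A critical point is stationary for the flow; solutions starting nearby are compared with
  it in \<open>flow_long_time\<close>.\<close>

lemma strong_solution_constant:
 assumes "critical_point K gradF p" "0 < T"
 shows "strong_solution K gradF T p (\<lambda>_. p)"
proof -
 have K: "p \<in> K" "p \<in> H2_sphere" "\<And>v. v \<in> K \<Longrightarrow> 0 \<le> (v - p) \<bullet> gradF p" using assms by (auto simp: critical_point_def)
 have "H1_curve a b (\<lambda>_. p) (\<lambda>_. 0)" for a b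
 proof -
  have "set_integrable lborel {a<..<b} (\<lambda>t. c :: real)" for c
  proof -
   have "integrable lborel (\<lambda>t. indicator {a<..<b} t * c)"
    using emeasure_bounded_finite[of "{a<..<b}"] by (intro integrable_mult_left integrable_real_indicator) simp_all
   then show ?thesis by (simp add: set_integrable_def)
  qed
  then show ?thesis by (simp add: H1_curve_def set_borel_measurable_def)
 qed
 moreover have "(\<forall>v\<in>K. 0 \<le> (0 + gradF p) \<bullet> (v - p))" using K(3) by (simp add: inner_commute)
 ultimately show ?thesis
  unfolding strong_solution_def H1_loc_curve_def using K(1,2) assms(2)
  by (auto simp: norm_H2_zero intro!: exI[of _ "\<lambda>_. 0"])
qed

lemma strong_solution_shift:
 assumes S: "strong_solution K gradF T u0 u" and s: "0 \<le> s" "s < T"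
 shows "strong_solution K gradF (T - s) (u s) (\<lambda>t. u (s + t))"
proof -
 obtain u' where u': "H1_loc_curve T u u'" "AE t in lborel. t \<in> {0<..<T} \<longrightarrow> (\<forall>v\<in>K. 0 \<le> (u' t + gradF (u t)) \<bullet> (v - u t))"
  using S by (auto simp: strong_solution_def)
 have c: "continuous_on {0..<T} u" using S by (simp add: strong_solution_def)
 have "continuous_on {0..<T - s} (\<lambda>t. u (s + t))"
  by (rule continuous_on_compose2[OF c]) (use s in \<open>auto intro!: continuous_intros\<close>)
 moreover have "u (s + t) \<in> H2_sphere \<and> ((\<lambda>r. norm_H2 (u (s + r) - u (s + t))) \<longlongrightarrow> 0) (at t within {0<..<T - s})" if t: "t \<in> {0<..<T - s}" for t
 proof
  have st: "s + t \<in> {0<..<T}" using t s by auto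
  then show "u (s + t) \<in> H2_sphere" using S by (simp add: strong_solution_def)
  have "((\<lambda>r. norm_H2 (u r - u (s + t))) \<longlongrightarrow> 0) (at (s + t) within {0<..<T})"
   using S st unfolding strong_solution_def by blast
  moreover have "filterlim (\<lambda>r. s + r) (at (s + t) within {0<..<T}) (at t within {0<..<T - s})"
   unfolding filterlim_at
  proof
   show "((\<lambda>r. s + r) \<longlongrightarrow> s + t) (at t within {0<..<T - s})" by (intro tendsto_intros)
   show "\<forall>\<^sub>F r in at t within {0<..<T - s}. s + r \<in> {0<..<T} \<and> s + r \<noteq> s + t"
    unfolding eventually_at_filter by (rule always_eventually) (use s in auto)
  qed
  ultimately show "((\<lambda>r. norm_H2 (u (s + r) - u (s + t))) \<longlongrightarrow> 0) (at t within {0<..<T - s})"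
   by (rule filterlim_compose)
 qed
 moreover have "H1_loc_curve (T - s) (\<lambda>t. u (s + t)) (\<lambda>t. u' (s + t))"
  unfolding H1_loc_curve_def
 proof (intro allI impI)
  fix a b assume ab: "0 < a \<and> a < b \<and> b < T - s"
  then have "H1_curve (s + a) (s + b) u u'" using u'(1) s by (auto simp: H1_loc_curve_def)
  from H1_curve_shift[OF this, of s] show "H1_curve a b (\<lambda>t. u (s + t)) (\<lambda>t. u' (s + t))" by simp
 qed
 moreover have "AE t in lborel. t \<in> {0<..<T - s} \<longrightarrow> (\<forall>v\<in>K. 0 \<le> (u' (s + t) + gradF (u (s + t))) \<bullet> (v - u (s + t)))"
  using AE_shift[OF u'(2), of s] by eventually_elim (use s in auto)
 moreover have "\<forall>t\<in>{0..<T - s}. u (s + t) \<in> K" using S s by (auto simp: strong_solution_def)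
 moreover have "0 < T - s" "u (s + 0) = u s" using s by simp_all
 ultimately show ?thesis unfolding strong_solution_def by blast
qed

lemma flow_continuousE:
 assumes "flow_continuous K gradF U" "0 < t" "0 < e"
 obtains d where "0 < d"
  "\<And>u0 v0 S T u v s. u0 \<in> U \<Longrightarrow> v0 \<in> U \<Longrightarrow> strong_solution K gradF S u0 u \<Longrightarrow> strong_solution K gradF T v0 v \<Longrightarrow>
    norm (u0 - v0) \<le> d \<Longrightarrow> 0 \<le> s \<Longrightarrow> s \<le> t \<Longrightarrow> s < S \<Longrightarrow> s < T \<Longrightarrow> norm (u s - v s) \<le> e"
proof -
 from assms(1)[unfolded flow_continuous_def, rule_format, OF assms(2,3)]
 obtain d where d: "d > 0" and P: "\<forall>u0\<in>U. \<forall>v0\<in>U. \<forall>S T u v.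
    strong_solution K gradF S u0 u \<and> strong_solution K gradF T v0 v \<and> norm (u0 - v0) \<le> d \<longrightarrow>
     (\<forall>s\<in>{0..t}. s < S \<and> s < T \<longrightarrow> norm (u s - v s) \<le> e)" by (elim exE conjE)
 show ?thesis
 proof (rule that[OF d])
  fix u0 v0 S T u v s
  assume a: "u0 \<in> U" "v0 \<in> U" "strong_solution K gradF S u0 u" "strong_solution K gradF T v0 v"
   "norm (u0 - v0) \<le> d" "0 \<le> s" "s \<le> t" "s < S" "s < T"
  show "norm (u s - v s) \<le> e"
   using P[rule_format, OF a(1,2) conjI[OF a(3) conjI[OF a(4,5)]]] a(6-9) by simp
 qed
qed

text \<open>Continuous dependence with equal data bounds the distance of the two solutions by every
  positive number.\<close>

lemma strong_solution_unique:
 assumes flow: "flow_continuous K gradF U" and U: "u0 \<in> U"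
  and u: "strong_solution K gradF S u0 u" and v: "strong_solution K gradF T u0 v"
  and t: "0 \<le> t" "t < S" "t < T"
 shows "u t = v t"
proof (cases "t = 0")
 case True
 then show ?thesis using u v by (simp add: strong_solution_def)
next
 case False
 have le: "norm (u t - v t) \<le> e" if e: "0 < e" for e
 proof -
  have t0: "0 < t" using False t by simp
  obtain d where "0 < d" and d: "\<And>u0 v0 S T u v s. u0 \<in> U \<Longrightarrow> v0 \<in> U \<Longrightarrow> strong_solution K gradF S u0 u \<Longrightarrow> strong_solution K gradF T v0 v \<Longrightarrow>
    norm (u0 - v0) \<le> d \<Longrightarrow> 0 \<le> s \<Longrightarrow> s \<le> t \<Longrightarrow> s < S \<Longrightarrow> s < T \<Longrightarrow> norm (u s - v s) \<le> e"
   by (rule flow_continuousE[OF flow t0 e]) (rule that)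
  show ?thesis using d[OF U U u v, of t] \<open>0 < d\<close> t by simp
 qed
 have "norm (u t - v t) \<le> 0"
  by (rule field_le_epsilon) (simp only: le add_0_left)
 then show ?thesis by simp
qed

text \<open>Both curves agree with \<open>w\<close> around \<open>m\<close>, and the derivative may
  switch there because a single point does not affect integrals.\<close>

lemma H1_curve_glue:
 assumes u: "H1_curve a b u u'" and v: "H1_curve c d v v'"
  and ab: "a < m" "m < b" "c < m" "m < d"
  and wu: "\<And>t. t \<in> {a<..<b} \<Longrightarrow> w t = u t" and wv: "\<And>t. t \<in> {c<..<d} \<Longrightarrow> w t = v t"
 shows "H1_curve a d w (\<lambda>t. if t \<le> m then u' t else v' t)"
proof -
 let ?w' = "\<lambda>t. if t \<le> m then u' t else v' t"
 have eqset: "{a<..<d} = {a<..m} \<union> {m<..<d}" using ab by auto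
 have si: "set_integrable lborel {a<..<d} h"
  if "set_integrable lborel {a<..<b} f" "set_integrable lborel {c<..<d} g" "\<And>t. t \<in> {a<..m} \<Longrightarrow> h t = f t" "\<And>t. t \<in> {m<..<d} \<Longrightarrow> h t = g t"
  for f g h :: "real \<Rightarrow> real"
 proof -
  have "set_integrable lborel {a<..m} f" by (rule set_integrable_subset[OF that(1)]) (use ab in auto)
  then have 1: "set_integrable lborel {a<..m} h"
   unfolding set_integrable_def by (rule Bochner_Integration.integrable_cong[THEN iffD1, rotated -1]) (auto simp: that(3) indicator_def)
  have "set_integrable lborel {m<..<d} g" by (rule set_integrable_subset[OF that(2)]) (use ab in auto)
  then have 2: "set_integrable lborel {m<..<d} h"
   unfolding set_integrable_def by (rule Bochner_Integration.integrable_cong[THEN iffD1, rotated -1]) (auto simp: that(4) indicator_def)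
  show ?thesis unfolding eqset by (rule set_integrable_Un[OF 1 2]) auto
 qed
 have "set_borel_measurable lborel {a<..<d} ?w'"
 proof -
  have mu: "(\<lambda>x. indicator {a<..<b} x *\<^sub>R u' x) \<in> borel_measurable borel"
   and mv: "(\<lambda>x. indicator {c<..<d} x *\<^sub>R v' x) \<in> borel_measurable borel"
   using u v by (simp_all add: H1_curve_def set_borel_measurable_def)
  have "(\<lambda>x. indicator {a<..m} x *\<^sub>R (indicator {a<..<b} x *\<^sub>R u' x) + indicator {m<..<d} x *\<^sub>R (indicator {c<..<d} x *\<^sub>R v' x)) \<in> borel_measurable borel"
   by (intro borel_measurable_add borel_measurable_scaleR mu mv) simp_all
  moreover have "(\<lambda>x. indicator {a<..m} x *\<^sub>R (indicator {a<..<b} x *\<^sub>R u' x) + indicator {m<..<d} x *\<^sub>R (indicator {c<..<d} x *\<^sub>R v' x))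
    = (\<lambda>x. indicator {a<..<d} x *\<^sub>R ?w' x)"
   using ab by (intro ext) (auto simp: indicator_def)
  ultimately show ?thesis by (simp add: set_borel_measurable_def)
 qed
 moreover have "set_integrable lborel {a<..<d} (\<lambda>t. (norm (w t))\<^sup>2)"
  by (rule si[of "\<lambda>t. (norm (u t))\<^sup>2" "\<lambda>t. (norm (v t))\<^sup>2"]) (use u v ab in \<open>auto simp: H1_curve_def wu wv\<close>)
 moreover have "set_integrable lborel {a<..<d} (\<lambda>t. (norm (?w' t))\<^sup>2)"
  by (rule si[of "\<lambda>t. (norm (u' t))\<^sup>2" "\<lambda>t. (norm (v' t))\<^sup>2"]) (use u v ab in \<open>auto simp: H1_curve_def\<close>)
 moreover have "(?w' has_integral (w t - w s)) {s..t}" if st: "a < s" "s \<le> t" "t < d" for s t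
 proof -
  have left: "(?w' has_integral (w t - w s)) {s..t}" if "a < s" "s \<le> t" "t \<le> m" for s t
  proof -
   have "(u' has_integral (u t - u s)) {s..t}" using u that ab by (auto simp: H1_curve_def)
   then have "(?w' has_integral (u t - u s)) {s..t}"
    by (rule has_integral_spike_finite[of "{}", rotated -1]) (use that in auto)
   then show ?thesis using that ab by (simp add: wu)
  qed
  have right: "(?w' has_integral (w t - w s)) {s..t}" if "m \<le> s" "s \<le> t" "t < d" for s t
  proof -
   have "(v' has_integral (v t - v s)) {s..t}" using v that ab by (auto simp: H1_curve_def)
   then have "(?w' has_integral (v t - v s)) {s..t}"
    by (rule has_integral_spike_finite[of "{m}", rotated -1]) (use that in auto)
   then show ?thesis using that ab by (simp add: wv)
  qed
  consider "t \<le> m" | "m \<le> s" | "s < m" "m < t" by linarith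
  then show ?thesis
  proof cases
   case 1 then show ?thesis using left st by simp
  next
   case 2 then show ?thesis using right st by simp
  next
   case 3
   have "(?w' has_integral ((w m - w s) + (w t - w m))) (cbox s t)"
   proof (rule has_integral_split[where k=1 and c=m])
    have "cbox s t \<inter> {x. x \<bullet> 1 \<le> m} = {s..m}" using 3 by auto
    then show "(?w' has_integral (w m - w s)) (cbox s t \<inter> {x. x \<bullet> 1 \<le> m})" using left[of s m] 3 st by simp
    have "cbox s t \<inter> {x. x \<bullet> 1 \<ge> m} = {m..t}" using 3 by auto
    then show "(?w' has_integral (w t - w m)) (cbox s t \<inter> {x. x \<bullet> 1 \<ge> m})" using right[of m t] 3 st by simp
   qed simp
   then show ?thesis by simp
  qed
 qed
 ultimately show ?thesis by (simp add: H1_curve_def)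
qed

text \<open>The restart happens at a time s0 before \<open>T\<close>. By uniqueness both solutions
  agree from s0 up to \<open>T\<close>, so around every time the glued curve coincides with one of
  two strong solutions, and all local requirements are inherited.\<close>

lemma strong_solution_extend:
 assumes flow: "flow_continuous K gradF U" and u: "strong_solution K gradF T u0 u"
  and s0: "0 < s0" "s0 < T" "u s0 \<in> U" and v: "strong_solution K gradF e (u s0) v" and T: "T < s0 + e"
 shows "strong_solution K gradF (s0 + e) u0 (\<lambda>t. if t < T then u t else v (t - s0))"
proof -
 let ?w = "\<lambda>t. if t < T then u t else v (t - s0)"
 let ?T' = "s0 + e"
 have wu: "?w t = u t" if "t < T" for t using that by simp
 have wv: "?w t = v (t - s0)" if "s0 \<le> t" "t < ?T'" for t
 proof (cases "t < T")
  case True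
  have "u (s0 + (t - s0)) = v (t - s0)"
   by (rule strong_solution_unique[OF flow s0(3) strong_solution_shift[OF u] v]) (use s0 that True in simp_all)
  then show ?thesis using True by simp
 qed simp
 obtain u' where u': "H1_loc_curve T u u'" "AE t in lborel. t \<in> {0<..<T} \<longrightarrow> (\<forall>v\<in>K. 0 \<le> (u' t + gradF (u t)) \<bullet> (v - u t))"
  using u by (auto simp: strong_solution_def)
 obtain v' where v': "H1_loc_curve e v v'" "AE t in lborel. t \<in> {0<..<e} \<longrightarrow> (\<forall>z\<in>K. 0 \<le> (v' t + gradF (v t)) \<bullet> (z - v t))"
  using v by (auto simp: strong_solution_def)
 have cu: "continuous_on {0..<T} u" and cv: "continuous_on {0..<e} v" using u v by (simp_all add: strong_solution_def)
 have K: "\<forall>t\<in>{0..<?T'}. ?w t \<in> K"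
 proof
  fix t assume t: "t \<in> {0..<?T'}"
  have "\<And>t. t \<in> {0..<T} \<Longrightarrow> u t \<in> K" "\<And>t. t \<in> {0..<e} \<Longrightarrow> v t \<in> K"
   using u v unfolding strong_solution_def by blast+
  then show "?w t \<in> K" using t s0 by (cases "t < T") auto
 qed
 have cw1: "continuous_on {0..<T} ?w" by (rule continuous_on_cong[THEN iffD2, OF refl _ cu]) (simp add: wu)
 have cw2: "continuous_on {s0<..<?T'} ?w"
 proof -
  have "continuous_on {s0<..<?T'} (\<lambda>t. v (t - s0))"
   by (rule continuous_on_compose2[OF cv]) (auto intro!: continuous_intros)
  moreover have "?w t = v (t - s0)" if "t \<in> {s0<..<?T'}" for t using wv that by auto
  ultimately show ?thesis by (subst continuous_on_cong[OF refl]) auto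
 qed
 have cw: "continuous_on {0..<?T'} ?w"
  unfolding continuous_on_def
 proof
  fix t assume t: "t \<in> {0..<?T'}"
  show "(?w \<longlongrightarrow> ?w t) (at t within {0..<?T'})"
  proof (cases "t < T")
   case True
   have "at t within {0..<?T'} = at t within {0..<T}"
    by (rule at_within_nhd[of _ "{..<T}"]) (use True T in auto)
   then show ?thesis using cw1 True t unfolding continuous_on_def by simp
  next
   case False
   have "at t within {0..<?T'} = at t within {s0<..<?T'}"
    by (rule at_within_nhd[of _ "{s0<..}"]) (use False s0 in auto)
   moreover have "t \<in> {s0<..<?T'}" using False t s0 by auto
   ultimately show ?thesis using cw2 unfolding continuous_on_def by simp
  qed
 qed
 have H2: "?w t \<in> H2_sphere \<and> ((\<lambda>s. norm_H2 (?w s - ?w t)) \<longlongrightarrow> 0) (at t within {0<..<?T'})" if t: "t \<in> {0<..<?T'}" for t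
 proof (cases "t < T")
  case True
  have "((\<lambda>s. norm_H2 (u s - u t)) \<longlongrightarrow> 0) (at t within {0<..<T})" "u t \<in> H2_sphere"
   using u True t by (auto simp: strong_solution_def)
  moreover have "at t within {0<..<?T'} = at t within {0<..<T}"
   by (rule at_within_nhd[of _ "{..<T}"]) (use True T in auto)
  moreover have "((\<lambda>s. norm_H2 (?w s - ?w t)) \<longlongrightarrow> 0) (at t within {0<..<T}) \<longleftrightarrow> ((\<lambda>s. norm_H2 (u s - u t)) \<longlongrightarrow> 0) (at t within {0<..<T})"
   by (rule filterlim_cong[OF refl refl]) (use True in \<open>auto simp: eventually_at_filter\<close>)
  ultimately show ?thesis using True by simp
 next
  case False
  then have ts: "t - s0 \<in> {0<..<e}" using t s0 by auto
  have v1: "((\<lambda>s. norm_H2 (v s - v (t - s0))) \<longlongrightarrow> 0) (at (t - s0) within {0<..<e})" "v (t - s0) \<in> H2_sphere"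
   using v ts by (auto simp: strong_solution_def)
  have "filterlim (\<lambda>r. r - s0) (at (t - s0) within {0<..<e}) (at t within {s0<..<?T'})"
   unfolding filterlim_at
  proof
   show "((\<lambda>r. r - s0) \<longlongrightarrow> t - s0) (at t within {s0<..<?T'})" by (intro tendsto_intros)
   show "\<forall>\<^sub>F r in at t within {s0<..<?T'}. r - s0 \<in> {0<..<e} \<and> r - s0 \<noteq> t - s0"
    unfolding eventually_at_filter by (rule always_eventually) auto
  qed
  from filterlim_compose[OF v1(1) this]
  have "((\<lambda>s. norm_H2 (v (s - s0) - v (t - s0))) \<longlongrightarrow> 0) (at t within {s0<..<?T'})" .
  moreover have "at t within {0<..<?T'} = at t within {s0<..<?T'}"
   by (rule at_within_nhd[of _ "{s0<..}"]) (use False s0 in auto)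
  moreover have "((\<lambda>s. norm_H2 (?w s - ?w t)) \<longlongrightarrow> 0) (at t within {s0<..<?T'}) \<longleftrightarrow> ((\<lambda>s. norm_H2 (v (s - s0) - v (t - s0))) \<longlongrightarrow> 0) (at t within {s0<..<?T'})"
  proof (rule filterlim_cong[OF refl refl])
   show "\<forall>\<^sub>F s in at t within {s0<..<?T'}. norm_H2 (?w s - ?w t) = norm_H2 (v (s - s0) - v (t - s0))"
    unfolding eventually_at_filter
   proof (rule always_eventually, intro allI impI)
    fix s assume "s \<in> {s0<..<?T'}"
    then have "?w s = v (s - s0)" by (intro wv) auto
    then show "norm_H2 (?w s - ?w t) = norm_H2 (v (s - s0) - v (t - s0))" using False by simp
   qed
  qed
  ultimately show ?thesis using v1(2) False by simp
 qed
 \<comment> \<open>A switching time inside the overlap, so that each derivative is used strictly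
   within the lifetime of its own solution.\<close>
 define m where "m = (s0 + T) / 2"
 have m: "s0 < m" "m < T" using s0 by (auto simp: m_def)
 define w' where "w' t = (if t \<le> m then u' t else v' (- s0 + t))" for t
 have H1: "H1_loc_curve ?T' ?w w'"
  unfolding H1_loc_curve_def
 proof (intro allI impI)
  fix a b assume ab: "0 < a \<and> a < b \<and> b < ?T'"
  define a1 where "a1 = min a (m/2)"
  define b1 where "b1 = max b ((m + ?T') / 2)"
  have a1: "0 < a1" "a1 < m" "a1 \<le> a" using ab m s0 by (auto simp: a1_def)
  have b1: "m < b1" "b1 < ?T'" "b \<le> b1" using ab m T by (auto simp: b1_def max_def)
  have c1: "H1_curve a1 ((m + T) / 2) u u'" using u'(1) a1 m unfolding H1_loc_curve_def by auto
  have "H1_curve ((m - s0) / 2) (b1 - s0) v v'"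
   using v'(1) b1 m unfolding H1_loc_curve_def by (auto simp: field_simps)
  from H1_curve_shift[OF this, of "- s0"]
  have c2: "H1_curve ((m + s0) / 2) b1 (\<lambda>t. v (- s0 + t)) (\<lambda>t. v' (- s0 + t))" by (simp add: field_simps)
  have "H1_curve a1 b1 ?w (\<lambda>t. if t \<le> m then u' t else v' (- s0 + t))"
  proof (rule H1_curve_glue[OF c1 c2])
   show "?w t = u t" if "t \<in> {a1<..<(m + T) / 2}" for t using that m by auto
   show "?w t = v (- s0 + t)" if "t \<in> {(m + s0) / 2<..<b1}" for t
    using wv[of t] that m b1 by auto
  qed (use a1 b1 m in auto)
  then show "H1_curve a b ?w w'" unfolding w'_def[abs_def] by (rule H1_curve_mono) (use a1 b1 in auto)
 qed
 have AE: "AE t in lborel. t \<in> {0<..<?T'} \<longrightarrow> (\<forall>z\<in>K. 0 \<le> (w' t + gradF (?w t)) \<bullet> (z - ?w t))"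
  using u'(2) AE_shift[OF v'(2), of "- s0"]
 proof eventually_elim
  case (elim t)
  show ?case
  proof
   assume t: "t \<in> {0<..<?T'}"
   show "\<forall>z\<in>K. 0 \<le> (w' t + gradF (?w t)) \<bullet> (z - ?w t)"
   proof (cases "t \<le> m")
    case True then show ?thesis using elim(1) t m by (simp add: w'_def)
   next
    case False
    then have "?w t = v (- s0 + t)" using wv[of t] t m by simp
    moreover have "- s0 + t \<in> {0<..<e}" using False t m by auto
    ultimately show ?thesis using elim(2) False by (simp add: w'_def)
   qed
  qed
 qed
 have "?w 0 = u0" "0 < ?T'" using u s0 T by (auto simp: strong_solution_def)
 then show ?thesis unfolding strong_solution_def using K cw H2 H1 AE by blast
qed

text \<open>Data in \<open>U\<close> have solutions of a fixed lifetime \<open>q\<close>. Continuous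
  dependence up to time \<open>T\<close>, compared with the stationary solution, keeps a solution
  within r/2 of \<open>p\<close>, hence in \<open>U\<close>, for as long as it exists before
  \<open>T\<close>. It can therefore be restarted q/2 before its end, and each restart gains
  q/2.\<close>

theorem flow_long_time:
 fixes K :: "'a::euclidean_space l2_sphere set"
 assumes fl: "flow_property K gradF p" and cr: "critical_point K gradF p" and T: "0 < T" and e: "0 < e"
 obtains d where "0 < d"
  "\<And>u0. u0 \<in> K \<Longrightarrow> norm (u0 - p) \<le> d \<Longrightarrow> \<exists>u S u' q. strong_solution K gradF S u0 u \<and> T < S \<and>
    (\<forall>s\<in>{0..T}. norm (u s - p) \<le> e) \<and> 0 < q \<and> q \<le> S \<and> H1_curve 0 q u u' \<and>
    set_integrable lborel {0<..<q} (\<lambda>t. (norm_H2 (u t))\<^sup>2)"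
proof -
 obtain U q where U: "openin (top_of_set K) U" "p \<in> U" and q: "0 < q"
  and ex: "\<And>u0. u0 \<in> U \<Longrightarrow> \<exists>u. strong_solution K gradF q u0 u \<and> (\<exists>u'. H1_curve 0 q u u') \<and>
      set_integrable lborel {0<..<q} (\<lambda>t. (norm_H2 (u t))\<^sup>2)"
  and flow: "flow_continuous K gradF U"
  using fl unfolding flow_property_def by blast
 obtain r where r: "0 < r" "ball p r \<inter> K \<subseteq> U"
  using U unfolding openin_contains_ball by blast
 have er: "0 < min e (r/2)" using e r by simp
 obtain d1 where d1: "0 < d1" "\<And>u0 v0 S T' u v s. u0 \<in> U \<Longrightarrow> v0 \<in> U \<Longrightarrow> strong_solution K gradF S u0 u \<Longrightarrow> strong_solution K gradF T' v0 v \<Longrightarrow>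
    norm (u0 - v0) \<le> d1 \<Longrightarrow> 0 \<le> s \<Longrightarrow> s \<le> T \<Longrightarrow> s < S \<Longrightarrow> s < T' \<Longrightarrow> norm (u s - v s) \<le> min e (r/2)"
  by (rule flow_continuousE[OF flow T er]) (rule that)
 define d where "d = min d1 (r/2)"
 have d: "0 < d" using d1(1) r by (simp add: d_def)
 show ?thesis
 proof (rule that[OF d])
  fix u0 assume u0: "u0 \<in> K" "norm (u0 - p) \<le> d"
  have u0U: "u0 \<in> U" using r u0 by (auto simp: d_def dist_norm norm_minus_commute intro!: subsetD[OF r(2)])
  have near: "norm (u s - p) \<le> min e (r/2)" if "strong_solution K gradF S u0 u" "s \<in> {0..T}" "s < S" for u S s
  proof -
   have c: "strong_solution K gradF (T + 1) p (\<lambda>_. p)" by (rule strong_solution_constant[OF cr]) (use T in simp)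
   have "norm (u0 - p) \<le> d1" using u0(2) by (simp add: d_def)
   from d1(2)[OF u0U U(2) that(1) c this, of s] show ?thesis using that(2,3) by simp
  qed
  obtain v v' where v: "strong_solution K gradF q u0 v" "H1_curve 0 q v v'" "set_integrable lborel {0<..<q} (\<lambda>t. (norm_H2 (v t))\<^sup>2)"
   using ex[OF u0U] by blast
  have "\<exists>u S. strong_solution K gradF S u0 u \<and> q \<le> S \<and> (T < S \<or> q + real n * (q / 2) \<le> S)" for n
  proof (induction n)
   case 0
   then show ?case using v(1) by (intro exI[of _ v] exI[of _ q]) auto
  next
   case (Suc n)
   then obtain u S where u: "strong_solution K gradF S u0 u" "q \<le> S" "T < S \<or> q + real n * (q / 2) \<le> S" by blast
   show ?case
   proof (cases "T < S")
    case True then show ?thesis using u by blast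
   next
    case False
    define s0 where "s0 = S - q / 2"
    have s0: "0 < s0" "s0 < S" "s0 \<in> {0..T}" using u(2) q False by (auto simp: s0_def)
    have "u s0 \<in> K" using u(1) s0 by (auto simp: strong_solution_def)
    moreover have "norm (u s0 - p) \<le> r/2" using near[OF u(1) s0(3) s0(2)] by simp
    ultimately have sU: "u s0 \<in> U" using r by (auto simp: dist_norm norm_minus_commute intro!: subsetD[OF r(2)])
    obtain z where z: "strong_solution K gradF q (u s0) z" using ex[OF sU] by blast
    have "strong_solution K gradF (s0 + q) u0 (\<lambda>t. if t < S then u t else z (t - s0))"
     by (rule strong_solution_extend[OF flow u(1) s0(1,2) sU z]) (use q in \<open>simp add: s0_def\<close>)
    moreover have "q \<le> s0 + q" using s0 by simp
    moreover have "q + real (Suc n) * (q / 2) \<le> s0 + q" using u(3) False by (simp add: s0_def field_simps)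
    ultimately show ?thesis by blast
   qed
  qed
  moreover obtain n :: nat where n: "T < real n * (q / 2)" using reals_Archimedean3[of "q / 2"] q by auto
  ultimately obtain u S where u: "strong_solution K gradF S u0 u" "q \<le> S" "T < S \<or> q + real n * (q / 2) \<le> S" by blast
  have TS: "T < S" using u(3) n q by linarith
  \<comment> \<open>The integrability near time 0 is known for the short solution \<open>v\<close>;
    uniqueness passes it on to the extended one.\<close>
  have eq: "v t = u t" if "t \<in> {0<..<q}" for t
   using strong_solution_unique[OF flow u0U v(1) u(1), of t] that u(2) by simp
  have "H1_curve 0 q u v'"
  proof -
   have "set_integrable lborel {0<..<q} (\<lambda>t. (norm (u t))\<^sup>2)"
   proof -
    have "set_integrable lborel {0<..<q} (\<lambda>t. (norm (v t))\<^sup>2)" using v(2) by (simp add: H1_curve_def)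
    then show ?thesis unfolding set_integrable_def
     by (rule Bochner_Integration.integrable_cong[THEN iffD1, rotated -1]) (auto simp: eq indicator_def)
   qed
   moreover have "(v' has_integral (u t - u s)) {s..t}" if "0 < s" "s \<le> t" "t < q" for s t
   proof -
    have "(v' has_integral (v t - v s)) {s..t}" using v(2) that by (simp add: H1_curve_def)
    then show ?thesis using eq[of s] eq[of t] that by simp
   qed
   ultimately show ?thesis using v(2) by (simp add: H1_curve_def)
  qed
  moreover have "set_integrable lborel {0<..<q} (\<lambda>t. (norm_H2 (u t))\<^sup>2)"
   using v(3) unfolding set_integrable_def
   by (rule Bochner_Integration.integrable_cong[THEN iffD1, rotated -1]) (auto simp: eq indicator_def)
  moreover have "\<forall>s\<in>{0..T}. norm (u s - p) \<le> e" using near[OF u(1)] TS by fastforce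
  ultimately show "\<exists>u S u' q. strong_solution K gradF S u0 u \<and> T < S \<and>
    (\<forall>s\<in>{0..T}. norm (u s - p) \<le> e) \<and> 0 < q \<and> q \<le> S \<and> H1_curve 0 q u u' \<and>
    set_integrable lborel {0<..<q} (\<lambda>t. (norm_H2 (u t))\<^sup>2)"
   using u(1,2) TS q by blast
 qed
qed

section \<open>The energy inequality\<close>

text \<open>A representative on time times sphere reduces the claim to the density of bounded
  continuous functions for the product measure. Boundedness lets dominated convergence turn the
  continuity of \<open>p\<close> into that of the curve \<open>P\<close> in L^2.\<close>

lemma continuous_dense_curve:
 fixes w' :: "real \<Rightarrow> 'a::euclidean_space l2_sphere"
 assumes mw': "w' \<in> borel_measurable borel" and iw': "set_integrable lborel {a..b} (\<lambda>r. (norm (w' r))\<^sup>2)" and e: "0 < e"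
 obtains P where "continuous_on UNIV P" "set_integrable lborel {a..b} (\<lambda>r. (norm (w' r - P r))\<^sup>2)"
  "(LINT r:{a..b}|lborel. (norm (w' r - P r))\<^sup>2) < e"
proof -
 let ?L = "density lborel (indicator {a..b}) :: real measure"
 have indm: "(indicator {a..b} :: real \<Rightarrow> ennreal) \<in> borel_measurable lborel" by simp
 interpret L: finite_measure ?L
 proof
  have "emeasure ?L (space ?L) = emeasure lborel {a..b}"
   by (subst emeasure_density[OF indm]) (simp_all add: nn_integral_indicator cong: nn_integral_cong)
  then show "emeasure ?L (space ?L) \<noteq> \<infinity>" using emeasure_bounded_finite[of "{a..b}"] by simp
 qed
 have intL: "integrable ?L f \<longleftrightarrow> set_integrable lborel {a..b} f" "(\<integral>r. f r \<partial>?L) = (LINT r:{a..b}|lborel. f r)"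
  if "f \<in> borel_measurable borel" for f :: "real \<Rightarrow> real"
 proof -
  have eq: "?L = density lborel (\<lambda>r. ennreal (indicator {a..b} r))" by (rule arg_cong[where f="density lborel"]) (simp add: fun_eq_iff indicator_def)
  show "integrable ?L f \<longleftrightarrow> set_integrable lborel {a..b} f" unfolding eq set_integrable_def
   by (rule integrable_density) (use that in auto)
  show "(\<integral>r. f r \<partial>?L) = (LINT r:{a..b}|lborel. f r)" unfolding eq set_lebesgue_integral_def
   by (rule integral_density) (use that in auto)
 qed
 interpret LS: pair_sigma_finite ?L "sphere_measure :: 'a measure" ..
 let ?M = "?L \<Otimes>\<^sub>M (sphere_measure :: 'a measure)"
 have setsM: "sets ?M = sets (borel :: (real \<times> 'a) measure)"
 proof -
  have "sets ?M = sets ((borel :: real measure) \<Otimes>\<^sub>M (borel :: 'a measure))"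
   by (rule sets_pair_measure_cong) (simp_all add: sets_sphere_measure)
  then show ?thesis by (rule trans) (rule arg_cong[where f=sets, OF borel_prod])
 qed
 have mM: "f \<in> borel_measurable ?M \<longleftrightarrow> f \<in> borel_measurable (borel \<Otimes>\<^sub>M borel)" for f :: "real \<times> 'a \<Rightarrow> real"
  by (rule arg_cong[where f="\<lambda>A. f \<in> A"], rule measurable_cong_sets)
   (rule trans[OF setsM arg_cong[where f=sets, OF borel_prod[symmetric]]], simp)
 interpret M: finite_measure ?M
  by (rule finite_measure_pair_measure) (rule L.finite_measure_axioms sphere_measure.finite_measure_axioms)+
 obtain g where mg: "(\<lambda>(r, y). g r y) \<in> borel_measurable (borel \<Otimes>\<^sub>M borel)"
  and gs: "\<And>r. L2_sphere (g r)" and ga: "\<And>r. cls (g r) = w' r"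
  using joint_representative[OF mw'] by blast
 have mn: "(\<lambda>r. (norm (w' r))\<^sup>2) \<in> borel_measurable borel" using mw' by measurable
 have "integrable ?M (\<lambda>x. (g (fst x) (snd x))\<^sup>2)"
 proof (rule LS.Fubini_integrable)
  show "(\<lambda>x. (g (fst x) (snd x))\<^sup>2) \<in> borel_measurable ?M"
   unfolding mM using mg by (intro borel_measurable_power) (simp add: case_prod_unfold)
  have "(\<lambda>r. \<integral>y. norm ((g (fst (r, y)) (snd (r, y)))\<^sup>2) \<partial>sphere_measure) = (\<lambda>r. (norm (w' r))\<^sup>2)"
   using norm_abs_l2_sphere[OF gs] by (simp add: ga)
  then show "integrable ?L (\<lambda>r. \<integral>y. norm ((g (fst (r, y)) (snd (r, y)))\<^sup>2) \<partial>sphere_measure)"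
   using iw' intL(1)[OF mn] by simp
  show "AE r in ?L. integrable sphere_measure (\<lambda>y. (g (fst (r, y)) (snd (r, y)))\<^sup>2)"
   using gs by (simp add: square_integrable_def)
 qed
 then have sqg: "square_integrable ?M (\<lambda>(r, y). g r y)"
  using mg by (simp add: square_integrable_def mM case_prod_unfold)
 obtain p where p: "continuous_on UNIV p" "bounded (range p)" "square_integrable ?M p"
  "(\<integral>x. ((case x of (r, y) \<Rightarrow> g r y) - p x)\<^sup>2 \<partial>?M) < e"
  by (rule continuous_dense_square_integrable[OF setsM M.finite_measure_axioms sqg e])
 obtain C where C: "\<And>x. \<bar>p x\<bar> \<le> C" using p(2) unfolding bounded_iff by auto
 have pc: "continuous_on UNIV (\<lambda>y. p (r, y))" for r
  by (rule continuous_on_compose2[OF p(1)]) (auto intro!: continuous_intros)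
 have ps: "L2_sphere (\<lambda>y. p (r, y))" for r
  by (rule square_integrable_sphere_continuous[OF pc])
 define P where "P r = cls (\<lambda>y. p (r, y))" for r
 have Pc: "continuous_on UNIV P"
  unfolding continuous_on_sequentially
 proof (intro ballI allI impI)
  fix x :: "nat \<Rightarrow> real" and r assume "r \<in> UNIV" "(\<forall>n. x n \<in> UNIV) \<and> x \<longlonglongrightarrow> r"
  then have xr: "x \<longlonglongrightarrow> r" by simp
  have N: "(norm (P (x n) - P r))\<^sup>2 = (\<oint>y. (p (x n, y) - p (r, y))\<^sup>2)" for n
   unfolding P_def abs_l2_sphere_diff[OF ps ps, symmetric]
   by (rule norm_abs_l2_sphere[OF square_integrable_diff[OF ps ps]])
  have "(\<lambda>n. \<integral>y. (p (x n, y) - p (r, y))\<^sup>2 \<partial>sphere_measure) \<longlonglongrightarrow> (\<integral>y. 0 \<partial>(sphere_measure :: 'a measure))"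
  proof (rule integral_dominated_convergence[where w="\<lambda>_. (2 * C)\<^sup>2"])
   show "(\<lambda>y. (p (x n, y) - p (r, y))\<^sup>2) \<in> borel_measurable sphere_measure" for n
    using ps by (intro borel_measurable_power borel_measurable_diff) (auto simp: square_integrable_def)
   show "AE y in sphere_measure. (\<lambda>n. (p (x n, y) - p (r, y))\<^sup>2) \<longlonglongrightarrow> 0"
   proof (rule AE_I2)
    fix y :: 'a
    have "isCont p (r, y)" using p(1) by (simp add: continuous_on_eq_continuous_at)
    then have "(\<lambda>n. p (x n, y)) \<longlonglongrightarrow> p (r, y)"
     by (rule isCont_tendsto_compose) (intro tendsto_intros xr)
    then have "(\<lambda>n. (p (x n, y) - p (r, y))\<^sup>2) \<longlonglongrightarrow> (p (r, y) - p (r, y))\<^sup>2" by (intro tendsto_intros)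
    then show "(\<lambda>n. (p (x n, y) - p (r, y))\<^sup>2) \<longlonglongrightarrow> 0" by simp
   qed
   show "AE y in sphere_measure. norm ((p (x n, y) - p (r, y))\<^sup>2) \<le> (2 * C)\<^sup>2" for n
   proof (rule AE_I2)
    fix y :: 'a
    have "\<bar>p (x n, y) - p (r, y)\<bar> \<le> 2 * C" using C[of "(x n, y)"] C[of "(r, y)"] by linarith
    then show "norm ((p (x n, y) - p (r, y))\<^sup>2) \<le> (2 * C)\<^sup>2"
     using power_mono[of "\<bar>p (x n, y) - p (r, y)\<bar>" "2 * C" 2] by simp
   qed
  qed simp_all
  then have "(\<lambda>n. (norm (P (x n) - P r))\<^sup>2) \<longlonglongrightarrow> 0" by (simp add: N)
  then have "(\<lambda>n. sqrt ((norm (P (x n) - P r))\<^sup>2)) \<longlonglongrightarrow> sqrt 0" by (rule tendsto_real_sqrt)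
  then show "(P \<circ> x) \<longlonglongrightarrow> P r" by (simp add: tendsto_norm_zero_iff LIM_zero_iff o_def)
 qed
 have N: "(norm (w' r - P r))\<^sup>2 = (\<oint>y. (g r y - p (r, y))\<^sup>2)" for r
  unfolding P_def ga[symmetric] abs_l2_sphere_diff[OF gs ps, symmetric]
  by (rule norm_abs_l2_sphere[OF square_integrable_diff[OF gs ps]])
 have mP: "P \<in> borel_measurable borel" using Pc by (simp add: borel_measurable_continuous_onI)
 have mN: "(\<lambda>r. (norm (w' r - P r))\<^sup>2) \<in> borel_measurable borel" using mw' mP by measurable
 have i: "integrable ?M (\<lambda>(r, y). (g r y - p (r, y))\<^sup>2)"
  using square_integrable_diff[OF sqg p(3)] by (simp add: square_integrable_def case_prod_unfold)
 have "integrable ?L (\<lambda>r. (norm (w' r - P r))\<^sup>2)"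
  unfolding N by (rule LS.integrable_fst[OF i])
 moreover have "(\<integral>r. (norm (w' r - P r))\<^sup>2 \<partial>?L) < e"
  unfolding N using p(4) LS.integral_fst[OF i] by (simp add: case_prod_unfold)
 ultimately show ?thesis using that[OF Pc] intL[OF mN] by simp
qed

text \<open>After a shift of the variable, only the integral over [t-h, t] minus that over [s-h, s]
  survives.\<close>

lemma integral_average_increment_le:
 fixes B :: "real \<Rightarrow> real"
 assumes B: "continuous_on {a..b} B" and bd: "\<And>x. x \<in> {a..b} \<Longrightarrow> 0 \<le> B x \<and> B x \<le> C"
  and h: "0 < h" "h \<le> s - a" and st: "s \<le> t" "t \<le> b"
 shows "integral {s..t} (\<lambda>r. B r - B (r - h)) \<le> h * C"
proof -
 have i: "B integrable_on {x..y}" if "a \<le> x" "y \<le> b" for x y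
  by (rule integrable_continuous_real, rule continuous_on_subset[OF B]) (use that in auto)
 have s1: "((\<lambda>r. B (r - h)) has_integral integral {s - h..t - h} B) {s..t}"
 proof -
  have "(B has_integral integral {s - h..t - h} B) {s - h..t - h}"
   by (intro integrable_integral i) (use h st in auto)
  from has_integral_shift_real_ivl[OF this, of "-h"] show ?thesis by simp
 qed
 have "integral {s..t} (\<lambda>r. B r - B (r - h)) = integral {s..t} B - integral {s - h..t - h} B"
  using has_integral_diff[OF integrable_integral[OF i] s1] h st by (intro integral_unique) auto
 moreover have "integral {s - h..s} B + integral {s..t} B = integral {s - h..t} B"
  by (rule Henstock_Kurzweil_Integration.integral_combine) (use h st in \<open>auto intro!: i\<close>)
 moreover have "integral {s - h..t - h} B + integral {t - h..t} B = integral {s - h..t} B"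
  by (rule Henstock_Kurzweil_Integration.integral_combine) (use h st in \<open>auto intro!: i\<close>)
 moreover have "integral {t - h..t} B \<le> h * C"
 proof -
  have "integral {t - h..t} B \<le> integral {t - h..t} (\<lambda>_. C)"
   by (rule integral_le) (use h st bd in \<open>auto intro!: i\<close>)
  then show ?thesis using h by simp
 qed
 moreover have "0 \<le> integral {s - h..s} B"
  by (rule Henstock_Kurzweil_Integration.integral_nonneg) (use h st bd in \<open>auto intro!: i\<close>)
 ultimately show ?thesis by linarith
qed

text \<open>The same cancellation as before; continuity at \<open>s\<close> and \<open>t\<close>
  turns the two remaining integrals into h times a value, each with error at most h e/2.\<close>

lemma integral_average_increment_ge:
 fixes R :: "real \<Rightarrow> real"
 assumes R: "continuous_on {a..b} R" and st: "a < s" "s \<le> t" "t \<le> b" and e: "0 < e"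
 shows "\<exists>h0>0. \<forall>h. 0 < h \<and> h < h0 \<longrightarrow> h \<le> s - a \<and> h * (R t - R s - e) \<le> integral {s..t} (\<lambda>r. R r - R (r - h))"
proof -
 have i: "R integrable_on {x..y}" if "a \<le> x" "y \<le> b" for x y
  by (rule integrable_continuous_real, rule continuous_on_subset[OF R]) (use that in auto)
 have tc: "t \<in> {a..b}" "s \<in> {a..b}" using st by auto
 obtain d1 where d1: "0 < d1" "\<And>x. x \<in> {a..b} \<Longrightarrow> dist x t < d1 \<Longrightarrow> dist (R x) (R t) < e/2"
  using R tc(1) e unfolding continuous_on_iff by (meson half_gt_zero)
 obtain d2 where d2: "0 < d2" "\<And>x. x \<in> {a..b} \<Longrightarrow> dist x s < d2 \<Longrightarrow> dist (R x) (R s) < e/2"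
  using R tc(2) e unfolding continuous_on_iff by (meson half_gt_zero)
 define h0 where "h0 = min (s - a) (min d1 d2)"
 have "0 < h0" using d1 d2 st by (simp add: h0_def)
 moreover have "h \<le> s - a \<and> h * (R t - R s - e) \<le> integral {s..t} (\<lambda>r. R r - R (r - h))" if h: "0 < h" "h < h0" for h
 proof -
  have hs: "h \<le> s - a" "h < d1" "h < d2" using h by (auto simp: h0_def)
  have s1: "((\<lambda>r. R (r - h)) has_integral integral {s - h..t - h} R) {s..t}"
  proof -
   have "(R has_integral integral {s - h..t - h} R) {s - h..t - h}"
    by (intro integrable_integral i) (use h hs st in auto)
   from has_integral_shift_real_ivl[OF this, of "-h"] show ?thesis by simp
  qed
  have "integral {s..t} (\<lambda>r. R r - R (r - h)) = integral {s..t} R - integral {s - h..t - h} R"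
   using has_integral_diff[OF integrable_integral[OF i] s1] st by (intro integral_unique) auto
  moreover have "integral {s - h..s} R + integral {s..t} R = integral {s - h..t} R"
   by (rule Henstock_Kurzweil_Integration.integral_combine) (use h hs st in \<open>auto intro!: i\<close>)
  moreover have "integral {s - h..t - h} R + integral {t - h..t} R = integral {s - h..t} R"
   by (rule Henstock_Kurzweil_Integration.integral_combine) (use h hs st in \<open>auto intro!: i\<close>)
  moreover have "h * (R t - e/2) \<le> integral {t - h..t} R"
  proof -
   have "integral {t - h..t} (\<lambda>_. R t - e/2) \<le> integral {t - h..t} R"
   proof (rule integral_le)
    fix x assume x: "x \<in> {t - h..t}"
    then have "dist (R x) (R t) < e/2" using d1(2)[of x] hs st by (auto simp: dist_real_def)
    then show "R t - e/2 \<le> R x" unfolding dist_real_def by linarith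
   qed (use hs st in \<open>auto intro!: i\<close>)
   then show ?thesis using h by (simp add: algebra_simps)
  qed
  moreover have "integral {s - h..s} R \<le> h * (R s + e/2)"
  proof -
   have "integral {s - h..s} R \<le> integral {s - h..s} (\<lambda>_. R s + e/2)"
   proof (rule integral_le)
    fix x assume x: "x \<in> {s - h..s}"
    then have "dist (R x) (R s) < e/2" using d2(2)[of x] hs st by (auto simp: dist_real_def)
    then show "R x \<le> R s + e/2" unfolding dist_real_def by linarith
   qed (use hs st in \<open>auto intro!: i\<close>)
   then show ?thesis using h by (simp add: algebra_simps)
  qed
  ultimately show ?thesis using hs(1) by (simp add: algebra_simps)
 qed
 ultimately show ?thesis by blast
qed

lemma set_integrable_imp_integrable_on:
 fixes f :: "real \<Rightarrow> real"
 assumes "set_integrable lborel {a..b} f" "a \<le> x" "y \<le> b"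
 shows "f integrable_on {x..y}" "set_integrable lborel {x..y} f"
proof -
 show 1: "set_integrable lborel {x..y} f" by (rule set_integrable_subset[OF assms(1)]) (use assms in auto)
 show "f integrable_on {x..y}" by (rule set_borel_integral_eq_integral(1)[OF 1])
qed

lemma set_integrable_norm_of_square:
 fixes f :: "real \<Rightarrow> 'b::{real_inner, second_countable_topology}"
 assumes m: "f \<in> borel_measurable borel" and i: "set_integrable lborel {a..b} (\<lambda>r. (norm (f r))\<^sup>2)"
 shows "set_integrable lborel {a..b} (\<lambda>r. norm (f r))"
proof (rule set_integrable_bound[where f="\<lambda>r. 1 + (norm (f r))\<^sup>2"])
 show "set_integrable lborel {a..b} (\<lambda>r. 1 + (norm (f r))\<^sup>2)"
  by (rule set_integral_add(1)[OF _ i]) (simp add: borel_integrable_atLeastAtMost')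
 show "set_borel_measurable lborel {a..b} (\<lambda>r. norm (f r))"
  using m unfolding set_borel_measurable_def by measurable
 have "x \<le> 1 + x\<^sup>2" for x :: real
 proof -
  have "x * x - x + 1/4 = (x - 1/2) * (x - 1/2)" by (simp add: algebra_simps)
  then have "0 \<le> x * x - x + 1/4" by simp
  then show ?thesis unfolding power2_eq_square by linarith
 qed
 then show "AE r in lborel. r \<in> {a..b} \<longrightarrow> norm (norm (f r)) \<le> norm (1 + (norm (f r))\<^sup>2)"
  by (intro AE_I2) simp
qed

context
 fixes w w' :: "real \<Rightarrow> 'a::euclidean_space l2_sphere" and a b :: real
 assumes mw': "w' \<in> borel_measurable borel" and iw': "set_integrable lborel {a..b} (\<lambda>r. (norm (w' r))\<^sup>2)"
  and cw: "continuous_on {a..b} w"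
  and prim: "\<forall>x y. a \<le> x \<and> x \<le> y \<and> y \<le> b \<longrightarrow> (w' has_integral (w y - w x)) {x..y}"
begin

text \<open>Testing with the increment itself reduces the vector integral to a scalar one.\<close>

lemma curve_increment_bound:
 assumes "a \<le> x" "x \<le> y" "y \<le> b"
 shows "norm (w y - w x) \<le> integral {x..y} (\<lambda>r. norm (w' r))"
proof (cases "w y = w x")
 case True
 have "0 \<le> integral {x..y} (\<lambda>r. norm (w' r))"
  by (rule Henstock_Kurzweil_Integration.integral_nonneg)
   (use set_integrable_imp_integrable_on(1)[OF set_integrable_norm_of_square[OF mw' iw'] assms(1,3)] in auto)
 then show ?thesis using True by simp
next
 case False
 let ?D = "w y - w x"
 have 1: "((\<lambda>r. ?D \<bullet> w' r) has_integral (?D \<bullet> ?D)) {x..y}"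
  using has_integral_linear[OF prim[rule_format, OF conjI[OF assms(1) conjI[OF assms(2,3)]]] bounded_linear_inner_right[of ?D]] by (simp add: o_def)
 have 2: "((\<lambda>r. norm ?D * norm (w' r)) has_integral (norm ?D * integral {x..y} (\<lambda>r. norm (w' r)))) {x..y}"
  by (intro has_integral_mult_right integrable_integral set_integrable_imp_integrable_on(1)[OF set_integrable_norm_of_square[OF mw' iw'] assms(1,3)])
 have "?D \<bullet> ?D \<le> norm ?D * integral {x..y} (\<lambda>r. norm (w' r))"
  by (rule has_integral_le[OF 1 2]) (rule norm_cauchy_schwarz)
 then show ?thesis using False by (simp add: dot_square_norm power2_eq_square)
qed

lemma curve_increment_integrable:
 assumes "0 \<le> h" "h \<le> s - a" "t \<le> b"
 shows "set_integrable lborel {s..t} (\<lambda>r. w' r \<bullet> (w r - w (r - h)))"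
  "continuous_on {s..t} (\<lambda>r. w r - w (r - h))"
proof -
 show c: "continuous_on {s..t} (\<lambda>r. w r - w (r - h))"
  by (intro continuous_on_diff continuous_on_subset[OF cw] continuous_on_compose2[OF cw]) (use assms in \<open>auto intro!: continuous_intros\<close>)
 have "bounded ((\<lambda>r. w r - w (r - h)) ` {s..t})" by (intro compact_imp_bounded compact_continuous_image c compact_Icc)
 then obtain C where C: "\<And>r. r \<in> {s..t} \<Longrightarrow> norm (w r - w (r - h)) \<le> C" unfolding bounded_iff by blast
 show "set_integrable lborel {s..t} (\<lambda>r. w' r \<bullet> (w r - w (r - h)))"
 proof (rule set_integrable_bound[where f="\<lambda>r. norm (w' r) * C"])
  show "set_integrable lborel {s..t} (\<lambda>r. norm (w' r) * C)"
   by (rule set_integrable_mult_left, rule set_integrable_imp_integrable_on(2)[OF set_integrable_norm_of_square[OF mw' iw']]) (use assms in auto)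
  have "(\<lambda>r. indicator {s..t} r *\<^sub>R (w r - w (r - h))) \<in> borel_measurable borel"
   by (rule borel_measurable_continuous_on_indicator[OF _ c]) simp
  from borel_measurable_inner[OF mw' this]
  show "set_borel_measurable lborel {s..t} (\<lambda>r. w' r \<bullet> (w r - w (r - h)))"
   by (simp add: set_borel_measurable_def)
  show "AE r in lborel. r \<in> {s..t} \<longrightarrow> norm (w' r \<bullet> (w r - w (r - h))) \<le> norm (norm (w' r) * C)"
  proof (rule AE_I2, rule impI)
   fix r assume "r \<in> {s..t}"
   then have "norm (w' r \<bullet> (w r - w (r - h))) \<le> norm (w' r) * C"
    using order_trans[OF Cauchy_Schwarz_ineq2 mult_left_mono[OF C, of r "norm (w' r)"]] by simp
   also have "\<dots> \<le> norm (norm (w' r) * C)" by (simp add: abs_ge_self)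
   finally show "norm (w' r \<bullet> (w r - w (r - h))) \<le> norm (norm (w' r) * C)" .
  qed
 qed
qed

text \<open>Backward difference quotients of \<open>w\<close> converge to \<open>w'\<close> in the
  mean. For q in [r-h, r] the product w'(r).w'(q) is compared with |w'(r)|^2 through a continuous
  \<open>P\<close> close to \<open>w'\<close>: two errors measure the distance to \<open>P\<close>
  at r and at q, one its modulus of continuity, and all are split by Young's inequality with weight
  d.\<close>

theorem curve_derivative_average:
 assumes st: "a < s" "s \<le> t" "t \<le> b" and e: "0 < e"
 shows "\<exists>h0>0. \<forall>h. 0 < h \<and> h < h0 \<longrightarrow>
  h * (integral {s..t} (\<lambda>r. (norm (w' r))\<^sup>2) - e) \<le> integral {s..t} (\<lambda>r. w' r \<bullet> (w r - w (r - h)))"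
proof -
 define N where "N = integral {a..b} (\<lambda>r. (norm (w' r))\<^sup>2)"
 define I where "I = integral {s..t} (\<lambda>r. (norm (w' r))\<^sup>2)"
 note ii = set_integrable_imp_integrable_on(1)[OF iw']
 have N0: "0 \<le> I" "I \<le> N"
 proof -
  show "0 \<le> I" unfolding I_def
   by (rule Henstock_Kurzweil_Integration.integral_nonneg) (use st in \<open>auto intro!: ii\<close>)
  show "I \<le> N" unfolding I_def N_def by (rule integral_subset_le) (use st in \<open>auto intro!: ii\<close>)
 qed
 \<comment> \<open>The errors, divided by h, add up to at most 3/2 d N + d (t - s)/2 + d, which is
   at most d (2 N + (t - s) + 1) = e.\<close>
 define d where "d = e / (2 * N + (t - s) + 1)"
 have D: "0 < 2 * N + (t - s) + 1" using N0 st by linarith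
 have d: "0 < d" and de: "d * (2 * N + (t - s) + 1) = e" using D e by (auto simp: d_def)
 obtain P where P: "continuous_on UNIV P" "set_integrable lborel {a..b} (\<lambda>r. (norm (w' r - P r))\<^sup>2)"
  "(LINT r:{a..b}|lborel. (norm (w' r - P r))\<^sup>2) < d\<^sup>2"
  by (rule continuous_dense_curve[OF mw' iw', of "d\<^sup>2"]) (use d in simp)
 define R where "R r = (norm (w' r - P r))\<^sup>2" for r
 have R0: "0 \<le> R r" for r by (simp add: R_def)
 have iR: "set_integrable lborel {a..b} R" using P(2) by (simp add: R_def[abs_def])
 note iRR = set_integrable_imp_integrable_on(1)[OF iR]
 \<comment> \<open>The error of \<open>P\<close> at the earlier time q enters through this
   primitive; its increments integrate to at most h d^2 by
   \<open>integral_average_increment_le\<close>.\<close>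
 define B where "B x = integral {a..x} R" for x
 have Bb: "B b < d\<^sup>2"
  using P(3) set_borel_integral_eq_integral(2)[OF iR] by (simp add: B_def R_def[abs_def])
 have Bc: "continuous_on {a..b} B" unfolding B_def by (rule indefinite_integral_continuous_1) (rule iRR, auto)
 have Bd: "0 \<le> B x \<and> B x \<le> d\<^sup>2" if "x \<in> {a..b}" for x
 proof
  show "0 \<le> B x" unfolding B_def
   by (rule Henstock_Kurzweil_Integration.integral_nonneg) (use that R0 in \<open>auto intro!: iRR\<close>)
  have "B x \<le> B b" unfolding B_def by (rule integral_subset_le) (use that R0 in \<open>auto intro!: iRR\<close>)
  then show "B x \<le> d\<^sup>2" using Bb by simp
 qed
 have "uniformly_continuous_on {a..b} P"
  by (intro compact_uniformly_continuous continuous_on_subset[OF P(1)]) auto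
 then obtain g where g: "0 < g" "\<And>x y. x \<in> {a..b} \<Longrightarrow> y \<in> {a..b} \<Longrightarrow> dist x y < g \<Longrightarrow> dist (P x) (P y) < d"
  using d unfolding uniformly_continuous_on_def by metis
 define h0 where "h0 = min (s - a) g"
 have "0 < h0" using g(1) st by (simp add: h0_def)
 moreover have "h * (I - e) \<le> integral {s..t} (\<lambda>r. w' r \<bullet> (w r - w (r - h)))" if h: "0 < h" "h < h0" for h
 proof -
  have hs: "h \<le> s - a" "h < g" using h by (auto simp: h0_def)
  define c where "c r = (norm (w' r))\<^sup>2 * (1 - 3 * d / 2) - d / 2 - R r / (2 * d)" for r
  have low: "h * c r - (B r - B (r - h)) / (2 * d) \<le> w' r \<bullet> (w r - w (r - h))" if r: "r \<in> {s..t}" for r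
  proof -
   have 1: "((\<lambda>q. w' r \<bullet> w' q) has_integral (w' r \<bullet> (w r - w (r - h)))) {r - h..r}"
    using has_integral_linear[OF prim[rule_format, of "r - h" r] bounded_linear_inner_right[of "w' r"]] r st h hs by (simp add: o_def)
   have "B (r - h) + integral {r - h..r} R = B r" unfolding B_def
    by (rule Henstock_Kurzweil_Integration.integral_combine) (use r st h hs in \<open>auto intro!: iRR\<close>)
   moreover have "(R has_integral integral {r - h..r} R) {r - h..r}"
    by (intro integrable_integral iRR) (use r st h hs in auto)
   ultimately have "(R has_integral (B r - B (r - h))) {r - h..r}" by (metis add_diff_cancel_left')
   from has_integral_divide[OF this, of "2 * d"]
   have 2: "((\<lambda>q. c r - R q / (2 * d)) has_integral (h * c r - (B r - B (r - h)) / (2 * d))) {r - h..r}"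
    using has_integral_diff[OF has_integral_const_real[of "c r" "r - h" r]] h by simp
   have am: "x * y \<le> d / 2 * x\<^sup>2 + y\<^sup>2 / (2 * d)" for x y :: real
   proof -
    have "0 \<le> (d * x - y)\<^sup>2 / (2 * d)" using d by simp
    also have "\<dots> = d / 2 * x\<^sup>2 + y\<^sup>2 / (2 * d) - x * y" using d by (simp add: power2_diff field_simps power2_eq_square)
    finally show ?thesis by simp
   qed
   have "c r - R q / (2 * d) \<le> w' r \<bullet> w' q" if q: "q \<in> {r - h..r}" for q
   proof -
    have eq: "w' r \<bullet> w' q = w' r \<bullet> w' r - w' r \<bullet> (w' r - P r) - w' r \<bullet> (P r - P q) + w' r \<bullet> (w' q - P q)"
     by (simp add: inner_diff_right)
    have i1: "w' r \<bullet> (w' r - P r) \<le> d / 2 * (norm (w' r))\<^sup>2 + R r / (2 * d)"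
     using order_trans[OF norm_cauchy_schwarz am] by (simp add: R_def)
    have "dist (P r) (P q) < d" by (rule g(2)) (use r q st hs in \<open>auto simp: dist_real_def\<close>)
    then have "w' r \<bullet> (P r - P q) \<le> norm (w' r) * d"
     using order_trans[OF norm_cauchy_schwarz mult_left_mono[of "norm (P r - P q)" d "norm (w' r)"]] by (simp add: dist_norm)
    also have "\<dots> \<le> d / 2 * (norm (w' r))\<^sup>2 + d / 2"
     using am[of "norm (w' r)" d] d by (simp add: power2_eq_square)
    finally have i2: "w' r \<bullet> (P r - P q) \<le> d / 2 * (norm (w' r))\<^sup>2 + d / 2" .
    have "- (norm (w' r) * norm (w' q - P q)) \<le> w' r \<bullet> (w' q - P q)"
     using Cauchy_Schwarz_ineq2[of "w' r" "w' q - P q"] by linarith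
    then have i3: "- (d / 2 * (norm (w' r))\<^sup>2 + R q / (2 * d)) \<le> w' r \<bullet> (w' q - P q)"
     using am[of "norm (w' r)" "norm (w' q - P q)"] unfolding R_def by linarith
    have "c r = (norm (w' r))\<^sup>2 - 3 * (d / 2 * (norm (w' r))\<^sup>2) - d / 2 - R r / (2 * d)"
     by (simp add: c_def algebra_simps)
    then show ?thesis using eq i1 i2 i3 by (simp only: power2_norm_eq_inner)
   qed
   then show ?thesis by (rule has_integral_le[OF 2 1])
  qed
  have ic: "c integrable_on {s..t}" "integral {s..t} c = (1 - 3 * d / 2) * I - d / 2 * (t - s) - integral {s..t} R / (2 * d)"
  proof -
   have "((\<lambda>r. (norm (w' r))\<^sup>2 * (1 - 3 * d / 2)) has_integral (I * (1 - 3 * d / 2))) {s..t}"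
    unfolding I_def by (intro has_integral_mult_left integrable_integral ii) (use st in auto)
   moreover have "((\<lambda>r. d / 2) has_integral (t - s) *\<^sub>R (d / 2)) {s..t}"
    using has_integral_const_real[of "d/2" s t] st by simp
   moreover have "((\<lambda>r. R r / (2 * d)) has_integral (integral {s..t} R / (2 * d))) {s..t}"
    by (intro has_integral_divide integrable_integral iRR) (use st in auto)
   ultimately have "(c has_integral (I * (1 - 3 * d / 2) - (t - s) *\<^sub>R (d / 2) - integral {s..t} R / (2 * d))) {s..t}"
    unfolding c_def[abs_def] by (intro has_integral_diff)
   then show "c integrable_on {s..t}" "integral {s..t} c = (1 - 3 * d / 2) * I - d / 2 * (t - s) - integral {s..t} R / (2 * d)"
    by (auto simp: has_integral_iff algebra_simps)
  qed
  have iBd: "(\<lambda>r. B r - B (r - h)) integrable_on {s..t}"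
   by (intro integrable_continuous_real continuous_on_diff continuous_on_subset[OF Bc] continuous_on_compose2[OF Bc])
    (use st h hs in \<open>auto intro!: continuous_intros\<close>)
  have J: "integral {s..t} (\<lambda>r. B r - B (r - h)) \<le> h * d\<^sup>2"
   by (rule integral_average_increment_le[OF Bc Bd h(1) hs(1) st(2,3)])
  have IR: "integral {s..t} R \<le> d\<^sup>2"
  proof -
   have "integral {s..t} R \<le> B b" unfolding B_def by (rule integral_subset_le) (use st R0 in \<open>auto intro!: iRR\<close>)
   then show ?thesis using Bb by simp
  qed
  have HL: "((\<lambda>r. h * c r - (B r - B (r - h)) / (2 * d)) has_integral (h * integral {s..t} c - integral {s..t} (\<lambda>r. B r - B (r - h)) / (2 * d))) {s..t}"
   by (intro has_integral_diff has_integral_mult_right has_integral_divide integrable_integral ic iBd)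
  have HR: "((\<lambda>r. w' r \<bullet> (w r - w (r - h))) has_integral integral {s..t} (\<lambda>r. w' r \<bullet> (w r - w (r - h)))) {s..t}"
   by (intro integrable_integral set_borel_integral_eq_integral(1) curve_increment_integrable(1)) (use st h hs in auto)
  have main: "h * integral {s..t} c - integral {s..t} (\<lambda>r. B r - B (r - h)) / (2 * d) \<le> integral {s..t} (\<lambda>r. w' r \<bullet> (w r - w (r - h)))"
   by (rule has_integral_le[OF HL HR]) (rule low)
  have "integral {s..t} (\<lambda>r. B r - B (r - h)) / (2 * d) \<le> h * (d / 2)"
   using divide_right_mono[OF J, of "2 * d"] d by (simp add: power2_eq_square)
  moreover have "integral {s..t} R / (2 * d) \<le> d / 2"
   using divide_right_mono[OF IR, of "2 * d"] d by (simp add: power2_eq_square)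
  moreover have "d * I \<le> d * N" using N0 d by simp
  moreover have "0 \<le> d * I" "0 \<le> d * (t - s)" using N0 d st by simp_all
  moreover have "e = 2 * (d * N) + d * (t - s) + d" using de by (simp add: algebra_simps)
  moreover have "(1 - 3 * d / 2) * I = I - 3 / 2 * (d * I)" by (simp add: algebra_simps)
  moreover have "d / 2 * (t - s) = 1 / 2 * (d * (t - s))" by simp
  ultimately have c1: "I - e + d / 2 \<le> integral {s..t} c" and c2: "integral {s..t} (\<lambda>r. B r - B (r - h)) / (2 * d) \<le> h * (d / 2)"
   unfolding ic(2) by linarith+
  have "h * (I - e + d / 2) \<le> h * integral {s..t} c" using c1 h by simp
  then show ?thesis using main c2 by (simp add: algebra_simps)
 qed
 ultimately show ?thesis unfolding I_def by blast
qed

end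

section \<open>Energy along the flow at positive times\<close>

lemma norm_continuous_onD_sequentially:
 fixes f :: "'b::real_vector \<Rightarrow> 'c::real_normed_vector"
 assumes "norm_continuous_on S N f" "x \<in> S" "\<And>n::nat. y n \<in> S" "(\<lambda>n. N (y n - x)) \<longlonglongrightarrow> 0"
 shows "(\<lambda>n. f (y n)) \<longlonglongrightarrow> f x"
proof (rule tendstoI)
 fix e :: real assume "0 < e"
 then obtain d where d: "d > 0" "\<And>v. v \<in> S \<Longrightarrow> N (v - x) < d \<Longrightarrow> dist (f v) (f x) < e"
  using assms(1,2) unfolding norm_continuous_on_def by meson
 have "\<forall>\<^sub>F n in sequentially. N (y n - x) < d" by (rule order_tendstoD(2)[OF assms(4) d(1)])
 then show "\<forall>\<^sub>F n in sequentially. dist (f (y n)) (f x) < e" by (rule eventually_mono) (rule d(2)[OF assms(3)])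
qed

context
 fixes K :: "'a::euclidean_space l2_sphere set" and F gradF T u0 u
 assumes sol: "strong_solution K gradF T u0 u" and en: "energy_functional F gradF"
begin

lemma strong_solution_H2:
 assumes "t \<in> {0<..<T}"
 shows "u t \<in> H2_sphere" "((\<lambda>s. norm_H2 (u s - u t)) \<longlongrightarrow> 0) (at t within {0<..<T})"
 using sol assms unfolding strong_solution_def by blast+

lemma strong_solution_H2_sequentially:
 assumes t: "t \<in> {0<..<T}" and x: "\<And>n. x n \<in> {0<..<T}" "x \<longlonglongrightarrow> t"
 shows "(\<lambda>n::nat. norm_H2 (u (x n) - u t)) \<longlonglongrightarrow> 0"
proof -
 have "continuous (at t within {0<..<T}) (\<lambda>s. norm_H2 (u s - u t))"
  using strong_solution_H2(2)[OF t] by (simp add: continuous_within norm_H2_zero)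
 from continuous_within_tendsto_compose'[OF this x]
 show ?thesis by (simp add: norm_H2_zero)
qed

lemma energy_H2_continuous:
 shows "norm_continuous_on H2_sphere norm_H2 F" "norm_continuous_on H2_sphere norm_H2 gradF"
  "norm_continuous_on H1_sphere norm_H1 F"
 using en by (auto simp: energy_functional_def)

lemma strong_solution_energy_continuous: "continuous_on {0<..<T} (\<lambda>t. F (u t))"
 unfolding continuous_on_sequentially
proof (intro ballI allI impI)
 fix x :: "nat \<Rightarrow> real" and t assume t: "t \<in> {0<..<T}" and x: "(\<forall>n. x n \<in> {0<..<T}) \<and> x \<longlonglongrightarrow> t"
 have "(\<lambda>n. F (u (x n))) \<longlonglongrightarrow> F (u t)"
  by (rule norm_continuous_onD_sequentially[OF energy_H2_continuous(1)])
   (use t x strong_solution_H2 strong_solution_H2_sequentially in auto)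
 then show "((\<lambda>t. F (u t)) \<circ> x) \<longlonglongrightarrow> F (u t)" by (simp add: o_def)
qed

text \<open>A first order expansion of F along the flow, uniform on compact time intervals. If it
  failed, the mean value theorem would give points on the segments from u(r - h) to u(r) at which
  gradF differs by more than e from its value at u(r), with h tending to 0. A subsequence of the
  times converges, all these points tend to the same limit in H^2, and gradF is continuous
  there.\<close>

lemma strong_solution_difference:
 assumes st: "0 < s" "t < T" and e: "0 < e"
 shows "\<exists>h0>0. \<forall>h r. 0 < h \<and> h < h0 \<and> s \<le> r \<and> r \<le> t \<longrightarrow>
  F (u r) - F (u (r - h)) \<le> (u r - u (r - h)) \<bullet> gradF (u r) + e * norm (u r - u (r - h))"
proof (rule ccontr)
 assume neg: "\<not> ?thesis"
 define s1 where "s1 n = min (s / 2) (1 / real (Suc n))" for n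
 have s1: "0 < s1 n" for n using st by (simp add: s1_def)
 have "\<forall>n. \<exists>h r. 0 < h \<and> h < s1 n \<and> s \<le> r \<and> r \<le> t \<and>
   (u r - u (r - h)) \<bullet> gradF (u r) + e * norm (u r - u (r - h)) < F (u r) - F (u (r - h))"
 proof
  fix n
  show "\<exists>h r. 0 < h \<and> h < s1 n \<and> s \<le> r \<and> r \<le> t \<and>
   (u r - u (r - h)) \<bullet> gradF (u r) + e * norm (u r - u (r - h)) < F (u r) - F (u (r - h))"
   using neg s1[of n] by (auto simp: not_le)
 qed
 then obtain h r where hr: "\<And>n. 0 < h n" "\<And>n. h n < s1 n" "\<And>n. s \<le> r n" "\<And>n. r n \<le> t"
  "\<And>n. (u (r n) - u (r n - h n)) \<bullet> gradF (u (r n)) + e * norm (u (r n) - u (r n - h n)) < F (u (r n)) - F (u (r n - h n))"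
  by metis
 have in1: "r n \<in> {0<..<T}" for n using hr(3)[of n] hr(4)[of n] st by simp
 have in2: "r n - h n \<in> {0<..<T}" for n
  using hr(1)[of n] hr(2)[of n] hr(3)[of n] hr(4)[of n] st by (auto simp: s1_def)
 have "\<exists>l>0. l < 1 \<and> F (u (r n)) - F (u (r n - h n)) =
   (u (r n) - u (r n - h n)) \<bullet> gradF (u (r n - h n) + l *\<^sub>R (u (r n) - u (r n - h n)))" for n
 proof -
  let ?x = "u (r n - h n)" and ?D = "u (r n) - u (r n - h n)"
  have H: "?x \<in> H2_sphere" "?D \<in> H2_sphere"
   using strong_solution_H2(1)[OF in1] strong_solution_H2(1)[OF in2] by (auto intro: subspace_diff subspace_H2_sphere)
  have "\<exists>z::real. z > 0 \<and> z < 1 \<and> F (?x + 1 *\<^sub>R ?D) - F (?x + 0 *\<^sub>R ?D) = (1 - 0) * (?D \<bullet> gradF (?x + z *\<^sub>R ?D))"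
  proof (rule MVT2)
   fix z :: real
   have "?x + z *\<^sub>R ?D \<in> H2_sphere" by (intro subspace_add subspace_scale subspace_H2_sphere H)
   then have "((\<lambda>t. F (?x + z *\<^sub>R ?D + t *\<^sub>R ?D)) has_real_derivative (?D \<bullet> gradF (?x + z *\<^sub>R ?D))) (at 0)"
    using en H(2) unfolding energy_functional_def by blast
   then have "((\<lambda>t. F (?x + (z + t) *\<^sub>R ?D)) has_real_derivative (?D \<bullet> gradF (?x + z *\<^sub>R ?D))) (at 0)"
    by (simp add: scaleR_add_left add.assoc)
   then show "((\<lambda>z. F (?x + z *\<^sub>R ?D)) has_real_derivative (?D \<bullet> gradF (?x + z *\<^sub>R ?D))) (at z)"
    using DERIV_shift[of "\<lambda>z. F (?x + z *\<^sub>R ?D)" _ 0 z] by (simp add: add.commute)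
  qed simp
  then show ?thesis by auto
 qed
 then obtain l where l: "\<And>n. 0 < l n" "\<And>n. l n < 1" "\<And>n. F (u (r n)) - F (u (r n - h n)) =
   (u (r n) - u (r n - h n)) \<bullet> gradF (u (r n - h n) + l n *\<^sub>R (u (r n) - u (r n - h n)))" by metis
 define a where "a n = u (r n - h n) + l n *\<^sub>R (u (r n) - u (r n - h n))" for n
 have aH: "a n \<in> H2_sphere" for n unfolding a_def
  by (intro subspace_add subspace_diff subspace_scale subspace_H2_sphere strong_solution_H2(1) in1 in2)
 have far: "e < norm (gradF (a n) - gradF (u (r n)))" for n
 proof -
  let ?D = "u (r n) - u (r n - h n)"
  have "e * norm ?D < ?D \<bullet> (gradF (a n) - gradF (u (r n)))"
   using hr(5)[of n] l(3)[of n] by (simp add: a_def inner_diff_right)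
  also have "\<dots> \<le> norm ?D * norm (gradF (a n) - gradF (u (r n)))" by (rule norm_cauchy_schwarz)
  finally have "norm ?D * e < norm ?D * norm (gradF (a n) - gradF (u (r n)))" by (simp add: mult.commute)
  then show ?thesis by (rule mult_left_less_imp_less) simp
 qed
 obtain k :: "nat \<Rightarrow> nat" and r0 where k: "strict_mono k" and r0: "r0 \<in> {s..t}" "(r \<circ> k) \<longlonglongrightarrow> r0"
  using compact_imp_seq_compact[of "{s..t}"] hr(3,4) unfolding seq_compact_def by (metis atLeastAtMost_iff compact_Icc)
 have r0T: "r0 \<in> {0<..<T}" using r0(1) st by auto
 have h0: "h \<longlonglongrightarrow> 0"
 proof (rule tendsto_sandwich[OF _ _ tendsto_const LIMSEQ_inverse_real_of_nat])
  show "\<forall>\<^sub>F n in sequentially. 0 \<le> h n" using hr(1) by (intro always_eventually allI less_imp_le)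
  show "\<forall>\<^sub>F n in sequentially. h n \<le> inverse (real (Suc n))"
  proof (intro always_eventually allI)
   fix n show "h n \<le> inverse (real (Suc n))" using hr(2)[of n] by (simp add: s1_def inverse_eq_divide)
  qed
 qed
 have x1: "(\<lambda>n. r (k n)) \<longlonglongrightarrow> r0" using r0(2) by (simp add: o_def)
 have "(\<lambda>n. h (k n)) \<longlonglongrightarrow> 0" using LIMSEQ_subseq_LIMSEQ[OF h0 k] by (simp add: o_def)
 from tendsto_diff[OF x1 this] have x2: "(\<lambda>n. r (k n) - h (k n)) \<longlonglongrightarrow> r0" by simp
 have n1: "(\<lambda>n. norm_H2 (u (r (k n)) - u r0)) \<longlonglongrightarrow> 0" by (rule strong_solution_H2_sequentially[OF r0T in1 x1])
 have n2: "(\<lambda>n. norm_H2 (u (r (k n) - h (k n)) - u r0)) \<longlonglongrightarrow> 0" by (rule strong_solution_H2_sequentially[OF r0T in2 x2])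
 have n3: "(\<lambda>n. norm_H2 (a (k n) - u r0)) \<longlonglongrightarrow> 0"
 proof (rule tendsto_sandwich[OF _ _ tendsto_const])
  show "\<forall>\<^sub>F n in sequentially. 0 \<le> norm_H2 (a (k n) - u r0)" by (simp add: norm_H2_nonneg)
  show "(\<lambda>n. norm_H2 (u (r (k n) - h (k n)) - u r0) + norm_H2 (u (r (k n)) - u r0)) \<longlonglongrightarrow> 0"
   using tendsto_add[OF n2 n1] by simp
  show "\<forall>\<^sub>F n in sequentially. norm_H2 (a (k n) - u r0) \<le> norm_H2 (u (r (k n) - h (k n)) - u r0) + norm_H2 (u (r (k n)) - u r0)"
  proof (intro always_eventually allI)
   fix n
   let ?m = "k n"
   let ?p = "u (r ?m - h ?m) - u r0" and ?q = "u (r ?m) - u r0"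
   have H: "?p \<in> H2_sphere" "?q \<in> H2_sphere"
    by (intro subspace_diff subspace_H2_sphere strong_solution_H2(1) in1 in2 r0T)+
   have "a ?m - u r0 = (1 - l ?m) *\<^sub>R ?p + l ?m *\<^sub>R ?q" by (simp add: a_def algebra_simps)
   then have "norm_H2 (a ?m - u r0) \<le> norm_H2 ((1 - l ?m) *\<^sub>R ?p) + norm_H2 (l ?m *\<^sub>R ?q)"
    using norm_H2_triangle[of "(1 - l ?m) *\<^sub>R ?p" "l ?m *\<^sub>R ?q"] H by (simp add: subspace_scale subspace_H2_sphere)
   also have "\<dots> = (1 - l ?m) * norm_H2 ?p + l ?m * norm_H2 ?q"
    using H l(1)[of ?m] l(2)[of ?m] by (simp add: norm_H2_scale)
   also have "\<dots> \<le> norm_H2 ?p + norm_H2 ?q"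
    using l(1)[of ?m] l(2)[of ?m] by (intro add_mono mult_left_le_one_le norm_H2_nonneg) auto
   finally show "norm_H2 (a ?m - u r0) \<le> norm_H2 ?p + norm_H2 ?q" .
  qed
 qed
 have r0H: "u r0 \<in> H2_sphere" by (rule strong_solution_H2(1)[OF r0T])
 have g1: "(\<lambda>n. gradF (a (k n))) \<longlonglongrightarrow> gradF (u r0)"
  by (rule norm_continuous_onD_sequentially[OF energy_H2_continuous(2) r0H aH n3])
 have g2: "(\<lambda>n. gradF (u (r (k n)))) \<longlonglongrightarrow> gradF (u r0)"
  by (rule norm_continuous_onD_sequentially[OF energy_H2_continuous(2) r0H strong_solution_H2(1)[OF in1] n1])
 have "(\<lambda>n. norm (gradF (a (k n)) - gradF (u (r (k n))))) \<longlonglongrightarrow> norm (gradF (u r0) - gradF (u r0))"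
  by (intro tendsto_norm tendsto_diff g1 g2)
 then have "\<forall>\<^sub>F n in sequentially. norm (gradF (a (k n)) - gradF (u (r (k n)))) < e"
  by (rule order_tendstoD(2)) (use e in simp)
 then obtain n where "norm (gradF (a (k n)) - gradF (u (r (k n)))) < e" by (auto simp: eventually_sequentially)
 then show False using far[of "k n"] by simp
qed

end

text \<open>A strong solution provides its derivative only locally in ]0, T[. One that is Borel on
  the whole line and zero outside ]0, T[ makes later measurability and integration arguments
  global.\<close>

definition solution_derivative ::
  "'a::euclidean_space l2_sphere set \<Rightarrow> ('a l2_sphere \<Rightarrow> 'a l2_sphere) \<Rightarrow> real \<Rightarrow>
   (real \<Rightarrow> 'a l2_sphere) \<Rightarrow> (real \<Rightarrow> 'a l2_sphere) \<Rightarrow> bool" where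
 "solution_derivative K gradF T u v \<longleftrightarrow>
   v \<in> borel_measurable borel \<and> (\<forall>r. r \<notin> {0<..<T} \<longrightarrow> v r = 0) \<and>
   (\<forall>a b. 0 < a \<and> b < T \<longrightarrow> set_integrable lborel {a..b} (\<lambda>r. (norm (v r))\<^sup>2)) \<and>
   (\<forall>x y. 0 < x \<and> x \<le> y \<and> y < T \<longrightarrow> (v has_integral (u y - u x)) {x..y}) \<and>
   (AE t in lborel. t \<in> {0<..<T} \<longrightarrow> (\<forall>z\<in>K. 0 \<le> (v t + gradF (u t)) \<bullet> (z - u t)))"

lemma strong_solution_derivative:
 fixes u :: "real \<Rightarrow> 'a::euclidean_space l2_sphere"
 assumes sol: "strong_solution K gradF T u0 u"
 shows "\<exists>v. solution_derivative K gradF T u v"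
proof -
 obtain u' where u': "H1_loc_curve T u u'" "AE t in lborel. t \<in> {0<..<T} \<longrightarrow> (\<forall>v\<in>K. 0 \<le> (u' t + gradF (u t)) \<bullet> (v - u t))"
  using sol by (auto simp: strong_solution_def)
 have T: "0 < T" using sol by (simp add: strong_solution_def)
 define v where "v r = (if r \<in> {0<..<T} then u' r else 0)" for r
 have c: "H1_curve a b u u'" if "0 < a" "a < b" "b < T" for a b using u'(1) that by (simp add: H1_loc_curve_def)
 \<comment> \<open>The shift by 3 keeps \<open>m n\<close> below T/2, so that the truncation
   intervals are nonempty.\<close>
 define m where "m n = T / real (n + 3)" for n
 have m: "0 < m n" "m n < T - m n" for n
 proof -
  show "0 < m n" using T by (simp add: m_def)
  have "2 * T < real (n + 3) * T" using T by (intro mult_strict_right_mono) auto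
  then have "2 * m n < T" by (simp add: m_def divide_less_eq mult.commute)
  then show "m n < T - m n" by simp
 qed
 have m0: "m \<longlonglongrightarrow> 0"
  unfolding m_def by (rule LIMSEQ_ignore_initial_segment[OF lim_const_over_n])
 have "v \<in> borel_measurable borel"
 proof (rule borel_measurable_LIMSEQ_metric)
  show "(\<lambda>x. indicator {m n<..<T - m n} x *\<^sub>R u' x) \<in> borel_measurable borel" for n
   using c[of "m n" "T - m n"] m[of n] by (simp add: H1_curve_def set_borel_measurable_def)
  show "(\<lambda>n. indicator {m n<..<T - m n} x *\<^sub>R u' x) \<longlonglongrightarrow> v x" for x
  proof (cases "x \<in> {0<..<T}")
   case True
   have "0 < min x (T - x)" using True by simp
   then have "\<forall>\<^sub>F n in sequentially. m n < min x (T - x)" by (rule order_tendstoD(2)[OF m0])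
   then have "\<forall>\<^sub>F n in sequentially. indicator {m n<..<T - m n} x *\<^sub>R u' x = v x"
    by (rule eventually_mono) (use True in \<open>auto simp: v_def indicator_def\<close>)
   then show ?thesis by (rule tendsto_eventually)
  next
   case False
   have "indicator {m n<..<T - m n} x *\<^sub>R u' x = 0" for n using False m(1)[of n] by (auto simp: indicator_def)
   moreover have "v x = 0" using False by (auto simp: v_def)
   ultimately show ?thesis by (simp only: tendsto_const)
  qed
 qed
 moreover have "set_integrable lborel {a..b} (\<lambda>r. (norm (v r))\<^sup>2)" if ab: "0 < a" "b < T" for a b
 proof (cases "a \<le> b")
  case True
  have "set_integrable lborel {a/2<..<(b + T)/2} (\<lambda>r. (norm (u' r))\<^sup>2)"
   using c[of "a/2" "(b + T)/2"] ab True by (simp add: H1_curve_def)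
  then have "set_integrable lborel {a..b} (\<lambda>r. (norm (u' r))\<^sup>2)"
   by (rule set_integrable_subset) (use ab in auto)
  then show ?thesis unfolding set_integrable_def
   by (rule Bochner_Integration.integrable_cong[THEN iffD1, rotated -1]) (use ab in \<open>auto simp: v_def indicator_def\<close>)
 qed (simp add: set_integrable_def)
 moreover have "(v has_integral (u y - u x)) {x..y}" if xy: "0 < x" "x \<le> y" "y < T" for x y
 proof -
  have "(u' has_integral (u y - u x)) {x..y}" using c[of "x/2" "(y + T)/2"] xy by (simp add: H1_curve_def)
  then show ?thesis by (rule has_integral_eq[rotated]) (use xy in \<open>auto simp: v_def\<close>)
 qed
 moreover have "AE t in lborel. t \<in> {0<..<T} \<longrightarrow> (\<forall>z\<in>K. 0 \<le> (v t + gradF (u t)) \<bullet> (z - u t))"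
  using u'(2) by eventually_elim (simp add: v_def)
 moreover have "\<And>r. r \<notin> {0<..<T} \<Longrightarrow> v r = 0" by (auto simp: v_def)
 ultimately show ?thesis unfolding solution_derivative_def by blast
qed

context
 fixes K :: "'a::euclidean_space l2_sphere set" and F gradF T u0 u v
 assumes sol: "strong_solution K gradF T u0 u" and en: "energy_functional F gradF"
  and der: "solution_derivative K gradF T u v"
begin

lemma solution_derivative_measurable: "v \<in> borel_measurable borel" and solution_derivative_square_integrable: "0 < a \<Longrightarrow> b < T \<Longrightarrow> set_integrable lborel {a..b} (\<lambda>r. (norm (v r))\<^sup>2)"
  and solution_derivative_integral: "0 < x \<Longrightarrow> x \<le> y \<Longrightarrow> y < T \<Longrightarrow> (v has_integral (u y - u x)) {x..y}"
  and solution_derivative_inequality: "AE t in lborel. t \<in> {0<..<T} \<longrightarrow> (\<forall>z\<in>K. 0 \<le> (v t + gradF (u t)) \<bullet> (z - u t))"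
 using der unfolding solution_derivative_def by blast+

lemma strong_solution_mem: "t \<in> {0..<T} \<Longrightarrow> u t \<in> K" and strong_solution_continuous: "continuous_on {0..<T} u"
 using sol unfolding strong_solution_def by blast+

lemma strong_solution_slope:
 "AE t in lborel. t \<in> {0<..<T} \<longrightarrow> constrained_slope K gradF (u t) \<le> norm (v t)"
 using solution_derivative_inequality
proof eventually_elim
 case (elim t)
 show ?case
 proof
  assume t: "t \<in> {0<..<T}"
  show "constrained_slope K gradF (u t) \<le> norm (v t)"
   unfolding constrained_slope_def
  proof (rule cSup_least)
   fix x assume "x \<in> insert 0 ((\<lambda>z. - ((z - u t) \<bullet> gradF (u t)) / norm (z - u t)) ` (K - {u t}))"
   then consider "x = 0" | z where "z \<in> K" "z \<noteq> u t" "x = - ((z - u t) \<bullet> gradF (u t)) / norm (z - u t)" by auto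
   then show "x \<le> norm (v t)"
   proof cases
    case 2
    have "0 \<le> (v t + gradF (u t)) \<bullet> (z - u t)" using elim t 2(1) by blast
    then have "- ((z - u t) \<bullet> gradF (u t)) \<le> v t \<bullet> (z - u t)"
     unfolding inner_add_left inner_commute[of "z - u t"] by linarith
    also have "\<dots> \<le> norm (v t) * norm (z - u t)" by (rule norm_cauchy_schwarz)
    finally have "- ((z - u t) \<bullet> gradF (u t)) / norm (z - u t) \<le> norm (v t)"
     using 2(2) by (subst pos_divide_le_eq) simp_all
    then show ?thesis unfolding 2(3) .
   qed simp
  qed simp
 qed
qed

text \<open>Increments are taken backwards in time because u(r - h) is an admissible test state. All
  estimates are integrated over [s, t] before dividing by h, so no differentiability of F(u(t)) in
  time enters.\<close>

theorem strong_solution_energy_interior: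
 assumes st: "0 < s" "s \<le> t" "t < T"
 shows "F (u t) + integral {s..t} (\<lambda>r. (norm (v r))\<^sup>2) \<le> F (u s)"
proof -
 \<comment> \<open>Leaves room for backward shifts inside ]0, T[.\<close>
 define a where "a = s / 2"
 have a: "0 < a" "a < s" using st by (auto simp: a_def)
 have cu: "continuous_on {a..t} u" by (rule continuous_on_subset[OF strong_solution_continuous]) (use a st in auto)
 have cF: "continuous_on {a..t} (\<lambda>r. F (u r))"
  by (rule continuous_on_subset[OF strong_solution_energy_continuous[OF sol en]]) (use a st in auto)
 have ivt: "set_integrable lborel {a..t} (\<lambda>r. (norm (v r))\<^sup>2)" by (rule solution_derivative_square_integrable) (use a st in auto)
 have prim: "\<forall>x y. a \<le> x \<and> x \<le> y \<and> y \<le> t \<longrightarrow> (v has_integral (u y - u x)) {x..y}"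
  using solution_derivative_integral a st by auto
 note bound = curve_increment_bound[OF solution_derivative_measurable ivt cu prim] and inc = curve_increment_integrable[OF solution_derivative_measurable ivt cu prim]
 define N where "N = integral {a..t} (\<lambda>r. norm (v r))"
 note inv = set_integrable_imp_integrable_on(1)[OF set_integrable_norm_of_square[OF solution_derivative_measurable ivt]]
 have N0: "0 \<le> N" unfolding N_def
  by (rule Henstock_Kurzweil_Integration.integral_nonneg) (auto intro!: inv)
 define B where "B x = integral {a..x} (\<lambda>r. norm (v r))" for x
 have Bc: "continuous_on {a..t} B" unfolding B_def by (rule indefinite_integral_continuous_1) (rule inv, auto)
 have Bd: "0 \<le> B x \<and> B x \<le> N" if "x \<in> {a..t}" for x
 proof
  show "0 \<le> B x" unfolding B_def
   by (rule Henstock_Kurzweil_Integration.integral_nonneg) (use that in \<open>auto intro!: inv\<close>)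
  show "B x \<le> N" unfolding B_def N_def by (rule integral_subset_le) (use that in \<open>auto intro!: inv\<close>)
 qed
 define I where "I = integral {s..t} (\<lambda>r. (norm (v r))\<^sup>2)"
 have "F (u t) + I \<le> F (u s) + e" if e: "0 < e" for e
 proof -
  \<comment> \<open>One error c comes from the average of the derivative, one from the average of F,
    and c N from the expansion of F, since \<open>N\<close> bounds the length of the curve; together
    they make e.\<close>
  define c where "c = e / (2 + N)"
  have c: "0 < c" "c * (2 + N) = e" using e N0 by (auto simp: c_def)
  obtain h1 where h1: "0 < h1" "\<forall>h. 0 < h \<and> h < h1 \<longrightarrow> h * (I - c) \<le> integral {s..t} (\<lambda>r. v r \<bullet> (u r - u (r - h)))"
   using curve_derivative_average[OF solution_derivative_measurable ivt cu prim a(2) st(2) order_refl c(1)] unfolding I_def by blast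
  obtain h2 where h2: "0 < h2" "\<forall>h. 0 < h \<and> h < h2 \<longrightarrow> h \<le> s - a \<and> h * (F (u t) - F (u s) - c) \<le> integral {s..t} (\<lambda>r. F (u r) - F (u (r - h)))"
   using integral_average_increment_ge[OF cF a(2) st(2) order_refl c(1)] by blast
  obtain h3 where h3: "0 < h3" "\<forall>h r. 0 < h \<and> h < h3 \<and> s \<le> r \<and> r \<le> t \<longrightarrow>
   F (u r) - F (u (r - h)) \<le> (u r - u (r - h)) \<bullet> gradF (u r) + c * norm (u r - u (r - h))"
   using strong_solution_difference[OF sol en st(1,3) c(1)] by blast
  define h where "h = min h1 (min h2 h3) / 2"
  have h: "0 < h" "h < h1" "h < h2" "h < h3" using h1(1) h2(1) h3(1) by (auto simp: h_def)
  have ha: "h \<le> s - a" using h2(2) h by blast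
  define G where "G r = - (v r \<bullet> (u r - u (r - h))) + c * norm (u r - u (r - h))" for r
  have iD: "set_integrable lborel {s..t} (\<lambda>r. norm (u r - u (r - h)))"
   using inc(2)[OF _ ha order_refl] h(1) by (intro borel_integrable_atLeastAtMost' continuous_on_norm) simp
  have iV: "set_integrable lborel {s..t} (\<lambda>r. v r \<bullet> (u r - u (r - h)))" using inc(1)[OF _ ha order_refl] h(1) by simp
  have iFd: "set_integrable lborel {s..t} (\<lambda>r. F (u r) - F (u (r - h)))"
   by (intro borel_integrable_atLeastAtMost' continuous_on_diff continuous_on_subset[OF cF] continuous_on_compose2[OF cF])
    (use h ha a st in \<open>auto intro!: continuous_intros\<close>)
  have iV1: "set_integrable lborel {s..t} (\<lambda>r. - (v r \<bullet> (u r - u (r - h))))"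
   using set_integrable_mult_right[of "-1" lborel "{s..t}" "\<lambda>r. v r \<bullet> (u r - u (r - h))"] iV by simp
  have iD1: "set_integrable lborel {s..t} (\<lambda>r. c * norm (u r - u (r - h)))"
   by (rule set_integrable_mult_right) (rule iD)
  have iG: "set_integrable lborel {s..t} G" unfolding G_def[abs_def] by (rule set_integral_add(1)[OF iV1 iD1])
  have "(LINT r:{s..t}|lborel. F (u r) - F (u (r - h))) \<le> (LINT r:{s..t}|lborel. G r)"
  proof (rule set_integral_mono_AE[OF iFd iG])
   show "AE r\<in>{s..t} in lborel. F (u r) - F (u (r - h)) \<le> G r"
    using solution_derivative_inequality
   proof eventually_elim
    case (elim r)
    show ?case
    proof
     assume r: "r \<in> {s..t}"
     have "u (r - h) \<in> K" by (rule strong_solution_mem) (use r ha a st h in auto)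
     moreover have "r \<in> {0<..<T}" using r st by auto
     ultimately have "0 \<le> (v r + gradF (u r)) \<bullet> (u (r - h) - u r)" using elim by blast
     then have "(u r - u (r - h)) \<bullet> gradF (u r) \<le> - (v r \<bullet> (u r - u (r - h)))"
      by (simp add: inner_add_left inner_diff_right inner_diff_left inner_commute[of "gradF (u r)"])
     moreover have "F (u r) - F (u (r - h)) \<le> (u r - u (r - h)) \<bullet> gradF (u r) + c * norm (u r - u (r - h))"
      using h3(2) h r by auto
     ultimately show "F (u r) - F (u (r - h)) \<le> G r" by (simp add: G_def)
    qed
   qed
  qed
  also have "(LINT r:{s..t}|lborel. G r) = integral {s..t} G" by (rule set_borel_integral_eq_integral(2)[OF iG])
  also have "\<dots> = - integral {s..t} (\<lambda>r. v r \<bullet> (u r - u (r - h))) + c * integral {s..t} (\<lambda>r. norm (u r - u (r - h)))"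
  proof -
   have "(G has_integral (- integral {s..t} (\<lambda>r. v r \<bullet> (u r - u (r - h))) + c * integral {s..t} (\<lambda>r. norm (u r - u (r - h))))) {s..t}"
    unfolding G_def[abs_def]
    by (intro has_integral_add has_integral_neg has_integral_mult_right integrable_integral set_borel_integral_eq_integral(1) iV iD)
   then show ?thesis by (rule integral_unique)
  qed
  finally have 1: "integral {s..t} (\<lambda>r. F (u r) - F (u (r - h))) \<le>
    - integral {s..t} (\<lambda>r. v r \<bullet> (u r - u (r - h))) + c * integral {s..t} (\<lambda>r. norm (u r - u (r - h)))"
   using set_borel_integral_eq_integral(2)[OF iFd] by simp
  have "integral {s..t} (\<lambda>r. norm (u r - u (r - h))) \<le> integral {s..t} (\<lambda>r. B r - B (r - h))"
  proof (rule integral_le)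
   show "(\<lambda>r. norm (u r - u (r - h))) integrable_on {s..t}" by (rule set_borel_integral_eq_integral(1)[OF iD])
   show "(\<lambda>r. B r - B (r - h)) integrable_on {s..t}"
    by (intro integrable_continuous_real continuous_on_diff continuous_on_subset[OF Bc] continuous_on_compose2[OF Bc])
     (use st h ha a in \<open>auto intro!: continuous_intros\<close>)
   fix r assume r: "r \<in> {s..t}"
   have "B (r - h) + integral {r - h..r} (\<lambda>r. norm (v r)) = B r" unfolding B_def
    by (rule Henstock_Kurzweil_Integration.integral_combine) (use r st h ha in \<open>auto intro!: inv\<close>)
   moreover have "norm (u r - u (r - h)) \<le> integral {r - h..r} (\<lambda>r. norm (v r))"
    by (rule bound) (use r h ha in auto)
   ultimately show "norm (u r - u (r - h)) \<le> B r - B (r - h)" by linarith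
  qed
  also have "\<dots> \<le> h * N" by (rule integral_average_increment_le[OF Bc Bd h(1) ha st(2) order_refl])
  finally have "c * integral {s..t} (\<lambda>r. norm (u r - u (r - h))) \<le> c * (h * N)" using c(1) by simp
  moreover have "h * (I - c) \<le> integral {s..t} (\<lambda>r. v r \<bullet> (u r - u (r - h)))" using h1(2) h by blast
  moreover have "h * (F (u t) - F (u s) - c) \<le> integral {s..t} (\<lambda>r. F (u r) - F (u (r - h)))" using h2(2) h by blast
  ultimately have "h * (F (u t) - F (u s) - c) \<le> - (h * (I - c)) + c * (h * N)" using 1 by linarith
  also have "\<dots> = h * (- I + c + c * N)" by (simp add: algebra_simps)
  finally have "F (u t) - F (u s) - c \<le> - I + c + c * N" using h(1) by simp
  then show ?thesis using c(2) by (simp add: algebra_simps)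
 qed
 then show ?thesis unfolding I_def by (rule field_le_epsilon)
qed

end

section \<open>The energy inequality down to time zero\<close>

lemma H1_curve_increment:
 assumes "H1_curve a b u u'" "a < x" "x \<le> y" "y < b"
 shows "(norm (u y - u x))\<^sup>2 \<le> (y - x) * integral {x..y} (\<lambda>r. (norm (u' r))\<^sup>2)"
proof (cases "x = y")
 case False
 define L where "L = y - x"
 have L: "0 < L" using assms False by (simp add: L_def)
 let ?D = "u y - u x"
 have "(u' has_integral ?D) {x..y}" using assms by (simp add: H1_curve_def)
 from has_integral_linear[OF this bounded_linear_inner_right[of ?D]]
 have 1: "((\<lambda>r. ?D \<bullet> u' r) has_integral (?D \<bullet> ?D)) {x..y}" by (simp add: o_def)
 have "set_integrable lborel {a<..<b} (\<lambda>r. (norm (u' r))\<^sup>2)" using assms(1) by (simp add: H1_curve_def)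
 then have "set_integrable lborel {x..y} (\<lambda>r. (norm (u' r))\<^sup>2)" by (rule set_integrable_subset) (use assms in auto)
 then have i: "(\<lambda>r. (norm (u' r))\<^sup>2) integrable_on {x..y}" by (rule set_borel_integral_eq_integral(1))
 have 2: "((\<lambda>r. (norm ?D)\<^sup>2 / (2 * L) + L / 2 * (norm (u' r))\<^sup>2) has_integral
   (L *\<^sub>R ((norm ?D)\<^sup>2 / (2 * L)) + L / 2 * integral {x..y} (\<lambda>r. (norm (u' r))\<^sup>2))) {x..y}"
  using has_integral_const_real[of "(norm ?D)\<^sup>2 / (2 * L)" x y] assms(3)
  by (intro has_integral_add has_integral_mult_right integrable_integral i) (simp add: L_def)
 have "?D \<bullet> ?D \<le> L *\<^sub>R ((norm ?D)\<^sup>2 / (2 * L)) + L / 2 * integral {x..y} (\<lambda>r. (norm (u' r))\<^sup>2)"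
 proof (rule has_integral_le[OF 1 2])
  fix r
  have "norm ?D * norm (u' r) \<le> (norm ?D)\<^sup>2 / (2 * L) + L / 2 * (norm (u' r))\<^sup>2"
  proof -
   have "0 \<le> (norm ?D - L * norm (u' r))\<^sup>2 / (2 * L)" using L by simp
   also have "\<dots> = (norm ?D)\<^sup>2 / (2 * L) + L / 2 * (norm (u' r))\<^sup>2 - norm ?D * norm (u' r)"
    using L by (simp add: power2_diff field_simps power2_eq_square)
   finally show ?thesis by simp
  qed
  then show "?D \<bullet> u' r \<le> (norm ?D)\<^sup>2 / (2 * L) + L / 2 * (norm (u' r))\<^sup>2"
   using norm_cauchy_schwarz[of ?D "u' r"] by linarith
 qed
 also have "L *\<^sub>R ((norm ?D)\<^sup>2 / (2 * L)) = (norm ?D)\<^sup>2 / 2" using L by simp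
 finally have "(norm ?D)\<^sup>2 \<le> L * integral {x..y} (\<lambda>r. (norm (u' r))\<^sup>2)"
  unfolding power2_norm_eq_inner[symmetric] by linarith
 then show ?thesis by (simp add: L_def)
qed simp

text \<open>
 The bound on the \<open>H\<^sup>2\<close> norms along the sequence is what makes the flow attain its initial datum in
 \<open>H\<^sup>1\<close>, by interpolation between \<open>L\<^sup>2\<close> and \<open>H\<^sup>2\<close>; it uses that \<open>1/t\<close> is not integrable at \<open>0\<close>.
\<close>

lemma strong_solution_initial_energy:
 fixes K :: "'a::euclidean_space l2_sphere set"
 assumes sol: "strong_solution K gradF T u0 u" and en: "energy_functional F gradF" and u0: "u0 \<in> H1_sphere"
  and e: "0 < e" "e \<le> T" and cur: "H1_curve 0 e u u'" and i2: "set_integrable lborel {0<..<e} (\<lambda>t. (norm_H2 (u t))\<^sup>2)"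
 obtains q where "\<And>n::nat. 0 < q n" "q \<longlonglongrightarrow> 0" "(\<lambda>n. F (u (q n))) \<longlonglongrightarrow> F u0"
proof -
 define b where "b = e / 2"
 have b: "0 < b" "b < e" using e by (auto simp: b_def)
 have lift: "set_integrable lborel {0..b} (\<lambda>t. indicator {0<..} t * f t)"
  if "set_integrable lborel {0<..<e} f" for f :: "real \<Rightarrow> real"
 proof -
  have "set_integrable lborel {0<..b} f" by (rule set_integrable_subset[OF that]) (use b in auto)
  then show ?thesis unfolding set_integrable_def
   by (rule Bochner_Integration.integrable_cong[THEN iffD1, rotated -1]) (auto simp: indicator_def)
 qed
 define f where "f t = indicator {0<..} t * (norm_H2 (u t))\<^sup>2" for t :: real
 define g where "g t = indicator {0<..} t * (norm (u' t))\<^sup>2" for t :: real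
 have fi: "set_integrable lborel {0..b} f" unfolding f_def[abs_def] by (rule lift[OF i2])
 have gi: "set_integrable lborel {0..b} g" unfolding g_def[abs_def] by (rule lift) (use cur in \<open>simp add: H1_curve_def\<close>)
 note fio = set_integrable_imp_integrable_on(1)[OF fi] and gio = set_integrable_imp_integrable_on(1)[OF gi]
 have f0: "0 \<le> f t" and g0: "0 \<le> g t" for t by (simp_all add: f_def g_def)
 define A where "A x = integral {0..x} f" for x
 define M where "M x = integral {0..x} g" for x
 have Ac: "continuous_on {0..b} A" unfolding A_def by (rule indefinite_integral_continuous_1) (rule fio, auto)
 have Mc: "continuous_on {0..b} M" unfolding M_def by (rule indefinite_integral_continuous_1) (rule gio, auto)
 \<comment> \<open>Otherwise the squared H^2 norm exceeds 1/r for all r below x, and its integral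
   over [y/2, y] is at least 1/2 for arbitrarily small y, against the continuity of \<open>A\<close>
   at 0.\<close>
 have ex: "\<exists>s. 0 < s \<and> s < x \<and> s * (norm_H2 (u s))\<^sup>2 \<le> 1" if x: "0 < x" "x \<le> b" for x
 proof (rule ccontr)
  assume neg: "\<not> ?thesis"
  have "\<exists>d>0. \<forall>y\<in>{0..b}. dist y 0 < d \<longrightarrow> dist (A y) (A 0) < 1/2"
   using Ac b unfolding continuous_on_iff by (meson atLeastAtMost_iff half_gt_zero_iff less_eq_real_def zero_less_one)
  then obtain d where d: "d > 0" "\<forall>y\<in>{0..b}. dist y 0 < d \<longrightarrow> dist (A y) (A 0) < 1/2" by blast
  define y where "y = min x d / 2"
  have y: "0 < y" "y < x" "y < d" "y \<in> {0..b}" using x d(1) by (auto simp: y_def)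
  have "A y < 1/2" using d(2) y by (auto simp: dist_real_def A_def)
  moreover have "1/2 \<le> integral {y/2..y} f"
  proof -
   have "integral {y/2..y} (\<lambda>_. 1 / y) \<le> integral {y/2..y} f"
   proof (rule integral_le)
    show "f integrable_on {y/2..y}" by (rule fio) (use y in auto)
    fix r assume r: "r \<in> {y/2..y}"
    then have "0 < r" "r < x" using y by auto
    then have "1 < r * (norm_H2 (u r))\<^sup>2" using neg by (auto simp: not_le)
    then have "1 / r < (norm_H2 (u r))\<^sup>2" using \<open>0 < r\<close> by (simp add: divide_less_eq mult.commute)
    moreover have "1 / y \<le> 1 / r" using r \<open>0 < r\<close> by (intro divide_left_mono) auto
    ultimately show "1 / y \<le> f r" using \<open>0 < r\<close> by (simp add: f_def)
   qed (rule integrable_const_ivl)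
   then show ?thesis using y by simp
  qed
  moreover have "integral {y/2..y} f \<le> A y" unfolding A_def
   by (rule integral_subset_le) (use y f0 in \<open>auto intro!: fio\<close>)
  ultimately show False by linarith
 qed
 define x where "x n = b / real (Suc n)" for n
 have x: "0 < x n" "x n \<le> b" for n using b by (auto simp: x_def divide_le_eq)
 have x0: "x \<longlonglongrightarrow> 0" unfolding x_def by (rule LIMSEQ_Suc[OF lim_const_over_n])
 obtain q where q: "\<And>n. 0 < q n" "\<And>n. q n < x n" "\<And>n. q n * (norm_H2 (u (q n)))\<^sup>2 \<le> 1"
  using ex[OF x] by metis
 have qb: "q n \<in> {0..b}" "q n < T" for n using q(1,2)[of n] x(2)[of n] b e by auto
 have q0: "q \<longlonglongrightarrow> 0"
  by (rule tendsto_sandwich[OF _ _ tendsto_const x0]) (auto intro!: always_eventually less_imp_le q)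
 have cu: "continuous_on {0..<T} u" "u 0 = u0" "0 < T" using sol by (auto simp: strong_solution_def)
 \<comment> \<open>Cauchy-Schwarz in time produces the factor s. It will be balanced by the bound 1
   on s times the squared H^2 norm along \<open>q\<close>, and the remaining factor M(s) tends to
   0.\<close>
 have near: "(norm (u s - u0))\<^sup>2 \<le> s * M s" if s: "0 < s" "s \<le> b" for s
 proof -
  have "(\<lambda>n. (norm (u s - u (s / real (Suc n))))\<^sup>2) \<longlonglongrightarrow> (norm (u s - u 0))\<^sup>2"
  proof (intro tendsto_power tendsto_norm tendsto_diff tendsto_const)
   show "(\<lambda>n. u (s / real (Suc n))) \<longlonglongrightarrow> u 0"
   proof (rule continuous_on_tendsto_compose[OF cu(1)])
    show "(\<lambda>n. s / real (Suc n)) \<longlonglongrightarrow> 0" by (rule LIMSEQ_Suc[OF lim_const_over_n])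
    show "\<forall>\<^sub>F n in sequentially. s / real (Suc n) \<in> {0..<T}"
    proof (intro always_eventually allI)
     fix n
     have "0 \<le> s / real (Suc n)" "s / real (Suc n) \<le> s" using s by (simp_all add: divide_le_eq)
     then show "s / real (Suc n) \<in> {0..<T}" using s b e by (simp del: of_nat_Suc)
    qed
   qed (use cu(3) in simp)
  qed
  moreover have "(norm (u s - u (s / real (Suc n))))\<^sup>2 \<le> s * M s" for n
  proof -
   let ?D = "s / real (Suc n)"
   have D: "0 < ?D" "?D \<le> s" using s by (auto simp: divide_le_eq)
   have "(norm (u s - u ?D))\<^sup>2 \<le> (s - ?D) * integral {?D..s} (\<lambda>r. (norm (u' r))\<^sup>2)"
    by (rule H1_curve_increment[OF cur]) (use D s b in auto)
   also have "integral {?D..s} (\<lambda>r. (norm (u' r))\<^sup>2) = integral {?D..s} g"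
    by (rule integral_cong) (use D in \<open>auto simp: g_def\<close>)
   also have "(s - ?D) * integral {?D..s} g \<le> s * M s"
   proof (rule mult_mono)
    show "integral {?D..s} g \<le> M s" unfolding M_def
     by (rule integral_subset_le) (use D s g0 in \<open>auto intro!: gio\<close>)
    show "0 \<le> integral {?D..s} g"
     by (rule Henstock_Kurzweil_Integration.integral_nonneg) (use D s g0 in \<open>auto intro!: gio\<close>)
   qed (use D s in auto)
   finally show ?thesis .
  qed
  ultimately have "(norm (u s - u 0))\<^sup>2 \<le> s * M s" by (intro LIMSEQ_le_const2) auto
  then show ?thesis by (simp only: cu(2))
 qed
 have M0: "(\<lambda>n. M (q n)) \<longlonglongrightarrow> 0"
 proof -
  have "(\<lambda>n. M (q n)) \<longlonglongrightarrow> M 0"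
   by (rule continuous_on_tendsto_compose[OF Mc q0]) (use qb b in auto)
  then show ?thesis by (simp add: M_def)
 qed
 have n0: "(\<lambda>n. norm (u (q n) - u0)) \<longlonglongrightarrow> 0"
 proof -
  have "(\<lambda>n. norm (u (q n) - u0)) \<longlonglongrightarrow> norm (u 0 - u0)"
   by (intro tendsto_norm tendsto_diff tendsto_const continuous_on_tendsto_compose[OF cu(1) q0])
    (use qb cu(3) q(1) in auto)
  then show ?thesis by (simp add: cu(2))
 qed
 have pr: "(\<lambda>n. norm (u (q n) - u0) * norm_H2 (u (q n))) \<longlonglongrightarrow> 0"
 proof (rule tendsto_sandwich[OF _ _ tendsto_const])
  show "\<forall>\<^sub>F n in sequentially. 0 \<le> norm (u (q n) - u0) * norm_H2 (u (q n))" by (simp add: norm_H2_nonneg)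
  show "(\<lambda>n. sqrt (M (q n))) \<longlonglongrightarrow> 0" using tendsto_real_sqrt[OF M0] by simp
  show "\<forall>\<^sub>F n in sequentially. norm (u (q n) - u0) * norm_H2 (u (q n)) \<le> sqrt (M (q n))"
  proof (intro always_eventually allI real_le_rsqrt)
   fix n
   have Mn: "0 \<le> M (q n)" unfolding M_def
    by (rule Henstock_Kurzweil_Integration.integral_nonneg) (use qb[of n] g0 in \<open>auto intro!: gio\<close>)
   have "(norm (u (q n) - u0) * norm_H2 (u (q n)))\<^sup>2 = (norm (u (q n) - u0))\<^sup>2 * (norm_H2 (u (q n)))\<^sup>2"
    by (rule power_mult_distrib)
   also have "\<dots> \<le> (q n * M (q n)) * (norm_H2 (u (q n)))\<^sup>2"
    by (intro mult_right_mono near) (use q(1)[of n] qb[of n] in auto)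
   also have "\<dots> = M (q n) * (q n * (norm_H2 (u (q n)))\<^sup>2)" by simp
   also have "\<dots> \<le> M (q n) * 1" by (rule mult_left_mono[OF q(3) Mn])
   finally show "(norm (u (q n) - u0) * norm_H2 (u (q n)))\<^sup>2 \<le> M (q n)" by simp
  qed
 qed
 have H2: "u (q n) \<in> H2_sphere" for n
  by (rule strong_solution_H2(1)[OF sol en]) (use q(1)[of n] qb[of n] in auto)
 have "(\<lambda>n. norm_H1 (u (q n) - u0)) \<longlonglongrightarrow> 0" by (rule H1_convergence[OF H2 u0 n0 pr])
 then have "(\<lambda>n. F (u (q n))) \<longlonglongrightarrow> F u0"
  using en u0 H2_sphere_H1[OF H2] by (intro norm_continuous_onD_sequentially[of H1_sphere norm_H1 F]) (auto simp: energy_functional_def)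
 then show ?thesis using that q(1) q0 by blast
qed

text \<open>Convergence of the energies to F(u0) is known only along a sequence of times, but the
  interior inequality carries the bound to all later times. It bounds the integrals of |v|^2 over
  [x_n, p] uniformly, so monotone convergence gives integrability up to 0; the primitive formula and
  the inequality then extend to time 0 by continuity.\<close>

theorem strong_solution_energy:
 fixes K :: "'a::euclidean_space l2_sphere set"
 assumes sol: "strong_solution K gradF T u0 u" and en: "energy_functional F gradF" and u0: "u0 \<in> H1_sphere"
  and e: "0 < e" "e \<le> T" and cur: "H1_curve 0 e u u'" and i2: "set_integrable lborel {0<..<e} (\<lambda>t. (norm_H2 (u t))\<^sup>2)"
  and p: "0 < p" "p < T"
 obtains v where "v \<in> borel_measurable borel" "set_integrable lborel {0..p} (\<lambda>r. (norm (v r))\<^sup>2)"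
  "\<And>t x. t \<in> {0..p} \<Longrightarrow> u t \<bullet> x = u0 \<bullet> x + integral {0..t} (\<lambda>r. v r \<bullet> x)"
  "\<And>s t. 0 \<le> s \<Longrightarrow> s \<le> t \<Longrightarrow> t \<le> p \<Longrightarrow> F (u t) + integral {s..t} (\<lambda>r. (norm (v r))\<^sup>2) \<le> F (u s)"
  "AE t in lborel. t \<in> {0<..<p} \<longrightarrow> constrained_slope K gradF (u t) \<le> norm (v t)"
proof -
 obtain v where der: "solution_derivative K gradF T u v" using strong_solution_derivative[OF sol] by blast
 note mv = solution_derivative_measurable[OF sol en der] and iv = solution_derivative_square_integrable[OF sol en der]
  and pv = solution_derivative_integral[OF sol en der]
 have v0: "v r = 0" if "r \<notin> {0<..<T}" for r using der that by (simp add: solution_derivative_def)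
 note interior = strong_solution_energy_interior[OF sol en der]
 have cu: "continuous_on {0..<T} u" "u 0 = u0" "0 < T" using sol by (auto simp: strong_solution_def)
 obtain d where d: "\<And>n::nat. 0 < d n" "d \<longlonglongrightarrow> 0" "(\<lambda>n. F (u (d n))) \<longlonglongrightarrow> F u0"
  by (rule strong_solution_initial_energy[OF sol en u0 e cur i2]) (rule that)
 let ?q = "\<lambda>r. (norm (v r))\<^sup>2"
 have ivo: "?q integrable_on {a..b}" if "0 < a" "b < T" for a b
  by (rule set_borel_integral_eq_integral(1)[OF iv[OF that]])
 have upper: "F (u t) + integral {s..t} ?q \<le> F u0" if st: "0 < s" "s \<le> t" "t < T" for s t
 proof (rule LIMSEQ_le_const[OF d(3)])
  obtain n0 where n0: "\<And>n. n \<ge> n0 \<Longrightarrow> d n < s"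
   using order_tendstoD(2)[OF d(2) st(1)] by (auto simp: eventually_sequentially)
  show "\<exists>N. \<forall>n\<ge>N. F (u t) + integral {s..t} ?q \<le> F (u (d n))"
  proof (intro exI allI impI)
   fix n assume n: "n0 \<le> n"
   have "integral {s..t} ?q \<le> integral {d n..t} ?q"
    by (rule integral_subset_le) (use n0[OF n] st d(1)[of n] in \<open>auto intro!: ivo\<close>)
   moreover have "F (u t) + integral {d n..t} ?q \<le> F (u (d n))"
    by (rule interior) (use n0[OF n] st d(1)[of n] in auto)
   ultimately show "F (u t) + integral {s..t} ?q \<le> F (u (d n))" by linarith
  qed
 qed
 define x where "x n = p / real (Suc n)" for n
 have x: "0 < x n" "x n \<le> p" for n using p by (auto simp: x_def divide_le_eq)
 have x0: "x \<longlonglongrightarrow> 0" unfolding x_def by (rule LIMSEQ_Suc[OF lim_const_over_n])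
 have xdec: "x n \<le> x m" if "m \<le> n" for m n using p that by (auto simp: x_def intro!: divide_left_mono)
 have iv0: "set_integrable lborel {0..p} ?q"
 proof -
  let ?f = "\<lambda>n r. indicator {x n..p} r *\<^sub>R ?q r"
  have fi: "integrable lborel (?f n)" for n using iv[OF x(1) p(2), of n] by (simp add: set_integrable_def)
  have fI: "integral\<^sup>L lborel (?f n) = integral {x n..p} ?q" for n
   using set_borel_integral_eq_integral(2)[OF iv[OF x(1) p(2)]] by (simp add: set_lebesgue_integral_def)
  have inc: "incseq (\<lambda>n. integral\<^sup>L lborel (?f n))"
  proof (rule incseq_SucI, rule integral_mono[OF fi fi])
   fix n r
   show "?f n r \<le> ?f (Suc n) r" using xdec[of n "Suc n"] by (auto simp: indicator_def)
  qed
  have "integral\<^sup>L lborel (?f n) \<le> F u0 - F (u p)" for n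
   unfolding fI using upper[OF x(1,2) p(2), of n] by linarith
  then obtain L where L: "(\<lambda>n. integral\<^sup>L lborel (?f n)) \<longlonglongrightarrow> L"
   using incseq_convergent[OF inc] by metis
  have "integrable lborel (\<lambda>r. indicator {0..p} r *\<^sub>R ?q r)"
  proof (rule integrable_monotone_convergence[OF fi _ _ L])
   show "AE r in lborel. mono (\<lambda>n. ?f n r)"
   proof (intro AE_I2 monoI)
    fix r and m n :: nat assume "m \<le> n"
    then show "?f m r \<le> ?f n r" using xdec[of m n] by (auto simp: indicator_def)
   qed
   show "AE r in lborel. (\<lambda>n. ?f n r) \<longlonglongrightarrow> indicator {0..p} r *\<^sub>R ?q r"
   proof (rule AE_I2)
    fix r :: real
    show "(\<lambda>n. ?f n r) \<longlonglongrightarrow> indicator {0..p} r *\<^sub>R ?q r"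
    proof (cases "0 < r")
     case True
     have "\<forall>\<^sub>F n in sequentially. x n < r" by (rule order_tendstoD(2)[OF x0 True])
     then have "\<forall>\<^sub>F n in sequentially. ?f n r = indicator {0..p} r *\<^sub>R ?q r"
      by (rule eventually_mono) (use True in \<open>auto simp: indicator_def\<close>)
     then show ?thesis by (rule tendsto_eventually)
    next
     case False
     then have "v r = 0" by (intro v0) auto
     then show ?thesis by simp
    qed
   qed
   show "(\<lambda>r. indicator {0..p} r *\<^sub>R ?q r) \<in> borel_measurable lborel" using mv by measurable
  qed
  then show ?thesis by (simp add: set_integrable_def)
 qed
 note io0 = set_integrable_imp_integrable_on(1)[OF iv0]
 have energy: "F (u t) + integral {s..t} ?q \<le> F (u s)" if st: "0 \<le> s" "s \<le> t" "t \<le> p" for s t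
 proof (cases "s = 0")
  case False
  then show ?thesis using interior[of s t] st p by simp
 next
  case True
  show ?thesis
  proof (cases "t = 0")
   case False
   then have t: "0 < t" using st True by simp
   have c: "continuous_on {0..t} (\<lambda>y. integral {0..y} ?q)"
    by (rule indefinite_integral_continuous_1, rule io0) (use st in auto)
   have y: "t / real (Suc n) \<in> {0..t}" "0 < t / real (Suc n)" for n using t by (auto simp: divide_le_eq)
   have y0: "(\<lambda>n. t / real (Suc n)) \<longlonglongrightarrow> 0" by (rule LIMSEQ_Suc[OF lim_const_over_n])
   have "(\<lambda>n. integral {0..t / real (Suc n)} ?q) \<longlonglongrightarrow> integral {0..0} ?q"
    by (rule continuous_on_tendsto_compose[OF c y0]) (use y t in \<open>auto intro!: always_eventually simp del: of_nat_Suc\<close>)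
   then have lim: "(\<lambda>n. F u0 + integral {0..t / real (Suc n)} ?q) \<longlonglongrightarrow> F u0 + 0" by (intro tendsto_add tendsto_const) simp
   have "F (u t) + integral {0..t} ?q \<le> F u0 + 0"
   proof (rule LIMSEQ_le_const[OF lim], intro exI allI impI)
    fix n
    have "integral {0..t / real (Suc n)} ?q + integral {t / real (Suc n)..t} ?q = integral {0..t} ?q"
     by (rule Henstock_Kurzweil_Integration.integral_combine) (use y[of n] st in \<open>auto intro!: io0\<close>)
    moreover have "F (u t) + integral {t / real (Suc n)..t} ?q \<le> F u0"
     by (rule upper) (use y[of n] st p in auto)
    ultimately show "F (u t) + integral {0..t} ?q \<le> F u0 + integral {0..t / real (Suc n)} ?q" by linarith
   qed
   then show ?thesis using True cu(2) by simp
  qed (use True cu(2) in simp)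
 qed
 have prim: "u t \<bullet> z = u0 \<bullet> z + integral {0..t} (\<lambda>r. v r \<bullet> z)" if t: "t \<in> {0..p}" for t z
 proof (cases "t = 0")
  case False
  then have t0: "0 < t" using t by simp
  have si: "set_integrable lborel {0..p} (\<lambda>r. v r \<bullet> z)"
  proof (rule set_integrable_bound[where f="\<lambda>r. norm (v r) * norm z"])
   show "set_integrable lborel {0..p} (\<lambda>r. norm (v r) * norm z)"
    by (rule set_integrable_mult_left) (rule set_integrable_norm_of_square[OF mv iv0])
   show "set_borel_measurable lborel {0..p} (\<lambda>r. v r \<bullet> z)"
    using mv unfolding set_borel_measurable_def by measurable
   show "AE r in lborel. r \<in> {0..p} \<longrightarrow> norm (v r \<bullet> z) \<le> norm (norm (v r) * norm z)"
    by (intro AE_I2) (simp add: Cauchy_Schwarz_ineq2)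
  qed
  note sio = set_integrable_imp_integrable_on(1)[OF si]
  have c: "continuous_on {0..t} (\<lambda>y. integral {0..y} (\<lambda>r. v r \<bullet> z))"
   by (rule indefinite_integral_continuous_1, rule sio) (use t in auto)
  have y: "t / real (Suc n) \<in> {0..t}" "0 < t / real (Suc n)" for n using t0 by (auto simp: divide_le_eq)
  have y0: "(\<lambda>n. t / real (Suc n)) \<longlonglongrightarrow> 0" by (rule LIMSEQ_Suc[OF lim_const_over_n])
  have cut: "continuous_on {0..t} u" by (rule continuous_on_subset[OF cu(1)]) (use t p in auto)
  have "continuous_on {0..t} (\<lambda>y. u y \<bullet> z - integral {0..y} (\<lambda>r. v r \<bullet> z))"
   by (intro continuous_on_diff continuous_on_inner cut c continuous_on_const)
  then have "(\<lambda>n. u (t / real (Suc n)) \<bullet> z - integral {0..t / real (Suc n)} (\<lambda>r. v r \<bullet> z)) \<longlonglongrightarrow> u 0 \<bullet> z - integral {0..0} (\<lambda>r. v r \<bullet> z)"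
   by (rule continuous_on_tendsto_compose[OF _ y0]) (use y t0 in \<open>auto intro!: always_eventually simp del: of_nat_Suc\<close>)
  moreover have "u (t / real (Suc n)) \<bullet> z - integral {0..t / real (Suc n)} (\<lambda>r. v r \<bullet> z) = u t \<bullet> z - integral {0..t} (\<lambda>r. v r \<bullet> z)" for n
  proof -
   let ?y = "t / real (Suc n)"
   have "(v has_integral (u t - u ?y)) {?y..t}" by (rule pv) (use y[of n] t p in auto)
   from has_integral_linear[OF this bounded_linear_inner_left[of z]]
   have "integral {?y..t} (\<lambda>r. v r \<bullet> z) = (u t - u ?y) \<bullet> z" by (intro integral_unique) (simp add: o_def)
   moreover have "integral {0..?y} (\<lambda>r. v r \<bullet> z) + integral {?y..t} (\<lambda>r. v r \<bullet> z) = integral {0..t} (\<lambda>r. v r \<bullet> z)"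
    by (rule Henstock_Kurzweil_Integration.integral_combine) (use y[of n] t in \<open>auto intro!: sio\<close>)
   ultimately show ?thesis by (simp add: inner_diff_left)
  qed
  ultimately have "u t \<bullet> z - integral {0..t} (\<lambda>r. v r \<bullet> z) = u 0 \<bullet> z - integral {0..0} (\<lambda>r. v r \<bullet> z)"
   by (simp add: LIMSEQ_const_iff del: of_nat_Suc)
  then show ?thesis by (simp add: cu(2))
 qed (simp add: cu(2))
 have slope: "AE t in lborel. t \<in> {0<..<p} \<longrightarrow> constrained_slope K gradF (u t) \<le> norm (v t)"
  using strong_solution_slope[OF sol en der] by eventually_elim (use p in auto)
 show ?thesis by (rule that[OF mv iv0 prim energy slope])
qed

section \<open>The competitor\<close>

text \<open>Near time 0 the integrable squared H^2 norm dominates; on later compact intervals the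
  tangential derivative is continuous in time because the flow is continuous in H^2.\<close>

lemma strong_solution_tangential:
 fixes K :: "'a::euclidean_space l2_sphere set"
 assumes sol: "strong_solution K gradF T u0 u" and en: "energy_functional F gradF"
  and a: "0 < a" "a \<le> T" and i2: "set_integrable lborel {0<..<a} (\<lambda>t. (norm_H2 (u t))\<^sup>2)"
  and r: "0 < r" "r < T" and e: "e \<in> Basis"
 defines "q \<equiv> \<lambda>t. if t \<in> {0<..r} then tangential_derivative e (u t) else 0"
 shows "q \<in> borel_measurable borel" "set_integrable lborel {0..r} (\<lambda>t. (norm (q t))\<^sup>2)"
proof -
 note H2 = strong_solution_H2[OF sol en]
 have lip: "norm (tangential_derivative e (u s) - tangential_derivative e (u t)) \<le> norm_H2 (u s - u t)"
  if "s \<in> {0<..<T}" "t \<in> {0<..<T}" for s t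
 proof -
  have "u s - u t \<in> H2_sphere" by (intro subspace_diff subspace_H2_sphere H2 that)
  moreover have "tangential_derivative e (u s - u t) = tangential_derivative e (u s) - tangential_derivative e (u t)"
   by (rule tangential_derivative_diff) (use H2_sphere_H1[OF H2(1)] that e in auto)
  ultimately show ?thesis using norm_tangential_derivative_le_H2[where c="u s - u t" and e=e] e by simp
 qed
 have c: "continuous_on {0<..<T} (\<lambda>t. tangential_derivative e (u t))"
  unfolding continuous_on_def
 proof
  fix t assume t: "t \<in> {0<..<T}"
  have "((\<lambda>s. tangential_derivative e (u s) - tangential_derivative e (u t)) \<longlongrightarrow> 0) (at t within {0<..<T})"
   by (rule Lim_null_comparison[OF _ H2(2)[OF t]]) (use lip t in \<open>auto simp: eventually_at_filter\<close>)
  then show "((\<lambda>t. tangential_derivative e (u t)) \<longlongrightarrow> tangential_derivative e (u t)) (at t within {0<..<T})"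
   by (simp add: LIM_zero_iff)
 qed
 have "(\<lambda>t. indicator {0<..r} t *\<^sub>R tangential_derivative e (u t)) \<in> borel_measurable borel"
  by (rule borel_measurable_continuous_on_indicator) (use r in \<open>auto intro: continuous_on_subset[OF c]\<close>)
 moreover have "(\<lambda>t. indicator {0<..r} t *\<^sub>R tangential_derivative e (u t)) = q"
  by (auto simp: q_def indicator_def)
 ultimately show m: "q \<in> borel_measurable borel" by simp
 define b where "b = min (a / 2) r"
 have b: "0 < b" "b < a" "b \<le> r" using a r by (auto simp: b_def)
 have 1: "set_integrable lborel {0..b} (\<lambda>t. (norm (q t))\<^sup>2)"
 proof -
  have "set_integrable lborel {0<..b} (\<lambda>t. (norm_H2 (u t))\<^sup>2)"
   by (rule set_integrable_subset[OF i2]) (use b in auto)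
  then have "set_integrable lborel {0<..b} (\<lambda>t. (norm (q t))\<^sup>2)"
  proof (rule set_integrable_bound)
   show "set_borel_measurable lborel {0<..b} (\<lambda>t. (norm (q t))\<^sup>2)"
    using m unfolding set_borel_measurable_def by measurable
   show "AE t in lborel. t \<in> {0<..b} \<longrightarrow> norm ((norm (q t))\<^sup>2) \<le> norm ((norm_H2 (u t))\<^sup>2)"
   proof (rule AE_I2, rule impI)
    fix t assume t: "t \<in> {0<..b}"
    have "norm (q t) \<le> norm_H2 (u t)"
     using norm_tangential_derivative_le_H2[where c="u t" and e=e] H2(1)[of t] t b r e by (simp add: q_def)
    then show "norm ((norm (q t))\<^sup>2) \<le> norm ((norm_H2 (u t))\<^sup>2)" by (simp add: power_mono)
   qed
  qed
  then show ?thesis unfolding set_integrable_def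
   by (rule Bochner_Integration.integrable_cong[THEN iffD1, rotated -1]) (auto simp: q_def indicator_def)
 qed
 have "continuous_on {b..r} (\<lambda>t. (norm (tangential_derivative e (u t)))\<^sup>2)"
  by (intro continuous_intros continuous_on_subset[OF c]) (use b r in auto)
 then have "continuous_on {b..r} (\<lambda>t. (norm (q t))\<^sup>2)"
  by (rule continuous_on_cong[THEN iffD1, rotated -1]) (use b in \<open>auto simp: q_def\<close>)
 then have 2: "set_integrable lborel {b..r} (\<lambda>t. (norm (q t))\<^sup>2)" by (rule borel_integrable_atLeastAtMost')
 have "{0..r} = {0..b} \<union> {b..r}" using b by auto
 then show "set_integrable lborel {0..r} (\<lambda>t. (norm (q t))\<^sup>2)" using set_integrable_Un[OF 1 2] by simp
qed

text \<open>The substitution t = a (1 - r), under which r = 1 is the initial time.\<close>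

lemma set_integral_reverse:
 fixes f :: "real \<Rightarrow> real"
 assumes a: "0 < a" and f: "set_integrable lborel {0..a} f"
 shows "set_integrable lborel {0..1} (\<lambda>r. f (a * (1 - r)))"
  "r \<in> {0..1} \<Longrightarrow> (LINT s:{r..1}|lborel. f (a * (1 - s))) = integral {0..a * (1 - r)} f / a"
proof -
 have ind: "indicator {0..a * (1 - r)} (a + - a * x) = (indicator {r..1} x :: real)" for x r :: real
  using a mult_le_cancel_left_pos[of a "1 - x" "1 - r"] mult_nonneg_nonneg[of a "1 - x"] mult_pos_neg[of a "1 - x"]
  by (auto simp: indicator_def algebra_simps)
 have arg: "a + - a * x = a * (1 - x)" for x by (simp add: algebra_simps)
 have "integrable lborel (\<lambda>x. indicator {0..a} (a + - a * x) *\<^sub>R f (a + - a * x))"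
  using f a unfolding set_integrable_def by (intro lborel_integrable_real_affine) auto
 then show "set_integrable lborel {0..1} (\<lambda>r. f (a * (1 - r)))"
  using ind[of 0] by (simp only: set_integrable_def arg mult_1_right diff_zero)
 assume r: "r \<in> {0..1}"
 have fr: "set_integrable lborel {0..a * (1 - r)} f"
  by (rule set_integrable_imp_integrable_on(2)[OF f]) (use r a in \<open>auto simp: mult_le_cancel_left1\<close>)
 have "integral {0..a * (1 - r)} f = (\<integral>x. indicator {0..a * (1 - r)} x *\<^sub>R f x \<partial>lborel)"
  using set_borel_integral_eq_integral(2)[OF fr] by (simp add: set_lebesgue_integral_def)
 also have "\<dots> = \<bar>- a\<bar> *\<^sub>R (\<integral>x. indicator {0..a * (1 - r)} (a + - a * x) *\<^sub>R f (a + - a * x) \<partial>lborel)"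
  by (rule lborel_integral_real_affine) (use a in simp)
 also have "\<dots> = a * (LINT s:{r..1}|lborel. f (a * (1 - s)))"
  unfolding ind unfolding arg set_lebesgue_integral_def using a by simp
 finally show "(LINT s:{r..1}|lborel. f (a * (1 - s))) = integral {0..a * (1 - r)} f / a"
  using a by simp
qed

lemma set_integral_power_unit_interval:
 "0 < n \<Longrightarrow> 0 \<le> b \<Longrightarrow> set_integrable lborel {0..b} (\<lambda>r::real. r ^ (n - 1))"
 "0 < n \<Longrightarrow> 0 \<le> b \<Longrightarrow> (LINT r:{0..b}|lborel. r ^ (n - 1)) = b ^ n / real n"
proof -
 assume n: "0 < n" and b: "0 \<le> b"
 show i: "set_integrable lborel {0..b} (\<lambda>r::real. r ^ (n - 1))"
  by (intro borel_integrable_atLeastAtMost' continuous_intros)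
 have "((\<lambda>r. r ^ (n - 1)) has_integral (b ^ n / real n - 0 ^ n / real n)) {0..b}"
 proof (rule fundamental_theorem_of_calculus[OF b])
  fix x :: real
  have "((\<lambda>r. r ^ n / real n) has_real_derivative (real n * x ^ (n - Suc 0)) / real n) (at x within {0..b})"
   by (intro derivative_eq_intros) (use n in auto)
  then show "((\<lambda>r. r ^ n / real n) has_vector_derivative x ^ (n - 1)) (at x within {0..b})"
   using n by (simp add: has_real_derivative_iff_has_vector_derivative)
 qed
 then show "(LINT r:{0..b}|lborel. r ^ (n - 1)) = b ^ n / real n"
  using set_borel_integral_eq_integral(2)[OF i] n by (simp add: integral_unique)
qed

lemma cylinder_curve_constant:
 fixes c :: "'a::euclidean_space l2_sphere"
 assumes c: "c \<in> H1_sphere"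
 obtains t where "cylinder_curve (\<lambda>_. rep c) (\<lambda>_ _. 0) t"
proof -
 let ?T = "\<lambda>e. rep (tangential_derivative e c)"
 define t :: "real \<Rightarrow> 'a \<Rightarrow> 'a" where "t r y = (\<Sum>e\<in>Basis. ?T e y *\<^sub>R e)" for r y
 have mc: "rep x \<in> borel_measurable borel" for x :: "'a l2_sphere"
  using rep_l2_sphere_square_integrable[of x]
  by (simp add: square_integrable_def measurable_def sets_sphere_measure space_sphere_measure)
 have mc2: "(\<lambda>(r::real, y). rep x y) \<in> borel_measurable (borel \<Otimes>\<^sub>M borel)" for x :: "'a l2_sphere"
  unfolding case_prod_unfold by (rule measurable_compose[OF measurable_snd mc])
 have mt: "(\<lambda>(r, y). t r y) \<in> borel_measurable (borel \<Otimes>\<^sub>M borel)"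
  unfolding t_def case_prod_unfold
  by (intro borel_measurable_sum borel_measurable_scaleR borel_measurable_const measurable_compose[OF measurable_snd mc])
 have sq: "integrable cylinder_measure (\<lambda>(r::real, y). (rep x y)\<^sup>2)" for x :: "'a l2_sphere"
  using integral_cylinder_mult(1)[of "\<lambda>_. 1" "\<lambda>y. (rep x y)\<^sup>2"] rep_l2_sphere_square_integrable[of x]
  by (simp add: square_integrable_def)
 have te: "t r y \<bullet> e = ?T e y" if "e \<in> Basis" for r y e
  using that by (simp add: t_def inner_sum_left inner_Basis if_distrib cong: if_cong)
 have nt: "(norm (t r y))\<^sup>2 = (\<Sum>e\<in>Basis. (?T e y)\<^sup>2)" for r y
 proof -
  have "(norm (t r y))\<^sup>2 = (\<Sum>e\<in>Basis. (t r y \<bullet> e) * (t r y \<bullet> e))"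
   unfolding power2_norm_eq_inner by (rule euclidean_inner)
  also have "\<dots> = (\<Sum>e\<in>Basis. (?T e y)\<^sup>2)"
   by (rule sum.cong) (simp_all add: te power2_eq_square)
  finally show ?thesis .
 qed
 have "integrable cylinder_measure (\<lambda>x. \<Sum>e\<in>Basis. (?T e (snd x))\<^sup>2)"
  using sq by (intro Bochner_Integration.integrable_sum) (simp add: case_prod_unfold)
 then have st: "L2_cylinder t"
  using measurable_cylinder[OF mt] by (simp add: square_integrable_def case_prod_unfold nt)
 have sc: "square_integrable cylinder_measure (\<lambda>(r::real, y). rep c y)"
  using measurable_cylinder[OF mc2[of c]] sq[of c] by (simp add: square_integrable_def case_prod_unfold)
 have td: "(\<oint>y. rep c y * (tangential y (Df y) \<bullet> e)) =
    - (\<oint>y. (t r y \<bullet> e) * f y)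
    + (real DIM('a) - 1) * (\<oint>y. rep c y * f y * (y \<bullet> e))"
  if "e \<in> Basis" "C1_gradient f Df" for e r f Df
  using H1_sphere_derivative[OF c that(1)] that(2) unfolding has_tangential_derivative_def te[OF that(1)] by blast
 have "cylinder_curve (\<lambda>_. rep c) (\<lambda>_ _. 0) t"
  unfolding cylinder_curve_def
  using mc2[of c] mt st sc td rep_l2_sphere_square_integrable[of c]
  by (auto simp: square_integrable_def case_prod_unfold)
 then show ?thesis by (rule that)
qed

text \<open>The radial term of the slicing identity is zero here, and with n = 2k + d - 2 the weight
  r^(n-1) integrates to 1/n over [0,1].\<close>

lemma homogeneous_extension_energy:
 fixes c :: "'a::euclidean_space l2_sphere"
 assumes c: "c \<in> H1_sphere" and d: "2 \<le> DIM('a)" "3 \<le> 2 * k + DIM('a)"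
  and sl: "slicing_property k Csl F G"
 shows "G (homogeneous_extension k c) = F c / real (2 * k + DIM('a) - 2)"
  "has_trace (homogeneous_extension k c) c"
  "r \<in> {0<..1} \<Longrightarrow> has_slice (homogeneous_extension k c) r (r ^ k *\<^sub>R c)"
proof -
 obtain t where C: "cylinder_curve (\<lambda>_. rep c) (\<lambda>_ _. 0) t" by (rule cylinder_curve_constant[OF c])
 let ?u = "\<lambda>_::real. rep c"
 define n where "n = 2 * k + DIM('a) - 2"
 have n: "0 < n" "2 * k + DIM('a) - 3 = n - 1" using d by (auto simp: n_def)
 have i: "set_integrable lborel {0..1} (\<lambda>r. F (cls (?u r)) * r ^ (2 * k + DIM('a) - 3))"
  using set_integral_power_unit_interval(1)[OF n(1), of 1] by (intro set_integrable_mult_right) (simp add: n(2))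
 have "zero_homogeneous ?u" unfolding zero_homogeneous_def by (intro exI[of _ "rep c"]) simp
 moreover have "weak_derivatives_cylinder ?u (\<lambda>_ _. 0) t" by (rule cylinder_curve_weak_derivatives[OF C])
 ultimately have "G (polar k ?u) = slicing_bound k Csl F ?u (\<lambda>_ _. 0)"
  using sl i unfolding slicing_property_def by blast
 also have "\<dots> = F c * (LINT r:{0..1}|lborel. r ^ (n - 1))"
  by (simp add: slicing_bound_def abs_rep_l2_sphere n(2))
 also have "\<dots> = F c / real n" using set_integral_power_unit_interval(2)[OF n(1), of 1] by simp
 finally show "G (homogeneous_extension k c) = F c / real (2 * k + DIM('a) - 2)"
  by (simp add: homogeneous_extension_def n_def)
 show "has_trace (homogeneous_extension k c) c"
  using cylinder_curve_trace[OF C d] by (simp add: homogeneous_extension_def abs_rep_l2_sphere)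
 show "has_slice (homogeneous_extension k c) r (r ^ k *\<^sub>R c)" if "r \<in> {0<..1}"
  using cylinder_curve_slice[OF C d, of r] that by (simp add: homogeneous_extension_def abs_rep_l2_sphere)
qed

lemma has_trace_imp_H1_ball: "has_trace h c \<Longrightarrow> h \<in> H1_ball"
 unfolding has_trace_def H1_ball_def by blast

section \<open>Energy drop along the flow, and the competitor built from it\<close>

context
 fixes K :: "'a::euclidean_space l2_sphere set" and F gradF T u0 u u' j p
 assumes sol: "strong_solution K gradF T u0 u" and en: "energy_functional F gradF" and u0: "u0 \<in> H1_sphere"
  and j: "0 < j" "j \<le> T" and cur: "H1_curve 0 j u u'" and i2: "set_integrable lborel {0<..<j} (\<lambda>t. (norm_H2 (u t))\<^sup>2)"
  and p: "0 < p" "p < T"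
begin

lemma solution_energy_antimono:
 assumes "0 \<le> s" "s \<le> t" "t \<le> p"
 shows "F (u t) \<le> F (u s)"
proof -
 obtain v where mv: "v \<in> borel_measurable borel" and iv: "set_integrable lborel {0..p} (\<lambda>r. (norm (v r))\<^sup>2)"
  and pr: "\<And>t x. t \<in> {0..p} \<Longrightarrow> u t \<bullet> x = u0 \<bullet> x + integral {0..t} (\<lambda>r. v r \<bullet> x)"
  and E: "\<And>s t. 0 \<le> s \<Longrightarrow> s \<le> t \<Longrightarrow> t \<le> p \<Longrightarrow> F (u t) + integral {s..t} (\<lambda>r. (norm (v r))\<^sup>2) \<le> F (u s)"
  and slope: "AE t in lborel. t \<in> {0<..<p} \<longrightarrow> constrained_slope K gradF (u t) \<le> norm (v t)"
  by (rule strong_solution_energy[OF sol en u0 j cur i2 p]) (rule that)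
 have "0 \<le> integral {s..t} (\<lambda>r. (norm (v r))\<^sup>2)"
  by (rule Henstock_Kurzweil_Integration.integral_nonneg)
   (use set_integrable_imp_integrable_on(1)[OF iv assms(1,3)] in auto)
 then show ?thesis using E[OF assms] by linarith
qed

text \<open>Time p/2 will correspond to r = 1/2 on the competitor. If half of the excess f0 is lost
  by then, the drop is at least f0/2 \<ge> P/2, as f0 \<le> 1 and 2 - 2i \<ge> 1. Otherwise the
  excess stays above f0/2 until p/2, so |v| \<ge> A there almost everywhere and the drop is at least
  p A^2/2; the 8 is this 2 times the bound 4 for 2^(2 - 2i).\<close>

theorem solution_energy_drop:
 assumes L: "lojasiewicz K F gradF b i CL dL EL" and near: "\<forall>s\<in>{0..p}. norm (u s - b) \<le> dL"
  and f0: "0 < F u0 - F b" "F u0 - F b \<le> 1" "F u0 - F b \<le> EL"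
 shows "min (1 / 2) (p / (8 * CL\<^sup>2)) * (F u0 - F b) powr (2 - 2 * i) \<le> F u0 - F (u (p / 2))"
proof -
 have i: "0 < i" "i \<le> 1 / 2" and CL: "0 < CL"
  and loj: "\<And>x. x \<in> K \<inter> H2_sphere \<Longrightarrow> norm (x - b) \<le> dL \<Longrightarrow> F x - F b \<le> EL \<Longrightarrow>
    (max 0 (F x - F b)) powr (1 - i) \<le> CL * constrained_slope K gradF x"
  using L by (auto simp: lojasiewicz_def)
 define f0 where "f0 = F u0 - F b"
 have f00: "0 < f0" "f0 \<le> 1" using f0 by (auto simp: f0_def)
 define P where "P = f0 powr (2 - 2 * i)"
 have P: "0 < P" using f00 by (simp add: P_def)
 have u00: "u 0 = u0" using sol by (simp add: strong_solution_def)
 show ?thesis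
 proof (cases "F (u (p / 2)) - F b \<le> f0 / 2")
  case True
  have "P \<le> f0 powr 1" unfolding P_def by (rule powr_mono') (use i f00 in auto)
  then have "P \<le> f0" using f00 by simp
  moreover have "min (1 / 2) (p / (8 * CL\<^sup>2)) * P \<le> 1 / 2 * P" using P by (intro mult_right_mono) auto
  ultimately show ?thesis using True by (simp add: f0_def P_def)
 next
  case False
  obtain v where mv: "v \<in> borel_measurable borel" and iv: "set_integrable lborel {0..p} (\<lambda>r. (norm (v r))\<^sup>2)"
   and pr: "\<And>t x. t \<in> {0..p} \<Longrightarrow> u t \<bullet> x = u0 \<bullet> x + integral {0..t} (\<lambda>r. v r \<bullet> x)"
   and E: "\<And>s t. 0 \<le> s \<Longrightarrow> s \<le> t \<Longrightarrow> t \<le> p \<Longrightarrow> F (u t) + integral {s..t} (\<lambda>r. (norm (v r))\<^sup>2) \<le> F (u s)"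
   and slope: "AE t in lborel. t \<in> {0<..<p} \<longrightarrow> constrained_slope K gradF (u t) \<le> norm (v t)"
   by (rule strong_solution_energy[OF sol en u0 j cur i2 p]) (rule that)
  define A where "A = (f0 / 2) powr (1 - i) / CL"
  have A0: "0 < A" using f00 CL by (simp add: A_def)
  have low: "A \<le> norm (v t)" if t: "t \<in> {0<..<p/2}" and sl: "constrained_slope K gradF (u t) \<le> norm (v t)" for t
  proof -
   have "u t \<in> K" using sol t p by (auto simp: strong_solution_def)
   moreover have "u t \<in> H2_sphere" by (rule strong_solution_H2(1)[OF sol en]) (use t p in auto)
   moreover have "norm (u t - b) \<le> dL" using near t by simp
   moreover have "F (u t) \<le> F u0" using solution_energy_antimono[of 0 t] t u00 by simp
   ultimately have "(max 0 (F (u t) - F b)) powr (1 - i) \<le> CL * constrained_slope K gradF (u t)"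
    using f0(3) by (intro loj) auto
   also have "\<dots> \<le> CL * norm (v t)" using sl CL by simp
   finally have 1: "(max 0 (F (u t) - F b)) powr (1 - i) \<le> CL * norm (v t)" .
   have "F (u (p / 2)) \<le> F (u t)" by (rule solution_energy_antimono) (use t p in auto)
   then have M: "f0 / 2 \<le> max 0 (F (u t) - F b)" using False unfolding le_max_iff_disj by linarith
   have "(f0 / 2) powr (1 - i) \<le> (max 0 (F (u t) - F b)) powr (1 - i)"
    by (rule powr_mono2[OF _ _ M]) (use i f00 in auto)
   then show ?thesis using 1 CL by (simp add: A_def divide_le_eq mult.commute)
  qed
  have ivh: "set_integrable lborel {0..p/2} (\<lambda>r. (norm (v r))\<^sup>2)"
   by (rule set_integrable_imp_integrable_on(2)[OF iv]) (use p in auto)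
  have ic: "set_integrable lborel {0..p/2} (\<lambda>r. A\<^sup>2)" by (simp add: borel_integrable_atLeastAtMost')
  have "(LINT r:{0..p/2}|lborel. A\<^sup>2) \<le> (LINT r:{0..p/2}|lborel. (norm (v r))\<^sup>2)"
  proof (rule set_integral_mono_AE[OF ic ivh])
   show "AE r\<in>{0..p/2} in lborel. A\<^sup>2 \<le> (norm (v r))\<^sup>2"
    using slope AE_lborel_singleton[of "0::real"] AE_lborel_singleton[of "p/2"]
   proof eventually_elim
    case (elim r)
    show ?case
    proof
     assume "r \<in> {0..p/2}"
     then have r: "r \<in> {0<..<p/2}" "r \<in> {0<..<p}" using elim(2,3) p by auto
     have "A \<le> norm (v r)" by (rule low[OF r(1)]) (use elim(1) r(2) in blast)
     then show "A\<^sup>2 \<le> (norm (v r))\<^sup>2" using A0 by (intro power_mono) auto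
    qed
   qed
  qed
  then have "p / 2 * A\<^sup>2 \<le> integral {0..p/2} (\<lambda>r. (norm (v r))\<^sup>2)"
   using set_borel_integral_eq_integral(2)[OF ivh] set_borel_integral_eq_integral(2)[OF ic] p by simp
  moreover have "F (u (p / 2)) + integral {0..p/2} (\<lambda>r. (norm (v r))\<^sup>2) \<le> F u0"
   using E[of 0 "p/2"] p u00 by simp
  ultimately have drop: "p / 2 * A\<^sup>2 \<le> F u0 - F (u (p / 2))" by linarith
  have "P / 4 \<le> ((f0 / 2) powr (1 - i))\<^sup>2"
  proof -
   have "((f0 / 2) powr (1 - i))\<^sup>2 = (f0 / 2) powr (2 - 2 * i)"
    by (simp add: power2_eq_square powr_add[symmetric])
   also have "\<dots> = P / 2 powr (2 - 2 * i)" using f00 by (simp add: powr_divide P_def)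
   finally have eq: "((f0 / 2) powr (1 - i))\<^sup>2 = P / 2 powr (2 - 2 * i)" .
   have "(2::real) powr (2 - 2 * i) \<le> 2 powr 2" by (rule powr_mono) (use i in auto)
   then have "P / 4 \<le> P / 2 powr (2 - 2 * i)" using P by (intro divide_left_mono) auto
   then show ?thesis using eq by simp
  qed
  then have "P / 4 / CL\<^sup>2 \<le> A\<^sup>2" unfolding A_def power_divide by (rule divide_right_mono) simp
  then have "p / 2 * (P / 4 / CL\<^sup>2) \<le> p / 2 * A\<^sup>2" using p by (intro mult_left_mono) auto
  moreover have "p / 2 * (P / 4 / CL\<^sup>2) = p / (8 * CL\<^sup>2) * P" by simp
  moreover have "min (1 / 2) (p / (8 * CL\<^sup>2)) * P \<le> p / (8 * CL\<^sup>2) * P" using P by (intro mult_right_mono) auto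
  ultimately have "min (1 / 2) (p / (8 * CL\<^sup>2)) * P \<le> F u0 - F (u (p / 2))" using drop by linarith
  then show ?thesis by (simp only: P_def f0_def)
 qed
qed

text \<open>
 The competitor follows the flow backwards in \<open>r\<close>, at a speed \<open>p\<close> for which half of the energy gained
 pays for the radial derivative.
\<close>

theorem flow_competitor:
 assumes d: "2 \<le> DIM('a)" "3 \<le> 2 * k + DIM('a)" and Csl: "0 < Csl" and K: "convex_cone K"
  and sl: "slicing_property k Csl F G" and n_eq: "n = 2 * k + DIM('a) - 2" and p_eq: "p = 1 / (2 * Csl * real n)"
 shows "\<exists>h\<in>H1_ball. has_trace h u0 \<and> (\<forall>r\<in>{0<..1}. \<exists>w\<in>K. has_slice h r w) \<and>
  G h \<le> F u0 / real n - (F u0 - F (u (p / 2))) * (1 / 2) ^ n / (2 * real n)"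
proof -
 have n: "0 < n" "2 * k + DIM('a) - 3 = n - 1" "2 * k + DIM('a) - 1 = n + 1" using d by (auto simp: n_eq)
 have u00: "u 0 = u0" using sol by (simp add: strong_solution_def)
 obtain v where mv: "v \<in> borel_measurable borel" and iv: "set_integrable lborel {0..p} (\<lambda>r. (norm (v r))\<^sup>2)"
  and pr: "\<And>t x. t \<in> {0..p} \<Longrightarrow> u t \<bullet> x = u0 \<bullet> x + integral {0..t} (\<lambda>r. v r \<bullet> x)"
  and E: "\<And>s t. 0 \<le> s \<Longrightarrow> s \<le> t \<Longrightarrow> t \<le> p \<Longrightarrow> F (u t) + integral {s..t} (\<lambda>r. (norm (v r))\<^sup>2) \<le> F (u s)"
  by (rule strong_solution_energy[OF sol en u0 j cur i2 p]) (rule that)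
 define w where "w r = u (p * (1 - r))" for r
 define w' where "w' r = (- p) *\<^sub>R v (p * (1 - r))" for r
 define T0 where "T0 e t = (if t \<in> {0<..p} then tangential_derivative e (u t) else 0)" for e t
 define q where "q r = p\<^sup>2 * (norm (v (p * (1 - r))))\<^sup>2" for r
 have T0: "T0 e \<in> borel_measurable borel" "set_integrable lborel {0..p} (\<lambda>t. (norm (T0 e t))\<^sup>2)" if "e \<in> Basis" for e
  using strong_solution_tangential[OF sol en j i2 p that] unfolding T0_def[abs_def] by blast+
 have time: "p * (1 - r) \<in> {0..p}" if "r \<in> {0..1}" for r using that p by (simp add: mult_left_le)
 have maff: "(\<lambda>r::real. p * (1 - r)) \<in> borel_measurable borel" by measurable
 have mw': "w' \<in> borel_measurable borel"
  unfolding w'_def[abs_def] by (intro borel_measurable_scaleR borel_measurable_const measurable_compose[OF maff mv])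
 have mT: "(\<lambda>r. T0 e (p * (1 - r))) \<in> borel_measurable borel" if "e \<in> Basis" for e
  by (rule measurable_compose[OF maff T0(1)[OF that]])
 have nw': "(norm (w' r))\<^sup>2 = q r" for r by (simp add: w'_def q_def power_mult_distrib)
 have iq: "set_integrable lborel {0..1} q"
  unfolding q_def[abs_def] by (rule set_integrable_mult_right) (rule set_integral_reverse(1)[OF p(1) iv])
 have iT: "set_integrable lborel {0..1} (\<lambda>r. (norm (T0 e (p * (1 - r))))\<^sup>2)" if "e \<in> Basis" for e
  by (rule set_integral_reverse(1)[OF p(1) T0(2)[OF that]])
 have prim: "w r \<bullet> x = w 1 \<bullet> x - (LINT s:{r..1}|lborel. w' s \<bullet> x)" if r: "r \<in> {0..1}" for r x
 proof -
  have si: "set_integrable lborel {0..p} (\<lambda>r. v r \<bullet> x)"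
  proof (rule set_integrable_bound[where f="\<lambda>r. norm (v r) * norm x"])
   show "set_integrable lborel {0..p} (\<lambda>r. norm (v r) * norm x)"
    by (rule set_integrable_mult_left) (rule set_integrable_norm_of_square[OF mv iv])
   show "set_borel_measurable lborel {0..p} (\<lambda>r. v r \<bullet> x)"
    using mv unfolding set_borel_measurable_def by measurable
   show "AE r in lborel. r \<in> {0..p} \<longrightarrow> norm (v r \<bullet> x) \<le> norm (norm (v r) * norm x)"
    by (intro AE_I2) (simp add: Cauchy_Schwarz_ineq2)
  qed
  have "(LINT s:{r..1}|lborel. w' s \<bullet> x) = - p * (LINT s:{r..1}|lborel. v (p * (1 - s)) \<bullet> x)"
   unfolding w'_def inner_scaleR_left by (rule set_integral_mult_right)
  also have "\<dots> = - integral {0..p * (1 - r)} (\<lambda>t. v t \<bullet> x)"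
   using set_integral_reverse(2)[OF p(1) si r] p(1) by simp
  finally show ?thesis using pr[OF time[OF r], of x] by (simp add: w_def u00)
 qed
 \<comment> \<open>Outside the null set r = 1 the time is positive, where the flow lies in H^2; at r
   = 1 the function \<open>T0\<close> takes the value 0.\<close>
 have td: "AE r in lborel. r \<in> {0..1} \<longrightarrow> (\<forall>e\<in>Basis. has_tangential_derivative (w r) e (T0 e (p * (1 - r))))"
  using AE_lborel_singleton[of "1::real"]
 proof (rule eventually_mono, intro impI ballI)
  fix r :: real and e :: 'a assume r: "r \<noteq> 1" "r \<in> {0..1}" and e: "e \<in> Basis"
  have t: "p * (1 - r) \<in> {0<..p}" using r p by (simp add: mult_left_le)
  have "p * (1 - r) \<in> {0<..<T}" using t p(2)
   unfolding greaterThanAtMost_iff greaterThanLessThan_iff by (meson le_less_trans)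
  then have "u (p * (1 - r)) \<in> H1_sphere" by (intro H2_sphere_H1 strong_solution_H2(1)[OF sol en])
  then show "has_tangential_derivative (w r) e (T0 e (p * (1 - r)))"
   using H1_sphere_derivative[OF _ e] t by (simp add: T0_def w_def)
 qed
 have iw': "set_integrable lborel {0..1} (\<lambda>r. (norm (w' r))\<^sup>2)" unfolding nw' by (rule iq)
 obtain y g c where C: "cylinder_curve y g c" and ya: "\<And>r. r \<in> {0..1} \<Longrightarrow> cls (y r) = w r"
  and gs: "\<And>r. L2_sphere (g r)" and ga: "\<And>r. cls (g r) = w' r"
  by (rule curve_representation[of w' "\<lambda>e r. T0 e (p * (1 - r))" w]; (rule mw' mT iw' iT prim td that)?; assumption?)
 define h where "h = polar k y"
 have tr: "has_trace h u0" using cylinder_curve_trace[OF C d] ya[of 1] by (simp add: h_def w_def u00)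
 have sli: "\<exists>x\<in>K. has_slice h r x" if r: "r \<in> {0<..1}" for r
 proof
  have "has_slice h r (r ^ k *\<^sub>R cls (y r))"
   using cylinder_curve_slice[OF C d, of r] r by (simp add: h_def)
  then show "has_slice h r (r ^ k *\<^sub>R w r)" using ya[of r] r by simp
  have "p * (1 - r) \<in> {0..<T}"
   using time[of r] r p(2) unfolding atLeastAtMost_iff atLeastLessThan_iff greaterThanAtMost_iff by linarith
  then have "u (p * (1 - r)) \<in> K" using sol unfolding strong_solution_def by blast
  then show "r ^ k *\<^sub>R w r \<in> K" using r by (intro convex_cone_scaleR[OF K]) (auto simp: w_def)
 qed
 \<comment> \<open>The energy lost up to the time belonging to r. It is decreasing in r, which
   provides its measurability, its bounds and the final lower estimate.\<close>
 define D where "D r = F u0 - F (w r)" for r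
 have Dmono: "D r' \<le> D r" if "0 \<le> r" "r \<le> r'" "r' \<le> 1" for r r'
 proof -
  have "p * (1 - r') \<le> p * (1 - r)" using that p by simp
  then have "F (u (p * (1 - r))) \<le> F (u (p * (1 - r')))"
   using time[of r] time[of r'] that by (intro solution_energy_antimono) auto
  then show ?thesis by (simp add: D_def w_def)
 qed
 have D1: "D 1 = 0" by (simp add: D_def w_def u00)
 have D0: "0 \<le> D r \<and> D r \<le> D 0" if "r \<in> {0..1}" for r
  using Dmono[of r 1] Dmono[of 0 r] D1 that by simp
 have iD: "set_integrable lborel {0..1} (\<lambda>r. D r * r ^ m)" for m
 proof -
  have "mono_on {0..1} (\<lambda>r. - D r)" by (rule mono_onI) (use Dmono in auto)
  from borel_measurable_uminus[OF borel_measurable_mono_on_fnc[OF this]]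
  have "D \<in> borel_measurable (restrict_space borel {0..1})" by (simp only: minus_minus)
  then have mD: "D \<in> borel_measurable unit_lebesgue"
   by (subst measurable_cong_sets[OF sets_restrict_space_cong[OF sets_lborel] refl])
  have mr: "(\<lambda>r::real. r ^ m) \<in> borel_measurable unit_lebesgue"
   by (rule measurable_restrict_space1) simp
  have "integrable unit_lebesgue (\<lambda>r. D r * r ^ m)"
  proof (rule unit_interval.integrable_const_bound[where B="D 0"])
   show "(\<lambda>r. D r * r ^ m) \<in> borel_measurable unit_lebesgue" by (rule borel_measurable_times[OF mD mr])
   show "AE r in unit_lebesgue. norm (D r * r ^ m) \<le> D 0"
   proof (rule AE_I2)
    fix r assume "r \<in> space unit_lebesgue"
    then have r: "r \<in> {0..1}" by (simp add: space_restrict_space)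
    have "norm (D r * r ^ m) = D r * r ^ m" using D0[OF r] r by simp
    also have "\<dots> \<le> D r" using D0[OF r] r by (intro mult_left_le power_le_one) auto
    finally show "norm (D r * r ^ m) \<le> D 0" using D0[OF r] by simp
   qed
  qed
  then show ?thesis by (simp add: integrable_unit_interval)
 qed
 define J where "J = (LINT r:{0..1}|lborel. D r * r ^ (n - 1))"
 have ip: "set_integrable lborel {0..1} (\<lambda>r::real. F u0 * r ^ (n - 1))"
  by (rule set_integrable_mult_right) (rule set_integral_power_unit_interval(1)[OF n(1)], simp)
 have iF: "set_integrable lborel {0..1} (\<lambda>r. F (w r) * r ^ (n - 1))"
  and JF: "(LINT r:{0..1}|lborel. F (w r) * r ^ (n - 1)) = F u0 / real n - J"
 proof -
  have eq: "(\<lambda>r. F (w r) * r ^ (n - 1)) = (\<lambda>r. F u0 * r ^ (n - 1) - D r * r ^ (n - 1))"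
   by (auto simp: D_def algebra_simps)
  show "set_integrable lborel {0..1} (\<lambda>r. F (w r) * r ^ (n - 1))"
   unfolding eq by (rule set_integral_diff(1)[OF ip iD])
  show "(LINT r:{0..1}|lborel. F (w r) * r ^ (n - 1)) = F u0 / real n - J"
   unfolding eq set_integral_diff(2)[OF ip iD] J_def
   using set_integral_power_unit_interval(2)[OF n(1), of 1] by simp
 qed
 have iqm: "set_integrable lborel {0..1} (\<lambda>r. q r * r ^ m)" for m
 proof (rule set_integrable_bound[OF iq])
  have "q \<in> borel_measurable borel" using mw' unfolding nw'[symmetric, abs_def] by measurable
  then show "set_borel_measurable lborel {0..1} (\<lambda>r. q r * r ^ m)" unfolding set_borel_measurable_def by measurable
  show "AE r in lborel. r \<in> {0..1} \<longrightarrow> norm (q r * r ^ m) \<le> norm (q r)"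
   by (intro AE_I2 impI) (auto simp: abs_mult power_abs intro!: mult_left_le power_le_one)
 qed
 have q0: "0 \<le> q r" for r by (simp add: q_def)
 \<comment> \<open>\<open>A\<close> is p times the dissipation up to the time of r; it vanishes at r
   = 1 and is a primitive of -q. By parts, the integral of q r^n is n times that of A r^(n-1), and
   the energy inequality gives A \<le> p D. Hence the radial cost is at most Csl n p J, which the
   choice of \<open>p\<close> turns into J/2.\<close>
 have kin: "Csl * (LINT r:{0..1}|lborel. q r * r ^ (n + 1)) \<le> J / 2"
 proof -
  define A where "A r = p * integral {0..p * (1 - r)} (\<lambda>t. (norm (v t))\<^sup>2)" for r
  have A: "A r = A 1 - (LINT s:{r..1}|lborel. - q s)" if r: "r \<in> {0..1}" for r
  proof -
   have "(LINT s:{r..1}|lborel. - q s) = (LINT s:{r..1}|lborel. - p\<^sup>2 * (norm (v (p * (1 - s))))\<^sup>2)"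
    by (simp add: q_def)
   also have "\<dots> = - p\<^sup>2 * (LINT s:{r..1}|lborel. (norm (v (p * (1 - s))))\<^sup>2)" by (rule set_integral_mult_right)
   also have "\<dots> = - A r"
    unfolding set_integral_reverse(2)[OF p(1) iv r] A_def using p(1) by (simp add: power2_eq_square)
   finally show ?thesis by (simp add: A_def)
  qed
  have ig: "integrable unit_lebesgue (\<lambda>r. - q r)" using iq by (simp add: integrable_unit_interval)
  have der: "((\<lambda>r. r ^ n / real n) has_real_derivative r ^ (n - 1)) (at r)" for r :: real
  proof -
   have "((\<lambda>r. r ^ n / real n) has_real_derivative (real n * r ^ (n - Suc 0)) / real n) (at r)"
    by (intro derivative_eq_intros) (use n in auto)
   then show ?thesis using n by simp
  qed
  have cp: "continuous_on {0..1::real} (\<lambda>r. r ^ (n - 1))" by (intro continuous_intros)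
  note parts = integral_by_parts_primitive[OF ig A der cp, unfolded integral_unit_interval integrable_unit_interval]
  have "(LINT r:{0..1}|lborel. A r * r ^ (n - 1)) = - (LINT r:{0..1}|lborel. - q r * (r ^ n / real n))"
   using parts(2) n(1) by (simp add: A_def)
  also have "\<dots> = (LINT r:{0..1}|lborel. q r * r ^ n) / real n"
   by (simp add: set_lebesgue_integral_def)
  finally have AJ: "(LINT r:{0..1}|lborel. q r * r ^ n) = real n * (LINT r:{0..1}|lborel. A r * r ^ (n - 1))" using n(1) by simp
  have "(LINT r:{0..1}|lborel. A r * r ^ (n - 1)) \<le> (LINT r:{0..1}|lborel. p * (D r * r ^ (n - 1)))"
  proof (rule set_integral_mono[OF parts(1)])
   show "set_integrable lborel {0..1} (\<lambda>r. p * (D r * r ^ (n - 1)))" by (rule set_integrable_mult_right) (rule iD)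
   fix r :: real assume r: "r \<in> {0..1}"
   have "A r \<le> p * D r" unfolding A_def
    using E[of 0 "p * (1 - r)"] time[OF r] p by (intro mult_left_mono) (auto simp: D_def w_def u00)
   then have "A r * r ^ (n - 1) \<le> (p * D r) * r ^ (n - 1)" using r by (intro mult_right_mono) auto
   then show "A r * r ^ (n - 1) \<le> p * (D r * r ^ (n - 1))" by (simp add: mult.assoc)
  qed
  also have "\<dots> = p * J" unfolding J_def by (rule set_integral_mult_right)
  finally have AD: "(LINT r:{0..1}|lborel. A r * r ^ (n - 1)) \<le> p * J" .
  have "(LINT r:{0..1}|lborel. q r * r ^ (n + 1)) \<le> (LINT r:{0..1}|lborel. q r * r ^ n)"
  proof (rule set_integral_mono[OF iqm iqm])
   fix r :: real assume "r \<in> {0..1}"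
   then have "r ^ (n + 1) \<le> r ^ n" by (intro power_decreasing) auto
   then show "q r * r ^ (n + 1) \<le> q r * r ^ n" using q0[of r] by (intro mult_left_mono)
  qed
  also have "\<dots> \<le> real n * (p * J)" unfolding AJ using AD by (intro mult_left_mono) auto
  finally have "Csl * (LINT r:{0..1}|lborel. q r * r ^ (n + 1)) \<le> Csl * (real n * (p * J))"
   using Csl by (intro mult_left_mono) auto
  also have "\<dots> = J / 2" unfolding p_eq using Csl n(1) by simp
  finally show ?thesis .
 qed
 have "G h \<le> slicing_bound k Csl F y g"
 proof -
  have "set_integrable lborel {0..1} (\<lambda>r. F (cls (y r)) * r ^ (2 * k + DIM('a) - 3))"
   using iF unfolding set_integrable_def n(2)
   by (rule Bochner_Integration.integrable_cong[THEN iffD1, rotated -1]) (auto simp: ya indicator_def)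
  then show ?thesis using sl cylinder_curve_weak_derivatives[OF C] unfolding slicing_property_def h_def by blast
 qed
 also have "slicing_bound k Csl F y g = (F u0 / real n - J) + Csl * (LINT r:{0..1}|lborel. q r * r ^ (n + 1))"
 proof -
  have 1: "(LINT r:{0..1}|lborel. F (cls (y r)) * r ^ (n - 1)) = F u0 / real n - J"
   unfolding JF[symmetric] by (rule set_lebesgue_integral_cong) (auto simp: ya)
  have 2: "(\<oint>z. (g r z)\<^sup>2 * r ^ (n + 1)) = q r * r ^ (n + 1)" for r
   using norm_abs_l2_sphere[OF gs[of r]] by (simp add: ga nw')
  show ?thesis unfolding slicing_bound_def n(2,3) 1 2 ..
 qed
 also have "\<dots> \<le> F u0 / real n - J / 2" using kin by simp
 \<comment> \<open>On [0, 1/2] the decreasing \<open>D\<close> is at least D(1/2), the drop up to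
   time p/2, and the weight r^(n-1) integrates to (1/2)^n / n there.\<close>
 also have "\<dots> \<le> F u0 / real n - (F u0 - F (u (p / 2))) * (1 / 2) ^ n / (2 * real n)"
 proof -
  have i1: "set_integrable lborel {0..1/2} (\<lambda>r::real. D (1/2) * r ^ (n - 1))"
   by (rule set_integrable_mult_right) (rule set_integral_power_unit_interval(1)[OF n(1)], simp)
  have i3: "set_integrable lborel {0..1/2} (\<lambda>r. D r * r ^ (n - 1))"
   by (rule set_integrable_imp_integrable_on(2)[OF iD]) auto
  have "D (1/2) * (1 / 2) ^ n / real n = (LINT r:{0..1/2}|lborel. D (1/2) * r ^ (n - 1))"
   using set_integral_power_unit_interval(2)[OF n(1), of "1/2"] by simp
  also have "\<dots> \<le> (LINT r:{0..1/2}|lborel. D r * r ^ (n - 1))"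
   by (rule set_integral_mono[OF i1 i3]) (use Dmono in \<open>auto intro!: mult_right_mono\<close>)
  also have "\<dots> \<le> J"
   unfolding J_def set_borel_integral_eq_integral(2)[OF iD] set_borel_integral_eq_integral(2)[OF i3]
   by (rule integral_subset_le) (use D0 set_borel_integral_eq_integral(1)[OF iD] set_borel_integral_eq_integral(1)[OF i3] in auto)
  finally show ?thesis by (simp add: D_def w_def)
 qed
 finally show ?thesis using tr sli has_trace_imp_H1_ball[OF tr] by blast
qed

end

theorem proposition3p1:
  fixes k :: nat and Csl \<gamma> CL \<delta>L EL :: real
  assumes "2 \<le> DIM('a::euclidean_space)" and "3 \<le> 2 * k + DIM('a)" and "0 < Csl"
  shows "\<exists>\<epsilon>>0. \<forall>(K :: 'a l2_sphere set) F gradF \<psi>.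
     convex_cone K \<and>
     energy_functional F gradF \<and>
     K \<subseteq> closure (K \<inter> H2_sphere) \<and>
     flow_property K gradF \<psi> \<and>
     critical_point K gradF \<psi> \<and>
     lojasiewicz K F gradF \<psi> \<gamma> CL \<delta>L EL \<longrightarrow>
     (\<exists>\<delta>0>0. \<exists>E>0. \<forall>G. ae_invariant G \<and> slicing_property k Csl F G \<longrightarrow>
        (\<forall>c\<in>H1_sphere \<inter> K. norm (c - \<psi>) \<le> \<delta>0 \<and> F c - F \<psi> \<le> E \<longrightarrow>
           (let \<phi> = homogeneous_extension k \<psi>; z = homogeneous_extension k c in
            \<exists>h\<in>H1_ball. has_trace h c \<and> (\<forall>r\<in>{0<..1}. \<exists>w\<in>K. has_slice h r w) \<and>
              G h - G \<phi> \<le> (1 - \<epsilon> * \<bar>G z - G \<phi>\<bar> powr (1 - 2 * \<gamma>)) * (G z - G \<phi>))))"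
proof (cases "0 < CL")
 \<comment> \<open>The hypothesis \<open>lojasiewicz\<close> contains CL > 0, so here every positive
   \<epsilon> is admissible.\<close>
 case False
 then show ?thesis by (intro exI[of _ 1]) (auto simp: lojasiewicz_def)
next
 case CL: True
 define n where "n = 2 * k + DIM('a) - 2"
 have n: "0 < n" using assms by (simp add: n_def)
 \<comment> \<open>Only d, k, Csl and CL enter \<rho>, \<kappa> and \<epsilon>, which makes
   \<epsilon> universal; the data F and \<psi> influence only \<delta>0, through the flow.\<close>
 define \<rho> where "\<rho> = 1 / (2 * Csl * real n)"
 have \<rho>: "0 < \<rho>" using assms(3) n by (simp add: \<rho>_def)
 \<comment> \<open>\<kappa> is the factor from \<open>solution_energy_drop\<close>; the remaining
   factor of \<epsilon> is the one from \<open>flow_competitor\<close>.\<close>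
 define \<kappa> where "\<kappa> = min (1 / 2) (\<rho> / (8 * CL\<^sup>2))"
 have \<kappa>: "0 < \<kappa>" using \<rho> CL by (simp add: \<kappa>_def)
 define \<epsilon> where "\<epsilon> = \<kappa> * (1 / 2) ^ n / (2 * real n)"
 have \<epsilon>: "0 < \<epsilon>" using \<kappa> n by (simp add: \<epsilon>_def)
 show ?thesis
 proof (rule exI[of _ \<epsilon>], intro conjI allI impI, rule \<epsilon>)
  fix K :: "'a l2_sphere set" and F gradF \<psi>
  assume "convex_cone K \<and> energy_functional F gradF \<and> K \<subseteq> closure (K \<inter> H2_sphere) \<and>
   flow_property K gradF \<psi> \<and> critical_point K gradF \<psi> \<and> lojasiewicz K F gradF \<psi> \<gamma> CL \<delta>L EL"
  then have K: "convex_cone K" and en: "energy_functional F gradF" and fl: "flow_property K gradF \<psi>"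
   and cr: "critical_point K gradF \<psi>" and L: "lojasiewicz K F gradF \<psi> \<gamma> CL \<delta>L EL" by blast+
  have \<gamma>: "0 < \<gamma>" "\<gamma> \<le> 1/2" and \<delta>L: "0 < \<delta>L" and EL: "0 < EL" using L by (auto simp: lojasiewicz_def)
  \<comment> \<open>The flow has to live until \<rho> and to remain in the ball where the
    Lojasiewicz inequality holds.\<close>
  obtain \<delta>0 where \<delta>0: "0 < \<delta>0" and flow: "\<And>u0. u0 \<in> K \<Longrightarrow> norm (u0 - \<psi>) \<le> \<delta>0 \<Longrightarrow> \<exists>u S u' \<epsilon>. strong_solution K gradF S u0 u \<and> \<rho> < S \<and>
    (\<forall>s\<in>{0..\<rho>}. norm (u s - \<psi>) \<le> \<delta>L) \<and> 0 < \<epsilon> \<and> \<epsilon> \<le> S \<and> H1_curve 0 \<epsilon> u u' \<and>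
    set_integrable lborel {0<..<\<epsilon>} (\<lambda>t. (norm_H2 (u t))\<^sup>2)"
   by (rule flow_long_time[OF fl cr \<rho> \<delta>L]) (rule that)
  have \<psi>: "\<psi> \<in> H1_sphere" using cr H2_sphere_H1 by (auto simp: critical_point_def)
  have concl: "\<exists>h\<in>H1_ball. has_trace h c \<and> (\<forall>r\<in>{0<..1}. \<exists>w\<in>K. has_slice h r w) \<and>
    G h - G (homogeneous_extension k \<psi>) \<le> (1 - \<epsilon> * \<bar>G (homogeneous_extension k c) - G (homogeneous_extension k \<psi>)\<bar> powr (1 - 2 * \<gamma>)) *
     (G (homogeneous_extension k c) - G (homogeneous_extension k \<psi>))"
   if sl: "slicing_property k Csl F G" and c: "c \<in> H1_sphere" "c \<in> K"
    and close: "norm (c - \<psi>) \<le> \<delta>0" "F c - F \<psi> \<le> min 1 EL" for G c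
  proof -
   note Hc = homogeneous_extension_energy[OF c(1) assms(1,2) sl] and H\<psi> = homogeneous_extension_energy[OF \<psi> assms(1,2) sl]
   define f0 where "f0 = F c - F \<psi>"
   define x where "x = G (homogeneous_extension k c) - G (homogeneous_extension k \<psi>)"
   have x: "x = f0 / real n"
    unfolding x_def Hc(1) H\<psi>(1) n_def f0_def by (simp add: diff_divide_distrib)
   show ?thesis
   proof (cases "f0 \<le> 0")
    \<comment> \<open>Without positive excess the homogeneous extension of \<open>c\<close> is
      itself the competitor: multiplying x \<le> 0 by a factor at most 1 can only increase
      it.\<close>
    case True
    have x0: "x \<le> 0" using True n by (simp add: x divide_nonpos_pos)
    have "x \<le> (1 - \<epsilon> * \<bar>x\<bar> powr (1 - 2 * \<gamma>)) * x"
     using mult_right_mono_neg[OF _ x0, of "1 - \<epsilon> * \<bar>x\<bar> powr (1 - 2 * \<gamma>)" 1] \<epsilon> by simp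
    moreover have "\<exists>w\<in>K. has_slice (homogeneous_extension k c) r w" if "r \<in> {0<..1}" for r
     using Hc(3)[OF that] convex_cone_scaleR[OF K _ c(2), of "r ^ k"] that by (intro bexI) auto
    ultimately show ?thesis
     using Hc(2) has_trace_imp_H1_ball[OF Hc(2)] unfolding x_def by blast
   next
    case False
    then have f0: "0 < f0" "f0 \<le> 1" "f0 \<le> EL" using close(2) by (auto simp: f0_def)
    obtain u S u' e where u: "strong_solution K gradF S c u" "\<rho> < S" "\<forall>s\<in>{0..\<rho>}. norm (u s - \<psi>) \<le> \<delta>L"
     "0 < e" "e \<le> S" "H1_curve 0 e u u'" "set_integrable lborel {0<..<e} (\<lambda>t. (norm_H2 (u t))\<^sup>2)"
     using flow[OF c(2) close(1)] by blast
    obtain h where h: "h \<in> H1_ball" "has_trace h c" "\<forall>r\<in>{0<..1}. \<exists>w\<in>K. has_slice h r w"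
     "G h \<le> F c / real n - (F c - F (u (\<rho> / 2))) * (1 / 2) ^ n / (2 * real n)"
     using flow_competitor[OF u(1) en c(1) u(4-7) \<rho> u(2) assms K sl n_def \<rho>_def] by blast
    have drop: "\<kappa> * f0 powr (2 - 2 * \<gamma>) \<le> F c - F (u (\<rho> / 2))"
     unfolding \<kappa>_def f0_def
     by (rule solution_energy_drop[OF u(1) en c(1) u(4-7) \<rho> u(2) L u(3)]) (use f0 in \<open>auto simp: f0_def\<close>)
    \<comment> \<open>As x = f0/n and n \<ge> 1, the power of f0 supplied by the flow dominates the
      power of x in the claim.\<close>
    have x0: "0 < x" "x \<le> f0"
    proof -
     show "0 < x" using f0 n by (simp add: x)
     have "1 \<le> real n" using n by simp
     then show "x \<le> f0" using f0 by (simp add: x divide_le_eq mult_le_cancel_left1)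
    qed
    have "x powr (1 - 2 * \<gamma>) * x = x powr (2 - 2 * \<gamma>)"
     using x0(1) powr_add[of x "1 - 2 * \<gamma>" 1] by simp
    also have "\<dots> \<le> f0 powr (2 - 2 * \<gamma>)" by (rule powr_mono2) (use \<gamma> x0 in auto)
    finally have "\<epsilon> * (x powr (1 - 2 * \<gamma>) * x) \<le> \<epsilon> * f0 powr (2 - 2 * \<gamma>)" using \<epsilon> by simp
    also have "\<dots> = (\<kappa> * f0 powr (2 - 2 * \<gamma>)) * ((1 / 2) ^ n / (2 * real n))" by (simp add: \<epsilon>_def)
    also have "\<dots> \<le> (F c - F (u (\<rho> / 2))) * ((1 / 2) ^ n / (2 * real n))"
     by (rule mult_right_mono[OF drop]) simp
    finally have gain: "\<epsilon> * (x powr (1 - 2 * \<gamma>) * x) \<le> (F c - F (u (\<rho> / 2))) * (1 / 2) ^ n / (2 * real n)" by simp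
    have "G h - G (homogeneous_extension k \<psi>) \<le> x - \<epsilon> * (x powr (1 - 2 * \<gamma>) * x)"
     using h(4) gain unfolding x_def Hc(1) n_def[symmetric] by linarith
    also have "\<dots> = (1 - \<epsilon> * \<bar>x\<bar> powr (1 - 2 * \<gamma>)) * x" using x0 by (simp add: algebra_simps)
    finally show ?thesis using h unfolding x_def by blast
   qed
  qed
  show "\<exists>\<delta>0>0. \<exists>E>0. \<forall>G. ae_invariant G \<and> slicing_property k Csl F G \<longrightarrow>
    (\<forall>c\<in>H1_sphere \<inter> K. norm (c - \<psi>) \<le> \<delta>0 \<and> F c - F \<psi> \<le> E \<longrightarrow>
      (let \<phi> = homogeneous_extension k \<psi>; z = homogeneous_extension k c in
      \<exists>h\<in>H1_ball. has_trace h c \<and> (\<forall>r\<in>{0<..1}. \<exists>w\<in>K. has_slice h r w) \<and>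
       G h - G \<phi> \<le> (1 - \<epsilon> * \<bar>G z - G \<phi>\<bar> powr (1 - 2 * \<gamma>)) * (G z - G \<phi>)))"
  \<comment> \<open>In E = min 1 EL, the 1 ensures f0 \<le> 1, so that an excess dominates its power
    2 - 2\<gamma>, and EL admits the Lojasiewicz inequality along the flow.\<close>
  proof (rule exI[of _ \<delta>0], rule conjI[OF \<delta>0], rule exI[of _ "min 1 EL"], rule conjI, use EL in simp, intro allI impI ballI)
   fix G c assume "ae_invariant G \<and> slicing_property k Csl F G" "c \<in> H1_sphere \<inter> K"
    "norm (c - \<psi>) \<le> \<delta>0 \<and> F c - F \<psi> \<le> min 1 EL"
   then show "let \<phi> = homogeneous_extension k \<psi>; z = homogeneous_extension k c in
      \<exists>h\<in>H1_ball. has_trace h c \<and> (\<forall>r\<in>{0<..1}. \<exists>w\<in>K. has_slice h r w) \<and>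
       G h - G \<phi> \<le> (1 - \<epsilon> * \<bar>G z - G \<phi>\<bar> powr (1 - 2 * \<gamma>)) * (G z - G \<phi>)"
    unfolding Let_def by (intro concl) auto
  qed
 qed
qed

end
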